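(* Let $\{V(\mathbf t):\mathbf t\in\mathbb Z^2\}$ be a stationary random field with mean $\mu$, and let $T=\{(t_1,t_2)\in\mathbb Z^2:1\le t_k\le d_k,\ k=1,2\}$. Assume: (1) there exist $0<\xi\le1/2$ and $c_1,c_2>0$ such that, for all sufficiently large $|T|$, $d_1>c_1|T|^\xi$ and $d_2>c_2|T|^\xi$; (2) $\sum_{\mathbf j\in\mathbb Z^2}|\gamma(\mathbf j)|<\infty$, where $\gamma(\mathbf j)=\mathrm{Cov}(V(\mathbf 0),V(\mathbf j))$; (3) the spectral density $f(\lambda)=\frac1{4\pi^2}\sum_{\mathbf j\in\mathbb Z^2}e^{-i\lambda'\mathbf j}\gamma(\mathbf j)$ satisfies $f(\lambda)\ge c$ for some $c>0$ and all $\lambda\in[0,2\pi]^2$; (4) either $V$ is a linear field of order $r$ with some $r>1/2$, or $V$ satisfies the geometric-moment contraction condition and $\mathbb E(|V(\mathbf 0)|^{16})<\infty$; (5) the bandwidth $\mathbf h_T=(h_{T1},h_{T2})$ satisfies $(|\mathbf h_T|^4|T|)^{-1}=o(1)$; (6) the kernel $K$ is a real, positive (i.e. $K\ge 0$), even function on $\mathbb R^2$ with $\int_{\mathbb R^2}K(\lambda)\,d\lambda=1$ and $\frac{4\pi^2}{|\mathbf h_T||T|}\sum_{\mathbf j\in\mathbb Z^2}K\big(\frac{2\pi j_1}{h_{T1}d_1},\frac{2\pi j_2}{h_{T2}d_2}\big)=1+o(1)$; (7) with $K_{\mathbf h}(\lambda)=\frac1{|\mathbf h_T|}\sum_{\mathbf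 j\in\mathbb Z^2}K\big(\frac{\lambda_1+2\pi j_1}{h_{T1}},\frac{\lambda_2+2\pi j_2}{h_{T2}}\big)$, there is a constant $L_K>0$ such that $|\mathbf h_T|^{3/2}|K_{\mathbf h}(\lambda_{\mathbf s})-K_{\mathbf h}(\lambda_{\mathbf t})|\le L_K\|\lambda_{\mathbf s}-\lambda_{\mathbf t}\|$ uniformly in $\lambda_{\mathbf s}=(\frac{2\pi s_1}{d_1},\frac{2\pi s_2}{d_2})$ and $\lambda_{\mathbf t}=(\frac{2\pi t_1}{d_1},\frac{2\pi t_2}{d_2})$; (8) $\frac1{|T||\mathbf h_T|}\sum_{\mathbf j\in\mathbb Z^2}K^2\big(\frac{2\pi j_1}{h_{T1}d_1},\frac{2\pi j_2}{h_{T2}d_2}\big)=O(1)$. Define the weights $$p_{\mathbf s,T}=\frac{K\big(\frac{2\pi s_1}{h_{T1}d_1},\frac{2\pi s_2}{h_{T2}d_2}\big)}{\sum_{\mathbf j\in\mathbb Z^2}K\big(\frac{2\pi j_1}{h_{T1}d_1},\frac{2\pi j_2}{h_{T2}d_2}\big)},\qquad\mathbf s\in\mathbb Z^2.$$ Then, as $T\to\infty$: (a) If $\sup_{\mathbf l,\mathbf k\in N}|\mathrm{Cov}(x(\mathbf l),x(\mathbf k))-2\pi^2f(\lambda_{\mathbf k})\delta_{\mathbf l,\mathbf k}|=O\big(\frac1{|\mathbf h_T||T|}\big)$ and $\sup_{\mathbf l,\mathbf k\in N}|\mathrm{Cov}(y(\mathbf l),y(\mathbf k))-2\pi^2f(\lambda_{\mathbf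 k})\delta_{\mathbf l,\mathbf k}|=O\big(\frac1{|\mathbf h_T||T|}\big)$, then $$\sup_{\mathbf j\in N}\Big|\sum_{\mathbf s\in\mathbb Z^2}p_{\mathbf s,T}\big(x(\mathbf j+\mathbf s)+y(\mathbf j+\mathbf s)\big)\Big|=o_p(1).$$ (b) $\displaystyle\sup_{\mathbf j\in N}\Big|\sum_{\mathbf s\in\mathbb Z^2}p_{\mathbf s,T}I(\mathbf j+\mathbf s)-4\pi^2f(\lambda_{\mathbf j})\Big|=o_p(1).$ (c) There is a constant $C_1$ such that $\displaystyle\sup_{\mathbf j\in N}\sum_{\mathbf s\in\mathbb Z^2}p_{\mathbf s,T}I^2(\mathbf j+\mathbf s)\le C_1+o_p(1).$ (d) There exist some $q=4+\epsilon$ with $\epsilon\in(0,1)$ and a constant $C_2$ such that $\displaystyle\sup_{\mathbf j\in N}\sum_{\mathbf s\in\mathbb Z^2}p_{\mathbf s,T}I^q(\mathbf j+\mathbf s)\le C_2+o_p(1).$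
   Context: Notation: for a vector $\mathbf a=(a_1,a_2)$, $|\mathbf a|=|a_1||a_2|$ (product of absolute values; in particular $|\mathbf h_T|=|h_{T1}h_{T2}|$) and $\|\mathbf a\|=\max_i|a_i|$; $|T|=d_1d_2$; $T\to\infty$ means $d_1,d_2\to\infty$; $\mathbf a'\mathbf b$ is the dot product; $\delta_{\mathbf l,\mathbf k}$ is the Kronecker delta; $a\asymp b$ means $a=O(b)$ and $b=O(a)$. Standing assumption on the bandwidth: $\mathbf h_T=(h_{T1},h_{T2})\in\mathbb R^2$ satisfies $h_{Tk}\to0$, $h_{T1}\asymp h_{T2}$ and $h_{Tk}d_k\to\infty$ for $k=1,2$. Fourier coefficients: for $\mathbf j=(j_1,j_2)\in\mathbb Z^2$ let $\lambda_{\mathbf j}=(2\pi j_1/d_1,2\pi j_2/d_2)$ and $$x(\mathbf j)=\frac1{\sqrt{|T|}}\sum_{\mathbf t\in T}V(\mathbf t)\cos(-\lambda_{\mathbf j}'\mathbf t),\qquad y(\mathbf j)=\frac1{\sqrt{|T|}}\sum_{\mathbf t\in T}V(\mathbf t)\sin(-\lambda_{\mathbf j}'\mathbf t).$$ Periodogram: $I(\mathbf j)=0$ if $\mathbf j\in D=\{(c_1d_1,c_2d_2):(c_1,c_2)\in\mathbb Z^2\}$ and $I(\mathbf j)=x^2(\mathbf j)+y^2(\mathbf j)$ if $\mathbf j\in\mathbb Z^2\setminus D$. The index set $N\subset T$: if $d_1,d_2$ are both odd, $N=\{1\le t_1\le d_1,\ 1\le t_2\le\frac{d_2-1}2\}\cup\{1\le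 t_1\le\frac{d_1-1}2,\ t_2=d_2\}$. If $d_1$ is odd and $d_2$ even, $N=\{1\le t_1\le d_1,\ 1\le t_2\le\frac{d_2}2-1\}\cup\{1\le t_1\le\frac{d_1-1}2,\ t_2\in\{\frac{d_2}2,d_2\}\}$; if $d_1$ is even and $d_2$ odd, the same with the roles of the two coordinates interchanged. If both are even, $N=\{1\le t_1\le d_1,\ 1\le t_2\le\frac{d_2}2-1\}\cup\{1\le t_1\le\frac{d_1}2-1,\ t_2\in\{\frac{d_2}2,d_2\}\}$. Linear field of order $r\ge0$: $V$ is real-valued and $V(\mathbf j)-\mu=\sum_{\mathbf s\in\mathbb Z^2}a_{\mathbf s}\varepsilon_{\mathbf j-\mathbf s}$, where $\{\varepsilon_{\mathbf i}\}_{\mathbf i\in\mathbb Z^2}$ is an i.i.d. random field with $\mathbb E(\varepsilon_{\mathbf 0})=0$, $\mathbb E(\varepsilon_{\mathbf 0}^8)<\infty$, $\sum_{\mathbf s\in\mathbb Z^2}|a_{\mathbf s}||\mathbf s|^r<\infty$, and Cramér's condition holds: there exist $\delta>0$, $u_0>0$ such that $|\mathbb E\exp(iu\varepsilon_{\mathbf 0})|\le1-\delta$ for all $u\in\mathbb R$ with $|u|>u_0$. Geometric-moment contraction condition: $V(\mathbf j)-\mu=G(\varepsilon_{\mathbf j-\mathbf s}:\mathbf s\in\mathbb Z^2)$ for all $\mathbf j\in\mathbb Z^2$, with $G$ measurable and $\{\varepsilon_{\mathbf i}\}_{\mathbf i\in\mathbb Z^2}$ an i.i.d. random field; with $\{\widetilde\varepsilon_{\mathbf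 i}\}$ an i.i.d. (independent) copy of $\{\varepsilon_{\mathbf i}\}$, let $\widetilde V^\dagger(\mathbf j)-\mu=G(\varepsilon^\dagger_{\mathbf j-\mathbf s}:\mathbf s\in\mathbb Z^2)$, where $\varepsilon^\dagger_{\mathbf j-\mathbf s}=\varepsilon_{\mathbf j-\mathbf s}$ if $\|\mathbf s\|<\|\mathbf j\|$ and $\varepsilon^\dagger_{\mathbf j-\mathbf s}=\widetilde\varepsilon_{\mathbf j-\mathbf s}$ if $\|\mathbf s\|\ge\|\mathbf j\|$. The condition is that there exist $\alpha>0$, $C>0$ and $0<\rho=\rho(\alpha)<1$ with $\mathbb E(|V(\mathbf j)-\widetilde V^\dagger(\mathbf j)|^\alpha)\le C\rho^{\|\mathbf j\|}$ for all $\mathbf j\in\mathbb Z^2$.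
   Formalization: In (6), ∫K=1 is an improper Riemann integral (K Riemann integrable on every square, limit over growing squares); with a Lebesgue integral (b) fails, since K enters only through its values on countably many lattice points, which that integral ignores. *)

theory Defs
  imports "HOL-Probability.Probability" "HOL-Library.Landau_Symbols"
begin

text \<open>Sizes of vectors: \<open>abs_prod\<close> is $|a| = |a_1||a_2|$ and \<open>max_norm\<close> is
  $\|a\| = \max_k |a_k|$, for real vectors and (through \<open>rvec\<close>) lattice points.\<close>

definition rvec :: "int \<times> int \<Rightarrow> real \<times> real" where
  "rvec t = (real_of_int (fst t), real_of_int (snd t))"

definition abs_prod :: "real \<times> real \<Rightarrow> real" where
  "abs_prod a = \<bar>fst a\<bar> * \<bar>snd a\<bar>"

definition max_norm :: "real \<times> real \<Rightarrow> real" where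
  "max_norm a = max \<bar>fst a\<bar> \<bar>snd a\<bar>"

text \<open>A pair \<open>d = (d\<^sub>1, d\<^sub>2)\<close> of side lengths describes the observation rectangle \<open>rect d\<close>,
  with \<open>vol d\<close> points.\<close>

definition rect :: "nat \<times> nat \<Rightarrow> (int \<times> int) set" where
  "rect d = {1..int (fst d)} \<times> {1..int (snd d)}"

definition vol :: "nat \<times> nat \<Rightarrow> real" where
  "vol d = real (fst d) * real (snd d)"

definition freq :: "nat \<times> nat \<Rightarrow> int \<times> int \<Rightarrow> real \<times> real" where
  "freq d j = (2 * pi * real_of_int (fst j) / real (fst d),
               2 * pi * real_of_int (snd j) / real (snd d))"

definition half_set :: "nat \<times> nat \<Rightarrow> (int \<times> int) set" where
  "half_set d = (let d1 = int (fst d); d2 = int (snd d) in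
     if odd d1 \<and> odd d2 then
       {1..d1} \<times> {1..(d2 - 1) div 2} \<union> {1..(d1 - 1) div 2} \<times> {d2}
     else if odd d1 \<and> even d2 then
       {1..d1} \<times> {1..d2 div 2 - 1} \<union> {1..(d1 - 1) div 2} \<times> {d2 div 2, d2}
     else if even d1 \<and> odd d2 then
       {1..d1 div 2 - 1} \<times> {1..d2} \<union> {d1 div 2, d1} \<times> {1..(d2 - 1) div 2}
     else
       {1..d1} \<times> {1..d2 div 2 - 1} \<union> {1..d1 div 2 - 1} \<times> {d2 div 2, d2})"

definition xcoef ::
  "(int \<times> int \<Rightarrow> 'a \<Rightarrow> real) \<Rightarrow> nat \<times> nat \<Rightarrow> int \<times> int \<Rightarrow> 'a \<Rightarrow> real" where
  "xcoef V d j \<omega> = 1 / sqrt (vol d) * (\<Sum>t\<in>rect d. V t \<omega> * cos (- (freq d j \<bullet> rvec t)))"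

definition ycoef ::
  "(int \<times> int \<Rightarrow> 'a \<Rightarrow> real) \<Rightarrow> nat \<times> nat \<Rightarrow> int \<times> int \<Rightarrow> 'a \<Rightarrow> real" where
  "ycoef V d j \<omega> = 1 / sqrt (vol d) * (\<Sum>t\<in>rect d. V t \<omega> * sin (- (freq d j \<bullet> rvec t)))"

definition zero_freqs :: "nat \<times> nat \<Rightarrow> (int \<times> int) set" where
  "zero_freqs d = {(c1 * int (fst d), c2 * int (snd d)) |c1 c2. True}"

definition periodogram ::
  "(int \<times> int \<Rightarrow> 'a \<Rightarrow> real) \<Rightarrow> nat \<times> nat \<Rightarrow> int \<times> int \<Rightarrow> 'a \<Rightarrow> real" where
  "periodogram V d j \<omega> =
     (if j \<in> zero_freqs d then 0 else (xcoef V d j \<omega>)\<^sup>2 + (ycoef V d j \<omega>)\<^sup>2)"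

text \<open>Strict stationarity: the law of the whole field on the product space is shift invariant.\<close>

definition stationary_field :: "'a measure \<Rightarrow> (int \<times> int \<Rightarrow> 'a \<Rightarrow> real) \<Rightarrow> bool" where
  "stationary_field M V \<longleftrightarrow>
     (\<forall>t. V t \<in> borel_measurable M) \<and>
     (\<forall>u. distr M (Pi\<^sub>M UNIV (\<lambda>_. borel)) (\<lambda>\<omega> t. V (t + u) \<omega>) =
          distr M (Pi\<^sub>M UNIV (\<lambda>_. borel)) (\<lambda>\<omega> t. V t \<omega>))"

definition iid_field :: "'a measure \<Rightarrow> (int \<times> int \<Rightarrow> 'a \<Rightarrow> real) \<Rightarrow> bool" where
  "iid_field M e \<longleftrightarrow>
     prob_space.indep_vars M (\<lambda>_. borel) e UNIV \<and>
     (\<forall>i. distr M borel (e i) = distr M borel (e 0))"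

definition cov :: "'a measure \<Rightarrow> ('a \<Rightarrow> real) \<Rightarrow> ('a \<Rightarrow> real) \<Rightarrow> real" where
  "cov M X Y = (\<integral>\<omega>. (X \<omega> - (\<integral>\<omega>'. X \<omega>' \<partial>M)) * (Y \<omega> - (\<integral>\<omega>'. Y \<omega>' \<partial>M)) \<partial>M)"

definition autocov :: "'a measure \<Rightarrow> (int \<times> int \<Rightarrow> 'a \<Rightarrow> real) \<Rightarrow> int \<times> int \<Rightarrow> real" where
  "autocov M V j = cov M (V 0) (V j)"

text \<open>The series of the spectral density is complex, but its sum is real because the
  autocovariance is even; \<open>Re\<close> only converts the type.\<close>

definition spectral_density ::
  "'a measure \<Rightarrow> (int \<times> int \<Rightarrow> 'a \<Rightarrow> real) \<Rightarrow> real \<times> real \<Rightarrow> real" where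
  "spectral_density M V lam =
     Re (1 / (4 * complex_of_real pi ^ 2) *
         (\<Sum>\<^sub>\<infinity>j. exp (- \<i> * complex_of_real (lam \<bullet> rvec j)) * complex_of_real (autocov M V j)))"

text \<open>The moving-average series is an unordered sum over the lattice, converging almost surely;
  so (unordered real series being absolutely convergent) the series of the \<open>\<bar>a s\<bar> * \<bar>e (j - s)\<bar>\<close>
  is almost surely finite as well.
  The weight $|s|^r$ uses the product $|s| = |s_1||s_2|$. The case distinction is needed because
  \<open>0 powr 0 = 0\<close>.\<close>

definition linear_field ::
  "'a measure \<Rightarrow> (int \<times> int \<Rightarrow> 'a \<Rightarrow> real) \<Rightarrow> real \<Rightarrow> real \<Rightarrow> bool" where
  "linear_field M V \<mu> r \<longleftrightarrow> r \<ge> 0 \<and>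
     (\<exists>(a :: int \<times> int \<Rightarrow> real) e.
        iid_field M e \<and>
        (\<forall>j. AE \<omega> in M. ((\<lambda>s. a s * e (j - s) \<omega>) has_sum (V j \<omega> - \<mu>)) UNIV) \<and>
        (\<integral>\<omega>. e 0 \<omega> \<partial>M) = 0 \<and>
        integrable M (\<lambda>\<omega>. e 0 \<omega> ^ 8) \<and>
        (\<lambda>s. \<bar>a s\<bar> * (if r = 0 then 1 else abs_prod (rvec s) powr r)) summable_on UNIV \<and>
        (\<exists>\<delta>>0. \<exists>u0>0. \<forall>u. \<bar>u\<bar> > u0 \<longrightarrow> cmod (char (distr M borel (e 0)) u) \<le> 1 - \<delta>))"

text \<open>The field \<open>e\<close> and its independent copy are realised on the product space \<open>M \<Otimes>\<^sub>M M\<close>, as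
  \<open>(\<omega>, \<omega>') \<mapsto> e i \<omega>\<close> and \<open>(\<omega>, \<omega>') \<mapsto> e i \<omega>'\<close>. The moment in the condition depends only on the joint
  law of the field and its copy, and no richness of \<open>M\<close> itself is required.\<close>

definition gmc_field :: "'a measure \<Rightarrow> (int \<times> int \<Rightarrow> 'a \<Rightarrow> real) \<Rightarrow> real \<Rightarrow> bool" where
  "gmc_field M V \<mu> \<longleftrightarrow>
     (\<exists>e. \<exists>G \<in> borel_measurable (Pi\<^sub>M (UNIV :: (int \<times> int) set) (\<lambda>_. borel)).
        iid_field M e \<and>
        (\<forall>j. AE \<omega> in M. V j \<omega> - \<mu> = G (\<lambda>s. e (j - s) \<omega>)) \<and>
        (let Vdag = (\<lambda>j (\<omega>, \<omega>'). \<mu> + G (\<lambda>s. if max_norm (rvec s) < max_norm (rvec j)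
                                             then e (j - s) \<omega> else e (j - s) \<omega>'))
         in \<exists>\<alpha>>0. \<exists>C>0. \<exists>\<rho>. 0 < \<rho> \<and> \<rho> < 1 \<and>
              (\<forall>j. integrable (M \<Otimes>\<^sub>M M) (\<lambda>w. \<bar>V j (fst w) - Vdag j w\<bar> powr \<alpha>) \<and>
                   (\<integral>w. \<bar>V j (fst w) - Vdag j w\<bar> powr \<alpha> \<partial>(M \<Otimes>\<^sub>M M))
                     \<le> C * \<rho> powr max_norm (rvec j))))"

text \<open>The kernel integral is an (improper) Riemann integral: \<open>has_riemann_integral\<close> is the library's
  gauge integral with constant gauges, and for nonnegative integrands exhausting the plane by
  squares is no restriction. The kernel enters everywhere through its values on lattices, i.e. on a
  countable set, which an a.e. defined (Lebesgue) integral would not see at all.\<close>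

definition has_riemann_integral ::
  "(real \<times> real \<Rightarrow> real) \<Rightarrow> real \<Rightarrow> (real \<times> real) set \<Rightarrow> bool" where
  "has_riemann_integral g I B \<longleftrightarrow>
     (\<forall>\<epsilon>>0. \<exists>\<delta>>0. \<forall>p. p tagged_division_of B \<and> (\<lambda>x. ball x \<delta>) fine p \<longrightarrow>
        \<bar>(\<Sum>(x, k)\<in>p. measure lborel k * g x) - I\<bar> < \<epsilon>)"

definition has_plane_integral :: "(real \<times> real \<Rightarrow> real) \<Rightarrow> real \<Rightarrow> bool" where
  "has_plane_integral g I \<longleftrightarrow>
     (\<exists>J. (\<forall>R>0. has_riemann_integral g (J R) (cbox (- R, - R) (R, R))) \<and> (J \<longlongrightarrow> I) at_top)"

text \<open>Value of the kernel at \<open>(\<lambda>\<^sub>1 / h\<^sub>1, \<lambda>\<^sub>2 / h\<^sub>2)\<close>; at \<open>freq d j\<close> this is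
  $K(2\pi j_1/(h_1 d_1), 2\pi j_2/(h_2 d_2))$.\<close>

definition scaled_kernel ::
  "(real \<times> real \<Rightarrow> real) \<Rightarrow> real \<times> real \<Rightarrow> real \<times> real \<Rightarrow> real" where
  "scaled_kernel K h lam = K (fst lam / fst h, snd lam / snd h)"

definition periodized_kernel ::
  "(real \<times> real \<Rightarrow> real) \<Rightarrow> real \<times> real \<Rightarrow> real \<times> real \<Rightarrow> real" where
  "periodized_kernel K h lam =
     1 / abs_prod h * (\<Sum>\<^sub>\<infinity>j. scaled_kernel K h (lam + (2 * pi) *\<^sub>R rvec j))"

definition weight ::
  "(real \<times> real \<Rightarrow> real) \<Rightarrow> nat \<times> nat \<Rightarrow> real \<times> real \<Rightarrow> int \<times> int \<Rightarrow> real" where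
  "weight K d h s =
     scaled_kernel K h (freq d s) / (\<Sum>\<^sub>\<infinity>j. scaled_kernel K h (freq d j))"

text \<open>$X_n = o_p(1)$. Measurability is part of the notion, as \<open>measure\<close> is \<open>0\<close> on nonmeasurable
  sets.\<close>

definition is_op1 :: "'a measure \<Rightarrow> (nat \<Rightarrow> 'a \<Rightarrow> real) \<Rightarrow> bool" where
  "is_op1 M X \<longleftrightarrow>
     (\<forall>n. X n \<in> borel_measurable M) \<and>
     (\<forall>\<epsilon>>0. (\<lambda>n. measure M {\<omega> \<in> space M. \<bar>X n \<omega>\<bar> > \<epsilon>}) \<longlonglongrightarrow> 0)"

text \<open>$X_n \le C + o_p(1)$.\<close>

definition le_plus_op1 :: "'a measure \<Rightarrow> (nat \<Rightarrow> 'a \<Rightarrow> real) \<Rightarrow> real \<Rightarrow> bool" where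
  "le_plus_op1 M X C \<longleftrightarrow>
     (\<exists>R. is_op1 M R \<and> (\<forall>n. \<forall>\<omega>\<in>space M. X n \<omega> \<le> C + R n \<omega>))"

end

theory Submission
  imports Defs "HOL-Real_Asymp.Real_Asymp"
begin

text \<open>The weights periodise to a probability $P$ on the $d_1d_2$ Fourier frequencies, and the Lipschitz
  condition forces $P \le C/(|h||T|)$: a cone under a maximum of $P$ has mass at most $1$. Put $W = V - \mu$.
  Under either alternative for the field, $W$ is an absolutely convergent combination of mean-zero variables
  with bounded eighth moments, each depending on a finite block of the innovations, so a quadratic form
  in $W$ has variance at most a constant times the squared Hilbert-Schmidt norm of its coefficients. Hence
  the smoothed coefficients and the smoothed centred periodogram have variance $O(1/(|h||T|))$ at each
  frequency; Chebyshev's inequality on a grid of $O(|h|^{-3})$ frequencies and the Lipschitz condition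
  between its points make this uniform, because $|h|^4|T| \to \infty$. The bias is small because the
  spectral density is uniformly continuous.

  Second moments are not available for the smoothed higher powers of the periodogram. There the innovation
  blocks are truncated at level $|T|^{1/6}$, exponential moments bound expectations of products of
  periodogram ordinates over about $\log |T|$ distinct frequencies, and these control the upper tail of
  the smoothed fifth power well enough for a union bound over all frequencies.\<close>

section \<open>Discrete Fourier coefficients\<close>

text \<open>Two balances fix the exponents. A net of mesh of order |h|^(3/2) in each coordinate
  makes the Lipschitz increments harmless, and its |h|^-3 points times a variance 1/(|h||T|) give
  exactly 1/(|h|^4|T|). The same exponent 3/2 enters the cone argument squared, so the cube of |T|P
  is of order |h|^-3. For the powers, the fifth is treated because it dominates, up to the constant
  1, both the square and a power above four. Eight moments of the innovation blocks do not reach the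
  tenth power of a Fourier coefficient. Truncation at |T|^(1/6) leaves a remainder whose total
  energy is bounded in mean, since |T| (|T|^(1/6))^-6 = 1, and keeps the blocks well below |T|^(1/2)
  / log |T|, as the exponential moments require. The absolutely convergent expansion has two
  origins. For a linear field the weight |s_1 s_2|^r vanishes on the axes, and summability of the
  coefficients is recovered from almost sure convergence of the series. Under contraction,
  conditional expectations on growing balls are telescoped. Centring V alters only the frequencies
  in D, one in each period.\<close>

lemma finite_rect [simp]: "finite (rect d)"
  by (simp add: rect_def)

lemma card_rect: "real (card (rect d)) = vol d"
  by (simp add: rect_def vol_def card_cartesian_product)

lemma freq_rvec_commute: "freq d k \<bullet> rvec t = freq d t \<bullet> rvec k"
  by (simp add: freq_def rvec_def inner_prod_def mult_ac)

lemma freq_diff: "freq d (j - k) = freq d j - freq d k"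
  by (simp add: freq_def prod_eq_iff diff_divide_distrib algebra_simps)

lemma freq_add: "freq d (j + k) = freq d j + freq d k"
  by (simp add: freq_def prod_eq_iff add_divide_distrib algebra_simps)

lemma rvec_diff: "rvec (s - t) = rvec s - rvec t"
  by (simp add: rvec_def)

section \<open>Orthogonality of the characters of the rectangle\<close>

lemma sum_cis_period:
  fixes t :: int and n :: nat
  assumes n: "0 < n"
  shows "(\<Sum>k\<in>{1..int n}. cis (2 * pi * real_of_int k / real n * real_of_int t)) =
    (if int n dvd t then of_nat n else 0)"
proof -
  define z where "z = cis (2 * pi * real_of_int t / real n)"
  have "(\<Sum>k\<in>{1..int n}. cis (2 * pi * real_of_int k / real n * real_of_int t)) =
    (\<Sum>k\<in>{1..n}. z ^ k)"
    by (rule sum.reindex_bij_witness[where i = int and j = nat])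
       (auto simp: z_def Complex.DeMoivre mult_ac)
  also have "\<dots> = (if int n dvd t then of_nat n else 0)"
  proof (cases "int n dvd t")
    case True
    then obtain q where "t = int n * q" by (elim dvdE)
    then have "2 * pi * real_of_int t / real n = 2 * pi * real_of_int q" using n by simp
    then have "z = cis (2 * pi * real_of_int q)" by (simp only: z_def)
    also have "\<dots> = 1" by (rule cis_multiple_2pi) simp
    finally have "z = 1" .
    then show ?thesis using True by simp
  next
    case False
    have ne: "z \<noteq> 1"
    proof
      assume "z = 1"
      then have "cos (2 * pi * real_of_int t / real n) = 1"
        by (simp add: z_def complex_eq_iff)
      then obtain m :: int where "2 * pi * real_of_int t / real n = real_of_int m * 2 * pi"
        by (auto simp: cos_one_2pi_int)
      then have "real_of_int t = real_of_int (m * int n)"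
        using n by (simp add: field_simps)
      then have "t = m * int n" by linarith
      then show False using False by simp
    qed
    have "z ^ n = cis (2 * pi * real_of_int t)" using n by (simp add: z_def Complex.DeMoivre)
    also have "\<dots> = 1" by (rule cis_multiple_2pi) simp
    finally have zn: "z ^ n = 1" .
    have "(\<Sum>k\<in>{1..n}. z ^ k) = (\<Sum>k<n. z * z ^ k)"
      by (rule sum.reindex_bij_witness[where i = Suc and j = "\<lambda>k. k - 1"])
         (auto simp flip: power_Suc)
    also have "\<dots> = z * (\<Sum>k<n. z ^ k)" by (simp add: sum_distrib_left)
    also have "\<dots> = 0" using ne zn by (simp add: geometric_sum)
    finally show ?thesis using False by simp
  qed
  finally show ?thesis .
qed

lemma sum_cis_rect:
  assumes "0 < fst d" "0 < snd d"
  shows "(\<Sum>k\<in>rect d. cis (freq d k \<bullet> rvec t)) = (if t \<in> zero_freqs d then of_real (vol d) else 0)"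
proof -
  have "(\<Sum>k\<in>rect d. cis (freq d k \<bullet> rvec t)) =
     (\<Sum>k\<in>{1..int (fst d)}. cis (2 * pi * real_of_int k / real (fst d) * real_of_int (fst t))) *
     (\<Sum>k\<in>{1..int (snd d)}. cis (2 * pi * real_of_int k / real (snd d) * real_of_int (snd t)))"
    unfolding sum_product sum.cartesian_product rect_def
    by (intro sum.cong) (auto simp: freq_def rvec_def inner_prod_def cis_mult)
  also have "\<dots> = (if t \<in> zero_freqs d then of_real (vol d) else 0)"
    unfolding sum_cis_period[OF assms(1)] sum_cis_period[OF assms(2)]
    by (cases t) (auto simp: zero_freqs_def vol_def dvd_def mult.commute)
  finally show ?thesis .
qed

lemma diff_in_zero_freqs_iff:
  assumes "s \<in> rect d" "t \<in> rect d"
  shows "s - t \<in> zero_freqs d \<longleftrightarrow> s = t"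
proof
  assume "s - t \<in> zero_freqs d"
  then obtain c1 c2 where c: "fst s - fst t = c1 * int (fst d)" "snd s - snd t = c2 * int (snd d)"
    by (auto simp: zero_freqs_def prod_eq_iff)
  \<comment> \<open>The representatives run over 1, ..., n; after subtracting one they lie in 0,
    ..., n - 1, where \<open>mod n\<close> is the identity.\<close>
  have "x = y" if "1 \<le> x" "x \<le> n" "1 \<le> y" "y \<le> n" "x - y = q * n" for x y q n :: int
  proof -
    have "x mod n = y mod n"
      using that(5) by (simp add: mod_eq_dvd_iff)
    moreover have "(x - 1) mod n = (y - 1) mod n"
      using that(5) by (simp add: mod_eq_dvd_iff)
    ultimately show ?thesis using that by (auto simp: mod_pos_pos_trivial)
  qed
  from this[of "fst s" _ "fst t" c1] this[of "snd s" _ "snd t" c2] show "s = t"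
    using assms c by (auto simp: rect_def prod_eq_iff)
next
  assume "s = t"
  then show "s - t \<in> zero_freqs d" by (auto simp: zero_freqs_def zero_prod_def intro!: exI[of _ 0])
qed

lemma sum_cos_rect:
  assumes "0 < fst d" "0 < snd d" "s \<in> rect d" "t \<in> rect d"
  shows "(\<Sum>k\<in>rect d. cos (freq d k \<bullet> rvec (s - t))) = (if s = t then vol d else 0)"
proof -
  have "(\<Sum>k\<in>rect d. cos (freq d k \<bullet> rvec (s - t))) = Re (\<Sum>k\<in>rect d. cis (freq d k \<bullet> rvec (s - t)))"
    by simp
  also have "\<dots> = (if s = t then vol d else 0)"
    using assms by (simp add: sum_cis_rect diff_in_zero_freqs_iff)
  finally show ?thesis .
qed

text \<open>Defined for an arbitrary real array, because the transform is applied not only to the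
  field but also to weights and to sign patterns. \<open>xcoef\<close> and \<open>ycoef\<close> are
  \<open>dcos\<close> and \<open>- dsin\<close> of the field.\<close>

definition dcos :: "nat \<times> nat \<Rightarrow> (int \<times> int \<Rightarrow> real) \<Rightarrow> int \<times> int \<Rightarrow> real" where
  "dcos d w j = (\<Sum>t\<in>rect d. w t * cos (freq d j \<bullet> rvec t)) / sqrt (vol d)"

definition dsin :: "nat \<times> nat \<Rightarrow> (int \<times> int \<Rightarrow> real) \<Rightarrow> int \<times> int \<Rightarrow> real" where
  "dsin d w j = (\<Sum>t\<in>rect d. w t * sin (freq d j \<bullet> rvec t)) / sqrt (vol d)"

lemma xcoef_eq_dcos: "xcoef V d j \<omega> = dcos d (\<lambda>t. V t \<omega>) j"
  by (simp add: xcoef_def dcos_def)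

lemma ycoef_eq_dsin: "ycoef V d j \<omega> = - dsin d (\<lambda>t. V t \<omega>) j"
  by (simp add: ycoef_def dsin_def sum_negf)

lemma vol_nonneg [simp]: "0 \<le> vol d"
  by (simp add: vol_def)

lemma vol_pos: "0 < fst d \<Longrightarrow> 0 < snd d \<Longrightarrow> 0 < vol d"
  by (simp add: vol_def)

lemma dcos_add: "dcos d (\<lambda>t. v t + w t) j = dcos d v j + dcos d w j"
  by (simp add: dcos_def distrib_right sum.distrib add_divide_distrib)

lemma dsin_add: "dsin d (\<lambda>t. v t + w t) j = dsin d v j + dsin d w j"
  by (simp add: dsin_def distrib_right sum.distrib add_divide_distrib)

section \<open>Power spectrum, Parseval's identity and duality\<close>

lemma power_spectrum_eq:
  "(dcos d w k)\<^sup>2 + (dsin d w k)\<^sup>2 =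
    (\<Sum>s\<in>rect d. \<Sum>t\<in>rect d. w s * w t * cos (freq d k \<bullet> rvec (s - t))) / vol d"
proof -
  have "(\<Sum>s\<in>rect d. w s * cos (freq d k \<bullet> rvec s))\<^sup>2 + (\<Sum>s\<in>rect d. w s * sin (freq d k \<bullet> rvec s))\<^sup>2
    = (\<Sum>s\<in>rect d. \<Sum>t\<in>rect d. w s * w t * cos (freq d k \<bullet> rvec (s - t)))"
    unfolding power2_eq_square sum_product sum.distrib[symmetric]
    by (intro sum.cong refl) (simp add: rvec_diff inner_diff_right cos_diff algebra_simps)
  then show ?thesis
    by (simp add: dcos_def dsin_def power_divide flip: add_divide_distrib)
qed

lemma parseval:
  assumes "0 < fst d" "0 < snd d"
  shows "(\<Sum>k\<in>rect d. (dcos d w k)\<^sup>2 + (dsin d w k)\<^sup>2) = (\<Sum>t\<in>rect d. (w t)\<^sup>2)"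
proof -
  have "(\<Sum>k\<in>rect d. (dcos d w k)\<^sup>2 + (dsin d w k)\<^sup>2) =
    (\<Sum>k\<in>rect d. \<Sum>s\<in>rect d. \<Sum>t\<in>rect d. w s * w t * cos (freq d k \<bullet> rvec (s - t))) / vol d"
    by (simp add: power_spectrum_eq sum_divide_distrib)
  also have "(\<Sum>k\<in>rect d. \<Sum>s\<in>rect d. \<Sum>t\<in>rect d. w s * w t * cos (freq d k \<bullet> rvec (s - t))) =
    (\<Sum>s\<in>rect d. \<Sum>k\<in>rect d. \<Sum>t\<in>rect d. w s * w t * cos (freq d k \<bullet> rvec (s - t)))"
    by (rule sum.swap)
  also have "\<dots> = (\<Sum>s\<in>rect d. \<Sum>t\<in>rect d. w s * w t * (\<Sum>k\<in>rect d. cos (freq d k \<bullet> rvec (s - t))))"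
    unfolding sum_distrib_left by (intro sum.cong refl sum.swap)
  also have "\<dots> = (\<Sum>s\<in>rect d. (w s)\<^sup>2 * vol d)"
    using assms by (intro sum.cong refl) (simp add: sum_cos_rect if_distrib power2_eq_square cong: if_cong)
  also have "\<dots> / vol d = (\<Sum>t\<in>rect d. (w t)\<^sup>2)"
    using vol_pos[OF assms] by (simp flip: sum_distrib_right)
  finally show ?thesis .
qed

lemma sum_dcos_sq_le:
  assumes "0 < fst d" "0 < snd d"
  shows "(\<Sum>k\<in>rect d. (dcos d w k)\<^sup>2) \<le> (\<Sum>t\<in>rect d. (w t)\<^sup>2)"
  unfolding parseval[OF assms, of w, symmetric] by (rule sum_mono) simp

lemma sum_dsin_sq_le:
  assumes "0 < fst d" "0 < snd d"
  shows "(\<Sum>k\<in>rect d. (dsin d w k)\<^sup>2) \<le> (\<Sum>t\<in>rect d. (w t)\<^sup>2)"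
  unfolding parseval[OF assms, of w, symmetric] by (rule sum_mono) simp

text \<open>The transform is symmetric in frequency and site, so it can be moved from the field to
  the coefficients. A combination of Fourier coefficients becomes a linear form in the field whose
  coefficients Parseval controls.\<close>

lemma sum_mult_dcos: "(\<Sum>k\<in>rect d. c k * dcos d w k) = (\<Sum>t\<in>rect d. w t * dcos d c t)"
proof -
  have "(\<Sum>k\<in>rect d. c k * dcos d w k) =
    (\<Sum>k\<in>rect d. \<Sum>t\<in>rect d. c k * (w t * cos (freq d k \<bullet> rvec t))) / sqrt (vol d)"
    by (simp add: dcos_def sum_distrib_left sum_divide_distrib)
  also have "\<dots> = (\<Sum>t\<in>rect d. \<Sum>k\<in>rect d. c k * (w t * cos (freq d k \<bullet> rvec t))) / sqrt (vol d)"
    by (subst sum.swap) simp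
  also have "\<dots> = (\<Sum>t\<in>rect d. w t * dcos d c t)"
    by (simp add: dcos_def sum_distrib_left sum_divide_distrib freq_rvec_commute mult_ac)
  finally show ?thesis .
qed

lemma sum_mult_dsin: "(\<Sum>k\<in>rect d. c k * dsin d w k) = (\<Sum>t\<in>rect d. w t * dsin d c t)"
proof -
  have "(\<Sum>k\<in>rect d. c k * dsin d w k) =
    (\<Sum>k\<in>rect d. \<Sum>t\<in>rect d. c k * (w t * sin (freq d k \<bullet> rvec t))) / sqrt (vol d)"
    by (simp add: dsin_def sum_distrib_left sum_divide_distrib)
  also have "\<dots> = (\<Sum>t\<in>rect d. \<Sum>k\<in>rect d. c k * (w t * sin (freq d k \<bullet> rvec t))) / sqrt (vol d)"
    by (subst sum.swap) simp
  also have "\<dots> = (\<Sum>t\<in>rect d. w t * dsin d c t)"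
    by (simp add: dsin_def sum_distrib_left sum_divide_distrib freq_rvec_commute mult_ac)
  finally show ?thesis .
qed

lemma sum_power_spectrum_eq:
  "(\<Sum>k\<in>rect d. p k * ((dcos d w k)\<^sup>2 + (dsin d w k)\<^sup>2)) =
    (\<Sum>s\<in>rect d. \<Sum>t\<in>rect d. (\<Sum>k\<in>rect d. p k * cos (freq d k \<bullet> rvec (s - t))) / vol d * (w s * w t))"
proof -
  have "(\<Sum>k\<in>rect d. p k * ((dcos d w k)\<^sup>2 + (dsin d w k)\<^sup>2)) =
    (\<Sum>k\<in>rect d. \<Sum>s\<in>rect d. \<Sum>t\<in>rect d. p k * cos (freq d k \<bullet> rvec (s - t)) / vol d * (w s * w t))"
    by (simp add: power_spectrum_eq sum_divide_distrib sum_distrib_left mult_ac)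
  also have "\<dots> = (\<Sum>s\<in>rect d. \<Sum>k\<in>rect d. \<Sum>t\<in>rect d. p k * cos (freq d k \<bullet> rvec (s - t)) / vol d * (w s * w t))"
    by (rule sum.swap)
  also have "\<dots> = (\<Sum>s\<in>rect d. \<Sum>t\<in>rect d. \<Sum>k\<in>rect d. p k * cos (freq d k \<bullet> rvec (s - t)) / vol d * (w s * w t))"
    by (intro sum.cong refl sum.swap)
  finally show ?thesis by (simp add: sum_divide_distrib sum_distrib_right)
qed

lemma sum_add_sq_le: "(\<Sum>i\<in>A. (f i + g i)\<^sup>2) \<le> 2 * ((\<Sum>i\<in>A. (f i)\<^sup>2) + (\<Sum>i\<in>A. (g i)\<^sup>2))"
  for f g :: "'i \<Rightarrow> real"
proof -
  have "(f i + g i)\<^sup>2 \<le> 2 * ((f i)\<^sup>2 + (g i)\<^sup>2)" for i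
    using sum_squares_bound[of "f i" "g i"] by (simp add: power2_sum)
  then show ?thesis by (simp add: sum.distrib[symmetric] sum_distrib_left sum_mono)
qed

text \<open>For fixed \<open>s\<close> the row in \<open>t\<close> is the transform of
  \<open>p\<close> modulated by a cosine and a sine. Parseval bounds the row, the squares of cosine
  and sine add up to one, and the \<open>vol d\<close> rows absorb the factor
  \<open>1 / vol d\<close>. The left side is the squared Hilbert-Schmidt norm of the quadratic form
  of a weighted periodogram.\<close>

lemma sum_spectral_kernel_sq_le:
  assumes d: "0 < fst d" "0 < snd d"
  shows "(\<Sum>s\<in>rect d. \<Sum>t\<in>rect d. ((\<Sum>k\<in>rect d. p k * cos (freq d k \<bullet> rvec (s - t))) / vol d)\<^sup>2)
    \<le> 2 * (\<Sum>k\<in>rect d. (p k)\<^sup>2)"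
proof -
  let ?V = "vol d"
  have V: "0 < ?V" using d by (rule vol_pos)
  have q: "(\<Sum>k\<in>rect d. p k * cos (freq d k \<bullet> rvec (s - t))) / ?V =
     (dcos d (\<lambda>k. p k * cos (freq d k \<bullet> rvec s)) t + dsin d (\<lambda>k. p k * sin (freq d k \<bullet> rvec s)) t) / sqrt ?V"
    for s t
    using V
    by (simp add: dcos_def dsin_def rvec_diff inner_diff_right cos_diff freq_rvec_commute[of d t]
        distrib_left sum.distrib mult_ac flip: add_divide_distrib)
  have "(\<Sum>t\<in>rect d. ((\<Sum>k\<in>rect d. p k * cos (freq d k \<bullet> rvec (s - t))) / ?V)\<^sup>2)
      \<le> 2 * (\<Sum>k\<in>rect d. (p k)\<^sup>2) / ?V" for s
  proof -
    have "(\<Sum>t\<in>rect d. ((\<Sum>k\<in>rect d. p k * cos (freq d k \<bullet> rvec (s - t))) / ?V)\<^sup>2) =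
       (\<Sum>t\<in>rect d. (dcos d (\<lambda>k. p k * cos (freq d k \<bullet> rvec s)) t + dsin d (\<lambda>k. p k * sin (freq d k \<bullet> rvec s)) t)\<^sup>2) / ?V"
      unfolding q using V by (simp add: power_divide sum_divide_distrib)
    also have "\<dots> \<le> (2 * ((\<Sum>k\<in>rect d. (p k * cos (freq d k \<bullet> rvec s))\<^sup>2) + (\<Sum>k\<in>rect d. (p k * sin (freq d k \<bullet> rvec s))\<^sup>2))) / ?V"
      using V
      by (intro divide_right_mono order.trans[OF sum_add_sq_le] mult_left_mono add_mono
          sum_dcos_sq_le sum_dsin_sq_le d) auto
    also have "(\<Sum>k\<in>rect d. (p k * cos (freq d k \<bullet> rvec s))\<^sup>2) + (\<Sum>k\<in>rect d. (p k * sin (freq d k \<bullet> rvec s))\<^sup>2) =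
       (\<Sum>k\<in>rect d. (p k)\<^sup>2)"
      by (simp add: power_mult_distrib flip: sum.distrib distrib_left)
    finally show ?thesis .
  qed
  then have "(\<Sum>s\<in>rect d. \<Sum>t\<in>rect d. ((\<Sum>k\<in>rect d. p k * cos (freq d k \<bullet> rvec (s - t))) / ?V)\<^sup>2)
    \<le> (\<Sum>s\<in>rect d. 2 * (\<Sum>k\<in>rect d. (p k)\<^sup>2) / ?V)"
    by (rule sum_mono)
  also have "\<dots> = 2 * (\<Sum>k\<in>rect d. (p k)\<^sup>2)"
    using V by (simp add: card_rect)
  finally show ?thesis .
qed

text \<open>Constants are orthogonal to every Fourier frequency outside \<open>zero_freqs d\<close>,
  so centring the field is invisible there.\<close>

lemma dcos_const:
  assumes "0 < fst d" "0 < snd d"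
  shows "dcos d (\<lambda>_. a) j = (if j \<in> zero_freqs d then a * sqrt (vol d) else 0)"
proof -
  have "(\<Sum>t\<in>rect d. cos (freq d j \<bullet> rvec t)) = Re (\<Sum>t\<in>rect d. cis (freq d t \<bullet> rvec j))"
    by (simp add: freq_rvec_commute)
  then have *: "(\<Sum>t\<in>rect d. cos (freq d j \<bullet> rvec t)) = (if j \<in> zero_freqs d then vol d else 0)"
    using assms by (simp add: sum_cis_rect)
  have "vol d / sqrt (vol d) = sqrt (vol d)" by (simp add: real_div_sqrt)
  then show ?thesis
    unfolding dcos_def sum_distrib_left[symmetric] * by (auto simp flip: times_divide_eq_right)
qed

lemma dsin_const:
  assumes "0 < fst d" "0 < snd d"
  shows "dsin d (\<lambda>_. a) j = 0"
proof -
  have "(\<Sum>t\<in>rect d. sin (freq d j \<bullet> rvec t)) = Im (\<Sum>t\<in>rect d. cis (freq d t \<bullet> rvec j))"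
    by (simp add: freq_rvec_commute)
  then show ?thesis using assms
    by (simp add: dsin_def sum_cis_rect flip: sum_distrib_left)
qed

section \<open>Periodisation of summable weights\<close>

definition period :: "nat \<times> nat \<Rightarrow> int \<times> int \<Rightarrow> int \<times> int" where
  "period d c = (fst c * int (fst d), snd c * int (snd d))"

lemma freq_period: "0 < fst d \<Longrightarrow> 0 < snd d \<Longrightarrow> freq d (k + period d c) = freq d k + (2 * pi) *\<^sub>R rvec c"
  by (simp add: freq_def period_def rvec_def prod_eq_iff field_simps)

text \<open>Division with remainder in each coordinate; the shifts by one occur because the
  representatives start at 1.\<close>

lemma residue_bij:
  assumes "0 < fst d" "0 < snd d"
  shows "bij_betw (\<lambda>(k, c). k + period d c) (rect d \<times> UNIV) UNIV"
proof (rule bij_betw_byWitness[where f' =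
      "\<lambda>u. (((fst u - 1) mod int (fst d) + 1, (snd u - 1) mod int (snd d) + 1),
            ((fst u - 1) div int (fst d), (snd u - 1) div int (snd d)))"])
  have 1: "(k + c * n - 1) mod n = k - 1" "(k + c * n - 1) div n = c" if "1 \<le> k" "k \<le> n" for k c n :: int
  proof -
    have e: "k + c * n - 1 = (k - 1) + c * n" by simp
    show "(k + c * n - 1) mod n = k - 1" "(k + c * n - 1) div n = c"
      unfolding e using that by (simp_all add: mod_pos_pos_trivial div_pos_pos_trivial)
  qed
  show "\<forall>a\<in>rect d \<times> UNIV. (\<lambda>u. (((fst u - 1) mod int (fst d) + 1, (snd u - 1) mod int (snd d) + 1),
            ((fst u - 1) div int (fst d), (snd u - 1) div int (snd d)))) (case a of (k, c) \<Rightarrow> k + period d c) = a"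
    by (auto simp: rect_def period_def 1)
  show "\<forall>a'\<in>UNIV. (case (((fst a' - 1) mod int (fst d) + 1, (snd a' - 1) mod int (snd d) + 1),
            ((fst a' - 1) div int (fst d), (snd a' - 1) div int (snd d))) of (k, c) \<Rightarrow> k + period d c) = a'"
    by (auto simp: period_def)
  show "(\<lambda>u. (((fst u - 1) mod int (fst d) + 1, (snd u - 1) mod int (snd d) + 1),
            ((fst u - 1) div int (fst d), (snd u - 1) div int (snd d)))) ` UNIV \<subseteq> rect d \<times> UNIV"
    using assms by (auto simp: rect_def add1_zle_eq)
qed auto

definition periodic :: "nat \<times> nat \<Rightarrow> (int \<times> int \<Rightarrow> 'b) \<Rightarrow> bool" where
  "periodic d \<phi> \<longleftrightarrow> (\<forall>k c. \<phi> (k + period d c) = \<phi> k)"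

lemma periodicD: "periodic d \<phi> \<Longrightarrow> \<phi> (k + period d c) = \<phi> k"
  unfolding periodic_def by blast

lemma periodic_range:
  assumes d: "0 < fst d" "0 < snd d" and "periodic d \<phi>"
  shows "range \<phi> = \<phi> ` rect d"
proof -
  have "UNIV = (\<lambda>(k, c). k + period d c) ` (rect d \<times> UNIV)"
    using residue_bij[OF d] by (simp add: bij_betw_def)
  then have "range \<phi> = \<phi> ` (\<lambda>(k, c). k + period d c) ` (rect d \<times> UNIV)" by simp
  also have "\<dots> = \<phi> ` rect d"
    unfolding image_image
  proof (intro equalityI subsetI)
    fix y assume "y \<in> (\<lambda>x. \<phi> (case x of (k, c) \<Rightarrow> k + period d c)) ` (rect d \<times> UNIV)"
    then show "y \<in> \<phi> ` rect d" by (auto simp: periodicD[OF assms(3)])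
  next
    fix y assume "y \<in> \<phi> ` rect d"
    then obtain k where k: "k \<in> rect d" "y = \<phi> k" by blast
    then show "y \<in> (\<lambda>x. \<phi> (case x of (k, c) \<Rightarrow> k + period d c)) ` (rect d \<times> UNIV)"
      by (intro image_eqI[of _ _ "(k, 0)"]) (auto simp: periodicD[OF assms(3)])
  qed
  finally show ?thesis .
qed

lemma periodic_mult_summable:
  fixes w \<phi> :: "int \<times> int \<Rightarrow> real"
  assumes d: "0 < fst d" "0 < snd d" and p: "periodic d \<phi>" and w: "w summable_on UNIV"
  shows "(\<lambda>s. w s * \<phi> s) summable_on UNIV"
proof -
  have "finite (range \<phi>)" by (simp add: periodic_range[OF d p])
  then have "bounded (range \<phi>)" by (rule finite_imp_bounded)
  then obtain B where B: "\<And>s. \<bar>\<phi> s\<bar> \<le> B" by (auto simp: bounded_iff)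
  have "(\<lambda>s. w s * B) summable_on UNIV" using w by (rule summable_on_cmult_left)
  then have "Infinite_Sum.abs_summable_on (\<lambda>s. w s * B) UNIV" by (rule summable_on_iff_abs_summable_on_real[THEN iffD1])
  then have "Infinite_Sum.abs_summable_on (\<lambda>s. w s * \<phi> s) UNIV"
  proof (rule Infinite_Sum.abs_summable_on_comparison_test)
    show "norm (w s * \<phi> s) \<le> norm (w s * B)" for s
      using B[of s] by (auto simp: abs_mult intro!: mult_left_mono)
  qed
  then show ?thesis by (rule Infinite_Sum.abs_summable_summable)
qed

text \<open>Coefficients and periodogram are periodic in the frequency, so a lattice sum against
  them sees only the total weight of each residue class.\<close>

definition periodize :: "nat \<times> nat \<Rightarrow> (int \<times> int \<Rightarrow> real) \<Rightarrow> int \<times> int \<Rightarrow> real" where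
  "periodize d w u = (\<Sum>\<^sub>\<infinity>c. w (u + period d c))"

lemma infsum_mult_periodic:
  fixes w \<phi> :: "int \<times> int \<Rightarrow> real"
  assumes d: "0 < fst d" "0 < snd d" and p: "periodic d \<phi>" and w: "w summable_on UNIV"
  shows "(\<Sum>\<^sub>\<infinity>s. w s * \<phi> s) = (\<Sum>k\<in>rect d. periodize d w k * \<phi> k)"
proof -
  note bij = residue_bij[OF d]
  let ?f = "\<lambda>(k, c). w (k + period d c) * \<phi> k"
  have eq: "(\<lambda>s. w s * \<phi> s) (case a of (k, c) \<Rightarrow> k + period d c) = ?f a" for a
    by (simp add: periodicD[OF p] split: prod.split)
  have "(\<Sum>\<^sub>\<infinity>s. w s * \<phi> s) = infsum ?f (rect d \<times> UNIV)"
    using infsum_reindex_bij_betw[OF bij, of "\<lambda>s. w s * \<phi> s"] by (simp add: eq)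
  moreover have "?f summable_on (rect d \<times> UNIV)"
    using summable_on_reindex_bij_betw[OF bij, of "\<lambda>s. w s * \<phi> s"] periodic_mult_summable[OF assms]
    by (simp add: eq)
  ultimately have "(\<Sum>\<^sub>\<infinity>s. w s * \<phi> s) = (\<Sum>k\<in>rect d. \<Sum>\<^sub>\<infinity>c. w (k + period d c) * \<phi> k)"
    by (simp add: infsum_Sigma_banach[symmetric])
  also have "\<dots> = (\<Sum>k\<in>rect d. periodize d w k * \<phi> k)"
    by (simp add: periodize_def infsum_cmult_left')
  finally show ?thesis .
qed

lemma infsum_mult_periodic_shift:
  fixes w \<phi> :: "int \<times> int \<Rightarrow> real"
  assumes d: "0 < fst d" "0 < snd d" and p: "periodic d \<phi>" and w: "w summable_on UNIV"
  shows "(\<Sum>\<^sub>\<infinity>s. w s * \<phi> (j + s)) = (\<Sum>k\<in>rect d. periodize d w (k - j) * \<phi> k)"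
proof -
  have bij: "bij_betw (\<lambda>u. u - j) UNIV UNIV"
    by (rule bij_betw_byWitness[where f' = "\<lambda>u. u + j"]) auto
  have "(\<Sum>\<^sub>\<infinity>s. w s * \<phi> (j + s)) = (\<Sum>\<^sub>\<infinity>u. w (u - j) * \<phi> u)"
    using infsum_reindex_bij_betw[OF bij, of "\<lambda>s. w s * \<phi> (j + s)"] by simp
  also have "\<dots> = (\<Sum>k\<in>rect d. periodize d (\<lambda>u. w (u - j)) k * \<phi> k)"
    using summable_on_reindex_bij_betw[OF bij, of w] w
    by (intro infsum_mult_periodic d p) simp
  finally show ?thesis
    by (simp add: periodize_def algebra_simps)
qed

lemma sum_periodize:
  assumes d: "0 < fst d" "0 < snd d" and w: "w summable_on UNIV"
  shows "(\<Sum>k\<in>rect d. periodize d w (k - j)) = infsum w UNIV"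
  using infsum_mult_periodic_shift[OF d _ w, of "\<lambda>_. 1" j] by (simp add: periodic_def del: split_paired_All)

text \<open>Sites are integer points, so a period in the frequency index changes each phase by an
  integer multiple of \<open>2 * pi\<close>.\<close>

lemma periodic_dcos: "0 < fst d \<Longrightarrow> 0 < snd d \<Longrightarrow> periodic d (dcos d w)"
  and periodic_dsin: "0 < fst d \<Longrightarrow> 0 < snd d \<Longrightarrow> periodic d (dsin d w)"
proof -
  have "rvec c \<bullet> rvec t = of_int (fst c * fst t + snd c * snd t)" for c t
    by (simp add: rvec_def inner_prod_def)
  then have e: "(freq d k + (2 * pi) *\<^sub>R rvec c) \<bullet> rvec t =
      freq d k \<bullet> rvec t + 2 * pi * of_int (fst c * fst t + snd c * snd t)" for k c t
    by (simp add: inner_add_left)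
  have "sin (x + 2 * pi * of_int n) = sin x" "cos (x + 2 * pi * of_int n) = cos x" for x and n :: int
    by (auto simp: sin_add cos_add sin_int_2pin cos_int_2pin)
  then show "0 < fst d \<Longrightarrow> 0 < snd d \<Longrightarrow> periodic d (dcos d w)"
    "0 < fst d \<Longrightarrow> 0 < snd d \<Longrightarrow> periodic d (dsin d w)"
    unfolding periodic_def dcos_def dsin_def by (simp_all only: freq_period e simp_thms)
qed

text \<open>The indices from 1 to floor(r n / (2 pi)) + 1 qualify. The offset in
  \<open>a - 1\<close> lets the centre itself count, which absorbs the rounding, and
  \<open>r \<le> pi\<close> keeps these indices inside one period.\<close>

lemma sum_nat_grid_card:
  fixes r :: real and n :: nat
  assumes "0 < n" "0 \<le> r" "r \<le> pi"
  shows "r / (2 * pi) * n \<le> card {a \<in> {1..int n}. 2 * pi * (real_of_int a - 1) / n \<le> r}"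
proof -
  define q where "q = nat \<lfloor>r / (2 * pi) * n\<rfloor>"
  have q: "real q \<le> r / (2 * pi) * n" "r / (2 * pi) * n < real q + 1"
    using assms unfolding q_def by (auto simp: of_nat_nat)
  have "r / (2 * pi) \<le> 1 / 2" using assms by (simp add: field_simps)
  then have "r / (2 * pi) * n \<le> 1 / 2 * n" by (intro mult_right_mono) auto
  with q have qn: "q < n" using assms by linarith
  have sub: "{1..int q + 1} \<subseteq> {a \<in> {1..int n}. 2 * pi * (real_of_int a - 1) / n \<le> r}"
  proof (clarsimp, safe)
    fix a :: int assume "1 \<le> a" "a \<le> int q + 1"
    then show "a \<le> int n" using qn by linarith
    have "real_of_int a - 1 \<le> r / (2 * pi) * n" using \<open>a \<le> int q + 1\<close> q by linarith
    then show "2 * pi * (real_of_int a - 1) / real n \<le> r"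
      using assms by (simp add: field_simps)
  qed
  have "finite {a \<in> {1..int n}. 2 * pi * (real_of_int a - 1) / n \<le> r}"
    by (rule finite_subset[OF Collect_restrict finite_atLeastAtMost_int])
  from card_mono[OF this sub]
  have "card {1..int q + 1} \<le> card {a \<in> {1..int n}. 2 * pi * (real_of_int a - 1) / n \<le> r}" .
  then show ?thesis using q by (simp add: le_nat_iff)
qed

text \<open>A cone of slope \<open>L\<close> below the maximum carries at most unit mass; in the plane this gives
  the cube of the maximum.\<close>

lemma periodic_lipschitz_bound:
  fixes P :: "int \<times> int \<Rightarrow> real" and L :: real
  assumes d: "0 < fst d" "0 < snd d"
    and nonneg: "\<And>u. 0 \<le> P u"
    and mass: "\<And>j. (\<Sum>k\<in>rect d. P (k - j)) = 1"
    and lip: "\<And>u v. \<bar>P u - P v\<bar> \<le> L / vol d * max_norm (freq d u - freq d v)"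
    and L: "0 < L"
  shows "(vol d * P u) ^ 3 \<le> 512 + 32 * pi\<^sup>2 * L\<^sup>2"
proof -
  define m where "m = vol d * P u"
  \<comment> \<open>Up to distance \<open>m / (2 * L)\<close> the Lipschitz bound costs at most half
    of the value at \<open>u\<close>; the cap at \<open>pi\<close> is what the counting of grid
    points allows.\<close>
  define r where "r = min pi (m / (2 * L))"
  have V: "0 < vol d" using d by (rule vol_pos)
  have m0: "0 \<le> m" using nonneg[of u] V by (simp add: m_def)
  have r: "0 \<le> r" "r \<le> pi" "r \<le> m / (2 * L)"
    using m0 L by (auto simp: r_def)
  define A1 where "A1 = {a \<in> {1..int (fst d)}. 2 * pi * (real_of_int a - 1) / fst d \<le> r}"
  define A2 where "A2 = {a \<in> {1..int (snd d)}. 2 * pi * (real_of_int a - 1) / snd d \<le> r}"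
  have sub: "A1 \<times> A2 \<subseteq> rect d" by (auto simp: A1_def A2_def rect_def)
  \<comment> \<open>The shift \<open>(1, 1) - u\<close> sends the index \<open>(1, 1)\<close> to
    \<open>u\<close>, so \<open>A1 \<times> A2\<close> becomes a box with a corner at
    \<open>u\<close>. One quadrant of the cone already carries enough mass.\<close>
  have lower: "m / (2 * vol d) \<le> P (k - ((1, 1) - u))" if "k \<in> A1 \<times> A2" for k
  proof -
    have "u - (k - ((1, 1) - u)) = (1, 1) - k" by simp
    then have "freq d u - freq d (k - ((1, 1) - u)) = freq d ((1, 1) - k)"
      by (simp only: freq_diff[symmetric])
    moreover have "\<bar>2 * pi * real_of_int (1 - a) / real n\<bar> \<le> r"
      if "1 \<le> a" "2 * pi * (real_of_int a - 1) / real n \<le> r" for a :: int and n :: nat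
      using that by (simp add: abs_mult)
    then have "max_norm (freq d ((1, 1) - k)) \<le> r"
      using that unfolding max_norm_def freq_def A1_def A2_def by auto
    ultimately have "max_norm (freq d u - freq d (k - ((1, 1) - u))) \<le> r" by simp
    then have "max_norm (freq d u - freq d (k - ((1, 1) - u))) \<le> m / (2 * L)" using r by linarith
    then have "\<bar>P u - P (k - ((1, 1) - u))\<bar> \<le> L / vol d * (m / (2 * L))"
      using L V by (intro order.trans[OF lip] mult_left_mono) auto
    also have "\<dots> = m / (2 * vol d)" using L by simp
    finally have "P u - P (k - ((1, 1) - u)) \<le> m / (2 * vol d)" by linarith
    moreover have "P u = 2 * (m / (2 * vol d))" using V by (simp add: m_def)
    ultimately show ?thesis by linarith
  qed
  have "r\<^sup>2 * m / (8 * pi\<^sup>2) = (r / (2 * pi) * fst d) * (r / (2 * pi) * snd d) * (m / (2 * vol d))"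
    using d by (simp add: vol_def field_simps power2_eq_square)
  also have "\<dots> \<le> real (card A1) * real (card A2) * (m / (2 * vol d))"
    unfolding A1_def A2_def using V r m0 d
    by (intro mult_right_mono mult_mono sum_nat_grid_card) auto
  also have "\<dots> = (\<Sum>k\<in>A1 \<times> A2. m / (2 * vol d))"
    by (simp add: card_cartesian_product)
  also have "\<dots> \<le> (\<Sum>k\<in>A1 \<times> A2. P (k - ((1, 1) - u)))"
    by (rule sum_mono) (rule lower)
  also have "\<dots> \<le> (\<Sum>k\<in>rect d. P (k - ((1, 1) - u)))"
    by (rule sum_mono2) (use sub nonneg in auto)
  also have "\<dots> = 1" by (rule mass)
  finally have key: "r\<^sup>2 * m \<le> 8 * pi\<^sup>2" by simp
  show ?thesis
  proof (cases "r = pi")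
    case True
    then have "m \<le> 8" using key by simp
    then have "m ^ 3 \<le> 8 ^ 3" using m0 by (rule power_mono)
    then have "(vol d * P u) ^ 3 \<le> 512" by (simp add: m_def)
    then show ?thesis by (rule order.trans) simp
  next
    case False
    then have "r = m / (2 * L)" by (auto simp: r_def min_def split: if_splits)
    then have "m ^ 3 = r\<^sup>2 * m * (4 * L\<^sup>2)"
      using L by (simp add: power2_eq_square power3_eq_cube)
    also have "\<dots> \<le> 8 * pi\<^sup>2 * (4 * L\<^sup>2)" by (intro mult_right_mono key) simp
    finally show ?thesis unfolding m_def[symmetric] by linarith
  qed
qed

section \<open>Riemann sums of the kernel\<close>

text \<open>The mesh of the lattice need not divide the box. Each axis is therefore cut into
  \<open>2 * m + 1\<close> equal cells of length \<open>l\<close>, with the lattice points as tags: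
  \<open>s * D\<close> is within \<open>l / 2\<close> of the cell centre \<open>s * l\<close>, since
  rounding displaces the outermost tag by at most that much. Passing from cell area to lattice area
  costs only factors \<open>D / l \<ge> 1 - D / (2 * R)\<close>.\<close>

lemma uniform_grid_division:
  fixes D1 D2 R :: real
  assumes D: "0 < D1" "0 < D2" and R: "D1 \<le> R" "D2 \<le> R"
  defines "m1 \<equiv> \<lfloor>R / D1\<rfloor>" and "m2 \<equiv> \<lfloor>R / D2\<rfloor>"
  defines "l1 \<equiv> 2 * R / (2 * real_of_int m1 + 1)" and "l2 \<equiv> 2 * R / (2 * real_of_int m2 + 1)"
  defines "cell \<equiv> \<lambda>s :: int \<times> int. cbox ((real_of_int (fst s) - 1/2) * l1, (real_of_int (snd s) - 1/2) * l2) ((real_of_int (fst s) + 1/2) * l1, (real_of_int (snd s) + 1/2) * l2)"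
  defines "p \<equiv> (\<lambda>s :: int \<times> int. ((real_of_int (fst s) * D1, real_of_int (snd s) * D2), cell s)) ` ({-m1..m1} \<times> {-m2..m2})"
  shows "p tagged_division_of cbox (-R, -R) (R, R)"
    and "\<And>\<delta>. l1 + l2 < \<delta> \<Longrightarrow> (\<lambda>x. ball x \<delta>) fine p"
    and "(\<Sum>(x, k)\<in>p. measure lborel k * g x) =
      l1 * l2 * (\<Sum>s\<in>{-m1..m1} \<times> {-m2..m2}. g (real_of_int (fst s) * D1, real_of_int (snd s) * D2))"
    and "0 < l1" "0 < l2" "D1 / l1 \<ge> 1 - D1 / (2 * R)" "D2 / l2 \<ge> 1 - D2 / (2 * R)"
    "l1 \<le> 2 * D1" "l2 \<le> 2 * D2"
proof -
  have aux: "0 < 2 * R / (2 * real_of_int m + 1)" "D / (2 * R / (2 * real_of_int m + 1)) \<ge> 1 - D / (2 * R)"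
      "2 * R / (2 * real_of_int m + 1) \<le> 2 * D" "R = (m + 1/2) * (2 * R / (2 * real_of_int m + 1))"
      "\<And>s. s \<in> {-m..m} \<Longrightarrow> \<bar>s * D - s * (2 * R / (2 * real_of_int m + 1))\<bar> \<le> (2 * R / (2 * real_of_int m + 1)) / 2"
      "1 \<le> m"
    if D: "0 < D" "D \<le> R" and m: "m = \<lfloor>R / D\<rfloor>" for D :: real and m :: int
  proof -
    have R0: "0 < R" using D by simp
    have "1 \<le> R / D" using D by simp
    then show m1: "1 \<le> m" unfolding m by linarith
    have mb: "m * D \<le> R" "R < (m + 1) * D"
      using floor_divide_lower[OF D(1), of R] floor_divide_upper[OF D(1), of R] by (simp_all add: m)
    have pos: "0 < 2 * real_of_int m + 1" using m1 by linarith
    show "0 < 2 * R / (2 * real_of_int m + 1)" using pos R0 by simp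
    have "2 * R - D \<le> D * (2 * real_of_int m + 1)" using mb by (simp add: algebra_simps)
    then have "(2 * R - D) / (2 * R) \<le> D * (2 * real_of_int m + 1) / (2 * R)"
      using R0 by (intro divide_right_mono) auto
    then show "D / (2 * R / (2 * real_of_int m + 1)) \<ge> 1 - D / (2 * R)"
      using R0 pos by (simp add: diff_divide_distrib)
    have "2 * R \<le> 2 * D * (m + 1)" using mb by (simp add: algebra_simps)
    also have "\<dots> \<le> 2 * D * (2 * real_of_int m + 1)" using m1 D by (intro mult_left_mono) auto
    finally show "2 * R / (2 * real_of_int m + 1) \<le> 2 * D" using pos by (simp add: field_simps)
    show "R = (m + 1/2) * (2 * R / (2 * real_of_int m + 1))" using pos by (simp add: field_simps)
    show "\<bar>s * D - s * (2 * R / (2 * real_of_int m + 1))\<bar> \<le> (2 * R / (2 * real_of_int m + 1)) / 2" if s: "s \<in> {-m..m}" for s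
    proof -
      have "s * D - s * (2 * R / (2 * real_of_int m + 1)) = s * ((D * (2 * real_of_int m + 1) - 2 * R) / (2 * real_of_int m + 1))"
        using pos by (simp add: field_simps)
      then have "\<bar>s * D - s * (2 * R / (2 * real_of_int m + 1))\<bar> = \<bar>real_of_int s\<bar> * (\<bar>D * (2 * real_of_int m + 1) - 2 * R\<bar> / (2 * real_of_int m + 1))"
        using pos by (simp add: abs_mult)
      also have "\<dots> \<le> m * (D / (2 * real_of_int m + 1))"
      proof (intro mult_mono divide_right_mono)
        show "\<bar>real_of_int s\<bar> \<le> m" using s by (auto simp: abs_le_iff)
        show "\<bar>D * (2 * real_of_int m + 1) - 2 * R\<bar> \<le> D" using mb by (simp add: abs_le_iff algebra_simps)
      qed (use pos m1 in auto)
      also have "\<dots> = m * D / (2 * real_of_int m + 1)" by simp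
      also have "\<dots> \<le> R / (2 * real_of_int m + 1)" using pos mb by (intro divide_right_mono) auto
      also have "\<dots> = (2 * R / (2 * real_of_int m + 1)) / 2" using pos by (simp add: field_simps)
      finally show ?thesis .
    qed
  qed
  have a1: "m1 = \<lfloor>R / D1\<rfloor>" and a2: "m2 = \<lfloor>R / D2\<rfloor>" by (simp_all add: m1_def m2_def)
  note A1 = aux[OF D(1) R(1) a1, folded l1_def]
  note A2 = aux[OF D(2) R(2) a2, folded l2_def]
  show "0 < l1" "0 < l2" "D1 / l1 \<ge> 1 - D1 / (2 * R)" "D2 / l2 \<ge> 1 - D2 / (2 * R)"
    "l1 \<le> 2 * D1" "l2 \<le> 2 * D2" using A1 A2 by blast+
  have mem1: "s * D \<in> {(s - 1/2) * l..(s + 1/2) * l}" if "\<bar>s * D - s * l\<bar> \<le> l / 2" for s :: int and D l :: real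
  proof -
    have "s * D - s * l \<le> l / 2" "s * l - s * D \<le> l / 2" using that by linarith+
    then show ?thesis by (simp add: algebra_simps)
  qed
  have tag: "(real_of_int (fst s) * D1, real_of_int (snd s) * D2) \<in> cell s" if "s \<in> {-m1..m1} \<times> {-m2..m2}" for s :: "int \<times> int"
    using that mem1[OF A1(5)] mem1[OF A2(5)] by (auto simp: cell_def)
  have sub1: "{(s - 1/2) * l..(s + 1/2) * l} \<subseteq> {-R..R}" if "s \<in> {-m..m}" "0 < l" "R = (m + 1/2) * l"
    for s m :: int and l :: real
  proof -
    have "(s + 1/2) * l \<le> (m + 1/2) * l" "(-m - 1/2) * l \<le> (s - 1/2) * l"
      using that(1,2) by (auto intro!: mult_right_mono)
    then show ?thesis using that(3) by (auto simp: algebra_simps)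
  qed
  have sub: "cell s \<subseteq> cbox (-R, -R) (R, R)" if "s \<in> {-m1..m1} \<times> {-m2..m2}" for s :: "int \<times> int"
    using that sub1[OF _ A1(1) A1(4)] sub1[OF _ A2(1) A2(4)] unfolding cell_def cbox_Pair_eq
    by (intro Sigma_mono) (auto simp: cbox_interval)
  have cov1: "\<exists>s\<in>{-m..m}. x \<in> {(s - 1/2) * l..(s + 1/2) * l}" if "x \<in> {-R..R}" "0 < l" "R = (m + 1/2) * l" "1 \<le> m"
    for x l :: real and m :: int
  proof -
    \<comment> \<open>The minimum catches the right end point of the interval, which rounding alone
      would put into a cell \<open>m + 1\<close>.\<close>
    define s where "s = min m \<lfloor>x / l + 1/2\<rfloor>"
    have xl: "- (m + 1/2) \<le> x / l" "x / l \<le> m + 1/2"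
      using that by (auto simp: field_simps)
    then have "- m \<le> \<lfloor>x / l + 1/2\<rfloor>" by linarith
    then have "s \<in> {-m..m}" using that by (auto simp: s_def)
    moreover have "s - 1/2 \<le> x / l" "x / l \<le> s + 1/2"
      using xl unfolding s_def by linarith+
    then have "x \<in> {(s - 1/2) * l..(s + 1/2) * l}" using that(2) by (auto simp: field_simps)
    ultimately show ?thesis by blast
  qed
  have disj1: "{(s - 1/2) * l<..<(s + 1/2) * l} \<inter> {(t - 1/2) * l<..<(t + 1/2) * l} = {}"
    if "s \<noteq> t" "0 < l" for s t :: int and l :: real
  proof -
    have *: "(a + 1/2) * l \<le> (b - 1/2) * l" if "a < b" for a b :: int
      using that \<open>0 < l\<close> by (intro mult_right_mono) auto
    from that(1) consider "s < t" | "t < s" by linarith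
    then show ?thesis by cases (use * in fastforce)+
  qed
  show div: "p tagged_division_of cbox (-R, -R) (R, R)"
  proof (rule tagged_division_ofI)
    show "finite p" by (simp add: p_def)
    show "x \<in> k" "k \<subseteq> cbox (-R, -R) (R, R)" "\<exists>a b. k = cbox a b" if p: "(x, k) \<in> p" for x k
    proof -
      obtain s :: "int \<times> int" where s: "s \<in> {-m1..m1} \<times> {-m2..m2}" "x = (real_of_int (fst s) * D1, real_of_int (snd s) * D2)" "k = cell s"
        using p unfolding p_def by (elim imageE) simp
      show "x \<in> k" "k \<subseteq> cbox (-R, -R) (R, R)" unfolding s(2,3) by (rule tag[OF s(1)], rule sub[OF s(1)])
      show "\<exists>a b. k = cbox a b" unfolding s(3) cell_def by blast
    qed
    show "interior k1 \<inter> interior k2 = {}" if p: "(x1, k1) \<in> p" "(x2, k2) \<in> p" "(x1, k1) \<noteq> (x2, k2)" for x1 k1 x2 k2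
    proof -
      from p obtain s t :: "int \<times> int" where st: "k1 = cell s" "k2 = cell t" "s \<noteq> t" by (auto simp: p_def)
      then consider "fst s \<noteq> fst t" | "snd s \<noteq> snd t" by (auto simp: prod_eq_iff)
      then show ?thesis
      proof cases
        case 1
        from disj1[OF this A1(1)] show ?thesis
          unfolding st cell_def cbox_Pair_eq interior_Times by (auto simp: cbox_interval interior_atLeastAtMost_real)
      next
        case 2
        from disj1[OF this A2(1)] show ?thesis
          unfolding st cell_def cbox_Pair_eq interior_Times by (auto simp: cbox_interval interior_atLeastAtMost_real)
      qed
    qed
    show "\<Union>{k. \<exists>x. (x, k) \<in> p} = cbox (-R, -R) (R, R)"
    proof
      show "\<Union>{k. \<exists>x. (x, k) \<in> p} \<subseteq> cbox (-R, -R) (R, R)" using sub by (auto simp: p_def)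
      show "cbox (-R, -R) (R, R) \<subseteq> \<Union>{k. \<exists>x. (x, k) \<in> p}"
      proof
        fix z :: "real \<times> real" assume "z \<in> cbox (-R, -R) (R, R)"
        then have "fst z \<in> {-R..R}" "snd z \<in> {-R..R}" by (cases z; simp add: cbox_interval)+
        from cov1[OF this(1) A1(1) A1(4) A1(6)] cov1[OF this(2) A2(1) A2(4) A2(6)]
        obtain s1 s2 where s: "s1 \<in> {-m1..m1}" "fst z \<in> {(s1 - 1/2) * l1..(s1 + 1/2) * l1}"
            "s2 \<in> {-m2..m2}" "snd z \<in> {(s2 - 1/2) * l2..(s2 + 1/2) * l2}" by blast
        have "z \<in> cell (s1, s2)" using s by (cases z) (simp add: cell_def cbox_interval)
        moreover have "((s1 * D1, s2 * D2), cell (s1, s2)) \<in> p"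
          unfolding p_def using s by (intro image_eqI[of _ _ "(s1, s2)"]) auto
        ultimately show "z \<in> \<Union>{k. \<exists>x. (x, k) \<in> p}" by blast
      qed
    qed
  qed
  show "(\<lambda>x. ball x \<delta>) fine p" if \<delta>: "l1 + l2 < \<delta>" for \<delta>
  proof (rule fineI)
    fix x k assume "(x, k) \<in> p"
    then obtain s :: "int \<times> int" where s: "s \<in> {-m1..m1} \<times> {-m2..m2}" "x = (real_of_int (fst s) * D1, real_of_int (snd s) * D2)" "k = cell s"
      by (auto simp: p_def)
    show "k \<subseteq> ball x \<delta>"
    proof
      fix z assume "z \<in> k"
      then have z: "fst z \<in> {(real_of_int (fst s) - 1/2) * l1..(real_of_int (fst s) + 1/2) * l1}" "snd z \<in> {(real_of_int (snd s) - 1/2) * l2..(real_of_int (snd s) + 1/2) * l2}"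
        by (cases z; simp add: s cell_def cbox_interval)+
      have x: "fst x \<in> {(real_of_int (fst s) - 1/2) * l1..(real_of_int (fst s) + 1/2) * l1}" "snd x \<in> {(real_of_int (snd s) - 1/2) * l2..(real_of_int (snd s) + 1/2) * l2}"
        using tag[OF s(1)] by (simp_all add: s cell_def cbox_interval)
      have "dist x z \<le> \<bar>fst x - fst z\<bar> + \<bar>snd x - snd z\<bar>"
        unfolding dist_prod_def by (rule order.trans[OF sqrt_sum_squares_le_sum_abs]) (simp add: dist_real_def)
      also have "\<bar>fst x - fst z\<bar> \<le> l1" using x z by (auto simp: abs_le_iff algebra_simps)
      also have "\<bar>snd x - snd z\<bar> \<le> l2" using x z by (auto simp: abs_le_iff algebra_simps)
      finally show "z \<in> ball x \<delta>" using \<delta> by simp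
    qed
  qed
  have inj: "inj_on (\<lambda>s :: int \<times> int. ((real_of_int (fst s) * D1, real_of_int (snd s) * D2), cell s)) A" for A
    using D by (auto simp: inj_on_def prod_eq_iff)
  have "measure lborel (cell s) = l1 * l2" for s
    using A1(1) A2(1) by (simp add: cell_def content_Pair algebra_simps)
  then show "(\<Sum>(x, k)\<in>p. measure lborel k * g x) =
      l1 * l2 * (\<Sum>s\<in>{-m1..m1} \<times> {-m2..m2}. g (real_of_int (fst s) * D1, real_of_int (snd s) * D2))"
    unfolding p_def by (simp add: sum.reindex[OF inj] sum_distrib_left)
qed

section \<open>Concentration of the kernel weights at the scale of the bandwidth\<close>

lemma abs_prod_pos: "0 < fst h \<Longrightarrow> 0 < snd h \<Longrightarrow> 0 < abs_prod h"
  by (simp add: abs_prod_def)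

lemma abs_prod_nonneg [simp]: "0 \<le> abs_prod h"
  by (simp add: abs_prod_def)

text \<open>Tightness of the weights. A large box carries almost all of the integral of
  \<open>K\<close>; a Riemann sum transfers this to the lattice points of the box; and the total
  lattice mass tends to 1, so by nonnegativity little can lie outside. This takes the place of
  pointwise decay of \<open>K\<close>.\<close>

lemma box_mass_ge:
  fixes d :: "nat \<Rightarrow> nat \<times> nat" and h :: "nat \<Rightarrow> real \<times> real"
  assumes K0: "\<And>x. 0 \<le> K x" and int: "has_plane_integral K 1"
    and riem: "(\<lambda>n. 4 * pi\<^sup>2 / (abs_prod (h n) * vol (d n)) *
                  (\<Sum>\<^sub>\<infinity>j. scaled_kernel K (h n) (freq (d n) j))) \<longlonglongrightarrow> 1"
    and pos: "\<forall>\<^sub>F n in sequentially. 0 < fst (h n) \<and> 0 < snd (h n) \<and> 0 < fst (d n) \<and> 0 < snd (d n)"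
    and mesh1: "(\<lambda>n. 2 * pi / (fst (h n) * real (fst (d n)))) \<longlonglongrightarrow> 0"
    and mesh2: "(\<lambda>n. 2 * pi / (snd (h n) * real (snd (d n)))) \<longlonglongrightarrow> 0"
    and \<epsilon>: "0 < \<epsilon>"
  obtains R where "0 < R" "\<forall>\<^sub>F n in sequentially. \<exists>B. finite B \<and> 1 - \<epsilon> \<le> (\<Sum>s\<in>B. weight K (d n) (h n) s) \<and>
     (\<forall>s\<in>B. \<bar>fst (freq (d n) s)\<bar> \<le> R * fst (h n) \<and> \<bar>snd (freq (d n) s)\<bar> \<le> R * snd (h n))"
proof -
  \<comment> \<open>The two mesh corrections \<open>1 - e\<close>, the Riemann sum
    \<open>1 - 2 * e\<close> and the total mass \<open>1 + e\<close> combine to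
    \<open>1 - 5 * e\<close>.\<close>
  define e where "e = min (\<epsilon> / 5) (1 / 5)"
  have e: "0 < e" "e \<le> 1 / 5" "5 * e \<le> \<epsilon>" using \<epsilon> by (auto simp: e_def)
  from int obtain J where J: "\<And>R. 0 < R \<Longrightarrow> has_riemann_integral K (J R) (cbox (- R, - R) (R, R))"
    and J1: "(J \<longlongrightarrow> 1) at_top" by (auto simp: has_plane_integral_def)
  have "\<forall>\<^sub>F R in at_top. 1 - e < J R \<and> 0 < R"
    using order_tendstoD(1)[OF J1, of "1 - e"] e by (auto intro: eventually_conj eventually_gt_at_top)
  then obtain R where R: "0 < R" "1 - e < J R" using eventually_happens[of _ "at_top :: real filter"] by auto
  from J[OF R(1)] e obtain \<delta> where \<delta>: "0 < \<delta>" and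
    riemann: "\<And>p. p tagged_division_of cbox (- R, - R) (R, R) \<Longrightarrow> (\<lambda>x. ball x \<delta>) fine p \<Longrightarrow>
         \<bar>(\<Sum>(x, k)\<in>p. measure lborel k * K x) - J R\<bar> < e"
    unfolding has_riemann_integral_def by meson
  define D1 where "D1 n = 2 * pi / (fst (h n) * real (fst (d n)))" for n
  define D2 where "D2 n = 2 * pi / (snd (h n) * real (snd (d n)))" for n
  \<comment> \<open>The three entries give
    \<open>l1 + l2 \<le> 2 * (D1 n + D2 n) < \<delta>\<close>, the condition
    \<open>D \<le> R\<close> of the grid, and a relative mesh error of at most
    \<open>e\<close>.\<close>
  define \<eta> where "\<eta> = min (\<delta> / 5) (min R (2 * R * e))"
  have \<eta>: "0 < \<eta>" using \<delta> R e by (simp add: \<eta>_def)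
  have "\<forall>\<^sub>F n in sequentially. D1 n < \<eta>" "\<forall>\<^sub>F n in sequentially. D2 n < \<eta>"
    using order_tendstoD(2)[OF mesh1 \<eta>] order_tendstoD(2)[OF mesh2 \<eta>] by (simp_all add: D1_def D2_def)
  moreover have "\<forall>\<^sub>F n in sequentially. 4 * pi\<^sup>2 / (abs_prod (h n) * vol (d n)) *
                  (\<Sum>\<^sub>\<infinity>j. scaled_kernel K (h n) (freq (d n) j)) < 1 + e"
    using order_tendstoD(2)[OF riem, of "1 + e"] e by simp
  moreover have "\<forall>\<^sub>F n in sequentially. 1 / 2 < 4 * pi\<^sup>2 / (abs_prod (h n) * vol (d n)) *
                  (\<Sum>\<^sub>\<infinity>j. scaled_kernel K (h n) (freq (d n) j))"
    using order_tendstoD(1)[OF riem, of "1 / 2"] e by simp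
  ultimately have "\<forall>\<^sub>F n in sequentially. \<exists>B. finite B \<and> 1 - \<epsilon> \<le> (\<Sum>s\<in>B. weight K (d n) (h n) s) \<and>
     (\<forall>s\<in>B. \<bar>fst (freq (d n) s)\<bar> \<le> R * fst (h n) \<and> \<bar>snd (freq (d n) s)\<bar> \<le> R * snd (h n))"
    using pos
  proof eventually_elim
    case (elim n)
    define S where "S = (\<Sum>\<^sub>\<infinity>j. scaled_kernel K (h n) (freq (d n) j))"
    have D: "0 < D1 n" "0 < D2 n" "D1 n \<le> R" "D2 n \<le> R" "5 * D1 n < \<delta>" "5 * D2 n < \<delta>"
        "D1 n / (2 * R) \<le> e" "D2 n / (2 * R) \<le> e"
      using elim R by (auto simp: D1_def[of n] D2_def[of n] \<eta>_def field_simps)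
    have DD: "D1 n * D2 n = 4 * pi\<^sup>2 / (abs_prod (h n) * vol (d n))"
      using elim by (simp add: D1_def D2_def abs_prod_def vol_def power2_eq_square)
    define m1 where "m1 = \<lfloor>R / D1 n\<rfloor>"
    define m2 where "m2 = \<lfloor>R / D2 n\<rfloor>"
    define l1 where "l1 = 2 * R / (2 * real_of_int m1 + 1)"
    define l2 where "l2 = 2 * R / (2 * real_of_int m2 + 1)"
    note ug = uniform_grid_division[OF D(1-4), folded m1_def m2_def, folded l1_def l2_def]
    define B where "B = {-m1..m1} \<times> {-m2..m2}"
    define A where "A = (\<Sum>s\<in>B. K (real_of_int (fst s) * D1 n, real_of_int (snd s) * D2 n))"
    have "l1 + l2 < \<delta>" using ug(8,9) D by linarith
    from riemann[OF ug(1) ug(2)[OF this]] have "\<bar>l1 * l2 * A - J R\<bar> < e"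
      by (simp add: ug(3) A_def B_def)
    then have A1: "1 - 2 * e \<le> l1 * l2 * A" using R by linarith
    have q: "1 - e \<le> D1 n / l1" "1 - e \<le> D2 n / l2" using ug(6,7) D by linarith+
    have "(1 - e) * (1 - e) * (1 - 2 * e) \<le> (D1 n / l1) * (D2 n / l2) * (l1 * l2 * A)"
      using q A1 e D ug(4,5) by (intro mult_mono) auto
    also have "\<dots> = D1 n * D2 n * A" using ug(4,5) by simp
    finally have low: "(1 - e) * (1 - e) * (1 - 2 * e) \<le> D1 n * D2 n * A" .
    have up: "1 / 2 < D1 n * D2 n * S" "D1 n * D2 n * S < 1 + e" using elim by (simp_all add: DD S_def)
    have "(1 - e) * (1 - e) * (1 - 2 * e) - (1 - 5 * e) * (1 + e) = 2 * (e * e) * (5 - e)"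
      by (simp add: algebra_simps)
    moreover have "0 \<le> 2 * (e * e) * (5 - e)" using e by (intro mult_nonneg_nonneg) auto
    ultimately have "(1 - 5 * e) * (1 + e) \<le> (1 - e) * (1 - e) * (1 - 2 * e)" by linarith
    note order.trans[OF this low]
    moreover have "(1 - 5 * e) * (D1 n * D2 n * S) \<le> (1 - 5 * e) * (1 + e)"
      using up e by (intro mult_left_mono) auto
    ultimately have "(1 - 5 * e) * (D1 n * D2 n * S) \<le> D1 n * D2 n * A" by (rule order.trans[rotated])
    then have "1 - 5 * e \<le> D1 n * D2 n * A / (D1 n * D2 n * S)"
      using up by (subst pos_le_divide_eq) linarith+
    also have "\<dots> = A / S" using D by simp
    also have "\<dots> = (\<Sum>s\<in>B. weight K (d n) (h n) s)"
      using elim by (simp add: A_def S_def weight_def sum_divide_distrib scaled_kernel_def freq_def D1_def D2_def mult_ac)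
    finally have "1 - \<epsilon> \<le> (\<Sum>s\<in>B. weight K (d n) (h n) s)" using e by linarith
    moreover have "\<bar>fst (freq (d n) s)\<bar> \<le> R * fst (h n) \<and> \<bar>snd (freq (d n) s)\<bar> \<le> R * snd (h n)" if "s \<in> B" for s
    proof -
      have "\<bar>real_of_int i\<bar> * D \<le> R" if "i \<in> {-\<lfloor>R / D\<rfloor>..\<lfloor>R / D\<rfloor>}" "0 < D" for i :: int and D
      proof -
        have "\<bar>real_of_int i\<bar> \<le> R / D" using that by (auto simp: abs_le_iff le_floor_iff) linarith
        then show ?thesis using that by (simp add: field_simps)
      qed
      from this[of "fst s" "D1 n"] this[of "snd s" "D2 n"]
      have "\<bar>real_of_int (fst s)\<bar> * D1 n \<le> R" "\<bar>real_of_int (snd s)\<bar> * D2 n \<le> R"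
        using that D by (auto simp: B_def m1_def m2_def)
      moreover have "\<bar>fst (freq (d n) s)\<bar> = \<bar>real_of_int (fst s)\<bar> * D1 n * fst (h n)"
        "\<bar>snd (freq (d n) s)\<bar> = \<bar>real_of_int (snd s)\<bar> * D2 n * snd (h n)"
        using elim by (simp_all add: freq_def D1_def D2_def abs_mult)
      ultimately show ?thesis using elim by (simp add: mult_right_mono)
    qed
    moreover have "finite B" by (simp add: B_def)
    ultimately show ?case by blast
  qed
  with R(1) show ?thesis by (rule that)
qed

section \<open>Normalised weights and their folding onto one period\<close>

lemma weight_nonneg: "(\<And>x. 0 \<le> K x) \<Longrightarrow> 0 \<le> weight K d h s"
  by (simp add: weight_def scaled_kernel_def infsum_nonneg)

lemma weight_summable: "(\<lambda>j. scaled_kernel K h (freq d j)) summable_on UNIV \<Longrightarrow> weight K d h summable_on UNIV"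
  unfolding weight_def divide_inverse by (rule summable_on_cmult_left)

lemma weight_infsum:
  assumes "(\<Sum>\<^sub>\<infinity>j. scaled_kernel K h (freq d j)) \<noteq> 0"
  shows "infsum (weight K d h) UNIV = 1"
  using assms unfolding weight_def divide_inverse by (simp add: infsum_cmult_left')

text \<open>A period in the index is \<open>2 * pi\<close> in the frequency, so the folded weights
  are multiples of the periodised kernel and inherit its Lipschitz bound at the Fourier
  frequencies.\<close>

lemma periodize_weight:
  assumes "0 < fst d" "0 < snd d" "0 < fst h" "0 < snd h"
  shows "periodize d (weight K d h) u =
    abs_prod h / (\<Sum>\<^sub>\<infinity>j. scaled_kernel K h (freq d j)) * periodized_kernel K h (freq d u)"
proof -
  have "periodize d (weight K d h) u =
      (\<Sum>\<^sub>\<infinity>c. scaled_kernel K h (freq d u + (2 * pi) *\<^sub>R rvec c)) / (\<Sum>\<^sub>\<infinity>j. scaled_kernel K h (freq d j))"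
    using assms unfolding periodize_def weight_def divide_inverse by (simp add: freq_period infsum_cmult_left')
  then show ?thesis
    using abs_prod_pos[OF assms(3,4)] by (simp add: periodized_kernel_def)
qed

text \<open>The normalising sum is at least of order |h||T|, so the folded weights have a Lipschitz
  constant of order |h|^(-3/2) / |T|. The cone argument squares |h|^(-3/2), and the cube root of the
  resulting |h|^-3 is the factor 1/|h| of the maximum bound.\<close>

lemma periodized_weight_bounds:
  assumes d: "0 < fst d" "0 < snd d" and h: "0 < fst h" "0 < snd h" "abs_prod h \<le> 1"
    and K0: "\<And>x. 0 \<le> K x" and L: "0 < L"
    and S: "1 / 2 < 4 * pi\<^sup>2 / (abs_prod h * vol d) * (\<Sum>\<^sub>\<infinity>j. scaled_kernel K h (freq d j))"
    and lip: "\<And>s t. abs_prod h powr (3/2) * \<bar>periodized_kernel K h (freq d s) - periodized_kernel K h (freq d t)\<bar>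
               \<le> L * max_norm (freq d s - freq d t)"
  defines "P \<equiv> periodize d (weight K d h)"
  shows "weight K d h summable_on UNIV" "infsum (weight K d h) UNIV = 1"
    "0 \<le> P u" "(\<Sum>k\<in>rect d. P (k - j)) = 1"
    "\<bar>P u - P v\<bar> \<le> 8 * pi\<^sup>2 * L * abs_prod h powr (- 3/2) / vol d * max_norm (freq d u - freq d v)"
    "P u \<le> (8 + 32 * pi\<^sup>2 * (8 * pi\<^sup>2 * L)\<^sup>2) / (abs_prod h * vol d)"
proof -
  have V: "0 < vol d" using d by (rule vol_pos)
  have H: "0 < abs_prod h" using h by (intro abs_prod_pos)
  let ?S = "\<Sum>\<^sub>\<infinity>j. scaled_kernel K h (freq d j)"
  have S0: "abs_prod h * vol d / (8 * pi\<^sup>2) < ?S" using S V H by (simp add: field_simps)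
  then have Spos: "0 < ?S" using V H by (smt (verit) divide_pos_pos mult_pos_pos pi_gt_zero zero_less_power)
  \<comment> \<open>\<open>infsum\<close> is zero on families that are not summable, so a positive
    value proves summability.\<close>
  have sm: "(\<lambda>j. scaled_kernel K h (freq d j)) summable_on UNIV"
    using Spos infsum_not_exists by fastforce
  show w1: "weight K d h summable_on UNIV" by (rule weight_summable[OF sm])
  show w2: "infsum (weight K d h) UNIV = 1" using Spos by (intro weight_infsum) simp
  show nonneg: "0 \<le> P u" for u
    unfolding P_def periodize_def by (intro infsum_nonneg weight_nonneg K0)
  show mass: "(\<Sum>k\<in>rect d. P (k - j)) = 1" for j
    unfolding P_def by (simp add: sum_periodize[OF d w1] w2)
  have ratio: "abs_prod h / ?S \<le> 8 * pi\<^sup>2 / vol d" "0 \<le> abs_prod h / ?S"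
    using S0 V H Spos by (simp_all add: field_simps)
  show Plip: "\<bar>P u - P v\<bar> \<le> 8 * pi\<^sup>2 * L * abs_prod h powr (- 3/2) / vol d * max_norm (freq d u - freq d v)" for u v
  proof -
    have inv: "abs_prod h powr (- 3/2) * abs_prod h powr (3/2) = 1"
      using H by (simp add: powr_add[symmetric])
    let ?x = "\<bar>periodized_kernel K h (freq d u) - periodized_kernel K h (freq d v)\<bar>"
    have "?x = abs_prod h powr (- 3/2) * (abs_prod h powr (3/2) * ?x)"
      unfolding mult.assoc[symmetric] inv by simp
    also have "\<dots> \<le> abs_prod h powr (- 3/2) * (L * max_norm (freq d u - freq d v))"
      by (intro mult_left_mono lip) simp
    finally have x: "?x \<le> abs_prod h powr (- 3/2) * (L * max_norm (freq d u - freq d v))" .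
    have "\<bar>P u - P v\<bar> = abs_prod h / ?S * ?x"
      unfolding P_def periodize_weight[OF d h(1,2)] right_diff_distrib[symmetric] abs_mult
      using ratio Spos by simp
    also have "\<dots> \<le> 8 * pi\<^sup>2 / vol d * (abs_prod h powr (- 3/2) * (L * max_norm (freq d u - freq d v)))"
      using ratio x V by (intro mult_mono) auto
    finally show ?thesis by (simp add: mult_ac)
  qed
  \<comment> \<open>\<open>c \<ge> 8\<close> and \<open>abs_prod h \<le> 1\<close> allow the
    constant \<open>512 = 8 ^ 3\<close> to be absorbed into the cube of
    \<open>c / abs_prod h\<close>.\<close>
  define c where "c = 8 + 32 * pi\<^sup>2 * (8 * pi\<^sup>2 * L)\<^sup>2"
  have c1: "8 \<le> c" by (simp add: c_def)
  have "(abs_prod h powr (- 3/2))\<^sup>2 = abs_prod h powr (-3)" 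
    by (simp add: power2_eq_square powr_add[symmetric])
  also have "\<dots> = 1 / abs_prod h ^ 3"
    using H by (simp add: powr_minus divide_inverse)
  finally have h3: "(abs_prod h powr (- 3/2))\<^sup>2 = 1 / abs_prod h ^ 3" .
  have "(vol d * P u) ^ 3 \<le> 512 + 32 * pi\<^sup>2 * (8 * pi\<^sup>2 * L * abs_prod h powr (- 3/2))\<^sup>2"
    using nonneg mass Plip L H by (intro periodic_lipschitz_bound d) auto
  also have "\<dots> = 512 + (c - 8) / abs_prod h ^ 3"
    unfolding power_mult_distrib[of "8 * pi\<^sup>2 * L"] h3 by (simp add: c_def)
  also have "\<dots> \<le> (c / abs_prod h) ^ 3"
  proof -
    have a3: "abs_prod h ^ 3 \<le> 1" "0 < abs_prod h ^ 3" using H h(3) by (simp_all add: power_le_one)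
    have "8\<^sup>2 * c \<le> c\<^sup>2 * c" using c1 power_mono[of 8 c 2] by (intro mult_right_mono) auto
    then have "512 + (c - 8) \<le> c ^ 3" using c1 unfolding power3_eq_cube power2_eq_square by linarith
    moreover have "512 * abs_prod h ^ 3 \<le> 512" using a3(1) by linarith
    ultimately have "512 * abs_prod h ^ 3 + (c - 8) \<le> c ^ 3" by linarith
    then have "(512 * abs_prod h ^ 3 + (c - 8)) / abs_prod h ^ 3 \<le> c ^ 3 / abs_prod h ^ 3"
      using a3(2) by (intro divide_right_mono) auto
    then show ?thesis using a3(2) by (simp add: power_divide add_divide_distrib)
  qed
  finally have "(vol d * P u) ^ Suc 2 \<le> (c / abs_prod h) ^ Suc 2" by (simp only: eval_nat_numeral)
  then have "vol d * P u \<le> c / abs_prod h"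
    by (rule power_le_imp_le_base) (use c1 H in auto)
  then have "P u \<le> c / abs_prod h / vol d" using V by (subst pos_le_divide_eq) (simp_all add: mult.commute)
  then show "P u \<le> (8 + 32 * pi\<^sup>2 * (8 * pi\<^sup>2 * L)\<^sup>2) / (abs_prod h * vol d)"
    by (simp only: c_def divide_divide_eq_left)
qed

section \<open>Uniformity over the frequencies by chaining\<close>

text \<open>Frequencies are grouped by rounding \<open>N * j / d\<close> down, and one member of
  each occupied cell is selected, so the net consists of genuine Fourier frequencies even when these
  are coarser than the mesh. The end value \<open>j = d\<close> is the reason for
  \<open>N + 1\<close> cells on each axis.\<close>

lemma freq_net:
  fixes N :: nat
  assumes d: "0 < fst d" "0 < snd d" and N: "0 < N"
  obtains J where "J \<subseteq> rect d" "card J \<le> (N + 1)\<^sup>2"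
    "\<And>j. j \<in> rect d \<Longrightarrow> \<exists>j'\<in>J. max_norm (freq d j - freq d j') \<le> 2 * pi / N"
proof -
  define \<kappa> :: "int \<times> int \<Rightarrow> int \<times> int"
    where "\<kappa> j = (\<lfloor>real N * real_of_int (fst j) / real (fst d)\<rfloor>, \<lfloor>real N * real_of_int (snd j) / real (snd d)\<rfloor>)" for j
  define J where "J = (\<lambda>c. SOME j. j \<in> rect d \<and> \<kappa> j = c) ` \<kappa> ` rect d"
  have some: "(SOME j'. j' \<in> rect d \<and> \<kappa> j' = \<kappa> j) \<in> rect d \<and> \<kappa> (SOME j'. j' \<in> rect d \<and> \<kappa> j' = \<kappa> j) = \<kappa> j"
    if "j \<in> rect d" for j
    using that by (intro someI[of "\<lambda>j'. j' \<in> rect d \<and> \<kappa> j' = \<kappa> j" j]) simp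
  have bnd: "\<lfloor>real N * real_of_int a / real n\<rfloor> \<in> {0..int N}" if "1 \<le> a" "a \<le> int n" for a :: int and n :: nat
  proof -
    have "real_of_int a / real n \<le> 1" using that by simp
    then have "real N * (real_of_int a / real n) \<le> real N * 1" by (intro mult_left_mono) auto
    then have "real N * real_of_int a / real n \<le> real_of_int (int N)" by simp
    then have "\<lfloor>real N * real_of_int a / real n\<rfloor> \<le> int N" by linarith
    moreover have "0 \<le> real N * real_of_int a / real n" using that by simp
    ultimately show ?thesis by simp
  qed
  have "\<kappa> ` rect d \<subseteq> {0..int N} \<times> {0..int N}"
    using bnd by (auto simp: \<kappa>_def rect_def)
  then have "card (\<kappa> ` rect d) \<le> card ({0..int N} \<times> {0..int N})" by (intro card_mono) auto
  also have "\<dots> = (N + 1)\<^sup>2" by (simp add: card_cartesian_product power2_eq_square nat_add_distrib)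
  finally have "card (\<kappa> ` rect d) \<le> (N + 1)\<^sup>2" .
  moreover have "card J \<le> card (\<kappa> ` rect d)" unfolding J_def by (rule card_image_le) simp
  ultimately have "card J \<le> (N + 1)\<^sup>2" by linarith
  moreover have "J \<subseteq> rect d" using some by (auto simp: J_def)
  moreover have "\<exists>j'\<in>J. max_norm (freq d j - freq d j') \<le> 2 * pi / N" if j: "j \<in> rect d" for j
  proof -
    define j' where "j' = (SOME j'. j' \<in> rect d \<and> \<kappa> j' = \<kappa> j)"
    have j': "j' \<in> J" "\<kappa> j' = \<kappa> j" using j some[OF j] by (auto simp: J_def j'_def)
    have close: "\<bar>2 * pi * real_of_int a / real n - 2 * pi * real_of_int b / real n\<bar> \<le> 2 * pi / real N"
      if "\<lfloor>real N * real_of_int a / real n\<rfloor> = \<lfloor>real N * real_of_int b / real n\<rfloor>" for a b :: int and n :: nat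
    proof -
      have "\<bar>real N * real_of_int a / real n - real N * real_of_int b / real n\<bar> \<le> 1"
        using that by linarith
      moreover have "2 * pi * real_of_int a / real n - 2 * pi * real_of_int b / real n
          = (2 * pi / real N) * (real N * real_of_int a / real n - real N * real_of_int b / real n)"
        using N by (simp add: right_diff_distrib)
      ultimately show ?thesis using N by (simp only: abs_mult) (simp add: mult_left_le divide_right_mono)
    qed
    have "max_norm (freq d j - freq d j') \<le> 2 * pi / N"
      using j'(2) by (simp add: max_norm_def freq_def \<kappa>_def close)
    with j' show ?thesis by blast
  qed
  ultimately show ?thesis by (intro that)
qed

context prob_space begin

section \<open>Markov bounds and the passage from a net to all frequencies\<close>

lemma second_moment_bound:
  assumes "integrable M (\<lambda>\<omega>. (X \<omega>)\<^sup>2)" "X \<in> borel_measurable M" "0 < a"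
  shows "prob {\<omega> \<in> space M. a \<le> \<bar>X \<omega> :: real\<bar>} \<le> expectation (\<lambda>\<omega>. (X \<omega>)\<^sup>2) / a\<^sup>2"
proof -
  have "{\<omega> \<in> space M. a \<le> \<bar>X \<omega>\<bar>} = {\<omega> \<in> space M. a\<^sup>2 \<le> (X \<omega>)\<^sup>2}"
    using assms(3) abs_le_square_iff[of a] by auto
  then show ?thesis
    using integral_Markov_inequality_measure[OF assms(1), of "space M" "a\<^sup>2"] assms(3) by simp
qed

lemma first_moment_bound:
  assumes "integrable M X" "0 < a" "\<And>\<omega>. 0 \<le> X \<omega>"
  shows "prob {\<omega> \<in> space M. a \<le> X \<omega>} \<le> expectation X / (a :: real)"
  using integral_Markov_inequality_measure[OF assms(1), of "space M" a] assms(2,3) by simp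

text \<open>A single net suffices. Chebyshev and a union bound treat its points; every other
  frequency differs from its net point by at most the Lipschitz constant times the mesh times the
  average of the \<open>\<bar>G k\<bar>\<close>. That average is one random variable for all pairs,
  so Markov's inequality is applied to it only once.\<close>

lemma chaining_bound:
  fixes P :: "int \<times> int \<Rightarrow> real" and G :: "int \<times> int \<Rightarrow> 'a \<Rightarrow> real" and N :: nat and \<eta> L m1 v :: real
  assumes d: "0 < fst d" "0 < snd d" and N: "0 < N" and \<eta>: "0 < \<eta>" and L: "0 \<le> L"
    and lip: "\<And>u v. \<bar>P u - P v\<bar> \<le> L / vol d * max_norm (freq d u - freq d v)"
    and int: "\<And>k. k \<in> rect d \<Longrightarrow> integrable M (G k)"
    and m1: "(\<Sum>k\<in>rect d. expectation (\<lambda>\<omega>. \<bar>G k \<omega>\<bar>)) \<le> m1 * vol d"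
    and int2: "\<And>j. j \<in> rect d \<Longrightarrow> integrable M (\<lambda>\<omega>. (\<Sum>k\<in>rect d. P (k - j) * G k \<omega>)\<^sup>2)"
    and v: "\<And>j. j \<in> rect d \<Longrightarrow> expectation (\<lambda>\<omega>. (\<Sum>k\<in>rect d. P (k - j) * G k \<omega>)\<^sup>2) \<le> v"
  shows "prob {\<omega> \<in> space M. \<exists>j\<in>rect d. \<eta> < \<bar>\<Sum>k\<in>rect d. P (k - j) * G k \<omega>\<bar>}
    \<le> (real N + 1)\<^sup>2 * (4 * v / \<eta>\<^sup>2) + 4 * pi * L * m1 / (N * \<eta>)"
proof -
  let ?F = "\<lambda>j \<omega>. \<Sum>k\<in>rect d. P (k - j) * G k \<omega>"
  have V: "0 < vol d" using d by (rule vol_pos)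
  have [measurable]: "G k \<in> borel_measurable M" if "k \<in> rect d" for k using int[OF that] by simp
  from freq_net[OF d N] obtain J where J: "J \<subseteq> rect d" "card J \<le> (N + 1)\<^sup>2"
    and net: "\<And>j. j \<in> rect d \<Longrightarrow> \<exists>j'\<in>J. max_norm (freq d j - freq d j') \<le> 2 * pi / N" by metis
  have fJ: "finite J" using J(1) by (rule finite_subset) simp
  define A where "A j = {\<omega> \<in> space M. \<eta> / 2 \<le> \<bar>?F j \<omega>\<bar>}" for j
  define S where "S \<omega> = (\<Sum>k\<in>rect d. \<bar>G k \<omega>\<bar>)" for \<omega>
  define B where "B = {\<omega> \<in> space M. \<eta> / 2 \<le> L / vol d * (2 * pi / N) * S \<omega>}"
  have [measurable]: "A j \<in> sets M" for j unfolding A_def by measurable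
  have [measurable]: "S \<in> borel_measurable M" unfolding S_def by measurable
  have [measurable]: "B \<in> sets M" unfolding B_def by measurable
  have diff: "\<bar>?F j \<omega> - ?F j' \<omega>\<bar> \<le> L / vol d * (2 * pi / N) * S \<omega>"
    if "max_norm (freq d j - freq d j') \<le> 2 * pi / N" for j j' \<omega>
  proof -
    have P: "\<bar>P (k - j) - P (k - j')\<bar> \<le> L / vol d * (2 * pi / N)" for k
    proof -
      have "max_norm (freq d (k - j) - freq d (k - j')) = max_norm (freq d j - freq d j')"
        by (simp add: freq_diff max_norm_def abs_minus_commute)
      then show ?thesis
        using that L V by (intro order.trans[OF lip] mult_left_mono) auto
    qed
    have "\<bar>?F j \<omega> - ?F j' \<omega>\<bar> = \<bar>\<Sum>k\<in>rect d. (P (k - j) - P (k - j')) * G k \<omega>\<bar>"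
      by (simp add: sum_subtractf left_diff_distrib)
    also have "\<dots> \<le> (\<Sum>k\<in>rect d. \<bar>(P (k - j) - P (k - j')) * G k \<omega>\<bar>)" by (rule sum_abs)
    also have "\<dots> \<le> (\<Sum>k\<in>rect d. L / vol d * (2 * pi / N) * \<bar>G k \<omega>\<bar>)"
      unfolding abs_mult by (intro sum_mono mult_right_mono P) simp
    finally show ?thesis by (simp add: S_def sum_distrib_left)
  qed
  have "{\<omega> \<in> space M. \<exists>j\<in>rect d. \<eta> < \<bar>?F j \<omega>\<bar>} \<subseteq> (\<Union>j\<in>J. A j) \<union> B"
  proof
    fix \<omega> assume "\<omega> \<in> {\<omega> \<in> space M. \<exists>j\<in>rect d. \<eta> < \<bar>?F j \<omega>\<bar>}"
    then obtain j where \<omega>: "\<omega> \<in> space M" and j: "j \<in> rect d" "\<eta> < \<bar>?F j \<omega>\<bar>" by blast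
    from net[OF j(1)] obtain j' where j': "j' \<in> J" "max_norm (freq d j - freq d j') \<le> 2 * pi / N" by blast
    from diff[OF j'(2), of \<omega>] j(2) have "\<eta> / 2 \<le> \<bar>?F j' \<omega>\<bar> \<or> \<eta> / 2 \<le> L / vol d * (2 * pi / N) * S \<omega>"
      by linarith
    then show "\<omega> \<in> (\<Union>j\<in>J. A j) \<union> B" using \<omega> j' by (auto simp: A_def B_def)
  qed
  then have "prob {\<omega> \<in> space M. \<exists>j\<in>rect d. \<eta> < \<bar>?F j \<omega>\<bar>} \<le> prob ((\<Union>j\<in>J. A j) \<union> B)"
    using fJ by (intro finite_measure_mono) auto
  also have "\<dots> \<le> prob (\<Union>j\<in>J. A j) + prob B" using fJ by (intro measure_Un_le) auto
  also have "prob (\<Union>j\<in>J. A j) \<le> (\<Sum>j\<in>J. prob (A j))" using fJ by (intro measure_UNION_le) auto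
  also have "(\<Sum>j\<in>J. prob (A j)) \<le> (\<Sum>j\<in>J. 4 * v / \<eta>\<^sup>2)"
  proof (rule sum_mono)
    fix j assume "j \<in> J"
    then have j: "j \<in> rect d" using J by auto
    have "prob (A j) \<le> expectation (\<lambda>\<omega>. (?F j \<omega>)\<^sup>2) / (\<eta> / 2)\<^sup>2"
      unfolding A_def using \<eta> int2[OF j] by (intro second_moment_bound) auto
    also have "\<dots> \<le> v / (\<eta> / 2)\<^sup>2" using v[OF j] by (intro divide_right_mono) auto
    finally show "prob (A j) \<le> 4 * v / \<eta>\<^sup>2" by (simp add: power_divide mult.commute)
  qed
  also have "\<dots> \<le> (real N + 1)\<^sup>2 * (4 * v / \<eta>\<^sup>2)"
  proof -
    have "rect d \<noteq> {}" using d by (auto simp: rect_def)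
    then obtain j where j: "j \<in> rect d" by blast
    have "0 \<le> expectation (\<lambda>\<omega>. (?F j \<omega>)\<^sup>2)" by simp
    then have "0 \<le> v" using v[OF j] by linarith
    moreover have "real (card J) \<le> (real N + 1)\<^sup>2" using of_nat_mono[OF J(2), where ?'a = real] by (simp add: add.commute)
    ultimately have "real (card J) * (4 * v / \<eta>\<^sup>2) \<le> (real N + 1)\<^sup>2 * (4 * v / \<eta>\<^sup>2)"
      by (intro mult_right_mono) auto
    then show ?thesis by simp
  qed
  also have "prob B \<le> 4 * pi * L * m1 / (N * \<eta>)"
  proof -
    have S: "integrable M S" unfolding S_def using int by (intro Bochner_Integration.integrable_sum integrable_abs) auto
    have ES: "expectation S \<le> m1 * vol d"
      unfolding S_def using int m1 by (subst Bochner_Integration.integral_sum) auto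
    have "prob B \<le> expectation (\<lambda>\<omega>. L / vol d * (2 * pi / N) * S \<omega>) / (\<eta> / 2)"
      unfolding B_def
    proof (rule first_moment_bound)
      show "integrable M (\<lambda>\<omega>. L / vol d * (2 * pi / real N) * S \<omega>)" using S by (rule integrable_mult_right)
      show "0 \<le> L / vol d * (2 * pi / real N) * S \<omega>" for \<omega>
        using L V by (intro mult_nonneg_nonneg divide_nonneg_nonneg) (auto simp: S_def sum_nonneg)
    qed (use \<eta> in simp)
    also have "\<dots> = L / vol d * (2 * pi / N) * expectation S / (\<eta> / 2)" using S by simp
    also have "\<dots> \<le> L / vol d * (2 * pi / N) * (m1 * vol d) / (\<eta> / 2)"
      using \<eta> L V ES by (intro divide_right_mono mult_left_mono) auto
    also have "\<dots> = 4 * pi * L * m1 / (N * \<eta>)" using V by simp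
    finally show ?thesis .
  qed
  finally show ?thesis by simp
qed

text \<open>With \<open>N\<close> of order H^(-3/2) / \<epsilon> the increment term is a fixed
  multiple of \<epsilon>, while the union bound costs H^-3 / \<epsilon>^2 points times a variance of
  order 1/(H vol), which is the vanishing quantity in \<open>lim\<close>.\<close>

lemma uniform_chaining:
  fixes P :: "nat \<Rightarrow> int \<times> int \<Rightarrow> real" and G :: "nat \<Rightarrow> int \<times> int \<Rightarrow> 'a \<Rightarrow> real" and H :: "nat \<Rightarrow> real" and c m1 \<eta> :: real
  assumes ev: "\<forall>\<^sub>F n in sequentially. 0 < fst (d n) \<and> 0 < snd (d n) \<and> 0 < H n \<and> H n \<le> 1 \<and>
      (\<forall>u v. \<bar>P n u - P n v\<bar> \<le> c * H n powr (- 3/2) / vol (d n) * max_norm (freq (d n) u - freq (d n) v)) \<and>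
      (\<forall>k\<in>rect (d n). integrable M (G n k)) \<and>
      (\<Sum>k\<in>rect (d n). expectation (\<lambda>\<omega>. \<bar>G n k \<omega>\<bar>)) \<le> m1 * vol (d n) \<and>
      (\<forall>j\<in>rect (d n). integrable M (\<lambda>\<omega>. (\<Sum>k\<in>rect (d n). P n (k - j) * G n k \<omega>)\<^sup>2) \<and>
         expectation (\<lambda>\<omega>. (\<Sum>k\<in>rect (d n). P n (k - j) * G n k \<omega>)\<^sup>2) \<le> c / (H n * vol (d n)))"
    and lim: "(\<lambda>n. 1 / (H n ^ 4 * vol (d n))) \<longlonglongrightarrow> 0" and c: "0 < c" and \<eta>: "0 < \<eta>"
  shows "(\<lambda>n. prob {\<omega> \<in> space M. \<exists>j\<in>rect (d n). \<eta> < \<bar>\<Sum>k\<in>rect (d n). P n (k - j) * G n k \<omega>\<bar>}) \<longlonglongrightarrow> 0"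
proof (rule order_tendstoI)
  fix a :: real assume a: "0 < a"
  \<comment> \<open>Makes the Markov term of the increments at most \<open>a / 2\<close>; the
    minimum with 1 ensures \<open>1 \<le> x / \<epsilon>\<close>, so that rounding up costs only a
    factor.\<close>
  define \<epsilon> where "\<epsilon> = min 1 (a / 2 * \<eta> / (4 * pi * c * (\<bar>m1\<bar> + 1)))"
  have \<epsilon>: "0 < \<epsilon>" "\<epsilon> \<le> 1" "4 * pi * c * \<bar>m1\<bar> * \<epsilon> / \<eta> \<le> a / 2"
  proof -
    show "0 < \<epsilon>" "\<epsilon> \<le> 1" using a \<eta> c by (auto simp: \<epsilon>_def intro!: divide_pos_pos mult_pos_pos)
    have "4 * pi * c * \<bar>m1\<bar> * \<epsilon> \<le> 4 * pi * c * (\<bar>m1\<bar> + 1) * (a / 2 * \<eta> / (4 * pi * c * (\<bar>m1\<bar> + 1)))"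
      using c \<open>0 < \<epsilon>\<close> by (intro mult_mono) (auto simp: \<epsilon>_def)
    also have "\<dots> = a / 2 * \<eta>"
    proof -
      have "4 * pi * c * (\<bar>m1\<bar> + 1) \<noteq> 0" using c by auto
      from nonzero_mult_div_cancel_left[OF this, of "a / 2 * \<eta>"] show ?thesis
        by (simp only: times_divide_eq_right)
    qed
    finally show "4 * pi * c * \<bar>m1\<bar> * \<epsilon> / \<eta> \<le> a / 2" using \<eta> by (simp add: pos_divide_le_eq)
  qed
  \<comment> \<open>The 9 is the square of the 3 in
    \<open>real N + 1 \<le> 3 * (x / \<epsilon>)\<close>, the 4 comes from testing the net points at
    \<open>\<eta> / 2\<close>.\<close>
  define b where "b = 9 / \<epsilon>\<^sup>2 * (4 * c / \<eta>\<^sup>2)"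
  have "(\<lambda>n. b * (1 / (H n ^ 4 * vol (d n)))) \<longlonglongrightarrow> 0" using lim by (rule tendsto_mult_right_zero)
  then have "\<forall>\<^sub>F n in sequentially. b * (1 / (H n ^ 4 * vol (d n))) < a / 2"
    using a by (intro order_tendstoD(2)) auto
  with ev show "\<forall>\<^sub>F n in sequentially. prob {\<omega> \<in> space M. \<exists>j\<in>rect (d n). \<eta> < \<bar>\<Sum>k\<in>rect (d n). P n (k - j) * G n k \<omega>\<bar>} < a"
  proof eventually_elim
    case (elim n)
    have H: "0 < H n" "H n \<le> 1" and d: "0 < fst (d n)" "0 < snd (d n)" using elim by blast+
    define x where "x = H n powr (- 3/2)"
    have "H n powr (3/2) \<le> 1" "0 < H n powr (3/2)" using H by (auto intro!: powr_le1)
    then have x1: "1 \<le> x" by (simp add: x_def powr_minus one_le_inverse)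
    have "x\<^sup>2 = H n powr (-3)" by (simp add: x_def power2_eq_square powr_add[symmetric])
    also have "\<dots> = 1 / H n ^ 3" using H by (simp add: powr_minus divide_inverse)
    finally have x2: "x\<^sup>2 = 1 / H n ^ 3" .
    define N where "N = nat \<lceil>x / \<epsilon>\<rceil>"
    have N: "x / \<epsilon> \<le> real N" "real N + 1 \<le> 3 * (x / \<epsilon>)"
    proof -
      show "x / \<epsilon> \<le> real N" by (simp add: N_def real_nat_ceiling_ge)
      have "1 \<le> x / \<epsilon>" using x1 \<epsilon> by (simp add: field_simps)
      then show "real N + 1 \<le> 3 * (x / \<epsilon>)" unfolding N_def by linarith
    qed
    have x0: "0 < x / \<epsilon>" using x1 \<epsilon> by auto
    have N0: "0 < N" using N x0 by (metis gr0I of_nat_0 not_le)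
    have V: "0 < vol (d n)" using d by (rule vol_pos)
    have cx: "0 \<le> c * x" using c x1 by simp
    have "prob {\<omega> \<in> space M. \<exists>j\<in>rect (d n). \<eta> < \<bar>\<Sum>k\<in>rect (d n). P n (k - j) * G n k \<omega>\<bar>}
        \<le> (real N + 1)\<^sup>2 * (4 * (c / (H n * vol (d n))) / \<eta>\<^sup>2) + 4 * pi * (c * x) * m1 / (N * \<eta>)"
      by (rule chaining_bound[OF d N0 \<eta> cx]) (use elim in \<open>unfold x_def, blast+\<close>)
    also have "(real N + 1)\<^sup>2 * (4 * (c / (H n * vol (d n))) / \<eta>\<^sup>2) \<le> (3 * (x / \<epsilon>))\<^sup>2 * (4 * (c / (H n * vol (d n))) / \<eta>\<^sup>2)"
      using N c H V by (intro mult_right_mono power_mono) auto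
    also have "\<dots> = b * (1 / (H n ^ 4 * vol (d n)))"
      unfolding power_mult_distrib power_divide x2 b_def by (simp add: power_numeral_reduce)
    also have "b * (1 / (H n ^ 4 * vol (d n))) < a / 2" using elim by blast
    also have "4 * pi * (c * x) * m1 / (N * \<eta>) \<le> 4 * pi * (c * x) * \<bar>m1\<bar> / (x / \<epsilon> * \<eta>)"
      using N x1 \<epsilon> \<eta> cx by (intro frac_le mult_left_mono mult_right_mono mult_pos_pos divide_pos_pos) auto
    also have "\<dots> = 4 * pi * c * \<bar>m1\<bar> * \<epsilon> / \<eta>" using x1 \<epsilon> by simp
    also have "\<dots> \<le> a / 2" by (rule \<epsilon>(3))
    finally show ?case by simp
  qed
qed (auto intro!: always_eventually less_le_trans[OF _ measure_nonneg])

end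

section \<open>Independence of blocks\<close>

text \<open>A factorisation through the restricted family, rather than measurability for a generated
  sigma-algebra, so that variables on disjoint index sets inherit independence by composing with
  restrictions.\<close>

definition depends_on :: "('s \<Rightarrow> 'a \<Rightarrow> real) \<Rightarrow> 's set \<Rightarrow> ('a \<Rightarrow> real) \<Rightarrow> bool" where
  "depends_on e A X \<longleftrightarrow>
    (\<exists>g\<in>borel_measurable (Pi\<^sub>M A (\<lambda>_. borel)). X = (\<lambda>\<omega>. g (restrict (\<lambda>s. e s \<omega>) A)))"

lemma depends_on_mono:
  assumes "depends_on e A X" "A \<subseteq> B"
  shows "depends_on e B X"
proof -
  from assms(1) obtain g where g: "g \<in> borel_measurable (Pi\<^sub>M A (\<lambda>_. borel))"
    "X = (\<lambda>\<omega>. g (restrict (\<lambda>s. e s \<omega>) A))" by (auto simp: depends_on_def)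
  have "(\<lambda>z. g (restrict z A)) \<in> borel_measurable (Pi\<^sub>M B (\<lambda>_. borel))"
    by (rule measurable_compose[OF measurable_restrict_subset[OF assms(2)] g(1)])
  moreover have "X = (\<lambda>\<omega>. g (restrict (restrict (\<lambda>s. e s \<omega>) B) A))"
    using assms(2) by (simp add: g(2) Int_absorb1)
  ultimately show ?thesis unfolding depends_on_def by (intro bexI) simp_all
qed

lemma depends_on_comp:
  assumes "depends_on e A X" "f \<in> borel_measurable borel"
  shows "depends_on e A (\<lambda>\<omega>. f (X \<omega>))"
proof -
  from assms(1) obtain g where g: "g \<in> borel_measurable (Pi\<^sub>M A (\<lambda>_. borel))"
    "X = (\<lambda>\<omega>. g (restrict (\<lambda>s. e s \<omega>) A))" by (auto simp: depends_on_def)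
  show ?thesis unfolding depends_on_def
    by (rule bexI[OF _ measurable_compose[OF g(1) assms(2)]]) (simp add: g(2))
qed

lemma depends_on_mult:
  assumes "depends_on e A X" "depends_on e A Y"
  shows "depends_on e A (\<lambda>\<omega>. X \<omega> * Y \<omega>)"
proof -
  from assms(1) obtain g where [measurable]: "g \<in> borel_measurable (Pi\<^sub>M A (\<lambda>_. borel))"
    and g: "X = (\<lambda>\<omega>. g (restrict (\<lambda>s. e s \<omega>) A))" by (auto simp: depends_on_def)
  from assms(2) obtain f where [measurable]: "f \<in> borel_measurable (Pi\<^sub>M A (\<lambda>_. borel))"
    and f: "Y = (\<lambda>\<omega>. f (restrict (\<lambda>s. e s \<omega>) A))" by (auto simp: depends_on_def)
  have "(\<lambda>z. g z * f z) \<in> borel_measurable (Pi\<^sub>M A (\<lambda>_. borel))" by measurable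
  then show ?thesis unfolding depends_on_def by (rule bexI[rotated]) (simp add: g f)
qed

lemma depends_on_mult_Un:
  assumes "depends_on e A X" "depends_on e B Y"
  shows "depends_on e (A \<union> B) (\<lambda>\<omega>. X \<omega> * Y \<omega>)"
  by (intro depends_on_mult depends_on_mono[OF assms(1)] depends_on_mono[OF assms(2)]) auto

context prob_space begin

lemma depends_on_measurable:
  assumes "\<And>s. e s \<in> borel_measurable M" "depends_on e A X"
  shows "X \<in> borel_measurable M"
proof -
  from assms(2) obtain g where g: "g \<in> borel_measurable (Pi\<^sub>M A (\<lambda>_. borel))"
    "X = (\<lambda>\<omega>. g (restrict (\<lambda>s. e s \<omega>) A))" by (auto simp: depends_on_def)
  have "(\<lambda>\<omega>. restrict (\<lambda>s. e s \<omega>) A) \<in> measurable M (Pi\<^sub>M A (\<lambda>_. borel))"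
    using assms(1) by (intro measurable_restrict) auto
  from measurable_compose[OF this g(1)] show ?thesis by (simp add: g(2))
qed

lemma depends_on_indep_vars:
  assumes e: "indep_vars (\<lambda>_. borel) e UNIV"
    and dep: "\<And>j. j \<in> L \<Longrightarrow> depends_on e (A j) (X j)" and disj: "disjoint_family_on A L"
  shows "indep_vars (\<lambda>_. borel) X L"
proof -
  have "\<forall>j\<in>L. \<exists>g. g \<in> borel_measurable (Pi\<^sub>M (A j) (\<lambda>_. borel)) \<and> X j = (\<lambda>\<omega>. g (restrict (\<lambda>s. e s \<omega>) (A j)))"
    using dep unfolding depends_on_def by blast
  from bchoice[OF this] obtain g where g: "\<And>j. j \<in> L \<Longrightarrow> g j \<in> borel_measurable (Pi\<^sub>M (A j) (\<lambda>_. borel))"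
    "\<And>j. j \<in> L \<Longrightarrow> X j = (\<lambda>\<omega>. g j (restrict (\<lambda>s. e s \<omega>) (A j)))" by blast
  have "indep_vars (\<lambda>_. borel) (\<lambda>j \<omega>. g j (restrict (\<lambda>s. e s \<omega>) (A j))) L"
    using indep_vars_compose2[OF indep_vars_restrict[OF e _ disj] g(1)] by simp
  then show ?thesis
    by (subst indep_vars_cong[OF refl _ refl, where Y = "\<lambda>j \<omega>. g j (restrict (\<lambda>s. e s \<omega>) (A j))"]) (simp_all add: g(2))
qed

lemma depends_on_expectation_mult:
  assumes e: "indep_vars (\<lambda>_. borel) e UNIV"
    and X: "depends_on e A X" "integrable M X" and Y: "depends_on e B Y" "integrable M Y"
    and disj: "A \<inter> B = {}"
  shows "expectation (\<lambda>\<omega>. X \<omega> * Y \<omega>) = expectation X * expectation Y"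
proof -
  have "indep_vars (\<lambda>_. borel) (case_bool X Y) UNIV"
  proof (rule depends_on_indep_vars[OF e])
    show "depends_on e (case_bool A B j) (case_bool X Y j)" for j
      using X Y by (cases j) auto
    show "disjoint_family_on (case_bool A B) UNIV"
      using disj by (auto simp: disjoint_family_on_def split: bool.splits)
  qed
  then have "indep_var borel X borel Y"
    unfolding indep_var_def by (rule indep_vars_cong[THEN iffD1, rotated -1]) (auto split: bool.split)
  then show ?thesis using X Y by (intro indep_var_lebesgue_integral)
qed

end

text \<open>The free weight \<open>\<rho>\<close> is later the growth of the standard deviation of
  the summands; splitting \<bar>a\<bar> into \<bar>a\<bar> \<rho> and \<bar>a\<bar> / \<rho> then
  leaves the same sum in both factors.\<close>

lemma weighted_cauchy_schwarz:
  fixes a z \<rho> :: "'i \<Rightarrow> real"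
  assumes "\<And>i. i \<in> I \<Longrightarrow> 0 < \<rho> i"
  shows "(\<Sum>i\<in>I. a i * z i)\<^sup>2 \<le> (\<Sum>i\<in>I. \<bar>a i\<bar> * \<rho> i) * (\<Sum>i\<in>I. \<bar>a i\<bar> * (z i)\<^sup>2 / \<rho> i)"
proof -
  have "(\<Sum>i\<in>I. a i * z i)\<^sup>2 = (\<Sum>i\<in>I. sqrt (\<bar>a i\<bar> * \<rho> i) * (sgn (a i) * sqrt (\<bar>a i\<bar> / \<rho> i) * z i))\<^sup>2"
  proof (intro arg_cong[where f = "\<lambda>x. x\<^sup>2"] sum.cong refl)
    fix i assume i: "i \<in> I"
    have "sqrt (\<bar>a i\<bar> * \<rho> i) * sqrt (\<bar>a i\<bar> / \<rho> i) = \<bar>a i\<bar>"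
      using assms[OF i] by (simp add: real_sqrt_mult[symmetric])
    then have "sqrt (\<bar>a i\<bar> * \<rho> i) * (sgn (a i) * sqrt (\<bar>a i\<bar> / \<rho> i) * z i) = sgn (a i) * \<bar>a i\<bar> * z i"
      by (simp add: mult_ac)
    then show "a i * z i = sqrt (\<bar>a i\<bar> * \<rho> i) * (sgn (a i) * sqrt (\<bar>a i\<bar> / \<rho> i) * z i)"
      unfolding sgn_mult_abs by (rule sym)
  qed
  also have "\<dots> \<le> (\<Sum>i\<in>I. (sqrt (\<bar>a i\<bar> * \<rho> i))\<^sup>2) * (\<Sum>i\<in>I. (sgn (a i) * sqrt (\<bar>a i\<bar> / \<rho> i) * z i)\<^sup>2)"
    by (rule Cauchy_Schwarz_ineq_sum)
  also have "(\<Sum>i\<in>I. (sqrt (\<bar>a i\<bar> * \<rho> i))\<^sup>2) = (\<Sum>i\<in>I. \<bar>a i\<bar> * \<rho> i)"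
    using assms by (intro sum.cong) (auto simp: less_imp_le)
  also have "(\<Sum>i\<in>I. (sgn (a i) * sqrt (\<bar>a i\<bar> / \<rho> i) * z i)\<^sup>2) = (\<Sum>i\<in>I. \<bar>a i\<bar> * (z i)\<^sup>2 / \<rho> i)"
    using assms by (intro sum.cong) (auto simp: power_mult_distrib less_imp_le sgn_if)
  finally show ?thesis .
qed

text \<open>Schur's test for a zero-one kernel: twice a product is at most the sum of the squares,
  and no index has more than \<open>m\<close> partners.\<close>

lemma sum_relation_le:
  fixes Q :: "'p \<Rightarrow> real"
  assumes fin: "finite A"
    and row: "\<And>p. p \<in> A \<Longrightarrow> card {q \<in> A. N p q} \<le> m" and col: "\<And>q. q \<in> A \<Longrightarrow> card {p \<in> A. N p q} \<le> m"
  shows "(\<Sum>p\<in>A. \<Sum>q\<in>A. of_bool (N p q) * (\<bar>Q p\<bar> * \<bar>Q q\<bar>)) \<le> m * (\<Sum>p\<in>A. (Q p)\<^sup>2)"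
proof -
  have c: "(\<Sum>q\<in>A. of_bool (N p q)) = (of_nat (card {q \<in> A. N p q}) :: real)" for p
    using fin by (simp add: of_bool_def sum.If_cases Int_def conj_commute)
  have c': "(\<Sum>p\<in>A. of_bool (N p q)) = (of_nat (card {p \<in> A. N p q}) :: real)" for q
    using fin by (simp add: of_bool_def sum.If_cases Int_def conj_commute)
  have "(\<Sum>p\<in>A. \<Sum>q\<in>A. of_bool (N p q) * (\<bar>Q p\<bar> * \<bar>Q q\<bar>))
      \<le> (\<Sum>p\<in>A. \<Sum>q\<in>A. of_bool (N p q) * ((Q p)\<^sup>2 / 2) + of_bool (N p q) * ((Q q)\<^sup>2 / 2))"
  proof (intro sum_mono)
    fix p q
    have "2 * \<bar>Q p\<bar> * \<bar>Q q\<bar> \<le> (Q p)\<^sup>2 + (Q q)\<^sup>2"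
      using sum_squares_bound[of "\<bar>Q p\<bar>" "\<bar>Q q\<bar>"] by simp
    then show "of_bool (N p q) * (\<bar>Q p\<bar> * \<bar>Q q\<bar>) \<le> of_bool (N p q) * ((Q p)\<^sup>2 / 2) + of_bool (N p q) * ((Q q)\<^sup>2 / 2)"
      by (cases "N p q") auto
  qed
  also have "\<dots> = (\<Sum>p\<in>A. \<Sum>q\<in>A. of_bool (N p q) * ((Q p)\<^sup>2 / 2)) + (\<Sum>q\<in>A. \<Sum>p\<in>A. of_bool (N p q) * ((Q q)\<^sup>2 / 2))"
    by (simp only: sum.distrib) (subst (2) sum.swap, simp)
  also have "\<dots> = (\<Sum>p\<in>A. card {q \<in> A. N p q} * ((Q p)\<^sup>2 / 2)) + (\<Sum>q\<in>A. card {p \<in> A. N p q} * ((Q q)\<^sup>2 / 2))"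
    by (simp only: c c' flip: sum_distrib_right)
  also have "\<dots> \<le> (\<Sum>p\<in>A. m * ((Q p)\<^sup>2 / 2)) + (\<Sum>q\<in>A. m * ((Q q)\<^sup>2 / 2))"
    by (intro add_mono sum_mono mult_right_mono) (simp_all add: row col)
  also have "\<dots> = m * (\<Sum>p\<in>A. (Q p)\<^sup>2)"
    by (simp add: sum_distrib_left flip: sum.distrib)
  finally show ?thesis .
qed

text \<open>Tonelli: the sum has finite expectation and is therefore finite almost surely.\<close>

lemma (in finite_measure) AE_summable_of_integrals:
  fixes f :: "nat \<Rightarrow> 'a \<Rightarrow> real"
  assumes int: "\<And>i. integrable M (f i)" and nonneg: "\<And>i \<omega>. 0 \<le> f i \<omega>"
    and sm: "summable (\<lambda>i. \<integral>\<omega>. f i \<omega> \<partial>M)"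
  shows "AE \<omega> in M. summable (\<lambda>i. f i \<omega>)" "integrable M (\<lambda>\<omega>. \<Sum>i. f i \<omega>)"
proof -
  have [measurable]: "f i \<in> borel_measurable M" for i using int by auto
  have "(\<integral>\<^sup>+\<omega>. (\<Sum>i. ennreal (f i \<omega>)) \<partial>M) = (\<Sum>i. \<integral>\<^sup>+\<omega>. ennreal (f i \<omega>) \<partial>M)"
    by (rule nn_integral_suminf) auto
  also have "\<dots> = (\<Sum>i. ennreal (\<integral>\<omega>. f i \<omega> \<partial>M))"
    using int nonneg by (intro suminf_cong nn_integral_eq_integral) auto
  also have "\<dots> = ennreal (\<Sum>i. \<integral>\<omega>. f i \<omega> \<partial>M)"
    using sm nonneg by (intro suminf_ennreal2) (auto intro: integral_nonneg)
  finally have "(\<integral>\<^sup>+\<omega>. (\<Sum>i. ennreal (f i \<omega>)) \<partial>M) \<noteq> \<infinity>" by simp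
  then have "AE \<omega> in M. (\<Sum>i. ennreal (f i \<omega>)) \<noteq> \<infinity>"
    by (rule nn_integral_PInf_AE[rotated]) measurable
  then show AE: "AE \<omega> in M. summable (\<lambda>i. f i \<omega>)"
    by eventually_elim (use nonneg in \<open>auto intro!: summable_suminf_not_top simp: top_unique\<close>)
  show "integrable M (\<lambda>\<omega>. \<Sum>i. f i \<omega>)"
    using AE nonneg sm by (intro integrable_suminf int) auto
qed

section \<open>Block expansions and quadratic forms\<close>

definition near :: "int \<Rightarrow> int \<times> int \<Rightarrow> int \<times> int \<Rightarrow> bool" where
  "near k x y \<longleftrightarrow> \<bar>fst x - fst y\<bar> \<le> k \<and> \<bar>snd x - snd y\<bar> \<le> k"

lemma near_sym: "near k x y \<longleftrightarrow> near k y x"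
  by (auto simp: near_def abs_minus_commute)

lemma near_trans: "near k x y \<Longrightarrow> near l y z \<Longrightarrow> near (k + l) x z"
  by (auto simp: near_def)

lemma near_mono: "near k x y \<Longrightarrow> k \<le> l \<Longrightarrow> near l x y"
  by (auto simp: near_def)

lemma near_set: "{x. near k x y} = {fst y - k..fst y + k} \<times> {snd y - k..snd y + k}"
  by (auto simp: near_def)

lemma finite_near [simp]: "finite {x. near k x y}"
  by (simp add: near_set)

lemma card_near: "card {x. near (int k) x y} = (2 * k + 1)\<^sup>2"
  unfolding near_set card_cartesian_product by (simp add: power2_eq_square nat_add_distrib nat_mult_distrib)

lemma card_near_pairs:
  assumes "finite A"
  shows "card {q \<in> A. near (int k) (fst q) x \<and> near (int k) (snd q) y} \<le> (2 * k + 1) ^ 4"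
proof -
  have "{q \<in> A. near (int k) (fst q) x \<and> near (int k) (snd q) y} \<subseteq> {q. near (int k) q x} \<times> {q. near (int k) q y}"
    by auto
  then have "card {q \<in> A. near (int k) (fst q) x \<and> near (int k) (snd q) y} \<le> card ({q. near (int k) q x} \<times> {q. near (int k) q y})"
    by (intro card_mono) auto
  also have "\<dots> = (2 * k + 1) ^ 4" by (simp add: card_cartesian_product card_near)
  finally show ?thesis .
qed

text \<open>Nearness is read as a graph on four sites in which some edge crosses between {a, b} and
  {c, d} and no site is isolated. Following edges for at most three steps matches the two pairs
  perfectly, which is why the radius triples.\<close>

lemma near_pairing:
  assumes cross: "near k a c \<or> near k a d \<or> near k b c \<or> near k b d"
    and "near k a b \<or> near k a c \<or> near k a d" "near k a b \<or> near k b c \<or> near k b d"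
    and "near k c d \<or> near k a c \<or> near k b c" "near k c d \<or> near k a d \<or> near k b d"
  shows "near (3 * k) a c \<and> near (3 * k) b d \<or> near (3 * k) a d \<and> near (3 * k) b c"
proof -
  define n where "n = near k"
  define m where "m = near (3 * k)"
  have k: "0 \<le> k" using cross by (auto simp: near_def)
  have sym: "n x y \<Longrightarrow> n y x" for x y unfolding n_def by (simp add: near_sym)
  have c1: "n x y \<Longrightarrow> m x y" for x y
    unfolding n_def m_def by (erule near_mono) (use k in simp)
  have c2: "n x y \<Longrightarrow> n y z \<Longrightarrow> m x z" for x y z
    unfolding n_def m_def by (rule near_mono[OF near_trans]) (use k in auto)
  have c3: "n x y \<Longrightarrow> n y z \<Longrightarrow> n z w \<Longrightarrow> m x w" for x y z w
    unfolding n_def m_def by (rule near_mono[OF near_trans[OF near_trans]]) auto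
  from cross consider "n a c" | "n a d" | "n b c" | "n b d" unfolding n_def by blast
  then have "m a c \<and> m b d \<or> m a d \<and> m b c"
  proof cases
    case 1
    then have "m b d" using assms(3,5) unfolding n_def[symmetric] by (blast intro: sym c1 c2 c3)
    then show ?thesis using c1[OF 1] by blast
  next
    case 2
    then have "m b c" using assms(3,4) unfolding n_def[symmetric] by (blast intro: sym c1 c2 c3)
    then show ?thesis using c1[OF 2] by blast
  next
    case 3
    then have "m a d" using assms(2,5) unfolding n_def[symmetric] by (blast intro: sym c1 c2 c3)
    then show ?thesis using c1[OF 3] by blast
  next
    case 4
    then have "m a c" using assms(2,4) unfolding n_def[symmetric] by (blast intro: sym c1 c2 c3)
    then show ?thesis using c1[OF 4] by blast
  qed
  then show ?thesis by (simp add: m_def)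
qed

text \<open>The displacement \<open>a\<close> of the centre serves the linear field, whose blocks
  are single sites \<open>t - a\<close> of radius zero; a contracting field uses balls around
  \<open>t\<close> itself.\<close>

definition block :: "int \<times> int \<Rightarrow> nat \<Rightarrow> int \<times> int \<Rightarrow> (int \<times> int) set" where
  "block a r t = {s. near (int r) s (t - a)}"

lemma block_disjoint:
  assumes "\<not> near (2 * int \<rho>) (s - a) (t - b)" "r \<le> \<rho>" "q \<le> \<rho>"
  shows "block a r s \<inter> block b q t = {}"
proof (rule ccontr)
  assume "block a r s \<inter> block b q t \<noteq> {}"
  then obtain x where "near (int r) x (s - a)" "near (int q) x (t - b)" by (auto simp: block_def)
  then have "near (int r + int q) (s - a) (t - b)" by (metis near_sym near_trans)
  then have "near (2 * int \<rho>) (s - a) (t - b)" by (rule near_mono) (use assms in linarith)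
  with assms(1) show False by blast
qed

lemma abs_power_le:
  fixes x :: real
  assumes "k \<le> n"
  shows "\<bar>x\<bar> ^ k \<le> 1 + \<bar>x\<bar> ^ n"
proof (cases "\<bar>x\<bar> \<le> 1")
  case True
  then have "\<bar>x\<bar> ^ k \<le> 1" by (intro power_le_one) auto
  moreover have "0 \<le> \<bar>x\<bar> ^ n" by simp
  ultimately show ?thesis by linarith
next
  case False
  then have "\<bar>x\<bar> ^ k \<le> \<bar>x\<bar> ^ n" using assms by (intro power_increasing) auto
  then show ?thesis by linarith
qed

lemma abs_mult2_le: "\<bar>a * b\<bar> \<le> \<bar>a\<bar> ^ 2 + \<bar>b\<bar> ^ 2" for a b :: real
proof -
  have "0 \<le> \<bar>a\<bar> * \<bar>b\<bar>" by simp
  then show ?thesis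
    using sum_squares_bound[of "\<bar>a\<bar>" "\<bar>b\<bar>"] unfolding abs_mult by linarith
qed

lemma abs_mult4_le: "\<bar>a * b * (x * y)\<bar> \<le> \<bar>a\<bar> ^ 4 + \<bar>b\<bar> ^ 4 + \<bar>x\<bar> ^ 4 + \<bar>y\<bar> ^ 4" for a b x y :: real
proof -
  have two: "p * q \<le> p\<^sup>2 + q\<^sup>2" if "0 \<le> p" "0 \<le> q" for p q :: real
    using abs_mult2_le[of p q] that by simp
  have "\<bar>a * b * (x * y)\<bar> = (\<bar>a\<bar> * \<bar>b\<bar>) * (\<bar>x\<bar> * \<bar>y\<bar>)" by (simp add: abs_mult)
  also have "\<dots> \<le> (\<bar>a\<bar> * \<bar>b\<bar>)\<^sup>2 + (\<bar>x\<bar> * \<bar>y\<bar>)\<^sup>2" by (rule two) auto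
  also have "\<dots> \<le> ((\<bar>a\<bar>\<^sup>2)\<^sup>2 + (\<bar>b\<bar>\<^sup>2)\<^sup>2) + ((\<bar>x\<bar>\<^sup>2)\<^sup>2 + (\<bar>y\<bar>\<^sup>2)\<^sup>2)"
    unfolding power_mult_distrib by (intro add_mono two) auto
  finally show ?thesis by simp
qed

text \<open>The common form of both alternatives for the field. The weight
  \<open>(real (r i) + 1)\<^sup>2\<close> is of the order of the number of sites in a block, and so
  of the number of translates of a block that meet it; every later estimate pays for dependence by
  such counts.\<close>

locale block_expansion = prob_space M for M :: "'a measure" +
  fixes e :: "int \<times> int \<Rightarrow> 'a \<Rightarrow> real" and U :: "nat \<Rightarrow> int \<times> int \<Rightarrow> 'a \<Rightarrow> real"
    and c :: "nat \<Rightarrow> real" and v :: "nat \<Rightarrow> int \<times> int" and r :: "nat \<Rightarrow> nat" and C0 :: real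
    and W :: "int \<times> int \<Rightarrow> 'a \<Rightarrow> real"
  assumes e_indep: "indep_vars (\<lambda>_. borel) e UNIV"
    and U_dep: "depends_on e (block (v i) (r i) t) (U i t)"
    and U_mean: "expectation (U i t) = 0"
    and U_int8: "integrable M (\<lambda>\<omega>. U i t \<omega> ^ 8)"
    and U_mom8: "expectation (\<lambda>\<omega>. U i t \<omega> ^ 8) \<le> C0"
    and c_summable: "summable (\<lambda>i. \<bar>c i\<bar> * (real (r i) + 1)\<^sup>2)"
    and W_meas [measurable]: "W t \<in> borel_measurable M"
    and W_sums: "AE \<omega> in M. (\<lambda>i. c i * U i t \<omega>) sums W t \<omega>"
begin

section \<open>Moments and covariances of products of block variables\<close>

lemma e_meas [measurable]: "e s \<in> borel_measurable M"
  using e_indep unfolding indep_vars_def by blast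

lemma U_meas [measurable]: "U i t \<in> borel_measurable M"
  by (rule depends_on_measurable[OF _ U_dep]) simp

lemma C0_nonneg: "0 \<le> C0"
proof -
  have "0 \<le> expectation (\<lambda>\<omega>. U 0 0 \<omega> ^ 8)" by simp
  then show ?thesis using U_mom8[of 0 0] by linarith
qed

lemma U_abs_moment:
  assumes "k \<le> 8"
  shows "integrable M (\<lambda>\<omega>. \<bar>U i t \<omega>\<bar> ^ k)" "expectation (\<lambda>\<omega>. \<bar>U i t \<omega>\<bar> ^ k) \<le> 1 + C0"
proof -
  have b: "\<bar>U i t \<omega>\<bar> ^ k \<le> 1 + U i t \<omega> ^ 8" for \<omega>
    using abs_power_le[OF assms, of "U i t \<omega>"] by (simp add: power_even_abs)
  have i: "integrable M (\<lambda>\<omega>. 1 + U i t \<omega> ^ 8)" using U_int8 by auto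
  show k: "integrable M (\<lambda>\<omega>. \<bar>U i t \<omega>\<bar> ^ k)"
    by (rule Bochner_Integration.integrable_bound[OF i]) (use b in \<open>auto intro!: AE_I2 order.trans[OF b]\<close>)
  have "expectation (\<lambda>\<omega>. \<bar>U i t \<omega>\<bar> ^ k) \<le> expectation (\<lambda>\<omega>. 1 + U i t \<omega> ^ 8)"
    using k i b by (intro integral_mono) auto
  also have "\<dots> \<le> 1 + C0" using U_int8 U_mom8[of i t] by (simp add: prob_space)
  finally show "expectation (\<lambda>\<omega>. \<bar>U i t \<omega>\<bar> ^ k) \<le> 1 + C0" .
qed

lemma U_integrable [simp]: "integrable M (U i t)"
  using U_abs_moment(1)[of 1 i t] by (simp add: integrable_abs_iff)

lemma U_mult2:
  "integrable M (\<lambda>\<omega>. U i s \<omega> * U j t \<omega>)" "\<bar>expectation (\<lambda>\<omega>. U i s \<omega> * U j t \<omega>)\<bar> \<le> 2 * (1 + C0)"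
proof -
  have b: "\<bar>U i s \<omega> * U j t \<omega>\<bar> \<le> \<bar>U i s \<omega>\<bar> ^ 2 + \<bar>U j t \<omega>\<bar> ^ 2" for \<omega>
    by (rule abs_mult2_le)
  have i: "integrable M (\<lambda>\<omega>. \<bar>U i s \<omega>\<bar> ^ 2 + \<bar>U j t \<omega>\<bar> ^ 2)" by (intro Bochner_Integration.integrable_add U_abs_moment) auto
  show int: "integrable M (\<lambda>\<omega>. U i s \<omega> * U j t \<omega>)"
    by (rule Bochner_Integration.integrable_bound[OF i]) (auto intro!: AE_I2 order.trans[OF b])
  have "\<bar>expectation (\<lambda>\<omega>. U i s \<omega> * U j t \<omega>)\<bar> \<le> expectation (\<lambda>\<omega>. \<bar>U i s \<omega> * U j t \<omega>\<bar>)"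
    by (rule integral_abs_bound)
  also have "\<dots> \<le> expectation (\<lambda>\<omega>. \<bar>U i s \<omega>\<bar> ^ 2 + \<bar>U j t \<omega>\<bar> ^ 2)"
    using int i b by (intro integral_mono) auto
  also have "\<dots> = expectation (\<lambda>\<omega>. \<bar>U i s \<omega>\<bar> ^ 2) + expectation (\<lambda>\<omega>. \<bar>U j t \<omega>\<bar> ^ 2)"
    by (intro Bochner_Integration.integral_add U_abs_moment) auto
  also have "\<dots> \<le> 2 * (1 + C0)"
    using U_abs_moment(2)[of 2 i s] U_abs_moment(2)[of 2 j t] by simp
  finally show "\<bar>expectation (\<lambda>\<omega>. U i s \<omega> * U j t \<omega>)\<bar> \<le> 2 * (1 + C0)" .
qed

lemma U_mult4:
  "integrable M (\<lambda>\<omega>. U i s \<omega> * U j t \<omega> * (U k x \<omega> * U l y \<omega>))"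
  "\<bar>expectation (\<lambda>\<omega>. U i s \<omega> * U j t \<omega> * (U k x \<omega> * U l y \<omega>))\<bar> \<le> 4 * (1 + C0)"
proof -
  let ?f = "\<lambda>\<omega>. U i s \<omega> * U j t \<omega> * (U k x \<omega> * U l y \<omega>)"
  let ?g = "\<lambda>\<omega>. \<bar>U i s \<omega>\<bar> ^ 4 + \<bar>U j t \<omega>\<bar> ^ 4 + \<bar>U k x \<omega>\<bar> ^ 4 + \<bar>U l y \<omega>\<bar> ^ 4"
  have b: "\<bar>?f \<omega>\<bar> \<le> ?g \<omega>" for \<omega> by (rule abs_mult4_le)
  have i: "integrable M ?g" by (intro Bochner_Integration.integrable_add U_abs_moment) auto
  show int: "integrable M ?f"
    by (rule Bochner_Integration.integrable_bound[OF i]) (auto intro!: AE_I2 order.trans[OF b])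
  have "\<bar>expectation ?f\<bar> \<le> expectation (\<lambda>\<omega>. \<bar>?f \<omega>\<bar>)" by (rule integral_abs_bound)
  also have "\<dots> \<le> expectation ?g" using int i b by (intro integral_mono integrable_abs) auto
  also have "\<dots> = expectation (\<lambda>\<omega>. \<bar>U i s \<omega>\<bar> ^ 4) + expectation (\<lambda>\<omega>. \<bar>U j t \<omega>\<bar> ^ 4)
      + expectation (\<lambda>\<omega>. \<bar>U k x \<omega>\<bar> ^ 4) + expectation (\<lambda>\<omega>. \<bar>U l y \<omega>\<bar> ^ 4)"
    using U_abs_moment(1)[of 4] by simp
  also have "\<dots> \<le> 4 * (1 + C0)"
    using U_abs_moment(2)[of 4 i s] U_abs_moment(2)[of 4 j t] U_abs_moment(2)[of 4 k x] U_abs_moment(2)[of 4 l y] by simp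
  finally show "\<bar>expectation ?f\<bar> \<le> 4 * (1 + C0)" .
qed

lemma U_mult3: "integrable M (\<lambda>\<omega>. U j t \<omega> * (U k x \<omega> * U l y \<omega>))"
proof -
  have b: "\<bar>U j t \<omega> * (U k x \<omega> * U l y \<omega>)\<bar> \<le> 1 + \<bar>U j t \<omega>\<bar> ^ 4 + \<bar>U k x \<omega>\<bar> ^ 4 + \<bar>U l y \<omega>\<bar> ^ 4" for \<omega>
    using abs_mult4_le[of 1 "U j t \<omega>"] by simp
  have i: "integrable M (\<lambda>\<omega>. 1 + \<bar>U j t \<omega>\<bar> ^ 4 + \<bar>U k x \<omega>\<bar> ^ 4 + \<bar>U l y \<omega>\<bar> ^ 4)"
    by (intro Bochner_Integration.integrable_add U_abs_moment) auto
  show ?thesis by (rule Bochner_Integration.integrable_bound[OF i]) (auto intro!: AE_I2 order.trans[OF b])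
qed

text \<open>A factor whose block is disjoint from all the others splits off by independence and has
  mean zero.\<close>

lemma isolated:
  assumes "block (v i) (r i) s \<inter> block (v j) (r j) t = {}" "block (v i) (r i) s \<inter> block (v k) (r k) x = {}"
    "block (v i) (r i) s \<inter> block (v l) (r l) y = {}"
  shows "expectation (\<lambda>\<omega>. U i s \<omega> * (U j t \<omega> * (U k x \<omega> * U l y \<omega>))) = 0"
    "expectation (\<lambda>\<omega>. U i s \<omega> * U j t \<omega>) = 0"
proof -
  have "block (v i) (r i) s \<inter> (block (v j) (r j) t \<union> (block (v k) (r k) x \<union> block (v l) (r l) y)) = {}"
    using assms by blast
  from depends_on_expectation_mult[OF e_indep U_dep _ depends_on_mult_Un[OF U_dep depends_on_mult_Un[OF U_dep U_dep]] U_mult3 this]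
  show "expectation (\<lambda>\<omega>. U i s \<omega> * (U j t \<omega> * (U k x \<omega> * U l y \<omega>))) = 0"
    by (simp add: U_mean)
  from depends_on_expectation_mult[OF e_indep U_dep _ U_dep _ assms(1)]
  show "expectation (\<lambda>\<omega>. U i s \<omega> * U j t \<omega>) = 0" by (simp add: U_mean)
qed

definition centered :: "nat \<Rightarrow> nat \<Rightarrow> (int \<times> int) \<times> (int \<times> int) \<Rightarrow> 'a \<Rightarrow> real" where
  "centered i j p \<omega> = U i (fst p) \<omega> * U j (snd p) \<omega> - expectation (\<lambda>\<omega>. U i (fst p) \<omega> * U j (snd p) \<omega>)"

lemma centered_mult:
  "integrable M (\<lambda>\<omega>. centered i j p \<omega> * centered i j q \<omega>)"
  "expectation (\<lambda>\<omega>. centered i j p \<omega> * centered i j q \<omega>) =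
    expectation (\<lambda>\<omega>. U i (fst p) \<omega> * U j (snd p) \<omega> * (U i (fst q) \<omega> * U j (snd q) \<omega>)) -
    expectation (\<lambda>\<omega>. U i (fst p) \<omega> * U j (snd p) \<omega>) * expectation (\<lambda>\<omega>. U i (fst q) \<omega> * U j (snd q) \<omega>)"
proof -
  let ?X = "\<lambda>\<omega>. U i (fst p) \<omega> * U j (snd p) \<omega>" and ?Y = "\<lambda>\<omega>. U i (fst q) \<omega> * U j (snd q) \<omega>"
  have e: "centered i j p \<omega> * centered i j q \<omega> = ?X \<omega> * ?Y \<omega> - expectation ?Y * ?X \<omega> - expectation ?X * ?Y \<omega> + expectation ?X * expectation ?Y" for \<omega>
    by (simp add: centered_def algebra_simps)
  have i: "integrable M (\<lambda>\<omega>. ?X \<omega> * ?Y \<omega>)" "integrable M ?X" "integrable M ?Y" by (rule U_mult4 U_mult2)+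
  show "integrable M (\<lambda>\<omega>. centered i j p \<omega> * centered i j q \<omega>)" unfolding e using i by simp
  show "expectation (\<lambda>\<omega>. centered i j p \<omega> * centered i j q \<omega>) = expectation (\<lambda>\<omega>. ?X \<omega> * ?Y \<omega>) - expectation ?X * expectation ?Y"
    unfolding e using i by (simp add: prob_space)
qed

lemma centered_cov_bound: "\<bar>expectation (\<lambda>\<omega>. centered i j p \<omega> * centered i j q \<omega>)\<bar> \<le> 8 * (1 + C0)\<^sup>2"
proof -
  let ?x = "expectation (\<lambda>\<omega>. U i (fst p) \<omega> * U j (snd p) \<omega>)" and ?y = "expectation (\<lambda>\<omega>. U i (fst q) \<omega> * U j (snd q) \<omega>)"
  have "\<bar>?x * ?y\<bar> \<le> 2 * (1 + C0) * (2 * (1 + C0))"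
    unfolding abs_mult using C0_nonneg by (intro mult_mono U_mult2) auto
  then have "\<bar>?x * ?y\<bar> \<le> 4 * (1 + C0)\<^sup>2" by (simp add: power2_eq_square algebra_simps)
  moreover have "1 + C0 \<le> (1 + C0)\<^sup>2" using C0_nonneg by (intro self_le_power) auto
  then have "4 * (1 + C0) \<le> 4 * (1 + C0)\<^sup>2" by simp
  with U_mult4(2) have "\<bar>expectation (\<lambda>\<omega>. U i (fst p) \<omega> * U j (snd p) \<omega> * (U i (fst q) \<omega> * U j (snd q) \<omega>))\<bar> \<le> 4 * (1 + C0)\<^sup>2"
    by (rule order.trans)
  ultimately show ?thesis
    unfolding centered_mult(2) by (intro order.trans[OF abs_triangle_ineq4]) simp
qed

text \<open>The factor is \<open>6 = 3 * 2\<close>: blocks of radius at most \<rho> are disjoint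
  once their centres are farther apart than 2 \<rho>, and matching the centres of \<open>p\<close>
  with those of \<open>q\<close> triples this distance. Both orders of matching are allowed.\<close>

definition linked :: "nat \<Rightarrow> nat \<Rightarrow> (int \<times> int) \<times> (int \<times> int) \<Rightarrow> (int \<times> int) \<times> (int \<times> int) \<Rightarrow> bool" where
  "linked i j p q \<longleftrightarrow>
    (let k = 6 * int (max (r i) (r j)) in
      near k (fst p - v i) (fst q - v i) \<and> near k (snd p - v j) (snd q - v j) \<or>
      near k (fst p - v i) (snd q - v j) \<and> near k (snd p - v j) (fst q - v i))"

text \<open>By the pairing of near centres, two situations remain. Either no centre of
  \<open>p\<close> is near one of \<open>q\<close>, and the two products are independent; or one of
  the four centres is near none of the others, and then the fourfold expectation and one of the
  twofold expectations vanish.\<close>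

lemma centered_cov_zero:
  assumes "\<not> linked i j p q"
  shows "expectation (\<lambda>\<omega>. centered i j p \<omega> * centered i j q \<omega>) = 0"
proof -
  define \<rho> where "\<rho> = max (r i) (r j)"
  have \<rho>: "r i \<le> \<rho>" "r j \<le> \<rho>" by (auto simp: \<rho>_def)
  define a b x y where "a = fst p - v i" and "b = snd p - v j" and "x = fst q - v i" and "y = snd q - v j"
  define A B X Y where "A = block (v i) (r i) (fst p)" and "B = block (v j) (r j) (snd p)"
    and "X = block (v i) (r i) (fst q)" and "Y = block (v j) (r j) (snd q)"
  let ?n = "near (2 * int \<rho>)"
  have disj: "\<not> ?n a b \<Longrightarrow> A \<inter> B = {}" "\<not> ?n a x \<Longrightarrow> A \<inter> X = {}" "\<not> ?n a y \<Longrightarrow> A \<inter> Y = {}"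
    "\<not> ?n b x \<Longrightarrow> B \<inter> X = {}" "\<not> ?n b y \<Longrightarrow> B \<inter> Y = {}" "\<not> ?n x y \<Longrightarrow> X \<inter> Y = {}"
    unfolding A_def B_def X_def Y_def a_def b_def x_def y_def by (rule block_disjoint; use \<rho> in simp)+
  let ?a = "U i (fst p)" and ?b = "U j (snd p)" and ?x = "U i (fst q)" and ?y = "U j (snd q)"
  have dep: "depends_on e A ?a" "depends_on e B ?b" "depends_on e X ?x" "depends_on e Y ?y"
    unfolding A_def B_def X_def Y_def by (rule U_dep)+
  have "\<not> (near (6 * int \<rho>) a x \<and> near (6 * int \<rho>) b y \<or> near (6 * int \<rho>) a y \<and> near (6 * int \<rho>) b x)"
    using assms by (simp add: linked_def Let_def \<rho>_def a_def b_def x_def y_def)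
  then consider (cross) "\<not> ?n a x" "\<not> ?n a y" "\<not> ?n b x" "\<not> ?n b y"
    | (a) "\<not> ?n a b" "\<not> ?n a x" "\<not> ?n a y" | (b) "\<not> ?n a b" "\<not> ?n b x" "\<not> ?n b y"
    | (x) "\<not> ?n x y" "\<not> ?n a x" "\<not> ?n b x" | (y) "\<not> ?n x y" "\<not> ?n a y" "\<not> ?n b y"
    using near_pairing[of "2 * int \<rho>" a x y b] by (simp add: mult.assoc[symmetric]) blast
  then show ?thesis
  proof cases
    case cross
    then have "(A \<union> B) \<inter> (X \<union> Y) = {}" using disj by blast
    then show ?thesis unfolding centered_mult(2)
      by (subst depends_on_expectation_mult[OF e_indep depends_on_mult_Un[OF dep(1,2)] U_mult2(1) depends_on_mult_Un[OF dep(3,4)] U_mult2(1)]) auto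
  next
    case a
    then show ?thesis
      using isolated[of i "fst p" j "snd p" i "fst q" j "snd q"] disj
      by (simp add: centered_mult(2) A_def B_def X_def Y_def mult_ac)
  next
    case b
    then show ?thesis
      using isolated[of j "snd p" i "fst p" i "fst q" j "snd q"] disj
      by (simp add: centered_mult(2) A_def B_def X_def Y_def mult_ac Int_commute)
  next
    case x
    then show ?thesis
      using isolated[of i "fst q" j "snd q" i "fst p" j "snd p"] disj
      by (simp add: centered_mult(2) A_def B_def X_def Y_def mult_ac Int_commute)
  next
    case y
    then show ?thesis
      using isolated[of j "snd q" i "fst q" i "fst p" j "snd p"] disj
      by (simp add: centered_mult(2) A_def B_def X_def Y_def mult_ac Int_commute)
  qed
qed

end

lemma near_diff_cancel: "near k (a - x) (b - x) \<longleftrightarrow> near k a b"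
  by (simp add: near_def)

lemma near_diff_shift: "near k a (b - x) \<longleftrightarrow> near k b (a + x)"
  by (auto simp: near_def abs_le_iff)

lemma sum_sq_le_mult:
  fixes a z :: "'i \<Rightarrow> real"
  assumes "(\<Sum>i\<in>I. \<bar>a i\<bar>) \<le> A"
  shows "(\<Sum>i\<in>I. a i * z i)\<^sup>2 \<le> A * (\<Sum>i\<in>I. \<bar>a i\<bar> * (z i)\<^sup>2)"
proof -
  have "(\<Sum>i\<in>I. a i * z i)\<^sup>2 \<le> (\<Sum>i\<in>I. \<bar>a i\<bar>) * (\<Sum>i\<in>I. \<bar>a i\<bar> * (z i)\<^sup>2)"
    using weighted_cauchy_schwarz[of I "\<lambda>_. 1" a z] by simp
  also have "\<dots> \<le> A * (\<Sum>i\<in>I. \<bar>a i\<bar> * (z i)\<^sup>2)"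
    by (rule mult_right_mono[OF assms]) (simp add: sum_nonneg)
  finally show ?thesis .
qed

text \<open>Jensen's inequality for the eighth power with weights \<open>\<bar>a i\<bar>\<close>, by
  three successive uses of Cauchy-Schwarz.\<close>

lemma sum_power8_le_mult:
  fixes a z :: "'i \<Rightarrow> real"
  assumes "(\<Sum>i\<in>I. \<bar>a i\<bar>) \<le> A"
  shows "(\<Sum>i\<in>I. a i * z i) ^ 8 \<le> A ^ 7 * (\<Sum>i\<in>I. \<bar>a i\<bar> * z i ^ 8)"
proof -
  have A: "0 \<le> A" using assms by (rule order.trans[rotated]) (simp add: sum_nonneg)
  define s where "s k = (\<Sum>i\<in>I. \<bar>a i\<bar> * z i ^ k)" for k :: nat
  have step: "(s k)\<^sup>2 \<le> A * s (2 * k)" for k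
    using sum_sq_le_mult[of "\<lambda>i. \<bar>a i\<bar>" I A "\<lambda>i. z i ^ k"] assms
    by (simp add: s_def power_mult[symmetric] mult.commute)
  have nn: "0 \<le> s (2 * k)" for k by (simp add: s_def sum_nonneg power_mult)
  have "(\<Sum>i\<in>I. a i * z i)\<^sup>2 \<le> A * s 2" unfolding s_def by (rule sum_sq_le_mult[OF assms])
  then have "((\<Sum>i\<in>I. a i * z i)\<^sup>2) ^ 4 \<le> (A * s 2) ^ 4" by (rule power_mono) simp
  also have "\<dots> = A ^ 4 * ((s 2)\<^sup>2)\<^sup>2" by (simp add: power_mult_distrib)
  also have "\<dots> \<le> A ^ 4 * (A * s 4)\<^sup>2"
    using step[of 2] A by (intro mult_left_mono power_mono) auto
  also have "\<dots> = A ^ 6 * (s 4)\<^sup>2" by (simp add: power_mult_distrib power_add[symmetric] mult.assoc[symmetric])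
  also have "\<dots> \<le> A ^ 6 * (A * s 8)" using step[of 4] A by (intro mult_left_mono) auto
  also have "\<dots> = A ^ 7 * s 8" by (simp add: eval_nat_numeral mult_ac)
  finally show ?thesis by (simp add: s_def)
qed

context block_expansion begin

section \<open>Variance of quadratic forms in the field\<close>

lemma linked_sym: "linked i j p q \<longleftrightarrow> linked i j q p"
  unfolding linked_def Let_def by (metis near_sym)

lemma card_linked:
  assumes "finite A"
  shows "card {q \<in> A. linked i j p q} \<le> 2 * (12 * max (r i) (r j) + 1) ^ 4"
proof -
  define \<rho> where "\<rho> = max (r i) (r j)"
  let ?S = "\<lambda>x y. {q \<in> A. near (int (6 * \<rho>)) (fst q) x \<and> near (int (6 * \<rho>)) (snd q) y}"
  have "{q \<in> A. linked i j p q} \<subseteq> ?S (fst p) (snd p) \<union> ?S (snd p - v j + v i) (fst p - v i + v j)"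
    unfolding linked_def Let_def near_diff_cancel near_diff_shift \<rho>_def[symmetric]
    by (auto simp: near_sym)
  then have "card {q \<in> A. linked i j p q} \<le> card (?S (fst p) (snd p) \<union> ?S (snd p - v j + v i) (fst p - v i + v j))"
    using assms by (intro card_mono) auto
  also have "\<dots> \<le> card (?S (fst p) (snd p)) + card (?S (snd p - v j + v i) (fst p - v i + v j))"
    by (rule card_Un_le)
  also have "\<dots> \<le> (2 * (6 * \<rho>) + 1) ^ 4 + (2 * (6 * \<rho>) + 1) ^ 4"
    by (intro add_mono card_near_pairs assms)
  finally show ?thesis by (simp add: \<rho>_def)
qed

definition wt :: "nat \<Rightarrow> real" where "wt i = (real (r i) + 1)\<^sup>2"

lemma wt_pos: "0 < wt i" and wt_ge1: "1 \<le> wt i"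
  by (simp_all add: wt_def add_pos_nonneg)

text \<open>Only linked pairs have a nonzero covariance, so Schur's test applies with the number of
  linked partners. The constant is the covariance bound \<open>8 * (1 + C0)\<^sup>2\<close> times
  \<open>2 * 12 ^ 4\<close> from the count of partners.\<close>

lemma centered_sum_sq:
  assumes A: "finite A"
  shows "integrable M (\<lambda>\<omega>. (\<Sum>p\<in>A. Q p * centered i j p \<omega>)\<^sup>2)"
    "expectation (\<lambda>\<omega>. (\<Sum>p\<in>A. Q p * centered i j p \<omega>)\<^sup>2) \<le>
      16 * 12 ^ 4 * (1 + C0)\<^sup>2 * (wt i * wt j)\<^sup>2 * (\<Sum>p\<in>A. (Q p)\<^sup>2)"
proof -
  let ?C = "\<lambda>p q. expectation (\<lambda>\<omega>. centered i j p \<omega> * centered i j q \<omega>)"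
  have sq: "(\<Sum>p\<in>A. Q p * centered i j p \<omega>)\<^sup>2 =
      (\<Sum>p\<in>A. \<Sum>q\<in>A. Q p * Q q * (centered i j p \<omega> * centered i j q \<omega>))" for \<omega>
    by (simp add: power2_eq_square sum_product mult_ac)
  show "integrable M (\<lambda>\<omega>. (\<Sum>p\<in>A. Q p * centered i j p \<omega>)\<^sup>2)"
    unfolding sq by (intro Bochner_Integration.integrable_sum integrable_mult_right centered_mult)
  have "expectation (\<lambda>\<omega>. (\<Sum>p\<in>A. Q p * centered i j p \<omega>)\<^sup>2) = (\<Sum>p\<in>A. \<Sum>q\<in>A. Q p * Q q * ?C p q)"
    unfolding sq by (simp add: centered_mult(1))
  also have "\<dots> \<le> (\<Sum>p\<in>A. \<Sum>q\<in>A. 8 * (1 + C0)\<^sup>2 * (of_bool (linked i j p q) * (\<bar>Q p\<bar> * \<bar>Q q\<bar>)))"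
  proof (intro sum_mono)
    fix p q
    show "Q p * Q q * ?C p q \<le> 8 * (1 + C0)\<^sup>2 * (of_bool (linked i j p q) * (\<bar>Q p\<bar> * \<bar>Q q\<bar>))"
    proof (cases "linked i j p q")
      case True
      have "Q p * Q q * ?C p q \<le> \<bar>Q p * Q q * ?C p q\<bar>" by (rule abs_ge_self)
      also have "\<dots> \<le> \<bar>Q p\<bar> * \<bar>Q q\<bar> * (8 * (1 + C0)\<^sup>2)"
        unfolding abs_mult by (intro mult_left_mono centered_cov_bound) auto
      finally show ?thesis using True by (simp add: mult_ac)
    qed (simp add: centered_cov_zero)
  qed
  also have "\<dots> = 8 * (1 + C0)\<^sup>2 * (\<Sum>p\<in>A. \<Sum>q\<in>A. of_bool (linked i j p q) * (\<bar>Q p\<bar> * \<bar>Q q\<bar>))"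
    by (simp add: sum_distrib_left)
  also have "\<dots> \<le> 8 * (1 + C0)\<^sup>2 * (real (2 * (12 * max (r i) (r j) + 1) ^ 4) * (\<Sum>p\<in>A. (Q p)\<^sup>2))"
  proof (intro mult_left_mono sum_relation_le A card_linked)
    show "card {p \<in> A. linked i j p q} \<le> 2 * (12 * max (r i) (r j) + 1) ^ 4" for q
      using card_linked[OF A, of i j q] by (simp add: linked_sym)
  qed simp
  also have "real (2 * (12 * max (r i) (r j) + 1) ^ 4) \<le> 2 * 12 ^ 4 * (wt i * wt j)\<^sup>2"
  proof -
    have "real (12 * max (r i) (r j) + 1) \<le> 12 * ((real (r i) + 1) * (real (r j) + 1))"
    proof -
      have "0 \<le> real (r i) * real (r j)" by simp
      then show ?thesis by (simp add: max_def algebra_simps)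
    qed
    then have "real (12 * max (r i) (r j) + 1) ^ 4 \<le> (12 * ((real (r i) + 1) * (real (r j) + 1))) ^ 4"
      by (intro power_mono) auto
    also have "\<dots> = 12 ^ 4 * (wt i * wt j)\<^sup>2"
      by (simp add: wt_def power_mult_distrib)
    finally show ?thesis by simp
  qed
  finally show "expectation (\<lambda>\<omega>. (\<Sum>p\<in>A. Q p * centered i j p \<omega>)\<^sup>2) \<le>
      16 * 12 ^ 4 * (1 + C0)\<^sup>2 * (wt i * wt j)\<^sup>2 * (\<Sum>p\<in>A. (Q p)\<^sup>2)"
    by (simp add: mult_left_mono mult_right_mono sum_nonneg mult_ac)
qed

definition psum :: "nat \<Rightarrow> int \<times> int \<Rightarrow> 'a \<Rightarrow> real" where
  "psum n t \<omega> = (\<Sum>i<n. c i * U i t \<omega>)"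

lemma psum_meas [measurable]: "psum n t \<in> borel_measurable M"
  unfolding psum_def by measurable

definition ctot :: real where "ctot = (\<Sum>i. \<bar>c i\<bar> * wt i)"

lemma c_wt_summable: "summable (\<lambda>i. \<bar>c i\<bar> * wt i)"
  using c_summable by (simp add: wt_def)

lemma c_abs_summable: "summable (\<lambda>i. \<bar>c i\<bar>)"
  by (rule summable_comparison_test'[OF c_wt_summable, of 0]) (use wt_ge1 in \<open>auto simp: mult_le_cancel_left1\<close>)

lemma partial_sum_wt_le: "(\<Sum>i<n. \<bar>c i\<bar> * wt i) \<le> ctot"
  unfolding ctot_def using wt_pos by (intro sum_le_suminf c_wt_summable) (auto simp: less_imp_le)

lemma ctot_nonneg: "0 \<le> ctot"
  using partial_sum_wt_le[of 0] by simp

lemma partial_sum_abs_le: "(\<Sum>i<n. \<bar>c i\<bar>) \<le> ctot"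
  by (rule order.trans[OF sum_mono partial_sum_wt_le]) (use wt_ge1 in \<open>auto simp: mult_le_cancel_left1\<close>)

definition quad_const :: real where "quad_const = 16 * 12 ^ 4 * (1 + C0)\<^sup>2 * ctot ^ 4"

lemma quad_const_nonneg: "0 \<le> quad_const"
  by (simp add: quad_const_def)

definition quad :: "nat \<Rightarrow> ((int \<times> int) \<times> (int \<times> int)) set \<Rightarrow> ((int \<times> int) \<times> (int \<times> int) \<Rightarrow> real) \<Rightarrow> 'a \<Rightarrow> real" where
  "quad n A Q \<omega> = (\<Sum>p\<in>A. Q p * (psum n (fst p) \<omega> * psum n (snd p) \<omega>))"

lemma psum_mult: "psum n s \<omega> * psum n t \<omega> = (\<Sum>i<n. \<Sum>j<n. c i * c j * (U i s \<omega> * U j t \<omega>))"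
  by (simp add: psum_def sum_product mult_ac)

lemma quad_expand:
  "quad n A Q \<omega> = (\<Sum>i<n. \<Sum>j<n. c i * c j * (\<Sum>p\<in>A. Q p * (U i (fst p) \<omega> * U j (snd p) \<omega>)))"
proof -
  have "quad n A Q \<omega> = (\<Sum>p\<in>A. \<Sum>i<n. \<Sum>j<n. c i * c j * (Q p * (U i (fst p) \<omega> * U j (snd p) \<omega>)))"
    unfolding quad_def psum_mult by (simp add: sum_distrib_left mult_ac)
  also have "\<dots> = (\<Sum>i<n. \<Sum>j<n. \<Sum>p\<in>A. c i * c j * (Q p * (U i (fst p) \<omega> * U j (snd p) \<omega>)))"
    by (subst sum.swap, intro sum.cong refl, rule sum.swap)
  finally show ?thesis by (simp add: sum_distrib_left)
qed

lemma quad_centered: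
  "quad n A Q \<omega> - expectation (quad n A Q) =
    (\<Sum>ij\<in>{..<n} \<times> {..<n}. (c (fst ij) * c (snd ij)) * (\<Sum>p\<in>A. Q p * centered (fst ij) (snd ij) p \<omega>))"
proof -
  have i: "integrable M (\<lambda>\<omega>. U i s \<omega> * U j t \<omega>)" for i j s t by (rule U_mult2)
  have "expectation (quad n A Q) = (\<Sum>i<n. \<Sum>j<n. c i * c j * (\<Sum>p\<in>A. Q p * expectation (\<lambda>\<omega>. U i (fst p) \<omega> * U j (snd p) \<omega>)))"
    unfolding quad_expand[abs_def] using i by simp
  then show ?thesis
    unfolding quad_expand sum.cartesian_product[symmetric] split_def centered_def
    by (simp add: sum.cartesian_product' right_diff_distrib sum_subtractf split_def)
qed

text \<open>The standard deviation of the part with indices \<open>i\<close> and \<open>j\<close>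
  grows like \<open>wt i * wt j\<close>. Cauchy-Schwarz with exactly this weight leaves only sums of
  \<open>\<bar>c i\<bar> * wt i\<close>, so the bound does not depend on \<open>n\<close>.\<close>

lemma quad_finite_variance:
  assumes A: "finite A"
  shows "integrable M (\<lambda>\<omega>. (quad n A Q \<omega> - expectation (quad n A Q))\<^sup>2)"
    "expectation (\<lambda>\<omega>. (quad n A Q \<omega> - expectation (quad n A Q))\<^sup>2) \<le> quad_const * (\<Sum>p\<in>A. (Q p)\<^sup>2)"
proof -
  let ?I = "{..<n} \<times> {..<n}"
  let ?Z = "\<lambda>ij \<omega>. \<Sum>p\<in>A. Q p * centered (fst ij) (snd ij) p \<omega>"
  let ?a = "\<lambda>ij. c (fst ij) * c (snd ij)" and ?w = "\<lambda>ij. wt (fst ij) * wt (snd ij)"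
  let ?q = "\<Sum>p\<in>A. (Q p)\<^sup>2"
  let ?R = "\<lambda>\<omega>. (\<Sum>ij\<in>?I. \<bar>?a ij\<bar> * ?w ij) * (\<Sum>ij\<in>?I. \<bar>?a ij\<bar> * (?Z ij \<omega>)\<^sup>2 / ?w ij)"
  have w: "0 < ?w ij" for ij by (simp add: wt_pos)
  have bnd: "(quad n A Q \<omega> - expectation (quad n A Q))\<^sup>2 \<le> ?R \<omega>" for \<omega>
    unfolding quad_centered by (rule weighted_cauchy_schwarz) (rule w)
  have iR: "integrable M ?R"
    by (intro integrable_mult_right Bochner_Integration.integrable_sum integrable_divide_zero centered_sum_sq A)
  have [measurable]: "quad n A Q \<in> borel_measurable M" unfolding quad_def by measurable
  show int: "integrable M (\<lambda>\<omega>. (quad n A Q \<omega> - expectation (quad n A Q))\<^sup>2)"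
    by (rule Bochner_Integration.integrable_bound[OF iR]) (auto intro!: AE_I2 order.trans[OF bnd])
  have s: "(\<Sum>ij\<in>?I. \<bar>?a ij\<bar> * ?w ij) \<le> ctot * ctot"
  proof -
    have "(\<Sum>ij\<in>?I. \<bar>?a ij\<bar> * ?w ij) = (\<Sum>i<n. \<bar>c i\<bar> * wt i) * (\<Sum>i<n. \<bar>c i\<bar> * wt i)"
      unfolding sum_product sum.cartesian_product by (intro sum.cong) (auto simp: abs_mult mult_ac)
    also have "\<dots> \<le> ctot * ctot"
      using wt_pos ctot_nonneg by (intro mult_mono partial_sum_wt_le sum_nonneg) (auto simp: less_imp_le)
    finally show ?thesis .
  qed
  have s0: "0 \<le> (\<Sum>ij\<in>?I. \<bar>?a ij\<bar> * ?w ij)" using w by (intro sum_nonneg) (auto simp: less_imp_le)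
  have "expectation (\<lambda>\<omega>. (quad n A Q \<omega> - expectation (quad n A Q))\<^sup>2) \<le> expectation ?R"
    using int iR bnd by (intro integral_mono) auto
  also have "\<dots> = (\<Sum>ij\<in>?I. \<bar>?a ij\<bar> * ?w ij) * (\<Sum>ij\<in>?I. \<bar>?a ij\<bar> * expectation (\<lambda>\<omega>. (?Z ij \<omega>)\<^sup>2) / ?w ij)"
    using centered_sum_sq(1)[OF A] by simp
  also have "\<dots> \<le> (\<Sum>ij\<in>?I. \<bar>?a ij\<bar> * ?w ij) * (\<Sum>ij\<in>?I. \<bar>?a ij\<bar> * (16 * 12 ^ 4 * (1 + C0)\<^sup>2 * (?w ij)\<^sup>2 * ?q) / ?w ij)"
    using w s0 by (intro mult_left_mono sum_mono divide_right_mono centered_sum_sq A) (auto simp: less_imp_le)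
  also have "(\<Sum>ij\<in>?I. \<bar>?a ij\<bar> * (16 * 12 ^ 4 * (1 + C0)\<^sup>2 * (?w ij)\<^sup>2 * ?q) / ?w ij) =
      (16 * 12 ^ 4 * (1 + C0)\<^sup>2 * ?q) * (\<Sum>ij\<in>?I. \<bar>?a ij\<bar> * ?w ij)"
  proof -
    have "\<bar>?a ij\<bar> * (16 * 12 ^ 4 * (1 + C0)\<^sup>2 * (?w ij)\<^sup>2 * ?q) / ?w ij = (16 * 12 ^ 4 * (1 + C0)\<^sup>2 * ?q) * (\<bar>?a ij\<bar> * ?w ij)" for ij
      using w[of ij] by (simp only: power2_eq_square) (simp add: mult_ac)
    then show ?thesis by (simp only: sum_distrib_left)
  qed
  also have "(\<Sum>ij\<in>?I. \<bar>?a ij\<bar> * ?w ij) * ((16 * 12 ^ 4 * (1 + C0)\<^sup>2 * ?q) * (\<Sum>ij\<in>?I. \<bar>?a ij\<bar> * ?w ij))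
      \<le> (ctot * ctot) * ((16 * 12 ^ 4 * (1 + C0)\<^sup>2 * ?q) * (ctot * ctot))"
    using s s0 ctot_nonneg by (intro mult_mono mult_nonneg_nonneg) (auto simp: sum_nonneg)
  also have "\<dots> = quad_const * ?q" by (simp add: quad_const_def eval_nat_numeral mult_ac)
  finally show "expectation (\<lambda>\<omega>. (quad n A Q \<omega> - expectation (quad n A Q))\<^sup>2) \<le> quad_const * ?q" .
qed

text \<open>Up to a constant, an integrable majorant for the eighth powers of all partial sums at
  one site; it dominates the squares of all truncated quadratic forms at once.\<close>

definition env :: "int \<times> int \<Rightarrow> 'a \<Rightarrow> real" where
  "env t \<omega> = (\<Sum>i. \<bar>c i\<bar> * U i t \<omega> ^ 8)"

lemma env: "AE \<omega> in M. summable (\<lambda>i. \<bar>c i\<bar> * U i t \<omega> ^ 8)" "integrable M (env t)"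
proof -
  have sm: "summable (\<lambda>i. expectation (\<lambda>\<omega>. \<bar>c i\<bar> * U i t \<omega> ^ 8))"
  proof (rule summable_comparison_test'[of "\<lambda>i. \<bar>c i\<bar> * C0" 0])
    show "summable (\<lambda>i. \<bar>c i\<bar> * C0)" by (rule summable_mult2[OF c_abs_summable])
    show "norm (expectation (\<lambda>\<omega>. \<bar>c i\<bar> * U i t \<omega> ^ 8)) \<le> \<bar>c i\<bar> * C0" for i
    proof -
      have "0 \<le> expectation (\<lambda>\<omega>. U i t \<omega> ^ 8)" by simp
      then show ?thesis using U_mom8[of i t] by (simp add: abs_mult mult_left_mono)
    qed
  qed
  show "AE \<omega> in M. summable (\<lambda>i. \<bar>c i\<bar> * U i t \<omega> ^ 8)" "integrable M (env t)"
    unfolding env_def[abs_def]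
    by (rule AE_summable_of_integrals[OF integrable_mult_right[OF U_int8] _ sm]; simp)+
qed

lemma psum_power8_le: "AE \<omega> in M. \<forall>n. psum n t \<omega> ^ 8 \<le> ctot ^ 7 * env t \<omega>"
  using env(1)[of t]
proof eventually_elim
  case (elim \<omega>)
  show ?case
  proof
    fix n
    have "psum n t \<omega> ^ 8 \<le> ctot ^ 7 * (\<Sum>i<n. \<bar>c i\<bar> * U i t \<omega> ^ 8)"
      unfolding psum_def by (rule sum_power8_le_mult[OF partial_sum_abs_le])
    also have "\<dots> \<le> ctot ^ 7 * env t \<omega>"
      unfolding env_def using ctot_nonneg elim by (intro mult_left_mono sum_le_suminf) auto
    finally show "psum n t \<omega> ^ 8 \<le> ctot ^ 7 * env t \<omega>" .
  qed
qed

lemma psum_tendsto: "AE \<omega> in M. (\<lambda>n. psum n t \<omega>) \<longlonglongrightarrow> W t \<omega>"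
  using W_sums[of t] by (simp add: sums_def psum_def)

text \<open>The bound for truncated expansions is uniform in the number of terms, and dominated
  convergence carries the first two moments to the limit.\<close>

lemma quadratic_form_variance:
  fixes Q :: "(int \<times> int) \<times> (int \<times> int) \<Rightarrow> real"
  assumes A: "finite A"
  defines "X \<equiv> \<lambda>\<omega>. \<Sum>p\<in>A. Q p * (W (fst p) \<omega> * W (snd p) \<omega>)"
  shows "integrable M X" "integrable M (\<lambda>\<omega>. (X \<omega>)\<^sup>2)"
    "expectation (\<lambda>\<omega>. (X \<omega> - expectation X)\<^sup>2) \<le> quad_const * (\<Sum>p\<in>A. (Q p)\<^sup>2)"
proof -
  define B where "B = (\<Sum>p\<in>A. \<bar>Q p\<bar>)"
  define D where "D \<omega> = B * (\<Sum>p\<in>A. \<bar>Q p\<bar> * (2 + ctot ^ 7 * env (fst p) \<omega> + ctot ^ 7 * env (snd p) \<omega>))" for \<omega>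
  have iD: "integrable M D" unfolding D_def[abs_def]
    by (intro integrable_mult_right Bochner_Integration.integrable_sum Bochner_Integration.integrable_add env(2) integrable_const)
  have [measurable]: "quad n A Q \<in> borel_measurable M" "X \<in> borel_measurable M" for n
    unfolding quad_def X_def by measurable
  have "AE \<omega> in M. \<forall>p\<in>A. \<forall>n. psum n (fst p) \<omega> ^ 8 \<le> ctot ^ 7 * env (fst p) \<omega>"
    "AE \<omega> in M. \<forall>p\<in>A. \<forall>n. psum n (snd p) \<omega> ^ 8 \<le> ctot ^ 7 * env (snd p) \<omega>"
    by (rule AE_finite_allI[OF A psum_power8_le])+
  then have dom: "AE \<omega> in M. \<forall>n. (quad n A Q \<omega>)\<^sup>2 \<le> D \<omega>"
  proof eventually_elim
    case (elim \<omega>)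
    show ?case
    proof
      fix n
      have "(quad n A Q \<omega>)\<^sup>2 \<le> B * (\<Sum>p\<in>A. \<bar>Q p\<bar> * (psum n (fst p) \<omega> * psum n (snd p) \<omega>)\<^sup>2)"
        unfolding quad_def by (rule sum_sq_le_mult) (simp add: B_def)
      also have "\<dots> \<le> D \<omega>" unfolding D_def
      proof (intro mult_left_mono sum_mono)
        fix p assume p: "p \<in> A"
        let ?x = "psum n (fst p) \<omega>" and ?y = "psum n (snd p) \<omega>"
        have "(?x * ?y)\<^sup>2 \<le> \<bar>?x\<bar> ^ 4 + \<bar>?y\<bar> ^ 4"
          using abs_mult2_le[of "?x\<^sup>2" "?y\<^sup>2"] by (simp add: power_mult_distrib)
        also have "\<dots> \<le> (1 + \<bar>?x\<bar> ^ 8) + (1 + \<bar>?y\<bar> ^ 8)" by (intro add_mono abs_power_le) auto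
        also have "\<dots> \<le> 2 + ctot ^ 7 * env (fst p) \<omega> + ctot ^ 7 * env (snd p) \<omega>"
          using elim(1)[THEN bspec, OF p, THEN spec, of n] elim(2)[THEN bspec, OF p, THEN spec, of n]
          by (simp add: power_even_abs)
        finally show "(?x * ?y)\<^sup>2 \<le> 2 + ctot ^ 7 * env (fst p) \<omega> + ctot ^ 7 * env (snd p) \<omega>" .
      qed (auto simp: B_def sum_nonneg)
      finally show "(quad n A Q \<omega>)\<^sup>2 \<le> D \<omega>" .
    qed
  qed
  have "AE \<omega> in M. \<forall>p\<in>A. (\<lambda>n. psum n (fst p) \<omega>) \<longlonglongrightarrow> W (fst p) \<omega>"
    "AE \<omega> in M. \<forall>p\<in>A. (\<lambda>n. psum n (snd p) \<omega>) \<longlonglongrightarrow> W (snd p) \<omega>"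
    by (rule AE_finite_allI[OF A psum_tendsto])+
  then have lim: "AE \<omega> in M. (\<lambda>n. quad n A Q \<omega>) \<longlonglongrightarrow> X \<omega>"
    unfolding quad_def X_def by eventually_elim (intro tendsto_intros, auto)
  have lim2: "AE \<omega> in M. (\<lambda>n. (quad n A Q \<omega>)\<^sup>2) \<longlonglongrightarrow> (X \<omega>)\<^sup>2"
    using lim by eventually_elim (rule tendsto_power)
  have d2: "AE \<omega> in M. norm ((quad n A Q \<omega>)\<^sup>2) \<le> D \<omega>" for n
    using dom by eventually_elim simp
  have d1: "AE \<omega> in M. norm (quad n A Q \<omega>) \<le> 1 + D \<omega>" for n
    using dom
  proof eventually_elim
    case (elim \<omega>)
    then have "(quad n A Q \<omega>)\<^sup>2 \<le> D \<omega>" by blast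
    then show ?case using abs_power_le[of 1 2 "quad n A Q \<omega>"] by simp
  qed
  have i1D: "integrable M (\<lambda>\<omega>. 1 + D \<omega>)" using iD by simp
  note dc2 = integrable_dominated_convergence[OF _ _ iD lim2 d2] integrable_dominated_convergence2[OF _ _ iD lim2 d2]
    integral_dominated_convergence[OF _ _ iD lim2 d2]
  note dc1 = integrable_dominated_convergence[OF _ _ i1D lim d1] integrable_dominated_convergence2[OF _ _ i1D lim d1]
    integral_dominated_convergence[OF _ _ i1D lim d1]
  show iX: "integrable M X" and iX2: "integrable M (\<lambda>\<omega>. (X \<omega>)\<^sup>2)" by (rule dc1 dc2; measurable)+
  have iq: "integrable M (quad n A Q)" "integrable M (\<lambda>\<omega>. (quad n A Q \<omega>)\<^sup>2)" for n by (rule dc1 dc2; measurable)+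
  have var: "expectation (\<lambda>\<omega>. (Y \<omega> - expectation Y)\<^sup>2) = expectation (\<lambda>\<omega>. (Y \<omega>)\<^sup>2) - (expectation Y)\<^sup>2"
    if "integrable M Y" "integrable M (\<lambda>\<omega>. (Y \<omega>)\<^sup>2)" for Y :: "'a \<Rightarrow> real"
    using variance_eq[OF that] .
  have "(\<lambda>n. expectation (\<lambda>\<omega>. (quad n A Q \<omega>)\<^sup>2) - (expectation (quad n A Q))\<^sup>2) \<longlonglongrightarrow>
      expectation (\<lambda>\<omega>. (X \<omega>)\<^sup>2) - (expectation X)\<^sup>2"
    by (intro tendsto_diff tendsto_power dc1 dc2) measurable
  moreover have "expectation (\<lambda>\<omega>. (quad n A Q \<omega>)\<^sup>2) - (expectation (quad n A Q))\<^sup>2 \<le> quad_const * (\<Sum>p\<in>A. (Q p)\<^sup>2)" for n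
    using quad_finite_variance(2)[OF A, of n Q] var[OF iq[of n]] by simp
  ultimately show "expectation (\<lambda>\<omega>. (X \<omega> - expectation X)\<^sup>2) \<le> quad_const * (\<Sum>p\<in>A. (Q p)\<^sup>2)"
    unfolding var[OF iX iX2] by (intro LIMSEQ_le_const2) auto
qed

end

section \<open>Truncation and exponential moments\<close>

text \<open>Jensen's inequality for weights of total mass at most one, with the missing mass placed
  at 0. The proof is the tangent line of the exponential at the weighted mean.\<close>

lemma exp_weighted_sum_le:
  fixes w x :: "'i \<Rightarrow> real"
  assumes fin: "finite I" and w: "\<And>i. i \<in> I \<Longrightarrow> 0 \<le> w i" "(\<Sum>i\<in>I. w i) \<le> 1"
  shows "exp (\<Sum>i\<in>I. w i * x i) \<le> (\<Sum>i\<in>I. w i * exp (x i)) + (1 - (\<Sum>i\<in>I. w i))"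
proof -
  define m where "m = (\<Sum>i\<in>I. w i * x i)"
  have tangent: "exp m * (1 + (y - m)) \<le> exp y" for y
  proof -
    have "exp m * (1 + (y - m)) \<le> exp m * exp (y - m)" by (intro mult_left_mono exp_ge_add_one_self) simp
    then show ?thesis by (simp add: exp_add[symmetric])
  qed
  have "exp m = (\<Sum>i\<in>I. w i * (exp m * (1 + (x i - m)))) + (1 - (\<Sum>i\<in>I. w i)) * (exp m * (1 + (0 - m)))"
  proof -
    have "(\<Sum>i\<in>I. w i * (exp m * (1 + (x i - m)))) = exp m * ((\<Sum>i\<in>I. w i) * (1 - m) + m)"
    proof -
      have "w i * (exp m * (1 + (x i - m))) = exp m * (1 - m) * w i + exp m * (w i * x i)" for i
        by (simp add: algebra_simps)
      then have "(\<Sum>i\<in>I. w i * (exp m * (1 + (x i - m)))) = exp m * (1 - m) * (\<Sum>i\<in>I. w i) + exp m * m"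
        by (simp only: sum.distrib sum_distrib_left[symmetric] m_def[symmetric])
      then show ?thesis by (simp add: algebra_simps)
    qed
    then show ?thesis by (simp add: algebra_simps)
  qed
  also have "\<dots> \<le> (\<Sum>i\<in>I. w i * exp (x i)) + (1 - (\<Sum>i\<in>I. w i)) * exp 0"
    using w by (intro add_mono sum_mono mult_left_mono tangent) auto
  finally show ?thesis by (simp add: m_def)
qed

text \<open>Used for bounded centred variables: in expectation the linear term disappears and only
  the variance remains.\<close>

lemma exp_le_quadratic:
  fixes y :: real
  assumes "\<bar>y\<bar> \<le> 1"
  shows "exp y \<le> 1 + y + y\<^sup>2"
proof (cases "0 \<le> y")
  case True
  then show ?thesis using assms exp_bound by simp
next
  case False
  have "exp y = 1 / exp (- y)" by (simp add: exp_minus divide_inverse)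
  also have "\<dots> \<le> 1 / (1 + (- y) + (- y)\<^sup>2 / 2)"
    using False exp_lower_Taylor_quadratic[of "- y"] by (intro divide_left_mono mult_pos_pos) (auto simp: add_pos_nonneg)
  also have "\<dots> \<le> 1 + y + y\<^sup>2"
  proof -
    have p: "0 < 1 - y + y\<^sup>2 / 2" using False by (simp add: add_pos_nonneg)
    have "(1 + y + y\<^sup>2) * (1 - y + y\<^sup>2 / 2) = 1 + y\<^sup>2 / 2 * (1 - y) + y ^ 4 / 2"
      by (simp add: field_simps power2_eq_square eval_nat_numeral)
    moreover have "0 \<le> y\<^sup>2 / 2 * (1 - y)" "0 \<le> y ^ 4 / 2" using False by auto
    ultimately have "1 \<le> (1 + y + y\<^sup>2) * (1 - y + y\<^sup>2 / 2)" by linarith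
    then show ?thesis using p by (simp add: pos_divide_le_eq)
  qed
  finally show ?thesis .
qed

context block_expansion begin

definition cut :: "real \<Rightarrow> real \<Rightarrow> real" where "cut B x = (if \<bar>x\<bar> \<le> B then x else 0)"

lemma cut_meas [measurable]: "cut B \<in> borel_measurable borel"
  unfolding cut_def by measurable

lemma cut_bounds: "0 \<le> B \<Longrightarrow> \<bar>cut B x\<bar> \<le> B" "\<bar>cut B x\<bar> \<le> \<bar>x\<bar>"
  by (auto simp: cut_def)

text \<open>Recentred after the truncation, because the exponential bound rests on mean zero; the
  block of dependence is unchanged.\<close>

definition UB :: "real \<Rightarrow> nat \<Rightarrow> int \<times> int \<Rightarrow> 'a \<Rightarrow> real" where
  "UB B i t \<omega> = cut B (U i t \<omega>) - expectation (\<lambda>\<omega>. cut B (U i t \<omega>))"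

lemma UB_meas [measurable]: "UB B i t \<in> borel_measurable M"
  unfolding UB_def[abs_def] by measurable

lemma cut_integrable:
  "integrable M (\<lambda>\<omega>. cut B (U i t \<omega>))" "integrable M (\<lambda>\<omega>. (cut B (U i t \<omega>))\<^sup>2)"
proof -
  show "integrable M (\<lambda>\<omega>. cut B (U i t \<omega>))"
    by (rule Bochner_Integration.integrable_bound[OF U_integrable[of i t]]) (auto intro!: AE_I2 simp: cut_bounds)
  show "integrable M (\<lambda>\<omega>. (cut B (U i t \<omega>))\<^sup>2)"
    by (rule Bochner_Integration.integrable_bound[OF U_abs_moment(1)[of 2 i t]])
       (auto intro!: AE_I2 simp: cut_def)
qed

lemma UB_bound: assumes "0 \<le> B" shows "\<bar>UB B i t \<omega>\<bar> \<le> 2 * B"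
proof -
  have "\<bar>expectation (\<lambda>\<omega>. cut B (U i t \<omega>))\<bar> \<le> expectation (\<lambda>\<omega>. \<bar>cut B (U i t \<omega>)\<bar>)"
    by (rule integral_abs_bound)
  also have "\<dots> \<le> expectation (\<lambda>_. B)"
    using cut_integrable cut_bounds(1)[OF assms] by (intro integral_mono) auto
  finally have "\<bar>expectation (\<lambda>\<omega>. cut B (U i t \<omega>))\<bar> \<le> B" by (simp add: prob_space)
  then show ?thesis using cut_bounds(1)[OF assms, of "U i t \<omega>"] unfolding UB_def by linarith
qed

lemma UB_integrable: "integrable M (UB B i t)" "integrable M (\<lambda>\<omega>. (UB B i t \<omega>)\<^sup>2)"
  unfolding UB_def[abs_def] power2_diff using cut_integrable by simp_all

lemma UB_mean: "expectation (UB B i t) = 0"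
  unfolding UB_def[abs_def] using cut_integrable by (simp add: prob_space)

lemma UB_second_moment: "expectation (\<lambda>\<omega>. (UB B i t \<omega>)\<^sup>2) \<le> 1 + C0"
proof -
  have "expectation (\<lambda>\<omega>. (UB B i t \<omega>)\<^sup>2) = expectation (\<lambda>\<omega>. (cut B (U i t \<omega>))\<^sup>2) - (expectation (\<lambda>\<omega>. cut B (U i t \<omega>)))\<^sup>2"
    unfolding UB_def by (rule variance_eq[OF cut_integrable])
  also have "\<dots> \<le> expectation (\<lambda>\<omega>. (cut B (U i t \<omega>))\<^sup>2)" by simp
  also have "\<dots> \<le> expectation (\<lambda>\<omega>. \<bar>U i t \<omega>\<bar> ^ 2)"
    using cut_integrable U_abs_moment(1)[of 2 i t] by (intro integral_mono) (auto simp: cut_def)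
  also have "\<dots> \<le> 1 + C0" by (rule U_abs_moment) simp
  finally show ?thesis .
qed

lemma UB_dep: "depends_on e (block (v i) (r i) t) (UB B i t)"
  unfolding UB_def[abs_def] by (rule depends_on_comp[OF U_dep]) measurable

text \<open>Where the truncation acts, \<open>\<bar>U i t \<omega>\<bar>\<close> exceeds
  \<open>B\<close>, so six of the eight powers can be traded for \<open>B ^ 6\<close>; centring only
  lowers the second moment.\<close>

lemma cut_rest_moment:
  assumes B: "0 < B"
  shows "integrable M (\<lambda>\<omega>. (U i t \<omega> - UB B i t \<omega>)\<^sup>2)" "expectation (\<lambda>\<omega>. (U i t \<omega> - UB B i t \<omega>)\<^sup>2) \<le> C0 / B ^ 6"
proof -
  define Y where "Y \<omega> = U i t \<omega> - cut B (U i t \<omega>)" for \<omega>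
  have iY: "integrable M Y" unfolding Y_def[abs_def] using cut_integrable by simp
  have bnd: "(Y \<omega>)\<^sup>2 \<le> U i t \<omega> ^ 8 / B ^ 6" for \<omega>
  proof (cases "\<bar>U i t \<omega>\<bar> \<le> B")
    case False
    then have "B ^ 6 \<le> \<bar>U i t \<omega>\<bar> ^ 6" using B by (intro power_mono) auto
    then have "B ^ 6 * (U i t \<omega>)\<^sup>2 \<le> U i t \<omega> ^ 6 * (U i t \<omega>)\<^sup>2"
      by (intro mult_right_mono) (auto simp: power_even_abs)
    also have "\<dots> = U i t \<omega> ^ 8" by (simp add: power_add[symmetric])
    finally show ?thesis using False B by (simp add: Y_def cut_def pos_le_divide_eq mult.commute)
  qed (simp add: Y_def cut_def)
  have i8: "integrable M (\<lambda>\<omega>. U i t \<omega> ^ 8 / B ^ 6)" using U_int8 by (rule integrable_divide_zero) 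
  have iY2: "integrable M (\<lambda>\<omega>. (Y \<omega>)\<^sup>2)"
  proof (rule Bochner_Integration.integrable_bound[OF i8])
    show "(\<lambda>\<omega>. (Y \<omega>)\<^sup>2) \<in> borel_measurable M" unfolding Y_def by measurable
    show "AE \<omega> in M. norm ((Y \<omega>)\<^sup>2) \<le> norm (U i t \<omega> ^ 8 / B ^ 6)"
      using bnd order.trans[OF bnd abs_ge_self] by (intro AE_I2) simp
  qed
  have eq: "U i t \<omega> - UB B i t \<omega> = Y \<omega> - expectation Y" for \<omega>
    unfolding Y_def UB_def using cut_integrable U_mean[of i t] by simp
  have e2: "(Y \<omega> - expectation Y)\<^sup>2 = (Y \<omega>)\<^sup>2 - 2 * Y \<omega> * expectation Y + (expectation Y)\<^sup>2" for \<omega>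
    by (simp add: power2_diff)
  show "integrable M (\<lambda>\<omega>. (U i t \<omega> - UB B i t \<omega>)\<^sup>2)" unfolding eq e2 using iY iY2 by simp
  have "expectation (\<lambda>\<omega>. (U i t \<omega> - UB B i t \<omega>)\<^sup>2) = expectation (\<lambda>\<omega>. (Y \<omega>)\<^sup>2) - (expectation Y)\<^sup>2"
    unfolding eq by (rule variance_eq[OF iY iY2])
  also have "\<dots> \<le> expectation (\<lambda>\<omega>. (Y \<omega>)\<^sup>2)" by simp
  also have "\<dots> \<le> expectation (\<lambda>\<omega>. U i t \<omega> ^ 8 / B ^ 6)" by (rule integral_mono[OF iY2 i8 bnd])
  also have "\<dots> = expectation (\<lambda>\<omega>. U i t \<omega> ^ 8) / B ^ 6" by simp
  also have "\<dots> \<le> C0 / B ^ 6" using B by (intro divide_right_mono U_mom8) simp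
  finally show "expectation (\<lambda>\<omega>. (U i t \<omega> - UB B i t \<omega>)\<^sup>2) \<le> C0 / B ^ 6" .
qed

definition WB :: "real \<Rightarrow> int \<times> int \<Rightarrow> 'a \<Rightarrow> real" where
  "WB B t \<omega> = (\<Sum>i. c i * UB B i t \<omega>)"

lemma WB_summable:
  assumes "0 \<le> B"
  shows "summable (\<lambda>i. c i * UB B i t \<omega>)" "\<bar>\<Sum>i<n. c i * UB B i t \<omega>\<bar> \<le> ctot * (2 * B)"
proof -
  have b: "\<bar>c i * UB B i t \<omega>\<bar> \<le> \<bar>c i\<bar> * (2 * B)" for i
    unfolding abs_mult by (intro mult_left_mono UB_bound assms) simp
  show "summable (\<lambda>i. c i * UB B i t \<omega>)"
    by (rule summable_comparison_test'[OF summable_mult2[OF c_abs_summable], of 0 _ "2 * B"]) (use b in simp)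
  have "\<bar>\<Sum>i<n. c i * UB B i t \<omega>\<bar> \<le> (\<Sum>i<n. \<bar>c i\<bar> * (2 * B))"
    by (rule order.trans[OF sum_abs sum_mono]) (rule b)
  also have "\<dots> \<le> ctot * (2 * B)"
    unfolding sum_distrib_right[symmetric] using assms by (intro mult_right_mono partial_sum_abs_le) auto
  finally show "\<bar>\<Sum>i<n. c i * UB B i t \<omega>\<bar> \<le> ctot * (2 * B)" .
qed

lemma WB_tendsto: "0 \<le> B \<Longrightarrow> (\<lambda>n. \<Sum>i<n. c i * UB B i t \<omega>) \<longlonglongrightarrow> WB B t \<omega>"
  unfolding WB_def using WB_summable(1) by (rule summable_LIMSEQ)

lemma WB_bound: "0 \<le> B \<Longrightarrow> \<bar>WB B t \<omega>\<bar> \<le> ctot * (2 * B)"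
  by (rule LIMSEQ_le_const2[OF tendsto_rabs[OF WB_tendsto]]) (auto intro: WB_summable)

lemma WB_meas [measurable]: "WB B t \<in> borel_measurable M"
  unfolding WB_def[abs_def] by measurable

text \<open>The expansion of \<open>W\<close> converges only almost surely, that of
  \<open>WB\<close> everywhere. The squared differences of the partial sums stay below one
  integrable series with weights \<open>\<bar>c i\<bar>\<close>, whose expectation gives the bound
  in the limit.\<close>

lemma rest_moment:
  assumes B: "0 < B"
  shows "integrable M (\<lambda>\<omega>. (W t \<omega> - WB B t \<omega>)\<^sup>2)"
    "expectation (\<lambda>\<omega>. (W t \<omega> - WB B t \<omega>)\<^sup>2) \<le> ctot\<^sup>2 * (C0 / B ^ 6)"
proof -
  let ?Y = "\<lambda>i \<omega>. U i t \<omega> - UB B i t \<omega>"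
  have i: "integrable M (\<lambda>\<omega>. \<bar>c i\<bar> * (?Y i \<omega>)\<^sup>2)" for i
    by (intro integrable_mult_right cut_rest_moment B)
  have le: "expectation (\<lambda>\<omega>. \<bar>c i\<bar> * (?Y i \<omega>)\<^sup>2) \<le> \<bar>c i\<bar> * (C0 / B ^ 6)" for i
    unfolding integral_mult_right_zero by (intro mult_left_mono cut_rest_moment B) simp
  have ge: "0 \<le> expectation (\<lambda>\<omega>. \<bar>c i\<bar> * (?Y i \<omega>)\<^sup>2)" for i by simp
  have sm: "summable (\<lambda>i. expectation (\<lambda>\<omega>. \<bar>c i\<bar> * (?Y i \<omega>)\<^sup>2))"
    by (rule summable_comparison_test'[OF summable_mult2[OF c_abs_summable], of 0 _ "C0 / B ^ 6"])
       (use le ge in \<open>simp only: real_norm_def abs_of_nonneg\<close>)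
  note s = AE_summable_of_integrals[OF i _ sm, simplified]
  let ?S = "\<lambda>\<omega>. \<Sum>i. \<bar>c i\<bar> * (?Y i \<omega>)\<^sup>2"
  have bnd: "AE \<omega> in M. (W t \<omega> - WB B t \<omega>)\<^sup>2 \<le> ctot * ?S \<omega>"
    using s(1) W_sums[of t]
  proof eventually_elim
    case (elim \<omega>)
    have "(\<lambda>n. (\<Sum>i<n. c i * U i t \<omega>) - (\<Sum>i<n. c i * UB B i t \<omega>)) \<longlonglongrightarrow> W t \<omega> - WB B t \<omega>"
      using elim(2) B by (intro tendsto_diff WB_tendsto) (auto simp: sums_def)
    then have "(\<lambda>n. (\<Sum>i<n. c i * ?Y i \<omega>)\<^sup>2) \<longlonglongrightarrow> (W t \<omega> - WB B t \<omega>)\<^sup>2"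
      by (intro tendsto_power) (simp add: right_diff_distrib sum_subtractf)
    moreover have "(\<Sum>i<n. c i * ?Y i \<omega>)\<^sup>2 \<le> ctot * ?S \<omega>" for n
    proof -
      have "(\<Sum>i<n. c i * ?Y i \<omega>)\<^sup>2 \<le> ctot * (\<Sum>i<n. \<bar>c i\<bar> * (?Y i \<omega>)\<^sup>2)"
        by (rule sum_sq_le_mult[OF partial_sum_abs_le])
      also have "\<dots> \<le> ctot * ?S \<omega>"
        using elim(1) ctot_nonneg by (intro mult_left_mono sum_le_suminf) auto
      finally show ?thesis .
    qed
    ultimately show ?case by (intro LIMSEQ_le_const2) auto
  qed
  have iS: "integrable M (\<lambda>\<omega>. ctot * ?S \<omega>)" using s(2) by simp
  show iW: "integrable M (\<lambda>\<omega>. (W t \<omega> - WB B t \<omega>)\<^sup>2)"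
    by (rule Bochner_Integration.integrable_bound[OF iS]) (use bnd in \<open>auto elim: eventually_mono\<close>)
  have "expectation ?S = (\<Sum>i. expectation (\<lambda>\<omega>. \<bar>c i\<bar> * (?Y i \<omega>)\<^sup>2))"
    using s(1) sm by (intro integral_suminf i) auto
  also have "\<dots> \<le> (\<Sum>i. \<bar>c i\<bar> * (C0 / B ^ 6))"
    by (intro suminf_le le sm summable_mult2 c_abs_summable)
  also have "\<dots> = (\<Sum>i. \<bar>c i\<bar>) * (C0 / B ^ 6)" by (rule suminf_mult2[OF c_abs_summable, symmetric])
  also have "\<dots> \<le> ctot * (C0 / B ^ 6)"
    using C0_nonneg B by (intro mult_right_mono suminf_le_const c_abs_summable partial_sum_abs_le) auto
  finally have ES: "expectation ?S \<le> ctot * (C0 / B ^ 6)" .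
  have "expectation (\<lambda>\<omega>. (W t \<omega> - WB B t \<omega>)\<^sup>2) \<le> expectation (\<lambda>\<omega>. ctot * ?S \<omega>)"
    by (rule integral_mono_AE[OF iW iS bnd])
  also have "\<dots> = ctot * expectation ?S" by simp
  also have "\<dots> \<le> ctot * (ctot * (C0 / B ^ 6))" by (intro mult_left_mono ES ctot_nonneg)
  also have "\<dots> = ctot\<^sup>2 * (C0 / B ^ 6)" by (simp add: power2_eq_square)
  finally show "expectation (\<lambda>\<omega>. (W t \<omega> - WB B t \<omega>)\<^sup>2) \<le> ctot\<^sup>2 * (C0 / B ^ 6)" .
qed

text \<open>A colouring of the lattice: distinct sites of one colour differ by more than
  \<open>2 * q\<close> in some coordinate, so their blocks of radius \<open>q\<close> are
  disjoint.\<close>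

definition cls :: "nat \<Rightarrow> int \<times> int \<Rightarrow> int \<times> int" where
  "cls q t = (fst t mod (2 * int q + 1), snd t mod (2 * int q + 1))"

lemma cls_range: "cls q t \<in> {0..2 * int q} \<times> {0..2 * int q}"
  using pos_mod_bound[of "2 * int q + 1" "fst t"] pos_mod_bound[of "2 * int q + 1" "snd t"]
  by (simp add: cls_def)

lemma cls_separated:
  assumes "cls q s = cls q t" "s \<noteq> t"
  shows "\<not> near (2 * int q) (s - a) (t - a)"
proof
  assume n: "near (2 * int q) (s - a) (t - a)"
  have "x = y" if "x mod (2 * int q + 1) = y mod (2 * int q + 1)" "\<bar>x - y\<bar> \<le> 2 * int q" for x y :: int
  proof -
    have "(2 * int q + 1) dvd (x - y)" using that(1) by (simp add: mod_eq_dvd_iff)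
    with that(2) show ?thesis using dvd_imp_le_int[of "x - y" "2 * int q + 1"] by fastforce
  qed
  from this[of "fst s" "fst t"] this[of "snd s" "snd t"] n assms show False
    by (auto simp: cls_def near_def prod_eq_iff)
qed

text \<open>Within one colour the summands live on disjoint blocks and are independent. The size
  condition keeps every exponent in [-1, 1], where the quadratic bound for the exponential turns
  each factor into the exponential of a variance.\<close>

lemma class_mgf:
  assumes R: "finite R" and \<psi>: "\<And>t. t \<in> R \<Longrightarrow> \<bar>x * \<psi> t\<bar> * (2 * B) \<le> 1" and B: "0 \<le> B"
  shows "expectation (\<lambda>\<omega>. exp (x * (\<Sum>t\<in>{t\<in>R. cls (r i) t = k}. \<psi> t * UB B i t \<omega>)))
    \<le> exp (x\<^sup>2 * (1 + C0) * (\<Sum>t\<in>R. (\<psi> t)\<^sup>2))"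
proof -
  let ?R = "{t\<in>R. cls (r i) t = k}"
  let ?X = "\<lambda>t \<omega>. exp (x * \<psi> t * UB B i t \<omega>)"
  have fin: "finite ?R" using R by simp
  have b: "\<bar>x * \<psi> t * UB B i t \<omega>\<bar> \<le> 1" if "t \<in> ?R" for t \<omega>
  proof -
    have "\<bar>x * \<psi> t * UB B i t \<omega>\<bar> \<le> \<bar>x * \<psi> t\<bar> * (2 * B)"
      unfolding abs_mult[of "x * \<psi> t"] by (intro mult_left_mono UB_bound B) simp
    also have "\<dots> \<le> 1" using that \<psi> by simp
    finally show ?thesis .
  qed
  have iX: "integrable M (?X t)" if "t \<in> ?R" for t
  proof (rule integrable_const_bound[of _ "exp 1"])
    show "AE \<omega> in M. norm (?X t \<omega>) \<le> exp 1" using b[OF that] by (intro AE_I2) (simp add: abs_le_iff)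
  qed measurable
  have "expectation (\<lambda>\<omega>. exp (x * (\<Sum>t\<in>?R. \<psi> t * UB B i t \<omega>))) = expectation (\<lambda>\<omega>. \<Prod>t\<in>?R. ?X t \<omega>)"
    using fin by (simp add: exp_sum sum_distrib_left mult.assoc)
  also have "\<dots> = (\<Prod>t\<in>?R. expectation (?X t))"
  proof (rule indep_vars_lebesgue_integral[OF fin _ iX])
    show "indep_vars (\<lambda>_. borel) ?X ?R"
    proof (rule depends_on_indep_vars[OF e_indep])
      show "depends_on e (block (v i) (r i) t) (?X t)" for t
        by (rule depends_on_comp[OF UB_dep]) measurable
      show "disjoint_family_on (block (v i) (r i)) ?R"
      proof (unfold disjoint_family_on_def, intro ballI impI)
        fix s t assume "s \<in> ?R" "t \<in> ?R" "s \<noteq> t"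
        then have "\<not> near (2 * int (r i)) (s - v i) (t - v i)" by (intro cls_separated) auto
        then show "block (v i) (r i) s \<inter> block (v i) (r i) t = {}" by (rule block_disjoint) auto
      qed
    qed
  qed
  also have "\<dots> \<le> (\<Prod>t\<in>?R. exp (x\<^sup>2 * (1 + C0) * (\<psi> t)\<^sup>2))"
  proof (rule prod_mono)
    fix t assume t: "t \<in> ?R"
    have q: "?X t \<omega> \<le> 1 + x * \<psi> t * UB B i t \<omega> + (x * \<psi> t)\<^sup>2 * (UB B i t \<omega>)\<^sup>2" for \<omega>
      using exp_le_quadratic[OF b[OF t, of \<omega>]] by (simp add: power_mult_distrib)
    have "expectation (?X t) \<le> expectation (\<lambda>\<omega>. 1 + x * \<psi> t * UB B i t \<omega> + (x * \<psi> t)\<^sup>2 * (UB B i t \<omega>)\<^sup>2)"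
      using UB_integrable by (intro integral_mono iX[OF t] q) auto
    also have "\<dots> = 1 + (x * \<psi> t)\<^sup>2 * expectation (\<lambda>\<omega>. (UB B i t \<omega>)\<^sup>2)"
      using UB_integrable by (simp add: UB_mean prob_space)
    also have "\<dots> \<le> 1 + (x * \<psi> t)\<^sup>2 * (1 + C0)"
      by (intro add_left_mono mult_left_mono UB_second_moment) simp
    also have "\<dots> \<le> exp ((x * \<psi> t)\<^sup>2 * (1 + C0))" by (rule exp_ge_add_one_self)
    finally show "0 \<le> expectation (?X t) \<and> expectation (?X t) \<le> exp (x\<^sup>2 * (1 + C0) * (\<psi> t)\<^sup>2)"
      by (simp add: power_mult_distrib mult_ac integral_nonneg)
  qed
  also have "\<dots> = exp (x\<^sup>2 * (1 + C0) * (\<Sum>t\<in>?R. (\<psi> t)\<^sup>2))" using fin by (simp add: exp_sum sum_distrib_left)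
  also have "\<dots> \<le> exp (x\<^sup>2 * (1 + C0) * (\<Sum>t\<in>R. (\<psi> t)\<^sup>2))"
    using R C0_nonneg by (intro iffD2[OF exp_le_cancel_iff] mult_left_mono sum_mono2) auto
  finally show ?thesis .
qed

text \<open>The linear form is a weighted sum over pairs of a block index and a colour. Jensen's
  inequality with weights \<open>\<bar>c i\<bar> / Z\<close> reduces it to a single colour class,
  with the coefficients scaled by \<open>Z\<close>; dependence therefore costs only a constant in
  the exponent.\<close>

lemma mgf_bound:
  assumes R: "finite R" and B: "0 \<le> B"
    and \<psi>: "\<And>t. t \<in> R \<Longrightarrow> (4 * ctot + 1) * \<bar>\<psi> t\<bar> * (2 * B) \<le> 1"
  shows "expectation (\<lambda>\<omega>. exp (\<Sum>t\<in>R. \<psi> t * WB B t \<omega>)) \<le> exp ((4 * ctot + 1)\<^sup>2 * (1 + C0) * (\<Sum>t\<in>R. (\<psi> t)\<^sup>2))"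
proof -
  \<comment> \<open>There are (2 r + 1)^2 colours for a block of radius r, at most 4 (r + 1)^2, so
    \<open>4 * ctot\<close> bounds the total weight; the added 1 keeps \<open>Z\<close> positive
    even if \<open>ctot\<close> is zero.\<close>
  define Z where "Z = 4 * ctot + 1"
  have Z: "0 < Z" using ctot_nonneg by (simp add: Z_def)
  define K where "K = exp (Z\<^sup>2 * (1 + C0) * (\<Sum>t\<in>R. (\<psi> t)\<^sup>2))"
  have K1: "1 \<le> K" unfolding K_def using C0_nonneg by (simp add: sum_nonneg)
  define S where "S n \<omega> = (\<Sum>t\<in>R. \<psi> t * (\<Sum>i<n. c i * UB B i t \<omega>))" for n \<omega>
  define Y where "Y i k \<omega> = (\<Sum>t\<in>{t\<in>R. cls (r i) t = k}. \<psi> t * UB B i t \<omega>)" for i k \<omega>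
  define I where "I n = (SIGMA i:{..<n}. {0..2 * int (r i)} \<times> {0..2 * int (r i)})" for n
  have [measurable]: "S n \<in> borel_measurable M" "Y i k \<in> borel_measurable M" for n i k
    unfolding S_def Y_def by measurable
  have finI: "finite (I n)" for n by (simp add: I_def)
  have w1: "(\<Sum>ik\<in>I n. \<bar>c (fst ik)\<bar> / Z) \<le> 1" for n
  proof -
    have "(\<Sum>ik\<in>I n. \<bar>c (fst ik)\<bar>) = (\<Sum>i<n. (2 * real (r i) + 1)\<^sup>2 * \<bar>c i\<bar>)"
    proof -
      have "(\<Sum>ik\<in>I n. \<bar>c (fst ik)\<bar>) = (\<Sum>i<n. \<Sum>k\<in>{0..2 * int (r i)} \<times> {0..2 * int (r i)}. \<bar>c i\<bar>)"
        unfolding I_def by (subst sum.Sigma) (auto simp: split_def)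
      then show ?thesis by (simp add: power2_eq_square add.commute)
    qed
    also have "\<dots> \<le> (\<Sum>i<n. 4 * (\<bar>c i\<bar> * wt i))"
    proof (rule sum_mono)
      fix i
      have "(2 * real (r i) + 1)\<^sup>2 \<le> 4 * wt i"
        by (simp add: wt_def power2_eq_square algebra_simps)
      then have "(2 * real (r i) + 1)\<^sup>2 * \<bar>c i\<bar> \<le> 4 * wt i * \<bar>c i\<bar>" by (intro mult_right_mono) auto
      then show "(2 * real (r i) + 1)\<^sup>2 * \<bar>c i\<bar> \<le> 4 * (\<bar>c i\<bar> * wt i)" by (simp add: mult_ac)
    qed
    also have "\<dots> \<le> Z" unfolding sum_distrib_left[symmetric] Z_def using partial_sum_wt_le[of n] by simp
    finally show ?thesis using Z by (simp add: sum_divide_distrib[symmetric])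
  qed
  have S_eq: "S n \<omega> = (\<Sum>ik\<in>I n. \<bar>c (fst ik)\<bar> / Z * (Z * sgn (c (fst ik)) * Y (fst ik) (snd ik) \<omega>))" for n \<omega>
  proof -
    have "S n \<omega> = (\<Sum>i<n. c i * (\<Sum>t\<in>R. \<psi> t * UB B i t \<omega>))"
      unfolding S_def sum_distrib_left by (subst sum.swap) (simp add: mult_ac)
    also have "\<dots> = (\<Sum>i<n. c i * (\<Sum>k\<in>{0..2 * int (r i)} \<times> {0..2 * int (r i)}. Y i k \<omega>))"
      unfolding Y_def by (subst sum.group[OF R _ image_subsetI[OF cls_range]]) auto
    also have "\<dots> = (\<Sum>ik\<in>I n. c (fst ik) * Y (fst ik) (snd ik) \<omega>)"
      unfolding I_def sum_distrib_left by (subst sum.Sigma) (auto simp: split_def)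
    also have "\<dots> = (\<Sum>ik\<in>I n. \<bar>c (fst ik)\<bar> / Z * (Z * sgn (c (fst ik)) * Y (fst ik) (snd ik) \<omega>))"
      using Z by (intro sum.cong) (auto simp: sgn_if)
    finally show ?thesis .
  qed
  have Sbound: "\<bar>S n \<omega>\<bar> \<le> (\<Sum>t\<in>R. \<bar>\<psi> t\<bar> * (ctot * (2 * B)))" for n \<omega>
    unfolding S_def by (rule order.trans[OF sum_abs sum_mono]) (auto simp: abs_mult intro!: mult_left_mono WB_summable(2) B)
  define b where "b = (\<Sum>t\<in>R. \<bar>\<psi> t\<bar> * (ctot * (2 * B)))"
  have iS: "integrable M (\<lambda>\<omega>. exp (S n \<omega>))" for n
    by (rule integrable_const_bound[of _ "exp b"]) (use Sbound in \<open>auto simp: b_def abs_le_iff\<close>)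
  have Ybound: "\<bar>Y i k \<omega>\<bar> \<le> (\<Sum>t\<in>R. \<bar>\<psi> t\<bar> * (2 * B))" for i k \<omega>
  proof -
    have "\<bar>Y i k \<omega>\<bar> \<le> (\<Sum>t\<in>{t\<in>R. cls (r i) t = k}. \<bar>\<psi> t\<bar> * (2 * B))"
      unfolding Y_def by (rule order.trans[OF sum_abs sum_mono]) (auto simp: abs_mult intro!: mult_left_mono UB_bound B)
    also have "\<dots> \<le> (\<Sum>t\<in>R. \<bar>\<psi> t\<bar> * (2 * B))" using R B by (intro sum_mono2) auto
    finally show ?thesis .
  qed
  have iY: "integrable M (\<lambda>\<omega>. exp (x * Y i k \<omega>))" for x i k
  proof (rule integrable_const_bound[of _ "exp (\<bar>x\<bar> * (\<Sum>t\<in>R. \<bar>\<psi> t\<bar> * (2 * B)))"])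
    have "x * Y i k \<omega> \<le> \<bar>x\<bar> * (\<Sum>t\<in>R. \<bar>\<psi> t\<bar> * (2 * B))" for \<omega>
      by (rule order.trans[OF abs_ge_self]) (auto simp only: abs_mult intro!: mult_left_mono Ybound abs_ge_zero)
    then show "AE \<omega> in M. norm (exp (x * Y i k \<omega>)) \<le> exp (\<bar>x\<bar> * (\<Sum>t\<in>R. \<bar>\<psi> t\<bar> * (2 * B)))" by simp
  qed measurable
  have mY: "expectation (\<lambda>\<omega>. exp (Z * sgn (c i) * Y i k \<omega>)) \<le> K" for i k
  proof -
    have z: "\<bar>Z * sgn (c i)\<bar> \<le> Z" using Z by (auto simp: sgn_if)
    then have "(Z * sgn (c i))\<^sup>2 \<le> Z\<^sup>2" using Z by (simp add: abs_le_square_iff[symmetric])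
    have "expectation (\<lambda>\<omega>. exp (Z * sgn (c i) * Y i k \<omega>)) \<le> exp ((Z * sgn (c i))\<^sup>2 * (1 + C0) * (\<Sum>t\<in>R. (\<psi> t)\<^sup>2))"
      unfolding Y_def
    proof (rule class_mgf[OF R _ B])
      fix t assume t: "t \<in> R"
      have "\<bar>Z * sgn (c i) * \<psi> t\<bar> * (2 * B) \<le> Z * \<bar>\<psi> t\<bar> * (2 * B)"
        unfolding abs_mult[of "Z * sgn (c i)"] using z B by (intro mult_right_mono) auto
      also have "\<dots> \<le> 1" using \<psi>[OF t] by (simp add: Z_def)
      finally show "\<bar>Z * sgn (c i) * \<psi> t\<bar> * (2 * B) \<le> 1" .
    qed
    also have "\<dots> \<le> K" unfolding K_def using C0_nonneg \<open>(Z * sgn (c i))\<^sup>2 \<le> Z\<^sup>2\<close>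
      by (intro iffD2[OF exp_le_cancel_iff] mult_right_mono) (auto simp: sum_nonneg)
    finally show ?thesis .
  qed
  have ES: "expectation (\<lambda>\<omega>. exp (S n \<omega>)) \<le> K" for n
  proof -
    let ?w = "\<lambda>ik. \<bar>c (fst ik)\<bar> / Z"
    have "expectation (\<lambda>\<omega>. exp (S n \<omega>)) \<le> expectation (\<lambda>\<omega>. (\<Sum>ik\<in>I n. ?w ik * exp (Z * sgn (c (fst ik)) * Y (fst ik) (snd ik) \<omega>)) + (1 - (\<Sum>ik\<in>I n. ?w ik)))"
    proof (rule integral_mono[OF iS])
      show "exp (S n \<omega>) \<le> (\<Sum>ik\<in>I n. ?w ik * exp (Z * sgn (c (fst ik)) * Y (fst ik) (snd ik) \<omega>)) + (1 - (\<Sum>ik\<in>I n. ?w ik))" for \<omega>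
        unfolding S_eq using Z w1[of n] by (intro exp_weighted_sum_le finI) auto
    qed (intro Bochner_Integration.integrable_add Bochner_Integration.integrable_sum integrable_mult_right iY integrable_const)
    also have "\<dots> = (\<Sum>ik\<in>I n. ?w ik * expectation (\<lambda>\<omega>. exp (Z * sgn (c (fst ik)) * Y (fst ik) (snd ik) \<omega>))) + (1 - (\<Sum>ik\<in>I n. ?w ik))"
      using iY by (simp add: prob_space)
    also have "\<dots> \<le> (\<Sum>ik\<in>I n. ?w ik * K) + (1 - (\<Sum>ik\<in>I n. ?w ik))"
      using Z by (intro add_right_mono sum_mono mult_left_mono mY) auto
    \<comment> \<open>The missing mass contributes \<open>exp 0 = 1\<close>, which is at most
      \<open>K\<close>.\<close>
    also have "\<dots> = K - (K - 1) * (1 - (\<Sum>ik\<in>I n. ?w ik))" unfolding sum_distrib_right[symmetric] by (simp add: algebra_simps)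
    also have "\<dots> \<le> K" using K1 w1[of n] by simp
    finally show ?thesis .
  qed
  have "(\<lambda>n. expectation (\<lambda>\<omega>. exp (S n \<omega>))) \<longlonglongrightarrow> expectation (\<lambda>\<omega>. exp (\<Sum>t\<in>R. \<psi> t * WB B t \<omega>))"
  proof (rule integral_dominated_convergence[where w = "\<lambda>_. exp b"])
    show "AE \<omega> in M. (\<lambda>n. exp (S n \<omega>)) \<longlonglongrightarrow> exp (\<Sum>t\<in>R. \<psi> t * WB B t \<omega>)"
      unfolding S_def by (intro AE_I2 tendsto_intros WB_tendsto B)
    show "AE \<omega> in M. norm (exp (S n \<omega>)) \<le> exp b" for n
      using Sbound by (intro AE_I2) (auto simp: b_def abs_le_iff)
  qed auto
  then have "expectation (\<lambda>\<omega>. exp (\<Sum>t\<in>R. \<psi> t * WB B t \<omega>)) \<le> K"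
    by (rule LIMSEQ_le_const2) (use ES in auto)
  then show ?thesis by (simp add: K_def Z_def)
qed

end

section \<open>Upper tails of weighted sums\<close>

text \<open>The sum of the products of \<open>y\<close> over ordered \<open>m\<close>-tuples of
  distinct indices of \<open>A\<close> outside \<open>J\<close>. It takes the place of the
  \<open>m\<close>-th power of the weighted sum, in which indices repeat and would call for high
  moments of a single term.\<close>

primrec chain_sum :: "('s \<Rightarrow> real) \<Rightarrow> 's set \<Rightarrow> nat \<Rightarrow> 's set \<Rightarrow> real" where
  "chain_sum y A 0 J = 1"
| "chain_sum y A (Suc m) J = (\<Sum>k\<in>A - J. y k * chain_sum y A m (insert k J))"

lemma chain_sum_nonneg: "(\<And>k. k \<in> A \<Longrightarrow> 0 \<le> y k) \<Longrightarrow> 0 \<le> chain_sum y A m J"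
  by (induction m arbitrary: J) (auto intro!: sum_nonneg)

text \<open>At every choice at most \<open>card J + m\<close> indices have been used up, each of
  weight at most \<open>b\<close>, so the remaining total is still at least the base of the
  power.\<close>

lemma chain_sum_ge:
  fixes y :: "'s \<Rightarrow> real"
  assumes A: "finite A" and y: "\<And>k. k \<in> A \<Longrightarrow> 0 \<le> y k \<and> y k \<le> b" and b: "0 \<le> b"
    and J: "finite J" "real (card J + m) * b \<le> (\<Sum>k\<in>A. y k)"
  shows "((\<Sum>k\<in>A. y k) - real (card J + m) * b) ^ m \<le> chain_sum y A m J"
  using J
proof (induction m arbitrary: J)
  case (Suc m)
  let ?F = "\<Sum>k\<in>A. y k"
  let ?x = "?F - real (card J + Suc m) * b"
  have x0: "0 \<le> ?x" using Suc.prems by simp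
  have "?x ^ m \<le> chain_sum y A m (insert k J)" if k: "k \<in> A - J" for k
  proof -
    have e: "card (insert k J) + m = card J + Suc m" using k Suc.prems(1) by simp
    show ?thesis using Suc.IH[of "insert k J"] Suc.prems unfolding e by simp
  qed
  then have "(\<Sum>k\<in>A - J. y k * ?x ^ m) \<le> chain_sum y A (Suc m) J"
    using y by (auto intro!: sum_mono mult_left_mono)
  moreover have "?x * ?x ^ m \<le> (\<Sum>k\<in>A - J. y k * ?x ^ m)"
  proof -
    have "?F = (\<Sum>k\<in>A - J. y k) + (\<Sum>k\<in>A \<inter> J. y k)"
      using sum.Int_Diff[OF A, of y J] by simp
    also have "(\<Sum>k\<in>A \<inter> J. y k) \<le> real (card (A \<inter> J)) * b"
      using sum_bounded_above[of "A \<inter> J" y b] y by auto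
    also have "\<dots> \<le> real (card J) * b"
      using b Suc.prems(1) by (intro mult_right_mono of_nat_mono card_mono) auto
    finally have "?F - real (card J) * b \<le> (\<Sum>k\<in>A - J. y k)" by simp
    moreover have "?x \<le> ?F - real (card J) * b" using b by (simp add: algebra_simps)
    ultimately have "?x \<le> (\<Sum>k\<in>A - J. y k)" by linarith
    then show ?thesis unfolding sum_distrib_right[symmetric] using x0 by (intro mult_right_mono) auto
  qed
  ultimately show ?case by simp
qed simp

context prob_space begin

text \<open>The factors are dependent, so the product over the indices already chosen is carried
  along in the induction. When the recursion ends, all chosen indices are distinct and the joint
  moment bound \<open>mom\<close> applies to them.\<close>

lemma chain_sum_expectation:
  fixes X :: "'s \<Rightarrow> 'a \<Rightarrow> real"
  assumes A: "finite A" and P: "\<And>k. k \<in> A \<Longrightarrow> 0 \<le> P k" "(\<Sum>k\<in>A. P k) \<le> 1"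
    and X: "\<And>k. k \<in> A \<Longrightarrow> X k \<in> borel_measurable M" "\<And>k \<omega>. k \<in> A \<Longrightarrow> 0 \<le> X k \<omega> \<and> X k \<omega> \<le> b"
    and mom: "\<And>J. J \<subseteq> A \<Longrightarrow> card J \<le> n \<Longrightarrow> expectation (\<lambda>\<omega>. \<Prod>k\<in>J. X k \<omega>) \<le> D ^ card J" and D: "0 \<le> D"
    and J: "J \<subseteq> A" "card J + m \<le> n"
  shows "expectation (\<lambda>\<omega>. (\<Prod>k\<in>J. X k \<omega>) * chain_sum (\<lambda>k. P k * X k \<omega>) A m J) \<le> D ^ (card J + m) \<and>
    integrable M (\<lambda>\<omega>. (\<Prod>k\<in>J. X k \<omega>) * chain_sum (\<lambda>k. P k * X k \<omega>) A m J)"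
  using J
proof (induction m arbitrary: J)
  case 0
  have "integrable M (\<lambda>\<omega>. \<Prod>k\<in>J. X k \<omega>)"
  proof (rule integrable_const_bound[of _ "b ^ card J"])
    show "AE \<omega> in M. norm (\<Prod>k\<in>J. X k \<omega>) \<le> b ^ card J"
    proof (rule AE_I2)
      fix \<omega>
      have "\<bar>\<Prod>k\<in>J. X k \<omega>\<bar> = (\<Prod>k\<in>J. \<bar>X k \<omega>\<bar>)" by (rule abs_prod)
      also have "\<dots> \<le> (\<Prod>k\<in>J. b)" using X(2) 0 by (intro prod_mono) (auto simp: subset_iff)
      finally show "norm (\<Prod>k\<in>J. X k \<omega>) \<le> b ^ card J" by simp
    qed
    show "(\<lambda>\<omega>. \<Prod>k\<in>J. X k \<omega>) \<in> borel_measurable M"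
      using X(1) 0 by (intro borel_measurable_prod) auto
  qed
  then show ?case using mom[of J] 0 by simp
next
  case (Suc m)
  have fJ: "finite J" using Suc.prems A by (auto intro: finite_subset)
  let ?T = "\<lambda>J m \<omega>. (\<Prod>k\<in>J. X k \<omega>) * chain_sum (\<lambda>k. P k * X k \<omega>) A m J"
  have eq: "?T J (Suc m) \<omega> = (\<Sum>k\<in>A - J. P k * ?T (insert k J) m \<omega>)" for \<omega>
    using fJ by (simp add: sum_distrib_left mult_ac)
  have IH: "expectation (?T (insert k J) m) \<le> D ^ (card J + Suc m)" "integrable M (?T (insert k J) m)"
    if k: "k \<in> A - J" for k
  proof -
    have e: "card (insert k J) + m = card J + Suc m" using k fJ by simp
    have "insert k J \<subseteq> A" "card (insert k J) + m \<le> n" using k Suc.prems e by auto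
    from Suc.IH[OF this] show "expectation (?T (insert k J) m) \<le> D ^ (card J + Suc m)" "integrable M (?T (insert k J) m)"
      unfolding e by auto
  qed
  have int: "integrable M (\<lambda>\<omega>. \<Sum>k\<in>A - J. P k * ?T (insert k J) m \<omega>)"
    by (intro Bochner_Integration.integrable_sum integrable_mult_right IH)
  have "expectation (\<lambda>\<omega>. \<Sum>k\<in>A - J. P k * ?T (insert k J) m \<omega>) = (\<Sum>k\<in>A - J. P k * expectation (?T (insert k J) m))"
    using IH(2) by (subst Bochner_Integration.integral_sum) auto
  also have "\<dots> \<le> (\<Sum>k\<in>A - J. P k * D ^ (card J + Suc m))"
    using IH(1) P by (auto intro!: sum_mono mult_left_mono)
  also have "\<dots> = (\<Sum>k\<in>A - J. P k) * D ^ (card J + Suc m)" by (simp add: sum_distrib_right)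
  also have "\<dots> \<le> 1 * D ^ (card J + Suc m)"
  proof (intro mult_right_mono)
    have "(\<Sum>k\<in>A - J. P k) \<le> (\<Sum>k\<in>A. P k)" using A P by (intro sum_mono2) auto
    then show "(\<Sum>k\<in>A - J. P k) \<le> 1" using P(2) by linarith
  qed (use D in simp)
  finally show ?case unfolding eq using int by simp
qed

text \<open>The upper tail of a weighted sum is controlled by moments of products over few distinct indices,
  so the union bound over the frequencies needs no smoothness of the weights.\<close>

lemma weighted_sum_tail:
  fixes X :: "'s \<Rightarrow> 'a \<Rightarrow> real"
  assumes A: "finite A" and P: "\<And>k. k \<in> A \<Longrightarrow> 0 \<le> P k \<and> P k \<le> p" "(\<Sum>k\<in>A. P k) \<le> 1"
    and X: "\<And>k. k \<in> A \<Longrightarrow> X k \<in> borel_measurable M" "\<And>k \<omega>. k \<in> A \<Longrightarrow> 0 \<le> X k \<omega> \<and> X k \<omega> \<le> b"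
    and mom: "\<And>J. J \<subseteq> A \<Longrightarrow> card J \<le> m \<Longrightarrow> expectation (\<lambda>\<omega>. \<Prod>k\<in>J. X k \<omega>) \<le> D ^ card J" and D: "0 \<le> D"
    and L: "0 \<le> L" "0 \<le> p" "real m * (p * L) < s"
  shows "prob {\<omega>\<in>space M. s \<le> (\<Sum>k\<in>A. P k * X k \<omega>) \<and> (\<forall>k\<in>A. X k \<omega> \<le> L)} \<le> D ^ m / (s - real m * (p * L)) ^ m"
proof -
  let ?T = "\<lambda>\<omega>. chain_sum (\<lambda>k. P k * X k \<omega>) A m {}"
  have T: "expectation ?T \<le> D ^ m" "integrable M ?T"
    using chain_sum_expectation[OF A _ P(2) X mom D, where J = "{}" and m = m] P(1) by auto
  have T0: "0 \<le> ?T \<omega>" for \<omega> using P X by (intro chain_sum_nonneg) (auto intro!: mult_nonneg_nonneg)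
  let ?c = "(s - real m * (p * L)) ^ m"
  have c: "0 < ?c" using L by simp
  have "prob {\<omega>\<in>space M. s \<le> (\<Sum>k\<in>A. P k * X k \<omega>) \<and> (\<forall>k\<in>A. X k \<omega> \<le> L)} \<le> prob {\<omega>\<in>space M. ?c \<le> ?T \<omega>}"
  proof (rule finite_measure_mono)
    show "{\<omega>\<in>space M. s \<le> (\<Sum>k\<in>A. P k * X k \<omega>) \<and> (\<forall>k\<in>A. X k \<omega> \<le> L)} \<subseteq> {\<omega>\<in>space M. ?c \<le> ?T \<omega>}"
    proof safe
      fix \<omega> assume \<omega>: "s \<le> (\<Sum>k\<in>A. P k * X k \<omega>)" "\<forall>k\<in>A. X k \<omega> \<le> L"
      have "?c \<le> ((\<Sum>k\<in>A. P k * X k \<omega>) - real m * (p * L)) ^ m"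
        using \<omega> L by (intro power_mono) auto
      also have "\<dots> \<le> ?T \<omega>"
      proof -
        have "0 \<le> P k * X k \<omega> \<and> P k * X k \<omega> \<le> p * L" if "k \<in> A" for k
          using P(1)[OF that] X(2)[OF that, of \<omega>] \<omega>(2) that by (auto intro!: mult_mono)
        from chain_sum_ge[OF A this, where J = "{}" and m = m] show ?thesis using L \<omega> by auto
      qed
      finally show "?c \<le> ?T \<omega>" .
    qed
    have [measurable]: "?T \<in> borel_measurable M" using T(2) by simp
    show "{\<omega>\<in>space M. ?c \<le> ?T \<omega>} \<in> events" by measurable
  qed
  also have "\<dots> \<le> expectation ?T / ?c" using c by (intro first_moment_bound T T0)
  also have "\<dots> \<le> D ^ m / ?c" using c T by (intro divide_right_mono) auto
  finally show ?thesis .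
qed

end

section \<open>Power means of the periodogram\<close>

definition pspec :: "nat \<times> nat \<Rightarrow> (int \<times> int \<Rightarrow> real) \<Rightarrow> int \<times> int \<Rightarrow> real" where
  "pspec d w k = (dcos d w k)\<^sup>2 + (dsin d w k)\<^sup>2"

lemma pspec_nonneg [simp]: "0 \<le> pspec d w k"
  by (simp add: pspec_def)

lemma pspec_add_le: "pspec d (\<lambda>t. u t + w t) k \<le> 2 * (pspec d u k + pspec d w k)"
proof -
  have "(x + y)\<^sup>2 \<le> 2 * (x\<^sup>2 + y\<^sup>2)" for x y :: real
    using sum_squares_bound[of x y] by (simp add: power2_sum)
  from this[of "dcos d u k" "dcos d w k"] this[of "dsin d u k" "dsin d w k"] show ?thesis
    by (simp add: pspec_def dcos_add dsin_add)
qed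

lemma power_add_le: "(u + w) ^ n \<le> 2 ^ n * (u ^ n + w ^ n)" if "0 \<le> u" "0 \<le> w" for u w :: real
proof -
  have "(u + w) ^ n \<le> (2 * max u w) ^ n" using that by (intro power_mono) auto
  also have "\<dots> = 2 ^ n * max u w ^ n" by (rule power_mult_distrib)
  also have "\<dots> \<le> 2 ^ n * (u ^ n + w ^ n)" using that by (intro mult_left_mono) (auto simp: max_def)
  finally show ?thesis .
qed

lemma power_le_fact_exp: "0 \<le> x \<Longrightarrow> x ^ n \<le> fact n * exp (x :: real)"
proof -
  assume x: "0 \<le> x"
  have s: "(\<lambda>n. x ^ n / fact n) sums exp x"
    using exp_converges[of x] by (simp add: divide_inverse mult.commute)
  have "x ^ n / fact n = (\<Sum>k\<in>{n}. x ^ k / fact k)" by simp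
  also have "\<dots> \<le> (\<Sum>k. x ^ k / fact k)"
    using s x by (intro sum_le_suminf) (auto simp: sums_iff)
  also have "\<dots> = exp x" using s by (simp add: sums_iff)
  finally show ?thesis by (simp add: pos_divide_le_eq mult.commute)
qed

lemma powr_pow: "(x powr a) ^ n = x powr (a * real n)" if "0 < x" for x :: real
  using that by (induction n) (simp_all add: powr_add[symmetric] algebra_simps)

text \<open>The directions whose exponentials add up to
  \<open>exp x + exp (- x) + exp y + exp (- y)\<close>, which dominates any even power of
  \<open>x\<close> or \<open>y\<close> up to a factorial.\<close>

definition signs :: "(real \<times> real) set" where "signs = {(1, 0), (-1, 0), (0, 1), (0, -1)}"

lemma finite_signs [simp]: "finite signs" and card_signs: "card signs = 4"
  by (simp_all add: signs_def)

lemma even_power_sum_le: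
  fixes x y :: real
  shows "(x\<^sup>2 + y\<^sup>2) ^ n \<le> 2 ^ n * fact (2 * n) * (\<Sum>q\<in>signs. exp (fst q * x + snd q * y))"
proof -
  have e: "z ^ (2 * n) \<le> fact (2 * n) * (exp z + exp (- z))" for z :: real
  proof -
    have "z ^ (2 * n) = \<bar>z\<bar> ^ (2 * n)" by (simp add: power_even_abs)
    also have "\<dots> \<le> fact (2 * n) * exp \<bar>z\<bar>" by (rule power_le_fact_exp) simp
    also have "\<dots> \<le> fact (2 * n) * (exp z + exp (- z))" by (intro mult_left_mono) (auto simp: abs_if)
    finally show ?thesis .
  qed
  have "(x\<^sup>2 + y\<^sup>2) ^ n \<le> 2 ^ n * (x ^ (2 * n) + y ^ (2 * n))"
    using power_add_le[of "x\<^sup>2" "y\<^sup>2" n] by (simp add: power_mult)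
  also have "\<dots> \<le> 2 ^ n * (fact (2 * n) * (exp x + exp (- x)) + fact (2 * n) * (exp y + exp (- y)))"
    by (intro mult_left_mono add_mono e) simp
  also have "\<dots> = 2 ^ n * fact (2 * n) * (\<Sum>q\<in>signs. exp (fst q * x + snd q * y))"
    by (simp add: signs_def algebra_simps)
  finally show ?thesis .
qed

lemma abs_dcos_le: "\<bar>dcos d a t\<bar> \<le> (\<Sum>k\<in>rect d. \<bar>a k\<bar>) / sqrt (vol d)"
  and abs_dsin_le: "\<bar>dsin d a t\<bar> \<le> (\<Sum>k\<in>rect d. \<bar>a k\<bar>) / sqrt (vol d)"
proof -
  have c: "\<bar>a k * cos z\<bar> \<le> \<bar>a k\<bar>" "\<bar>a k * sin z\<bar> \<le> \<bar>a k\<bar>" for k z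
    unfolding abs_mult by (auto intro!: mult_left_le)
  show "\<bar>dcos d a t\<bar> \<le> (\<Sum>k\<in>rect d. \<bar>a k\<bar>) / sqrt (vol d)"
    unfolding dcos_def abs_divide by (auto intro!: divide_right_mono order.trans[OF sum_abs sum_mono] c)
  show "\<bar>dsin d a t\<bar> \<le> (\<Sum>k\<in>rect d. \<bar>a k\<bar>) / sqrt (vol d)"
    unfolding dsin_def abs_divide by (auto intro!: divide_right_mono order.trans[OF sum_abs sum_mono] c)
qed

context block_expansion begin

section \<open>Joint moments of the truncated periodogram at distinct frequencies\<close>

definition mgf_const :: real where "mgf_const = (4 * ctot + 1)\<^sup>2 * (1 + C0)"

definition moment_const :: "nat \<Rightarrow> real" where
  "moment_const n = 2 ^ n * fact (2 * n) * (4 * exp (2 * mgf_const))"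

lemma moment_const_pos: "0 < moment_const n"
  by (simp add: moment_const_def)

lemma dcos_meas [measurable]: "(\<lambda>\<omega>. dcos d (\<lambda>t. WB B t \<omega>) k) \<in> borel_measurable M"
  and dsin_meas [measurable]: "(\<lambda>\<omega>. dsin d (\<lambda>t. WB B t \<omega>) k) \<in> borel_measurable M"
  unfolding dcos_def dsin_def by measurable

lemma pspec_meas [measurable]: "(\<lambda>\<omega>. pspec d (\<lambda>t. WB B t \<omega>) k) \<in> borel_measurable M"
  unfolding pspec_def by measurable

lemma dft_WB_bound:
  assumes "0 \<le> B"
  shows "\<bar>dcos d (\<lambda>t. WB B t \<omega>) k\<bar> \<le> vol d * (ctot * (2 * B)) / sqrt (vol d)"
    "\<bar>dsin d (\<lambda>t. WB B t \<omega>) k\<bar> \<le> vol d * (ctot * (2 * B)) / sqrt (vol d)"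
proof -
  have "(\<Sum>t\<in>rect d. \<bar>WB B t \<omega>\<bar>) \<le> vol d * (ctot * (2 * B))"
    using sum_bounded_above[of "rect d" "\<lambda>t. \<bar>WB B t \<omega>\<bar>" "ctot * (2 * B)"] WB_bound[OF assms] by (simp add: card_rect)
  then have "(\<Sum>t\<in>rect d. \<bar>WB B t \<omega>\<bar>) / sqrt (vol d) \<le> vol d * (ctot * (2 * B)) / sqrt (vol d)"
    by (intro divide_right_mono) auto
  then show "\<bar>dcos d (\<lambda>t. WB B t \<omega>) k\<bar> \<le> vol d * (ctot * (2 * B)) / sqrt (vol d)"
    "\<bar>dsin d (\<lambda>t. WB B t \<omega>) k\<bar> \<le> vol d * (ctot * (2 * B)) / sqrt (vol d)"
    by (rule order.trans[OF abs_dcos_le] order.trans[OF abs_dsin_le])+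
qed

definition osc :: "nat \<times> nat \<Rightarrow> real \<Rightarrow> real \<times> real \<Rightarrow> int \<times> int \<Rightarrow> 'a \<Rightarrow> real" where
  "osc d B q k \<omega> = fst q * dcos d (\<lambda>t. WB B t \<omega>) k + snd q * dsin d (\<lambda>t. WB B t \<omega>) k"

lemma osc_meas [measurable]: "osc d B q k \<in> borel_measurable M"
  unfolding osc_def by measurable

lemma exp_osc_integrable:
  assumes B: "0 \<le> B" and J: "finite J"
  shows "integrable M (\<lambda>\<omega>. exp (\<Sum>k\<in>J. osc d B (g k) k \<omega>))"
proof -
  let ?y = "vol d * (ctot * (2 * B)) / sqrt (vol d)"
  define b where "b = (\<Sum>k\<in>J. \<bar>fst (g k)\<bar> * ?y + \<bar>snd (g k)\<bar> * ?y)"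
  have "osc d B q k \<omega> \<le> \<bar>fst q\<bar> * ?y + \<bar>snd q\<bar> * ?y" for q k \<omega>
  proof -
    have "osc d B q k \<omega> \<le> \<bar>fst q * dcos d (\<lambda>t. WB B t \<omega>) k\<bar> + \<bar>snd q * dsin d (\<lambda>t. WB B t \<omega>) k\<bar>"
      unfolding osc_def by (intro add_mono abs_ge_self)
    also have "\<dots> \<le> \<bar>fst q\<bar> * ?y + \<bar>snd q\<bar> * ?y"
      unfolding abs_mult by (intro add_mono mult_left_mono dft_WB_bound B) auto
    finally show ?thesis .
  qed
  then have "(\<Sum>k\<in>J. osc d B (g k) k \<omega>) \<le> b" for \<omega>
    unfolding b_def by (intro sum_mono)
  then show ?thesis by (intro integrable_const_bound[of _ "exp b"]) auto
qed

text \<open>By duality the exponent is a linear form in the truncated field. Its coefficients are at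
  most \<open>2 * real m / sqrt (vol d)\<close>, which is what \<open>small\<close> controls, and by
  Parseval their squares sum to at most \<open>2 * card J\<close>. The bound is geometric in
  \<open>card J\<close>, as it would be for independent ordinates.\<close>

lemma exp_osc_expectation:
  assumes d: "0 < fst d" "0 < snd d" and B: "0 \<le> B" and J: "J \<subseteq> rect d" "card J \<le> m"
    and g: "\<And>k. k \<in> J \<Longrightarrow> g k \<in> signs"
    and small: "(4 * ctot + 1) * (2 * real m / sqrt (vol d)) * (2 * B) \<le> 1"
  shows "expectation (\<lambda>\<omega>. exp (\<Sum>k\<in>J. osc d B (g k) k \<omega>)) \<le> exp (2 * mgf_const) ^ card J"
proof -
  define a where "a k = (if k \<in> J then fst (g k) else 0)" for k
  define b where "b k = (if k \<in> J then snd (g k) else 0)" for k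
  define \<psi> where "\<psi> t = dcos d a t + dsin d b t" for t
  have V: "0 < vol d" using d by (rule vol_pos)
  have fin: "finite J" using J(1) by (rule finite_subset) simp
  have sgn: "\<bar>fst q\<bar> \<le> 1" "\<bar>snd q\<bar> \<le> 1" "(fst q)\<^sup>2 + (snd q)\<^sup>2 = 1" if "q \<in> signs" for q :: "real \<times> real"
    using that by (auto simp: signs_def)
  have split: "(\<Sum>k\<in>J. f k) = (\<Sum>k\<in>rect d. if k \<in> J then f k else 0)" for f :: "int \<times> int \<Rightarrow> real"
    using J(1) by (simp add: sum.inter_restrict[symmetric] Int_absorb1)
  have "(\<Sum>k\<in>J. osc d B (g k) k \<omega>) = (\<Sum>t\<in>rect d. \<psi> t * WB B t \<omega>)" for \<omega>
  proof -
    have "(\<Sum>k\<in>J. osc d B (g k) k \<omega>) = (\<Sum>k\<in>rect d. a k * dcos d (\<lambda>t. WB B t \<omega>) k) + (\<Sum>k\<in>rect d. b k * dsin d (\<lambda>t. WB B t \<omega>) k)"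
      unfolding split sum.distrib[symmetric] by (intro sum.cong) (auto simp: osc_def a_def b_def)
    also have "\<dots> = (\<Sum>t\<in>rect d. \<psi> t * WB B t \<omega>)"
      unfolding sum_mult_dcos[where c = a] sum_mult_dsin[where c = b] \<psi>_def by (simp add: algebra_simps sum.distrib)
    finally show ?thesis .
  qed
  then have "expectation (\<lambda>\<omega>. exp (\<Sum>k\<in>J. osc d B (g k) k \<omega>)) = expectation (\<lambda>\<omega>. exp (\<Sum>t\<in>rect d. \<psi> t * WB B t \<omega>))"
    by simp
  also have "\<dots> \<le> exp (mgf_const * (\<Sum>t\<in>rect d. (\<psi> t)\<^sup>2))"
    unfolding mgf_const_def
  proof (rule mgf_bound[OF finite_rect B])
    fix t
    have "(\<Sum>k\<in>rect d. \<bar>a k\<bar>) \<le> real m" "(\<Sum>k\<in>rect d. \<bar>b k\<bar>) \<le> real m"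
    proof -
      have "(\<Sum>k\<in>J. \<bar>fst (g k)\<bar>) \<le> real (card J)" "(\<Sum>k\<in>J. \<bar>snd (g k)\<bar>) \<le> real (card J)"
        using sgn g sum_bounded_above[of J "\<lambda>k. \<bar>fst (g k)\<bar>" 1] sum_bounded_above[of J "\<lambda>k. \<bar>snd (g k)\<bar>" 1] by auto
      then show "(\<Sum>k\<in>rect d. \<bar>a k\<bar>) \<le> real m" "(\<Sum>k\<in>rect d. \<bar>b k\<bar>) \<le> real m"
        using J(2) unfolding split a_def b_def by (auto simp: if_distrib cong: if_cong)
    qed
    then have "(\<Sum>k\<in>rect d. \<bar>a k\<bar>) / sqrt (vol d) \<le> real m / sqrt (vol d)"
      "(\<Sum>k\<in>rect d. \<bar>b k\<bar>) / sqrt (vol d) \<le> real m / sqrt (vol d)" by (auto intro: divide_right_mono)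
    then have "\<bar>\<psi> t\<bar> \<le> 2 * real m / sqrt (vol d)"
      using abs_dcos_le[of d a t] abs_dsin_le[of d b t] unfolding \<psi>_def by linarith
    then have "(4 * ctot + 1) * \<bar>\<psi> t\<bar> * (2 * B) \<le> (4 * ctot + 1) * (2 * real m / sqrt (vol d)) * (2 * B)"
      using B ctot_nonneg by (intro mult_right_mono mult_left_mono) auto
    then show "(4 * ctot + 1) * \<bar>\<psi> t\<bar> * (2 * B) \<le> 1" using small by linarith
  qed
  also have "\<dots> \<le> exp (mgf_const * (2 * real (card J)))"
  proof -
    have "(\<Sum>t\<in>rect d. (\<psi> t)\<^sup>2) \<le> 2 * ((\<Sum>t\<in>rect d. (dcos d a t)\<^sup>2) + (\<Sum>t\<in>rect d. (dsin d b t)\<^sup>2))"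
      unfolding \<psi>_def by (rule sum_add_sq_le)
    also have "\<dots> \<le> 2 * ((\<Sum>k\<in>rect d. (a k)\<^sup>2) + (\<Sum>k\<in>rect d. (b k)\<^sup>2))"
      by (intro mult_left_mono add_mono sum_dcos_sq_le sum_dsin_sq_le d) simp
    also have "(\<Sum>k\<in>rect d. (a k)\<^sup>2) + (\<Sum>k\<in>rect d. (b k)\<^sup>2) = (\<Sum>k\<in>J. (fst (g k))\<^sup>2 + (snd (g k))\<^sup>2)"
      unfolding split sum.distrib[symmetric] by (intro sum.cong) (auto simp: a_def b_def)
    also have "\<dots> = real (card J)" using sgn(3) g by simp
    finally show ?thesis
      using C0_nonneg by (intro iffD2[OF exp_le_cancel_iff] mult_left_mono) (auto simp: mgf_const_def)
  qed
  also have "\<dots> = exp (2 * mgf_const) ^ card J" by (simp add: exp_of_nat_mult[symmetric] mult_ac)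
  finally show ?thesis .
qed

text \<open>Each even power is dominated by four exponentials. Expanding the product chooses one
  direction for every frequency in \<open>J\<close>, and the factor 4 in \<open>moment_const\<close>
  counts these choices.\<close>

lemma pspec_prod_moment:
  assumes d: "0 < fst d" "0 < snd d" and B: "0 \<le> B" and J: "J \<subseteq> rect d" "card J \<le> m"
    and small: "(4 * ctot + 1) * (2 * real m / sqrt (vol d)) * (2 * B) \<le> 1"
  shows "expectation (\<lambda>\<omega>. \<Prod>k\<in>J. pspec d (\<lambda>t. WB B t \<omega>) k ^ n) \<le> moment_const n ^ card J"
proof -
  let ?K = "2 ^ n * fact (2 * n) :: real"
  have fin: "finite J" using J(1) by (rule finite_subset) simp
  have i: "integrable M (\<lambda>\<omega>. exp (\<Sum>k\<in>J. osc d B (g k) k \<omega>))" for g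
    by (rule exp_osc_integrable[OF B fin])
  have "(\<Prod>k\<in>J. pspec d (\<lambda>t. WB B t \<omega>) k ^ n) \<le> (\<Prod>k\<in>J. ?K * (\<Sum>q\<in>signs. exp (osc d B q k \<omega>)))" for \<omega>
    unfolding pspec_def osc_def by (intro prod_mono conjI even_power_sum_le) auto
  also have "(\<Prod>k\<in>J. ?K * (\<Sum>q\<in>signs. exp (osc d B q k \<omega>))) =
      ?K ^ card J * (\<Sum>g\<in>PiE J (\<lambda>_. signs). exp (\<Sum>k\<in>J. osc d B (g k) k \<omega>))" for \<omega>
    using fin by (simp add: prod.distrib prod_sum_PiE exp_sum)
  finally have le: "(\<Prod>k\<in>J. pspec d (\<lambda>t. WB B t \<omega>) k ^ n) \<le>
      ?K ^ card J * (\<Sum>g\<in>PiE J (\<lambda>_. signs). exp (\<Sum>k\<in>J. osc d B (g k) k \<omega>))" for \<omega> .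
  have iR: "integrable M (\<lambda>\<omega>. ?K ^ card J * (\<Sum>g\<in>PiE J (\<lambda>_. signs). exp (\<Sum>k\<in>J. osc d B (g k) k \<omega>)))"
    by (intro integrable_mult_right Bochner_Integration.integrable_sum i)
  have "expectation (\<lambda>\<omega>. \<Prod>k\<in>J. pspec d (\<lambda>t. WB B t \<omega>) k ^ n) \<le>
      expectation (\<lambda>\<omega>. ?K ^ card J * (\<Sum>g\<in>PiE J (\<lambda>_. signs). exp (\<Sum>k\<in>J. osc d B (g k) k \<omega>)))"
    by (rule integral_mono'[OF iR le]) (auto intro!: mult_nonneg_nonneg sum_nonneg)
  also have "\<dots> = ?K ^ card J * (\<Sum>g\<in>PiE J (\<lambda>_. signs). expectation (\<lambda>\<omega>. exp (\<Sum>k\<in>J. osc d B (g k) k \<omega>)))"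
    using i by simp
  also have "\<dots> \<le> ?K ^ card J * (\<Sum>g\<in>PiE J (\<lambda>_. signs). exp (2 * mgf_const) ^ card J)"
    by (intro mult_left_mono sum_mono exp_osc_expectation[OF d B J _ small]) auto
  also have "\<dots> = moment_const n ^ card J"
    using fin by (simp add: card_PiE card_signs moment_const_def power_mult_distrib mult_ac)
  finally show ?thesis .
qed

text \<open>The tail bound for weighted sums needs terms capped at \<open>L\<close>. Ordinates whose
  fifth power exceeds \<open>L\<close> are excluded through their tenth moments, and both kinds of
  events are summed over the \<open>vol d\<close> frequencies.\<close>

lemma WB_tail:
  assumes d: "0 < fst d" "0 < snd d" and B: "0 \<le> B" and m: "0 < m"
    and small: "(4 * ctot + 1) * (2 * real m / sqrt (vol d)) * (2 * B) \<le> 1"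
    and P: "\<And>u. 0 \<le> P u \<and> P u \<le> p" "\<And>j. (\<Sum>k\<in>rect d. P (k - j)) \<le> 1"
    and L: "0 < L" "0 \<le> p" "real m * (p * L) < s"
  shows "prob {\<omega>\<in>space M. \<exists>j\<in>rect d. s \<le> (\<Sum>k\<in>rect d. P (k - j) * pspec d (\<lambda>t. WB B t \<omega>) k ^ 5)}
    \<le> vol d * (moment_const 5 ^ m / (s - real m * (p * L)) ^ m) + vol d * (moment_const 10 / L\<^sup>2)"
proof -
  let ?X = "\<lambda>k \<omega>. pspec d (\<lambda>t. WB B t \<omega>) k ^ 5"
  let ?y = "vol d * (ctot * (2 * B)) / sqrt (vol d)"
  define b where "b = (2 * ?y\<^sup>2) ^ 5"
  have Xb: "0 \<le> ?X k \<omega> \<and> ?X k \<omega> \<le> b" for k \<omega>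
  proof -
    have "pspec d (\<lambda>t. WB B t \<omega>) k \<le> 2 * ?y\<^sup>2"
      using power_mono[OF dft_WB_bound(1)[OF B, of d \<omega> k], of 2] power_mono[OF dft_WB_bound(2)[OF B, of d \<omega> k], of 2]
      by (simp add: pspec_def)
    from power_mono[OF this pspec_nonneg] show ?thesis
      unfolding b_def by (intro conjI zero_le_power pspec_nonneg)
  qed
  define E where "E j = {\<omega>\<in>space M. s \<le> (\<Sum>k\<in>rect d. P (k - j) * ?X k \<omega>) \<and> (\<forall>k\<in>rect d. ?X k \<omega> \<le> L)}" for j
  define F where "F k = {\<omega>\<in>space M. L \<le> \<bar>?X k \<omega>\<bar>}" for k
  have [measurable]: "E j \<in> events" "F k \<in> events" for j k unfolding E_def F_def by measurable
  have PE: "prob (E j) \<le> moment_const 5 ^ m / (s - real m * (p * L)) ^ m" for j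
    unfolding E_def
    using P L Xb moment_const_pos[of 5] pspec_prod_moment[OF d B _ _ small, of _ 5]
    by (intro weighted_sum_tail[where b = b]) (auto intro: less_imp_le)
  have PF: "prob (F k) \<le> moment_const 10 / L\<^sup>2" if k: "k \<in> rect d" for k
  proof -
    have "integrable M (\<lambda>\<omega>. (?X k \<omega>)\<^sup>2)"
    proof (rule integrable_const_bound[of _ "b\<^sup>2"])
      have "(?X k \<omega>)\<^sup>2 \<le> b\<^sup>2" for \<omega> using Xb[of \<omega> k] by (intro power_mono) auto
      then show "AE \<omega> in M. norm ((?X k \<omega>)\<^sup>2) \<le> b\<^sup>2" by simp
    qed measurable
    then have "prob (F k) \<le> expectation (\<lambda>\<omega>. (?X k \<omega>)\<^sup>2) / L\<^sup>2"
      unfolding F_def using L by (intro second_moment_bound) auto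
    \<comment> \<open>The square of a fifth power is a tenth power at a single frequency; the moment
      bound with a singleton applies because \<open>0 < m\<close>.\<close>
    also have "expectation (\<lambda>\<omega>. (?X k \<omega>)\<^sup>2) \<le> moment_const 10"
      using pspec_prod_moment[OF d B _ _ small, of "{k}" 10] k m by (simp add: power_mult[symmetric])
    finally show ?thesis using L by (simp add: divide_right_mono)
  qed
  have "prob {\<omega>\<in>space M. \<exists>j\<in>rect d. s \<le> (\<Sum>k\<in>rect d. P (k - j) * ?X k \<omega>)} \<le> prob ((\<Union>j\<in>rect d. E j) \<union> (\<Union>k\<in>rect d. F k))"
  proof (rule finite_measure_mono)
    show "{\<omega>\<in>space M. \<exists>j\<in>rect d. s \<le> (\<Sum>k\<in>rect d. P (k - j) * ?X k \<omega>)} \<subseteq> (\<Union>j\<in>rect d. E j) \<union> (\<Union>k\<in>rect d. F k)"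
      unfolding E_def F_def by (auto simp: not_le less_imp_le)
  qed auto
  also have "\<dots> \<le> prob (\<Union>j\<in>rect d. E j) + prob (\<Union>k\<in>rect d. F k)" by (intro measure_Un_le) auto
  also have "\<dots> \<le> (\<Sum>j\<in>rect d. prob (E j)) + (\<Sum>k\<in>rect d. prob (F k))"
    by (intro add_mono measure_UNION_le) auto
  also have "\<dots> \<le> (\<Sum>j\<in>rect d. moment_const 5 ^ m / (s - real m * (p * L)) ^ m) + (\<Sum>k\<in>rect d. moment_const 10 / L\<^sup>2)"
    by (intro add_mono sum_mono PE PF)
  finally show ?thesis by (simp add: card_rect)
qed

section \<open>The truncation remainder and the choice of the thresholds\<close>

lemma small_eventually:
  assumes "(g \<longlongrightarrow> 0) at_top" "0 < (a :: real)"
  shows "\<forall>\<^sub>F x :: real in at_top. z * g x < a"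
  using order_tendstoD(2)[OF tendsto_mult_right_zero[OF assms(1)] assms(2)] .

lemma sum_power_le_power_sum:
  fixes b :: "'i \<Rightarrow> real"
  assumes "finite A" "\<And>k. k \<in> A \<Longrightarrow> 0 \<le> b k"
  shows "(\<Sum>k\<in>A. b k ^ Suc n) \<le> (\<Sum>k\<in>A. b k) ^ Suc n"
proof -
  have "b k \<le> (\<Sum>k\<in>A. b k)" if "k \<in> A" for k using assms that by (intro member_le_sum) auto
  then have "(\<Sum>k\<in>A. b k ^ Suc n) \<le> (\<Sum>k\<in>A. b k * (\<Sum>k\<in>A. b k) ^ n)"
    using assms(2) by (intro sum_mono) (auto intro!: mult_left_mono power_mono)
  then show ?thesis by (simp add: sum_distrib_right)
qed

lemma rest_tail:
  assumes d: "0 < fst d" "0 < snd d" and B: "0 < B" and y: "0 < y"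
  shows "prob {\<omega>\<in>space M. y \<le> (\<Sum>t\<in>rect d. (W t \<omega> - WB B t \<omega>)\<^sup>2)} \<le> vol d * (ctot\<^sup>2 * (C0 / B ^ 6)) / y"
proof -
  have "prob {\<omega>\<in>space M. y \<le> (\<Sum>t\<in>rect d. (W t \<omega> - WB B t \<omega>)\<^sup>2)} \<le>
      expectation (\<lambda>\<omega>. \<Sum>t\<in>rect d. (W t \<omega> - WB B t \<omega>)\<^sup>2) / y"
    using rest_moment(1)[OF B] y by (intro first_moment_bound) (auto intro: sum_nonneg)
  also have "\<dots> = (\<Sum>t\<in>rect d. expectation (\<lambda>\<omega>. (W t \<omega> - WB B t \<omega>)\<^sup>2)) / y"
    using rest_moment(1)[OF B] by (subst Bochner_Integration.integral_sum) auto
  also have "\<dots> \<le> (\<Sum>t\<in>rect d. ctot\<^sup>2 * (C0 / B ^ 6)) / y"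
    using y by (intro divide_right_mono sum_mono rest_moment B) auto
  finally show ?thesis by (simp add: card_rect)
qed

text \<open>\<open>1024 = 2 ^ 5 * 2 ^ 5\<close>, once from splitting the power spectrum and once
  from splitting its fifth power. The remainder is treated crudely, by the largest weight times the
  fifth power of its total energy, which Parseval expresses through the sites.\<close>

lemma weighted_pspec5_split:
  assumes d: "0 < fst d" "0 < snd d" and P: "\<And>u. 0 \<le> P u \<and> P u \<le> p"
  shows "(\<Sum>k\<in>rect d. P (k - j) * pspec d (\<lambda>t. W t \<omega>) k ^ 5) \<le>
    1024 * ((\<Sum>k\<in>rect d. P (k - j) * pspec d (\<lambda>t. WB B t \<omega>) k ^ 5) + p * (\<Sum>t\<in>rect d. (W t \<omega> - WB B t \<omega>)\<^sup>2) ^ 5)"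
proof -
  let ?a = "pspec d (\<lambda>t. WB B t \<omega>)" and ?b = "pspec d (\<lambda>t. W t \<omega> - WB B t \<omega>)"
  have one: "pspec d (\<lambda>t. W t \<omega>) k ^ 5 \<le> 1024 * (?a k ^ 5 + ?b k ^ 5)" for k
  proof -
    have "pspec d (\<lambda>t. W t \<omega>) k \<le> 2 * (?a k + ?b k)"
      using pspec_add_le[of d "\<lambda>t. WB B t \<omega>" "\<lambda>t. W t \<omega> - WB B t \<omega>" k] by simp
    then have "pspec d (\<lambda>t. W t \<omega>) k ^ 5 \<le> (2 * (?a k + ?b k)) ^ 5" by (rule power_mono) simp
    also have "\<dots> = 32 * (?a k + ?b k) ^ 5" by (subst power_mult_distrib) simp
    also have "\<dots> \<le> 32 * (2 ^ 5 * (?a k ^ 5 + ?b k ^ 5))" by (intro mult_left_mono power_add_le) auto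
    finally show ?thesis by simp
  qed
  have "(\<Sum>k\<in>rect d. P (k - j) * pspec d (\<lambda>t. W t \<omega>) k ^ 5) \<le> (\<Sum>k\<in>rect d. P (k - j) * (1024 * (?a k ^ 5 + ?b k ^ 5)))"
    using P by (intro sum_mono mult_left_mono one) auto
  also have "\<dots> = 1024 * ((\<Sum>k\<in>rect d. P (k - j) * ?a k ^ 5) + (\<Sum>k\<in>rect d. P (k - j) * ?b k ^ 5))"
    by (simp add: sum.distrib[symmetric] sum_distrib_left algebra_simps)
  also have "(\<Sum>k\<in>rect d. P (k - j) * ?b k ^ 5) \<le> p * (\<Sum>t\<in>rect d. (W t \<omega> - WB B t \<omega>)\<^sup>2) ^ 5"
  proof -
    have p0: "0 \<le> p" using P[of 0] by auto
    have "(\<Sum>k\<in>rect d. P (k - j) * ?b k ^ 5) \<le> (\<Sum>k\<in>rect d. p * ?b k ^ 5)"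
      using P by (intro sum_mono mult_right_mono) auto
    also have "\<dots> = p * (\<Sum>k\<in>rect d. ?b k ^ Suc 4)" by (simp add: sum_distrib_left)
    also have "\<dots> \<le> p * (\<Sum>k\<in>rect d. ?b k) ^ Suc 4"
      by (intro mult_left_mono sum_power_le_power_sum p0) auto
    also have "(\<Sum>k\<in>rect d. ?b k) = (\<Sum>t\<in>rect d. (W t \<omega> - WB B t \<omega>)\<^sup>2)"
      unfolding pspec_def by (rule parseval[OF d])
    finally show ?thesis by simp
  qed
  finally show ?thesis by simp
qed

text \<open>All thresholds are powers of \<open>T = vol (d n)\<close>, balanced so that every error
  has a negative exponent. Only the order \<open>m\<close> of the product moments is logarithmic:
  just large enough for a union bound over \<open>T\<close> frequencies.\<close>

lemma power_mean_bounded: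
  fixes d :: "nat \<Rightarrow> nat \<times> nat" and H :: "nat \<Rightarrow> real" and P :: "nat \<Rightarrow> int \<times> int \<Rightarrow> real"
  assumes ev: "\<forall>\<^sub>F n in sequentially. 0 < fst (d n) \<and> 0 < snd (d n) \<and> 0 < H n \<and>
      (\<forall>u. 0 \<le> P n u \<and> P n u \<le> Cp / (H n * vol (d n))) \<and> (\<forall>j. (\<Sum>k\<in>rect (d n). P n (k - j)) = 1)"
    and lim: "(\<lambda>n. 1 / (H n ^ 4 * vol (d n))) \<longlonglongrightarrow> 0" and inf: "filterlim (\<lambda>n. vol (d n)) at_top sequentially"
    and Cp: "0 < Cp"
  obtains s where "(\<lambda>n. prob {\<omega>\<in>space M. \<exists>j\<in>rect (d n). s < (\<Sum>k\<in>rect (d n). P n (k - j) * pspec (d n) (\<lambda>t. W t \<omega>) k ^ 5)}) \<longlonglongrightarrow> 0"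
proof -
  define D where "D = moment_const 5"
  \<comment> \<open>The factor \<open>exp 2\<close> makes \<open>(D / (s0 / 2)) ^ m\<close> equal to
    \<open>exp (- 2) ^ m\<close>, at most \<open>1 / T\<^sup>2\<close> for
    \<open>m \<ge> ln T\<close>; the factor 2 leaves room for the correction
    \<open>real m * (p * L)\<close>.\<close>
  define s0 where "s0 = 2 * exp 2 * D"
  have D: "0 < D" unfolding D_def by (rule moment_const_pos)
  have s0: "0 < s0" using D by (simp add: s0_def)
  define E where "E n = {\<omega>\<in>space M. \<exists>j\<in>rect (d n). 1024 * (s0 + 1) < (\<Sum>k\<in>rect (d n). P n (k - j) * pspec (d n) (\<lambda>t. W t \<omega>) k ^ 5)}" for n
  define bnd where "bnd x = 1 / x + moment_const 10 * x powr (- 1/8) + ctot\<^sup>2 * C0 * x powr (- 1/10)" for x :: real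
  have "((\<lambda>x :: real. x powr (- 1/8)) \<longlongrightarrow> 0) at_top" "((\<lambda>x :: real. x powr (- 1/10)) \<longlongrightarrow> 0) at_top"
    "((\<lambda>x :: real. 1 / x) \<longlongrightarrow> 0) at_top" by real_asymp+
  then have "(bnd \<longlongrightarrow> 0 + moment_const 10 * 0 + ctot\<^sup>2 * C0 * 0) at_top"
    unfolding bnd_def[abs_def] by (intro tendsto_intros)
  then have bnd0: "(\<lambda>n. bnd (vol (d n))) \<longlonglongrightarrow> 0"
    using filterlim_compose[OF _ inf] by simp
  have "((\<lambda>x :: real. (ln x + 1) / sqrt x * x powr (1/6)) \<longlongrightarrow> 0) at_top"
    "((\<lambda>x :: real. (ln x + 1) * x powr (- 3/16)) \<longlongrightarrow> 0) at_top"
    "((\<lambda>x :: real. x powr (- 1/4)) \<longlongrightarrow> 0) at_top" by real_asymp+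
  note small = small_eventually[OF this(1), of 1 "(4 * ctot + 1) * 4"] small_eventually[OF this(2), of "s0 / 2" Cp]
    small_eventually[OF this(3), of 1 Cp]
  have "\<forall>\<^sub>F x :: real in at_top. (4 * ctot + 1) * 4 * ((ln x + 1) / sqrt x * x powr (1/6)) < 1 \<and>
      Cp * ((ln x + 1) * x powr (- 3/16)) < s0 / 2 \<and> Cp * x powr (- 1/4) < 1 \<and> 2 \<le> x"
    using small s0 by (intro eventually_conj eventually_ge_at_top) auto
  from eventually_compose_filterlim[OF this inf]
  have evT: "\<forall>\<^sub>F n in sequentially. (4 * ctot + 1) * 4 * ((ln (vol (d n)) + 1) / sqrt (vol (d n)) * vol (d n) powr (1/6)) < 1 \<and>
      Cp * ((ln (vol (d n)) + 1) * vol (d n) powr (- 3/16)) < s0 / 2 \<and> Cp * vol (d n) powr (- 1/4) < 1 \<and> 2 \<le> vol (d n)" .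
  have evH: "\<forall>\<^sub>F n in sequentially. 1 / (H n ^ 4 * vol (d n)) < 1" using order_tendstoD(2)[OF lim] by simp
  have "\<forall>\<^sub>F n in sequentially. norm (prob (E n)) \<le> bnd (vol (d n))"
    using ev evT evH
  proof eventually_elim
    case (elim n)
    define T where "T = vol (d n)"
    have d: "0 < fst (d n)" "0 < snd (d n)" and Hn: "0 < H n"
      and P: "\<And>u. 0 \<le> P n u \<and> P n u \<le> Cp / (H n * T)" "\<And>j. (\<Sum>k\<in>rect (d n). P n (k - j)) = 1"
      using elim(1) unfolding T_def by blast+
    have T: "2 \<le> T" and c1: "(4 * ctot + 1) * 4 * ((ln T + 1) / sqrt T * T powr (1/6)) < 1"
      and c2: "Cp * ((ln T + 1) * T powr (- 3/16)) < s0 / 2" and c3: "Cp * T powr (- 1/4) < 1"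
      using elim(2) by (auto simp: T_def)
    \<comment> \<open>The rate condition gives \<open>H n \<ge> T powr (- 1/4)\<close>, so
      \<open>p\<close> bounds the largest weight \<open>Cp / (H n * T)\<close>.\<close>
    define p where "p = Cp * T powr (- 3/4)"
    have "1 < H n ^ 4 * T" using elim(3) Hn T by (simp add: T_def)
    then have "1 / T \<le> H n ^ 4" using T by (simp add: pos_divide_le_eq)
    moreover have "(T powr (- 1/4)) ^ Suc 3 = 1 / T"
      using T by (simp only: powr_pow) (simp add: powr_minus_divide)
    ultimately have "T powr (- 1/4) \<le> H n" using Hn by (intro power_le_imp_le_base[of "T powr (- 1/4)" 3 "H n"]) auto
    then have "Cp / (H n * T) \<le> Cp / (T powr (- 1/4) * T)"
      using Cp T Hn by (intro divide_left_mono mult_right_mono mult_pos_pos) auto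
    also have "\<dots> = p"
    proof -
      have "T powr (- 1/4) * T = T powr (- 1/4) * T powr 1" using T by simp
      also have "\<dots> = T powr (3/4)" by (subst powr_add[symmetric]) simp
      finally have e: "T powr (- 1/4) * T = T powr (3/4)" .
      have "T powr (- 3/4) = 1 / T powr (3/4)" by (simp add: powr_minus_divide)
      then show ?thesis unfolding e p_def by simp
    qed
    finally have Pp: "\<And>u. 0 \<le> P n u \<and> P n u \<le> p" using P(1) by (blast intro: order.trans)
    define m where "m = nat \<lceil>ln T\<rceil>"
    have lnT: "0 < ln T" using T by simp
    have m: "ln T \<le> real m" "real m \<le> ln T + 1" "0 < m" unfolding m_def using lnT by linarith+
    \<comment> \<open>\<open>B ^ 6 = T\<close> keeps the mean energy of the remainder bounded. The
      exponent of \<open>L\<close> lies between 1/2, so that \<open>T / L\<^sup>2\<close> vanishes,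
      and 3/4, so that \<open>p * L\<close> vanishes even against the logarithm. The exponent of
      \<open>y\<close> is positive for Markov's inequality and below 3/20, so that
      \<open>p * y ^ 5\<close> vanishes.\<close>
    define B where "B = T powr (1/6)"
    define L where "L = T powr (9/16)"
    define y where "y = T powr (1/10)"
    have pos: "0 < B" "0 < L" "0 < y" "0 \<le> p" using T Cp by (auto simp: B_def L_def y_def p_def)
    have sm: "(4 * ctot + 1) * (2 * real m / sqrt (vol (d n))) * (2 * B) \<le> 1"
    proof -
      have "(4 * ctot + 1) * (2 * real m / sqrt T) * (2 * B) \<le> (4 * ctot + 1) * (2 * (ln T + 1) / sqrt T) * (2 * B)"
        using m pos T ctot_nonneg by (intro mult_right_mono mult_left_mono divide_right_mono) auto
      also have "\<dots> = (4 * ctot + 1) * 4 * ((ln T + 1) / sqrt T * T powr (1/6))"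
        using T by (simp add: B_def field_simps)
      finally show ?thesis using c1 by (simp add: T_def)
    qed
    have mpL: "real m * (p * L) \<le> s0 / 2"
    proof -
      have "p * L = Cp * T powr (- 3/16)" by (simp add: p_def L_def powr_add[symmetric])
      then have "real m * (p * L) \<le> (ln T + 1) * (Cp * T powr (- 3/16))" using m Cp by (simp add: mult_right_mono)
      then show ?thesis using c2 by (simp add: mult_ac)
    qed
    have py: "p * y ^ 5 \<le> 1"
    proof -
      have "y ^ 5 = T powr (1/2)" using T by (simp add: y_def powr_pow)
      then have "p * y ^ 5 = Cp * T powr (- 1/4)" by (simp add: p_def powr_add[symmetric])
      then show ?thesis using c3 by simp
    qed
    have [measurable]: "(\<lambda>\<omega>. pspec (d n) (\<lambda>t. W t \<omega>) k) \<in> borel_measurable M" for k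
      unfolding pspec_def dcos_def dsin_def by measurable
    let ?A = "{\<omega>\<in>space M. \<exists>j\<in>rect (d n). s0 \<le> (\<Sum>k\<in>rect (d n). P n (k - j) * pspec (d n) (\<lambda>t. WB B t \<omega>) k ^ 5)}"
    let ?R = "{\<omega>\<in>space M. y \<le> (\<Sum>t\<in>rect (d n). (W t \<omega> - WB B t \<omega>)\<^sup>2)}"
    define A where "A j = {\<omega>\<in>space M. s0 \<le> (\<Sum>k\<in>rect (d n). P n (k - j) * pspec (d n) (\<lambda>t. WB B t \<omega>) k ^ 5)}" for j
    have "A j \<in> events" for j unfolding A_def by measurable
    then have "(\<Union>j\<in>rect (d n). A j) \<in> events" by (intro sets.finite_UN finite_rect)
    moreover have "(\<Union>j\<in>rect (d n). A j) = ?A" unfolding A_def by blast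
    ultimately have measA: "?A \<in> events" by simp
    have measR: "?R \<in> events" by measurable
    note meas = measA measR
    have "E n \<subseteq> ?A \<union> ?R"
    proof
      fix \<omega> assume "\<omega> \<in> E n"
      then obtain j where \<omega>: "\<omega> \<in> space M" and j: "j \<in> rect (d n)"
        "1024 * (s0 + 1) < (\<Sum>k\<in>rect (d n). P n (k - j) * pspec (d n) (\<lambda>t. W t \<omega>) k ^ 5)" unfolding E_def by blast
      show "\<omega> \<in> ?A \<union> ?R"
      proof (rule ccontr)
        assume n: "\<omega> \<notin> ?A \<union> ?R"
        then have "\<not> s0 \<le> (\<Sum>k\<in>rect (d n). P n (k - j) * pspec (d n) (\<lambda>t. WB B t \<omega>) k ^ 5)"
          "\<not> y \<le> (\<Sum>t\<in>rect (d n). (W t \<omega> - WB B t \<omega>)\<^sup>2)" using \<omega> j(1) by blast+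
        then have a: "(\<Sum>k\<in>rect (d n). P n (k - j) * pspec (d n) (\<lambda>t. WB B t \<omega>) k ^ 5) < s0"
          and b: "(\<Sum>t\<in>rect (d n). (W t \<omega> - WB B t \<omega>)\<^sup>2) < y" by (simp_all only: not_le)
        have "p * (\<Sum>t\<in>rect (d n). (W t \<omega> - WB B t \<omega>)\<^sup>2) ^ 5 \<le> p * y ^ 5"
          using b pos by (intro mult_left_mono power_mono) (auto intro: sum_nonneg)
        with py have c: "p * (\<Sum>t\<in>rect (d n). (W t \<omega> - WB B t \<omega>)\<^sup>2) ^ 5 \<le> 1" by (rule order.trans[rotated])
        have "(\<Sum>k\<in>rect (d n). P n (k - j) * pspec (d n) (\<lambda>t. W t \<omega>) k ^ 5) \<le> 1024 * (s0 + 1)"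
          by (rule order.trans[OF weighted_pspec5_split[where P = "P n", OF d Pp, where \<omega> = \<omega> and B = B]])
             (intro mult_left_mono add_mono less_imp_le[OF a] c, simp)
        from leD[OF this] j(2) show False by blast
      qed
    qed
    then have "prob (E n) \<le> prob (?A \<union> ?R)" using meas by (intro finite_measure_mono) auto
    also have "\<dots> \<le> prob ?A + prob ?R" using meas by (intro measure_Un_le)
    finally have split: "prob (E n) \<le> prob ?A + prob ?R" .
    have "prob ?A \<le> T * (moment_const 5 ^ m / (s0 - real m * (p * L)) ^ m) + T * (moment_const 10 / L\<^sup>2)"
      unfolding T_def using mpL s0 pos by (intro WB_tail d m sm Pp eq_refl[OF P(2)]) auto
    also have "\<dots> \<le> T * (1 / T\<^sup>2) + T * (moment_const 10 / L\<^sup>2)"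
    proof (intro add_right_mono mult_left_mono)
      have "D ^ m / (s0 - real m * (p * L)) ^ m \<le> D ^ m / (s0 / 2) ^ m"
        using mpL s0 D by (intro divide_left_mono power_mono mult_pos_pos) auto
      also have "s0 / 2 = exp 2 * D" by (simp add: s0_def)
      also have "D ^ m / (exp 2 * D) ^ m = (D / (exp 2 * D)) ^ m" by (rule power_divide[symmetric])
      also have "D / (exp 2 * D) = exp (- 2)" using D by (simp add: exp_minus divide_inverse)
      also have "exp (- 2) ^ m = exp (real m * (- 2))" by (rule exp_of_nat_mult[symmetric])
      also have "\<dots> \<le> exp (- (2 * ln T))" using m by simp
      also have "\<dots> = 1 / T\<^sup>2" using T by (simp add: exp_minus exp_double divide_inverse)
      finally show "moment_const 5 ^ m / (s0 - real m * (p * L)) ^ m \<le> 1 / T\<^sup>2" by (simp add: D_def)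
    qed (use T in simp)
    also have "T * (1 / T\<^sup>2) = 1 / T" using T by (simp add: power2_eq_square)
    also have "T * (moment_const 10 / L\<^sup>2) = moment_const 10 * T powr (- 1/8)"
    proof -
      have L2: "L\<^sup>2 = T powr (9/8)" by (simp add: L_def power2_eq_square powr_add[symmetric])
      have "T / L\<^sup>2 = T powr 1 / T powr (9/8)" using T by (simp add: L2)
      also have "\<dots> = T powr (- 1/8)" by (subst powr_diff[symmetric]) simp
      finally have "moment_const 10 * (T / L\<^sup>2) = moment_const 10 * T powr (- 1/8)" by (rule arg_cong)
      then show ?thesis by (simp add: mult.commute)
    qed
    finally have b1: "prob ?A \<le> 1 / T + moment_const 10 * T powr (- 1/8)" .
    have "prob ?R \<le> T * (ctot\<^sup>2 * (C0 / B ^ 6)) / y" unfolding T_def by (rule rest_tail[OF d pos(1,3)])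
    also have "\<dots> = ctot\<^sup>2 * C0 * T powr (- 1/10)"
    proof -
      have "B ^ 6 = T" using T by (simp add: B_def powr_pow)
      then have e1: "T * (ctot\<^sup>2 * (C0 / B ^ 6)) = ctot\<^sup>2 * C0" using T by simp
      have e2: "1 / y = T powr (- 1/10)" by (simp add: y_def powr_minus_divide)
      have "T * (ctot\<^sup>2 * (C0 / B ^ 6)) / y = ctot\<^sup>2 * C0 * (1 / y)" unfolding e1 by simp
      then show ?thesis unfolding e2 .
    qed
    finally have "prob ?R \<le> ctot\<^sup>2 * C0 * T powr (- 1/10)" .
    with split b1 have "prob (E n) \<le> bnd T" unfolding bnd_def by linarith
    then show ?case by (simp add: T_def)
  qed
  then have "(\<lambda>n. prob (E n)) \<longlonglongrightarrow> 0" by (rule Lim_null_comparison[OF _ bnd0])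
  then show ?thesis unfolding E_def by (rule that)
qed

end

section \<open>Linear fields\<close>

lemma depends_on_self: "s \<in> A \<Longrightarrow> depends_on e A (e s)"
  unfolding depends_on_def
  by (rule bexI[of _ "\<lambda>z. z s"]) (auto intro: measurable_component_singleton)

text \<open>The expected exponential of minus the sum is positive, because the sum is finite almost
  surely. By independence it is at most a product of factors
  \<open>exp (- (q * (x i / (1 + x i))))\<close>, so the sums of \<open>x i / (1 + x i)\<close> are
  bounded. Laplace transforms avoid any moment assumption on the \<open>X i\<close>.\<close>

lemma (in prob_space) AE_abs_summable_imp_coeff_summable:
  fixes X :: "nat \<Rightarrow> 'a \<Rightarrow> real" and x :: "nat \<Rightarrow> real"
  assumes indep: "indep_vars (\<lambda>_. borel) X UNIV"
    and nonneg: "\<And>i \<omega>. 0 \<le> X i \<omega>" and x: "\<And>i. 0 \<le> x i"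
    and q: "\<And>i. expectation (\<lambda>\<omega>. X i \<omega> / (1 + X i \<omega>)) = q" "0 < q"
    and sm: "AE \<omega> in M. summable (\<lambda>i. x i * X i \<omega>)"
  shows "summable x"
proof -
  have [measurable]: "X i \<in> borel_measurable M" for i
    using indep unfolding indep_vars_def by blast
  define S where "S \<omega> = (\<Sum>i. x i * X i \<omega>)" for \<omega>
  have [measurable]: "S \<in> borel_measurable M" unfolding S_def by measurable
  define \<phi> where "\<phi> i = expectation (\<lambda>\<omega>. exp (- (x i * X i \<omega>)))" for i
  have xX: "0 \<le> x i * X i \<omega>" for i \<omega> using x nonneg by simp
  have ie: "integrable M (\<lambda>\<omega>. exp (- (x i * X i \<omega>)))" for i
    by (rule integrable_const_bound[of _ 1]) (use xX in auto)
  have S0: "0 \<le> S \<omega>" if "summable (\<lambda>i. x i * X i \<omega>)" for \<omega>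
    unfolding S_def using that xX by (intro suminf_nonneg) auto
  have iS: "integrable M (\<lambda>\<omega>. exp (- S \<omega>))"
    by (rule integrable_const_bound[of _ 1]) (use sm S0 in \<open>auto elim!: eventually_mono\<close>)
  define \<kappa> where "\<kappa> = expectation (\<lambda>\<omega>. exp (- S \<omega>))"
  have "\<kappa> \<noteq> 0"
  proof
    assume "\<kappa> = 0"
    then have "AE \<omega> in M. exp (- S \<omega>) = 0"
      unfolding \<kappa>_def using iS by (subst (asm) integral_nonneg_eq_0_iff_AE) auto
    then have "AE \<omega> in M. False" by simp
    then show False by (simp add: AE_False)
  qed
  moreover have "0 \<le> \<kappa>" unfolding \<kappa>_def by simp
  ultimately have \<kappa>: "0 < \<kappa>" by linarith
  have bound: "(\<Sum>i<n. x i / (1 + x i)) \<le> - ln \<kappa> / q" for n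
  proof -
    have "\<kappa> \<le> expectation (\<lambda>\<omega>. \<Prod>i<n. exp (- (x i * X i \<omega>)))"
      unfolding \<kappa>_def
    proof (rule integral_mono_AE[OF iS])
      show "integrable M (\<lambda>\<omega>. \<Prod>i<n. exp (- (x i * X i \<omega>)))"
        by (rule integrable_const_bound[of _ 1]) (use xX in \<open>auto intro!: AE_I2 prod_le_1 simp: abs_prod\<close>)
      show "AE \<omega> in M. exp (- S \<omega>) \<le> (\<Prod>i<n. exp (- (x i * X i \<omega>)))"
        using sm
      proof eventually_elim
        case (elim \<omega>)
        have "(\<Sum>i<n. x i * X i \<omega>) \<le> S \<omega>" unfolding S_def using elim xX by (intro sum_le_suminf) auto
        then show ?case by (simp add: exp_sum[symmetric] sum_negf)
      qed
    qed
    also have "\<dots> = (\<Prod>i<n. \<phi> i)"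
      unfolding \<phi>_def
    proof (rule indep_vars_lebesgue_integral)
      have "indep_vars (\<lambda>_. borel) X {..<n}" by (rule indep_vars_subset[OF indep]) simp
      then show "indep_vars (\<lambda>_. borel) (\<lambda>i \<omega>. exp (- (x i * X i \<omega>))) {..<n}"
        by (rule indep_vars_compose2[where Y = "\<lambda>i z. exp (- (x i * z))"]) measurable
    qed (use ie in auto)
    also have "\<dots> \<le> (\<Prod>i<n. exp (- (q * (x i / (1 + x i)))))"
    proof (rule prod_mono)
      fix i
      have "q * (x i / (1 + x i)) = expectation (\<lambda>\<omega>. X i \<omega> / (1 + X i \<omega>) * (x i / (1 + x i)))"
        unfolding integral_mult_left_zero q(1) ..
      also have "\<dots> \<le> expectation (\<lambda>\<omega>. 1 - exp (- (x i * X i \<omega>)))"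
      proof (rule integral_mono)
        show "integrable M (\<lambda>\<omega>. X i \<omega> / (1 + X i \<omega>) * (x i / (1 + x i)))"
          by (rule integrable_mult_left, rule integrable_const_bound[of _ 1])
             (use nonneg in \<open>auto intro!: AE_I2 simp: divide_le_eq_1 add_nonneg_pos add_pos_nonneg\<close>)
        show "integrable M (\<lambda>\<omega>. 1 - exp (- (x i * X i \<omega>)))" using ie by simp
        fix \<omega>
        \<comment> \<open>The chain shows that the product of a / (1 + a) and b / (1 + b) is at most
          ab / (1 + ab), which is at most 1 - exp (- ab).\<close>
        let ?a = "x i" and ?b = "X i \<omega>"
        have ab: "0 \<le> ?a" "0 \<le> ?b" using x nonneg by auto
        have "?b / (1 + ?b) * (?a / (1 + ?a)) = ?a * ?b / (1 + ?a + ?b + ?a * ?b)"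
          by (simp add: algebra_simps)
        also have "\<dots> \<le> ?a * ?b / (1 + ?a * ?b)"
          using ab by (intro divide_left_mono mult_pos_pos) (auto intro!: add_pos_nonneg mult_nonneg_nonneg)
        also have "\<dots> = 1 - 1 / (1 + ?a * ?b)"
          using mult_nonneg_nonneg[OF ab] by (simp add: field_simps)
        also have "\<dots> \<le> 1 - exp (- (?a * ?b))"
          using exp_ge_add_one_self[of "?a * ?b"] mult_nonneg_nonneg[OF ab] by (simp add: exp_minus field_simps)
        finally show "?b / (1 + ?b) * (?a / (1 + ?a)) \<le> 1 - exp (- (?a * ?b))" .
      qed
      also have "\<dots> = 1 - \<phi> i" using ie by (simp add: \<phi>_def prob_space)
      finally have "\<phi> i \<le> 1 + (- (q * (x i / (1 + x i))))" by simp
      also have "\<dots> \<le> exp (- (q * (x i / (1 + x i))))" by (rule exp_ge_add_one_self)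
      finally show "0 \<le> \<phi> i \<and> \<phi> i \<le> exp (- (q * (x i / (1 + x i))))" by (simp add: \<phi>_def)
    qed
    also have "\<dots> = exp (- (q * (\<Sum>i<n. x i / (1 + x i))))"
      by (simp add: exp_sum[symmetric] sum_negf sum_distrib_left)
    finally have "ln \<kappa> \<le> ln (exp (- (q * (\<Sum>i<n. x i / (1 + x i)))))" using \<kappa> by (subst ln_le_cancel_iff) auto
    then have "ln \<kappa> \<le> - (q * (\<Sum>i<n. x i / (1 + x i)))" by simp
    then show ?thesis using q(2) by (simp add: field_simps)
  qed
  have z: "summable (\<lambda>i. x i / (1 + x i))"
  proof (rule bounded_imp_summable)
    show "(\<Sum>k\<le>n. x k / (1 + x k)) \<le> - ln \<kappa> / q" for n
      using bound[of "Suc n"] by (simp only: lessThan_Suc_atMost)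
  qed (use x in auto)
  then have "(\<lambda>i. x i / (1 + x i)) \<longlonglongrightarrow> 0" by (rule summable_LIMSEQ_zero)
  \<comment> \<open>Below 1/2 the quotient forces \<open>x i < 1\<close>, so \<open>x i\<close> is
    at most twice the quotient.\<close>
  then have "\<forall>\<^sub>F i in sequentially. x i / (1 + x i) < 1 / 2" by (rule order_tendstoD) simp
  then have "\<forall>\<^sub>F i in sequentially. norm (x i) \<le> 2 * (x i / (1 + x i))"
  proof eventually_elim
    case (elim i)
    have p: "0 < 1 + x i" using x[of i] by linarith
    then have "x i < 1" using elim by (simp add: divide_less_eq)
    then have "x i * (1 + x i) \<le> x i * 2" using x[of i] by (intro mult_left_mono) auto
    then show ?case using x[of i] p by (simp add: pos_le_divide_eq mult.commute)
  qed
  then show ?thesis by (rule summable_comparison_test_ev) (intro summable_mult z)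
qed

lemma iid_field_expectation:
  assumes "iid_field M e" "prob_space M" "f \<in> borel_measurable borel"
  shows "(\<integral>\<omega>. f (e s \<omega>) \<partial>M) = (\<integral>\<omega>. f (e 0 \<omega>) \<partial>M :: real)"
    "integrable M (\<lambda>\<omega>. f (e s \<omega>)) \<longleftrightarrow> integrable M (\<lambda>\<omega>. f (e 0 \<omega>) :: real)"
proof -
  interpret prob_space M by fact
  have m: "e s \<in> borel_measurable M" for s
    using assms(1) unfolding iid_field_def indep_vars_def by blast
  have d: "distr M borel (e s) = distr M borel (e 0)" using assms(1) unfolding iid_field_def by blast
  show "(\<integral>\<omega>. f (e s \<omega>) \<partial>M) = (\<integral>\<omega>. f (e 0 \<omega>) \<partial>M)"
    using integral_distr[OF m assms(3), of s] integral_distr[OF m assms(3), of 0] d by simp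
  show "integrable M (\<lambda>\<omega>. f (e s \<omega>)) \<longleftrightarrow> integrable M (\<lambda>\<omega>. f (e 0 \<omega>))"
    using integrable_distr_eq[OF m assms(3), of s] integrable_distr_eq[OF m assms(3), of 0] d by simp
qed

text \<open>The weight \<open>abs_prod (rvec s) powr r\<close> vanishes on the coordinate axes, so
  absolute summability of the coefficients is drawn from the almost sure convergence of the series,
  which is absolute. The blocks are single sites, in an enumeration of the lattice.\<close>

lemma linear_field_block_expansion:
  assumes prob: "prob_space M" and V: "\<And>t. V t \<in> borel_measurable M" and lin: "linear_field M V \<mu> r"
  obtains e U c v q C0 where "block_expansion M e U c v q C0 (\<lambda>t \<omega>. V t \<omega> - \<mu>)"
proof -
  interpret prob_space M by fact
  from lin obtain a e \<delta> u0 where iid: "iid_field M e"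
    and hs: "\<And>j. AE \<omega> in M. ((\<lambda>s. a s * e (j - s) \<omega>) has_sum (V j \<omega> - \<mu>)) UNIV"
    and mean: "(\<integral>\<omega>. e 0 \<omega> \<partial>M) = 0" and int8: "integrable M (\<lambda>\<omega>. e 0 \<omega> ^ 8)"
    and cram: "0 < \<delta>" "0 < u0" "\<And>u. u0 < \<bar>u\<bar> \<Longrightarrow> cmod (char (distr M borel (e 0)) u) \<le> 1 - \<delta>"
    unfolding linear_field_def by blast
  have ind: "indep_vars (\<lambda>_. borel) e UNIV" using iid unfolding iid_field_def by blast
  have [measurable]: "e s \<in> borel_measurable M" for s using ind unfolding indep_vars_def by blast
  define b :: "nat \<Rightarrow> int \<times> int" where "b = from_nat_into UNIV"
  have b: "bij b" unfolding b_def
    by (rule bij_betw_from_nat_into) (simp_all add: finite_prod)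
  have sums: "AE \<omega> in M. (\<lambda>i. a (b i) * e (j - b i) \<omega>) sums (V j \<omega> - \<mu>) \<and> summable (\<lambda>i. \<bar>a (b i)\<bar> * \<bar>e (j - b i) \<omega>\<bar>)" for j
    using hs[of j]
  proof eventually_elim
    case (elim \<omega>)
    then have h: "((\<lambda>i. a (b i) * e (j - b i) \<omega>) has_sum (V j \<omega> - \<mu>)) UNIV"
      by (subst has_sum_reindex_bij_betw[OF b, of "\<lambda>s. a s * e (j - s) \<omega>"])
    then have "(\<lambda>i. a (b i) * e (j - b i) \<omega>) summable_on UNIV" by (rule has_sum_imp_summable)
    then have "Infinite_Sum.abs_summable_on (\<lambda>i. a (b i) * e (j - b i) \<omega>) UNIV"
      by (rule summable_on_iff_abs_summable_on_real[THEN iffD1])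
    then have "summable (\<lambda>i. norm (a (b i) * e (j - b i) \<omega>))"
      by (rule summable_on_imp_summable)
    then show ?case using has_sum_imp_sums[OF h] by (simp add: abs_mult)
  qed
  define q where "q = expectation (\<lambda>\<omega>. \<bar>e 0 \<omega>\<bar> / (1 + \<bar>e 0 \<omega>\<bar>))"
  have iq: "integrable M (\<lambda>\<omega>. \<bar>e 0 \<omega>\<bar> / (1 + \<bar>e 0 \<omega>\<bar>))"
    by (rule integrable_const_bound[of _ 1]) (auto intro!: AE_I2 simp: divide_le_eq_1 add_pos_nonneg)
  \<comment> \<open>Otherwise the innovations vanish almost surely and their characteristic function
    is constantly 1, which Cramer's condition excludes.\<close>
  have "q \<noteq> 0"
  proof
    assume "q = 0"
    then have "AE \<omega> in M. \<bar>e 0 \<omega>\<bar> / (1 + \<bar>e 0 \<omega>\<bar>) = 0"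
      unfolding q_def using iq by (subst (asm) integral_nonneg_eq_0_iff_AE) auto
    then have z: "AE \<omega> in M. e 0 \<omega> = 0"
      by eventually_elim (simp add: add_nonneg_eq_0_iff)
    let ?u = "u0 + 1"
    have "char (distr M borel (e 0)) ?u = (CLINT \<omega>|M. iexp (?u * e 0 \<omega>))"
      unfolding char_def by (subst integral_distr) auto
    also have "\<dots> = (CLINT \<omega>|M. 1)"
      by (rule integral_cong_AE) (use z in \<open>auto elim: eventually_mono\<close>)
    also have "\<dots> = 1" by (simp add: prob_space)
    finally show False using cram(3)[of ?u] cram(1,2) by simp
  qed
  moreover have "0 \<le> q" unfolding q_def by simp
  ultimately have q: "0 < q" by linarith
  have "summable (\<lambda>i. \<bar>a (b i)\<bar>)"
  proof (rule AE_abs_summable_imp_coeff_summable[where X = "\<lambda>i \<omega>. \<bar>e (0 - b i) \<omega>\<bar>"])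
    have "disjoint_family (\<lambda>i. {0 - b i})" using b by (auto simp: disjoint_family_on_def bij_def inj_def)
    then have "indep_vars (\<lambda>_. borel) (\<lambda>i. e (0 - b i)) UNIV"
      by (intro depends_on_indep_vars[OF ind, where A = "\<lambda>i. {0 - b i}"] depends_on_self) auto
    then show "indep_vars (\<lambda>_. borel) (\<lambda>i \<omega>. \<bar>e (0 - b i) \<omega>\<bar>) UNIV"
      by (rule indep_vars_compose2[where Y = "\<lambda>_ z. \<bar>z\<bar>"]) measurable
    show "expectation (\<lambda>\<omega>. \<bar>e (0 - b i) \<omega>\<bar> / (1 + \<bar>e (0 - b i) \<omega>\<bar>)) = q" for i
      unfolding q_def by (rule iid_field_expectation(1)[OF iid prob, where f = "\<lambda>z. \<bar>z\<bar> / (1 + \<bar>z\<bar>)"]) measurable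
    show "AE \<omega> in M. summable (\<lambda>i. \<bar>a (b i)\<bar> * \<bar>e (0 - b i) \<omega>\<bar>)" using sums[of 0] by eventually_elim blast
  qed (use q in auto)
  then have "block_expansion M e (\<lambda>i t. e (t - b i)) (\<lambda>i. a (b i)) b (\<lambda>_. 0) (expectation (\<lambda>\<omega>. e 0 \<omega> ^ 8)) (\<lambda>t \<omega>. V t \<omega> - \<mu>)"
  proof (unfold_locales)
    show "indep_vars (\<lambda>_. borel) e UNIV" by (rule ind)
    show "depends_on e (block (b i) 0 t) (e (t - b i))" for i t
      by (rule depends_on_self) (simp add: block_def near_def)
    show "expectation (e (t - b i)) = 0" for i t
      using iid_field_expectation(1)[OF iid prob, where f = "\<lambda>z. z"] mean by simp
    show "integrable M (\<lambda>\<omega>. e (t - b i) \<omega> ^ 8)" "expectation (\<lambda>\<omega>. e (t - b i) \<omega> ^ 8) \<le> expectation (\<lambda>\<omega>. e 0 \<omega> ^ 8)" for i t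
      using iid_field_expectation[OF iid prob, where f = "\<lambda>z. z ^ 8" and s = "t - b i"] int8 by simp_all
    show "(\<lambda>\<omega>. V t \<omega> - \<mu>) \<in> borel_measurable M" for t using V by measurable
    show "AE \<omega> in M. (\<lambda>i. a (b i) * e (t - b i) \<omega>) sums (V t \<omega> - \<mu>)" for t
      using sums[of t] by eventually_elim blast
  qed simp
  then show ?thesis by (rule that)
qed

section \<open>Geometric-moment contraction\<close>

text \<open>The strict inequality makes \<open>mix 0\<close> resample every coordinate, the origin
  included.\<close>

definition mix :: "nat \<Rightarrow> (int \<times> int \<Rightarrow> real) \<Rightarrow> (int \<times> int \<Rightarrow> real) \<Rightarrow> int \<times> int \<Rightarrow> real" where
  "mix m x y s = (if max_norm (rvec s) < real m then x s else y s)"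

text \<open>Small, middle and large values of \<open>z\<close> account for the three terms. In this
  way a geometric bound on a low moment and a bounded sixteenth moment yield a geometric bound on
  the eighth.\<close>

lemma power8_interpolation:
  fixes z \<alpha> \<epsilon> \<Lambda> :: real
  assumes "0 \<le> z" "0 < \<alpha>" "0 < \<epsilon>" "\<epsilon> \<le> \<Lambda>"
  shows "z ^ 8 \<le> \<epsilon> ^ 8 + \<Lambda> ^ 8 / \<epsilon> powr \<alpha> * z powr \<alpha> + z ^ 16 / \<Lambda> ^ 8"
proof -
  have L: "0 < \<Lambda>" using assms by simp
  have nn: "0 \<le> \<epsilon> ^ 8" "0 \<le> \<Lambda> ^ 8 / \<epsilon> powr \<alpha> * z powr \<alpha>" "0 \<le> z ^ 16 / \<Lambda> ^ 8" using assms L by auto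
  consider "z \<le> \<epsilon>" | "\<epsilon> < z" "z \<le> \<Lambda>" | "\<Lambda> < z" by linarith
  then show ?thesis
  proof cases
    case 1
    then have "z ^ 8 \<le> \<epsilon> ^ 8" using assms by (intro power_mono) auto
    then show ?thesis using nn by linarith
  next
    case 2
    have "\<epsilon> powr \<alpha> \<le> z powr \<alpha>" using 2 assms by (intro powr_mono2) auto
    then have "1 \<le> z powr \<alpha> / \<epsilon> powr \<alpha>" using assms by simp
    then have "\<Lambda> ^ 8 * 1 \<le> \<Lambda> ^ 8 * (z powr \<alpha> / \<epsilon> powr \<alpha>)" using L by (intro mult_left_mono) auto
    moreover have "z ^ 8 \<le> \<Lambda> ^ 8" using 2 assms by (intro power_mono) auto
    ultimately have "z ^ 8 \<le> \<Lambda> ^ 8 / \<epsilon> powr \<alpha> * z powr \<alpha>" by simp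
    then show ?thesis using nn by linarith
  next
    case 3
    have "\<Lambda> ^ 8 * z ^ 8 \<le> z ^ 8 * z ^ 8" using 3 L by (intro mult_right_mono power_mono) auto
    then have "z ^ 8 \<le> z ^ 16 / \<Lambda> ^ 8" using L by (simp add: pos_le_divide_eq mult.commute power_add[symmetric])
    then show ?thesis using nn by linarith
  qed
qed

lemma powr_lt_one: "0 < x \<Longrightarrow> x < 1 \<Longrightarrow> 0 < a \<Longrightarrow> x powr a < (1 :: real)"
  using powr_less_mono2[of a x 1] by simp

text \<open>Writing \<open>\<theta> = \<sigma> ^ 4\<close>, half of the power absorbs the polynomial
  factor and the other half stays geometric.\<close>

lemma poly_geometric_summable:
  fixes \<theta> :: real
  assumes "0 < \<theta>" "\<theta> < 1"
  shows "summable (\<lambda>i. \<theta> ^ i * (real i + 1)\<^sup>2)"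
proof -
  define \<sigma> where "\<sigma> = \<theta> powr (1/4)"
  have \<sigma>: "0 < \<sigma>" "\<sigma> < 1" using assms by (auto simp: \<sigma>_def powr_lt_one)
  have \<sigma>4: "\<sigma> ^ 4 = \<theta>" using assms powr_realpow[of \<sigma> 4] \<sigma> by (simp add: \<sigma>_def powr_powr)
  have "(\<lambda>n. real n * \<sigma> ^ n) \<longlonglongrightarrow> 0" by (rule powser_times_n_limit_0) (use \<sigma> in simp)
  then have "Bseq (\<lambda>n. real n * \<sigma> ^ n)" by (rule convergent_imp_Bseq[OF convergentI])
  then obtain K where K: "0 < K" "\<And>n. norm (real n * \<sigma> ^ n) \<le> K" by (auto elim: BseqE)
  have b: "(real i + 1) * \<sigma> ^ i \<le> K + 1" for i
  proof -
    have "\<sigma> ^ i \<le> 1" using \<sigma> by (intro power_le_one) auto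
    then show ?thesis using K(2)[of i] by (simp add: distrib_right)
  qed
  show ?thesis
  proof (rule summable_comparison_test'[of "\<lambda>i. (K + 1)\<^sup>2 * (\<sigma>\<^sup>2) ^ i" 0])
    have "\<sigma>\<^sup>2 < 1" using \<sigma> by (simp add: power_less_one_iff)
    then show "summable (\<lambda>i. (K + 1)\<^sup>2 * (\<sigma>\<^sup>2) ^ i)" by (intro summable_mult summable_geometric) simp
    fix i
    have "\<theta> ^ i * (real i + 1)\<^sup>2 = ((real i + 1) * \<sigma> ^ i)\<^sup>2 * (\<sigma>\<^sup>2) ^ i"
      unfolding \<sigma>4[symmetric] by (simp add: power_mult_distrib power_mult[symmetric] power_add[symmetric] mult.commute)
    also have "\<dots> \<le> (K + 1)\<^sup>2 * (\<sigma>\<^sup>2) ^ i"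
      using b[of i] \<sigma> by (intro mult_right_mono power_mono) auto
    finally show "norm (\<theta> ^ i * (real i + 1)\<^sup>2) \<le> (K + 1)\<^sup>2 * (\<sigma>\<^sup>2) ^ i" using assms by simp
  qed
qed

text \<open>Innovations and their copy are realised canonically as the two coordinates of a product
  of sequence spaces. There resampling is a measurable map and conditioning on a ball is integration
  over the second coordinate.\<close>

locale iid_coding =
  fixes \<nu> :: "real measure" and G :: "(int \<times> int \<Rightarrow> real) \<Rightarrow> real"
  assumes \<nu>: "prob_space \<nu>" "sets \<nu> = sets borel"
    and G_borel: "G \<in> borel_measurable (Pi\<^sub>M UNIV (\<lambda>_. borel))"
begin

abbreviation PP :: "(int \<times> int \<Rightarrow> real) measure" where "PP \<equiv> Pi\<^sub>M UNIV (\<lambda>_. \<nu>)"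

lemma sets_PP: "sets PP = sets (Pi\<^sub>M UNIV (\<lambda>_. borel))"
  using \<nu>(2) by (intro sets_PiM_cong) auto

sublocale product_prob_space "\<lambda>_ :: int \<times> int. \<nu>" UNIV
  by (intro product_prob_spaceI \<nu>)

sublocale PPP: pair_prob_space PP PP ..

lemma G_meas [measurable]: "G \<in> borel_measurable PP"
  using G_borel by (simp add: measurable_cong_sets[OF sets_PP refl])

lemma space_PP [simp]: "space PP = UNIV"
  using \<nu>(2) sets_eq_imp_space_eq[of \<nu> borel] by (simp add: space_PiM)

lemma space_\<nu> [simp]: "space \<nu> = UNIV"
  using \<nu>(2) sets_eq_imp_space_eq[of \<nu> borel] by simp

lemma mix_meas [measurable]: "(\<lambda>p. mix m (fst p) (snd p)) \<in> measurable (PP \<Otimes>\<^sub>M PP) PP"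
proof -
  have "(\<lambda>p s. mix m (fst p) (snd p) s) \<in> measurable (PP \<Otimes>\<^sub>M PP) PP"
  proof (rule measurable_PiM_single')
    fix s :: "int \<times> int"
    have [measurable]: "(\<lambda>x. x s) \<in> measurable PP \<nu>" by (rule measurable_component_singleton) simp
    show "(\<lambda>p. mix m (fst p) (snd p) s) \<in> measurable (PP \<Otimes>\<^sub>M PP) \<nu>"
      unfolding mix_def by (cases "max_norm (rvec s) < real m") simp_all
  qed simp
  then show ?thesis by simp
qed

text \<open>Which copy a coordinate is taken from depends only on its position. On a cylinder the
  measure therefore splits into the coordinates inside and outside the ball, and the two products
  recombine.\<close>

lemma distr_mix: "distr (PP \<Otimes>\<^sub>M PP) PP (\<lambda>p. mix m (fst p) (snd p)) = PP"
proof (rule PiM_eq)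
  fix J and F :: "int \<times> int \<Rightarrow> real set"
  assume J: "finite J" and F: "\<And>j. j \<in> J \<Longrightarrow> F j \<in> sets \<nu>"
  let ?in = "\<lambda>s. max_norm (rvec s) < real m"
  let ?E = "\<lambda>J. prod_emb UNIV (\<lambda>_. \<nu>) J (\<Pi>\<^sub>E j\<in>J. F j)"
  let ?A = "{j\<in>J. ?in j}" and ?B = "{j\<in>J. \<not> ?in j}"
  have E: "?E J' = {x. \<forall>j\<in>J'. x j \<in> F j}" for J'
    by (auto simp: prod_emb_def PiE_def Pi_def extensional_def space_PiM)
  have sE: "?E J' \<in> sets PP" if "J' \<subseteq> J" for J'
    using that J F by (intro sets_PiM_I) (auto intro: finite_subset)
  have "emeasure (distr (PP \<Otimes>\<^sub>M PP) PP (\<lambda>p. mix m (fst p) (snd p))) (?E J) =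
      emeasure (PP \<Otimes>\<^sub>M PP) ((\<lambda>p. mix m (fst p) (snd p)) -` ?E J \<inter> space (PP \<Otimes>\<^sub>M PP))"
    by (rule emeasure_distr) (auto intro: sE)
  also have "(\<lambda>p. mix m (fst p) (snd p)) -` ?E J \<inter> space (PP \<Otimes>\<^sub>M PP) = ?E ?A \<times> ?E ?B"
    unfolding E by (auto simp: space_pair_measure mix_def)
  also have "emeasure (PP \<Otimes>\<^sub>M PP) (?E ?A \<times> ?E ?B) = emeasure PP (?E ?A) * emeasure PP (?E ?B)"
    by (rule P.emeasure_pair_measure_Times) (auto intro!: sE)
  also have "\<dots> = (\<Prod>j\<in>?A. emeasure \<nu> (F j)) * (\<Prod>j\<in>?B. emeasure \<nu> (F j))"
    using J F by (intro arg_cong2[where f = "(*)"] emeasure_PiM_emb) auto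
  also have "\<dots> = (\<Prod>j\<in>?A \<union> ?B. emeasure \<nu> (F j))"
    using J by (intro prod.union_disjoint[symmetric]) auto
  also have "?A \<union> ?B = J" by auto
  finally show "emeasure (distr (PP \<Otimes>\<^sub>M PP) PP (\<lambda>p. mix m (fst p) (snd p))) (?E J) = (\<Prod>j\<in>J. emeasure \<nu> (F j))" .
qed simp

text \<open>A version of the conditional expectation of \<open>G\<close> given the coordinates of
  max-norm below \<open>m\<close>.\<close>

definition H :: "nat \<Rightarrow> (int \<times> int \<Rightarrow> real) \<Rightarrow> real" where
  "H m x = (\<integral>y. G (mix m x y) \<partial>PP)"

lemma H_meas [measurable]: "H m \<in> borel_measurable PP"
  unfolding H_def[abs_def] by measurable

lemma mix_expectation:
  assumes "f \<in> borel_measurable PP"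
  shows "(\<integral>p. f (mix m (fst p) (snd p)) \<partial>(PP \<Otimes>\<^sub>M PP)) = (\<integral>x. f x \<partial>PP :: real)"
    "integrable (PP \<Otimes>\<^sub>M PP) (\<lambda>p. f (mix m (fst p) (snd p))) \<longleftrightarrow> integrable PP (f :: _ \<Rightarrow> real)"
  using integral_distr[OF mix_meas assms, of m] integrable_distr_eq[OF mix_meas assms, of m]
  by (simp_all add: distr_mix)

lemma fst_expectation:
  assumes "f \<in> borel_measurable PP"
  shows "(\<integral>p. f (fst p) \<partial>(PP \<Otimes>\<^sub>M PP)) = (\<integral>x. f x \<partial>PP :: real)"
    "integrable (PP \<Otimes>\<^sub>M PP) (\<lambda>p. f (fst p)) \<longleftrightarrow> integrable PP (f :: _ \<Rightarrow> real)"
  using integral_distr[OF measurable_fst assms, of PP] integrable_distr_eq[OF measurable_fst assms, of PP]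
  by (simp_all add: P.distr_pair_fst)

end

locale contracting_coding = iid_coding +
  fixes \<alpha> C \<rho> :: real
  assumes \<alpha>: "0 < \<alpha>" and C: "0 < C" and \<rho>: "0 < \<rho>" "\<rho> < 1"
    and G16: "integrable PP (\<lambda>x. G x ^ 16)" and G_mean: "(\<integral>x. G x \<partial>PP) = 0"
    and contr: "\<And>m. integrable (PP \<Otimes>\<^sub>M PP) (\<lambda>p. \<bar>G (fst p) - G (mix m (fst p) (snd p))\<bar> powr \<alpha>)"
      "\<And>m. (\<integral>p. \<bar>G (fst p) - G (mix m (fst p) (snd p))\<bar> powr \<alpha> \<partial>(PP \<Otimes>\<^sub>M PP)) \<le> C * \<rho> ^ m"
begin

section \<open>The resampling error and the telescoped expansion\<close>

lemma G_int: "integrable PP G"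
proof (rule Bochner_Integration.integrable_bound[of _ "\<lambda>x. 1 + G x ^ 16"])
  show "AE x in PP. norm (G x) \<le> norm (1 + G x ^ 16)"
    using abs_power_le[of 1 16] by (intro AE_I2) (simp add: power_even_abs)
qed (use G16 in auto)

definition Z :: "nat \<Rightarrow> (int \<times> int \<Rightarrow> real) \<times> (int \<times> int \<Rightarrow> real) \<Rightarrow> real" where
  "Z m p = G (mix m (fst p) (snd p)) - G (fst p)"

lemma Z_meas [measurable]: "Z m \<in> borel_measurable (PP \<Otimes>\<^sub>M PP)"
  unfolding Z_def[abs_def] by measurable

definition K16 :: real where "K16 = 2 ^ 17 * (\<integral>x. G x ^ 16 \<partial>PP)"

lemma Z16: "integrable (PP \<Otimes>\<^sub>M PP) (\<lambda>p. Z m p ^ 16)" "(\<integral>p. Z m p ^ 16 \<partial>(PP \<Otimes>\<^sub>M PP)) \<le> K16"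
proof -
  let ?R = "\<lambda>p. 2 ^ 16 * (G (mix m (fst p) (snd p)) ^ 16 + G (fst p) ^ 16)"
  have b: "Z m p ^ 16 \<le> ?R p" for p
  proof -
    have "Z m p ^ 16 = \<bar>Z m p\<bar> ^ 16" by (simp add: power_even_abs)
    also have "\<dots> \<le> (2 * max \<bar>G (mix m (fst p) (snd p))\<bar> \<bar>G (fst p)\<bar>) ^ 16"
      by (intro power_mono) (auto simp: Z_def)
    also have "\<dots> = 2 ^ 16 * max \<bar>G (mix m (fst p) (snd p))\<bar> \<bar>G (fst p)\<bar> ^ 16" by (rule power_mult_distrib)
    also have "\<dots> \<le> ?R p" by (intro mult_left_mono) (auto simp: max_def power_even_abs)
    finally show ?thesis .
  qed
  have i: "integrable (PP \<Otimes>\<^sub>M PP) (\<lambda>p. G (mix m (fst p) (snd p)) ^ 16)" "integrable (PP \<Otimes>\<^sub>M PP) (\<lambda>p. G (fst p) ^ 16)"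
    using mix_expectation(2)[of "\<lambda>x. G x ^ 16" m] fst_expectation(2)[of "\<lambda>x. G x ^ 16"] G16 by auto
  then have iR: "integrable (PP \<Otimes>\<^sub>M PP) ?R" by simp
  show int: "integrable (PP \<Otimes>\<^sub>M PP) (\<lambda>p. Z m p ^ 16)"
    by (rule Bochner_Integration.integrable_bound[OF iR]) (auto intro!: AE_I2 order.trans[OF b])
  have "(\<integral>p. Z m p ^ 16 \<partial>(PP \<Otimes>\<^sub>M PP)) \<le> (\<integral>p. ?R p \<partial>(PP \<Otimes>\<^sub>M PP))"
    by (rule integral_mono[OF int iR b])
  also have "\<dots> = K16"
    using i mix_expectation(1)[of "\<lambda>x. G x ^ 16" m] fst_expectation(1)[of "\<lambda>x. G x ^ 16"] by (simp add: K16_def)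
  finally show "(\<integral>p. Z m p ^ 16 \<partial>(PP \<Otimes>\<^sub>M PP)) \<le> K16" .
qed

text \<open>The decay rates of the interpolation terms: the first comes from
  \<open>\<epsilon> ^ 8\<close>, the second is shared by the contraction term and the
  sixteenth-moment term.\<close>

definition rate :: real where "rate = max (\<rho> powr (4 / \<alpha>)) (\<rho> powr (1 / 4))"

lemma rate: "0 < rate" "rate < 1"
  using \<rho> \<alpha> by (auto simp: rate_def powr_lt_one less_max_iff_disj)

definition C1 :: real where "C1 = 1 + C + K16"

lemma Z8: "integrable (PP \<Otimes>\<^sub>M PP) (\<lambda>p. Z m p ^ 8)" "(\<integral>p. Z m p ^ 8 \<partial>(PP \<Otimes>\<^sub>M PP)) \<le> C1 * rate ^ m"
proof -
  \<comment> \<open>With these exponents \<open>\<Lambda> ^ 8 / \<epsilon> powr \<alpha>\<close>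
    equals \<rho> to the power -3m/4, so the contraction bound still leaves \<rho> to the power m/4,
    the same as the sixteenth-moment term.\<close>
  define \<epsilon> where "\<epsilon> = \<rho> powr (m / (2 * \<alpha>))"
  define \<Lambda> where "\<Lambda> = \<rho> powr (- (m / 32))"
  have e1: "\<epsilon> \<le> 1" "0 < \<epsilon>" using \<rho> \<alpha> by (auto simp: \<epsilon>_def powr_le1)
  have "\<rho> powr (m / 32) \<le> 1" "0 < \<rho> powr (m / 32)" using \<rho> by (auto simp: powr_le1)
  then have L1: "1 \<le> \<Lambda>" by (simp add: \<Lambda>_def powr_minus one_le_inverse)
  have L8: "\<Lambda> ^ 8 = \<rho> powr (- (m / 4))" and e8: "\<epsilon> ^ 8 = \<rho> powr (4 * m / \<alpha>)" and ea: "\<epsilon> powr \<alpha> = \<rho> powr (m / 2)"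
  proof -
    have pw: "(\<rho> powr x) ^ 8 = \<rho> powr (8 * x)" for x using powr_pow[OF \<rho>(1), of x 8] by (simp add: mult.commute)
    show "\<Lambda> ^ 8 = \<rho> powr (- (m / 4))" by (simp add: \<Lambda>_def pw)
    show "\<epsilon> ^ 8 = \<rho> powr (4 * m / \<alpha>)" unfolding \<epsilon>_def pw by (rule arg_cong[where f = "\<lambda>x. \<rho> powr x"]) (simp add: field_simps)
    show "\<epsilon> powr \<alpha> = \<rho> powr (m / 2)" using \<alpha> by (simp add: \<epsilon>_def powr_powr)
  qed
  let ?a = "\<lambda>p. \<bar>G (fst p) - G (mix m (fst p) (snd p))\<bar> powr \<alpha>"
  let ?R = "\<lambda>p. \<epsilon> ^ 8 + \<Lambda> ^ 8 / \<epsilon> powr \<alpha> * ?a p + Z m p ^ 16 / \<Lambda> ^ 8"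
  have b: "Z m p ^ 8 \<le> ?R p" for p
  proof -
    have eq: "\<bar>G (fst p) - G (mix m (fst p) (snd p))\<bar> = \<bar>Z m p\<bar>" by (simp add: Z_def abs_minus_commute)
    show ?thesis unfolding eq
      using power8_interpolation[of "\<bar>Z m p\<bar>" \<alpha> \<epsilon> \<Lambda>] \<alpha> e1 L1 by (simp add: power_even_abs)
  qed
  have iR: "integrable (PP \<Otimes>\<^sub>M PP) ?R" using contr(1)[of m] Z16(1)[of m] by simp
  show int: "integrable (PP \<Otimes>\<^sub>M PP) (\<lambda>p. Z m p ^ 8)"
    by (rule Bochner_Integration.integrable_bound[OF iR]) (auto intro!: AE_I2 order.trans[OF b])
  have "(\<integral>p. Z m p ^ 8 \<partial>(PP \<Otimes>\<^sub>M PP)) \<le> (\<integral>p. ?R p \<partial>(PP \<Otimes>\<^sub>M PP))"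
    by (rule integral_mono[OF int iR b])
  also have "\<dots> = \<epsilon> ^ 8 + \<Lambda> ^ 8 / \<epsilon> powr \<alpha> * (\<integral>p. ?a p \<partial>(PP \<Otimes>\<^sub>M PP)) + (\<integral>p. Z m p ^ 16 \<partial>(PP \<Otimes>\<^sub>M PP)) / \<Lambda> ^ 8"
    using contr(1)[of m] Z16(1)[of m] by (simp add: PPP.prob_space)
  also have "\<dots> \<le> \<epsilon> ^ 8 + \<Lambda> ^ 8 / \<epsilon> powr \<alpha> * (C * \<rho> ^ m) + K16 / \<Lambda> ^ 8"
    using L1 by (intro add_mono mult_left_mono divide_right_mono contr(2) Z16(2)) auto
  also have "\<epsilon> ^ 8 \<le> rate ^ m"
  proof -
    have "\<epsilon> ^ 8 = (\<rho> powr (4 / \<alpha>)) ^ m" using \<rho> by (simp add: e8 powr_pow)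
    also have "\<dots> \<le> rate ^ m" by (intro power_mono) (auto simp: rate_def)
    finally show ?thesis .
  qed
  also have rm: "\<rho> powr (m / 4) \<le> rate ^ m"
  proof -
    have "\<rho> powr (m / 4) = (\<rho> powr (1 / 4)) ^ m" using \<rho> by (simp add: powr_pow)
    also have "\<dots> \<le> rate ^ m" by (intro power_mono) (auto simp: rate_def)
    finally show ?thesis .
  qed
  then have "\<Lambda> ^ 8 / \<epsilon> powr \<alpha> * (C * \<rho> ^ m) \<le> C * rate ^ m"
  proof -
    have "\<Lambda> ^ 8 / \<epsilon> powr \<alpha> * \<rho> ^ m = \<rho> powr (- (m / 4) - m / 2 + m)"
      unfolding L8 ea powr_diff powr_add using \<rho> by (simp add: powr_realpow)
    also have "- (real m / 4) - real m / 2 + real m = real m / 4" by simp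
    finally have "\<Lambda> ^ 8 / \<epsilon> powr \<alpha> * \<rho> ^ m \<le> rate ^ m" using rm by simp
    then have "C * (\<Lambda> ^ 8 / \<epsilon> powr \<alpha> * \<rho> ^ m) \<le> C * rate ^ m" using C by (intro mult_left_mono) auto
    then show ?thesis by (simp add: mult_ac)
  qed
  moreover have "K16 / \<Lambda> ^ 8 \<le> K16 * rate ^ m"
  proof -
    have k: "0 \<le> K16" unfolding K16_def by simp
    have "K16 / \<Lambda> ^ 8 = K16 * \<rho> powr (m / 4)" unfolding L8 powr_minus divide_inverse by simp
    then show ?thesis using rm k by (simp add: mult_left_mono)
  qed
  moreover have "C1 * rate ^ m = rate ^ m + C * rate ^ m + K16 * rate ^ m" by (simp add: C1_def algebra_simps)
  ultimately show "(\<integral>p. Z m p ^ 8 \<partial>(PP \<Otimes>\<^sub>M PP)) \<le> C1 * rate ^ m" by linarith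
qed

text \<open>\<open>H m x - G x\<close> is the mean of \<open>Z m (x, y)\<close> over the resampled
  \<open>y\<close>, so Jensen's inequality carries over the eighth-moment bound; the mean of
  \<open>H m\<close> is that of \<open>G\<close> because resampling preserves the law.\<close>

lemma H_props:
  "integrable PP (H m)" "(\<integral>x. H m x \<partial>PP) = 0"
  "integrable PP (\<lambda>x. (H m x - G x) ^ 8)" "(\<integral>x. (H m x - G x) ^ 8 \<partial>PP) \<le> C1 * rate ^ m"
proof -
  have iG: "integrable (PP \<Otimes>\<^sub>M PP) (\<lambda>(x, y). G (mix m x y))"
    using mix_expectation(2)[OF G_meas, of m] G_int by (simp add: split_def)
  show "integrable PP (H m)" using PPP.integrable_fst[OF iG] by (simp add: H_def[abs_def])
  show "(\<integral>x. H m x \<partial>PP) = 0"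
    using PPP.integral_fst[OF iG] mix_expectation(1)[OF G_meas, of m] G_mean by (simp add: H_def[abs_def] split_def)
  have iZ: "integrable (PP \<Otimes>\<^sub>M PP) (\<lambda>(x, y). Z m (x, y) ^ 8)" using Z8(1)[of m] by (simp add: split_def)
  have jen: "AE x in PP. (H m x - G x) ^ 8 \<le> (\<integral>y. Z m (x, y) ^ 8 \<partial>PP)"
    using PPP.AE_integrable_fst[OF iG] PPP.AE_integrable_fst[OF iZ]
  proof eventually_elim
    case (elim x)
    have "H m x - G x = (\<integral>y. Z m (x, y) \<partial>PP)"
      using elim(1) by (simp add: H_def Z_def P.prob_space[unfolded space_PP])
    also have "\<dots> ^ 8 \<le> (\<integral>y. Z m (x, y) ^ 8 \<partial>PP)"
      using elim by (intro P.jensens_inequality[where I = UNIV]) (auto simp: Z_def intro: convex_power_even)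
    finally show ?case .
  qed
  show i8: "integrable PP (\<lambda>x. (H m x - G x) ^ 8)"
    by (rule Bochner_Integration.integrable_bound[OF PPP.integrable_fst[OF iZ]])
       (use jen in \<open>auto elim!: eventually_mono\<close>)
  have "(\<integral>x. (H m x - G x) ^ 8 \<partial>PP) \<le> (\<integral>x. (\<integral>y. Z m (x, y) ^ 8 \<partial>PP) \<partial>PP)"
    by (rule integral_mono_AE[OF i8 PPP.integrable_fst[OF iZ] jen])
  also have "\<dots> = (\<integral>p. Z m p ^ 8 \<partial>(PP \<Otimes>\<^sub>M PP))" using PPP.integral_fst[OF iZ] by (simp add: split_def)
  also have "\<dots> \<le> C1 * rate ^ m" by (rule Z8)
  finally show "(\<integral>x. (H m x - G x) ^ 8 \<partial>PP) \<le> C1 * rate ^ m" .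
qed

text \<open>The eighth moments of the errors are summable in \<open>m\<close>, so the eighth powers
  are summable almost surely and tend to zero.\<close>

lemma H_tendsto: "AE x in PP. (\<lambda>n. H n x) \<longlonglongrightarrow> G x"
proof -
  have "summable (\<lambda>m. \<integral>x. (H m x - G x) ^ 8 \<partial>PP)"
  proof (rule summable_comparison_test'[of "\<lambda>m. C1 * rate ^ m" 0])
    show "summable (\<lambda>m. C1 * rate ^ m)" using rate by (intro summable_mult summable_geometric) simp
    show "norm (\<integral>x. (H m x - G x) ^ 8 \<partial>PP) \<le> C1 * rate ^ m" for m
      using H_props(4)[of m] by (simp add: integral_nonneg)
  qed
  from P.AE_summable_of_integrals(1)[OF H_props(3) _ this] have "AE x in PP. summable (\<lambda>m. (H m x - G x) ^ 8)" by simp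
  then show ?thesis
  proof eventually_elim
    case (elim x)
    then have "(\<lambda>m. (H m x - G x) ^ 8) \<longlonglongrightarrow> 0" by (rule summable_LIMSEQ_zero)
    then have "(\<lambda>m. \<bar>H m x - G x\<bar> ^ 8) \<longlonglongrightarrow> 0" by (simp add: power_even_abs)
    then have "(\<lambda>m. root 8 (\<bar>H m x - G x\<bar> ^ 8)) \<longlonglongrightarrow> root 8 0" by (rule tendsto_real_root)
    then have "(\<lambda>m. \<bar>H m x - G x\<bar>) \<longlonglongrightarrow> 0" by (simp only: real_root_power_cancel zero_less_numeral abs_ge_zero real_root_zero)
    then show ?case using LIM_zero_cancel tendsto_rabs_zero_iff by blast
  qed
qed

text \<open>The eighth root is the scale at which the normalised increments keep bounded eighth
  moments; as a coefficient sequence its powers are summable against any polynomial in the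
  radius.\<close>

definition decay :: real where "decay = rate powr (1 / 8)"

lemma decay: "0 < decay" "decay < 1" "decay ^ 8 = rate"
  using rate by (auto simp: decay_def powr_lt_one powr_pow)

definition incr :: "nat \<Rightarrow> (int \<times> int \<Rightarrow> real) \<Rightarrow> real" where
  "incr m x = (H (Suc m) x - H m x) / decay ^ m"

lemma incr_meas [measurable]: "incr m \<in> borel_measurable PP"
  unfolding incr_def[abs_def] by measurable

lemma incr_mean: "(\<integral>x. incr m x \<partial>PP) = 0"
  using H_props(1,2) by (simp add: incr_def[abs_def])

lemma incr_mom8: "integrable PP (\<lambda>x. incr m x ^ 8)" "(\<integral>x. incr m x ^ 8 \<partial>PP) \<le> 512 * C1"
proof -
  let ?R = "\<lambda>x. 256 * ((H (Suc m) x - G x) ^ 8 + (H m x - G x) ^ 8) / rate ^ m"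
  have r: "0 < rate ^ m" using rate by simp
  have b: "incr m x ^ 8 \<le> ?R x" for x
  proof -
    let ?a = "H (Suc m) x - G x" and ?b = "H m x - G x"
    have "\<bar>?a - ?b\<bar> \<le> 2 * max \<bar>?a\<bar> \<bar>?b\<bar>"
      using abs_triangle_ineq4[of ?a ?b] max.cobounded1[of "\<bar>?a\<bar>" "\<bar>?b\<bar>"] max.cobounded2[of "\<bar>?b\<bar>" "\<bar>?a\<bar>"] by linarith
    then have "\<bar>?a - ?b\<bar> ^ 8 \<le> (2 * max \<bar>?a\<bar> \<bar>?b\<bar>) ^ 8" by (intro power_mono) auto
    also have "\<dots> = 256 * max \<bar>?a\<bar> \<bar>?b\<bar> ^ 8" by (simp add: power_mult_distrib)
    also have "\<dots> \<le> 256 * (?a ^ 8 + ?b ^ 8)" by (intro mult_left_mono) (auto simp: max_def power_even_abs)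
    finally have "(H (Suc m) x - H m x) ^ 8 \<le> 256 * (?a ^ 8 + ?b ^ 8)" by (simp add: power_even_abs)
    moreover have "(decay ^ m) ^ 8 = rate ^ m" unfolding decay(3)[symmetric] by (simp add: power_mult[symmetric] mult.commute)
    ultimately show ?thesis using r by (simp add: incr_def power_divide divide_right_mono)
  qed
  have iR: "integrable PP ?R" using H_props(3) by simp
  show int: "integrable PP (\<lambda>x. incr m x ^ 8)"
  proof (rule Bochner_Integration.integrable_bound[OF iR])
    show "AE x in PP. norm (incr m x ^ 8) \<le> norm (?R x)"
    proof (rule AE_I2)
      fix x
      have "norm (incr m x ^ 8) = incr m x ^ 8" by simp
      also have "\<dots> \<le> norm (?R x)" unfolding real_norm_def by (rule order.trans[OF b abs_ge_self])
      finally show "norm (incr m x ^ 8) \<le> norm (?R x)" .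
    qed
  qed measurable
  have "(\<integral>x. incr m x ^ 8 \<partial>PP) \<le> (\<integral>x. ?R x \<partial>PP)" by (rule integral_mono[OF int iR b])
  also have "\<dots> = 256 * ((\<integral>x. (H (Suc m) x - G x) ^ 8 \<partial>PP) + (\<integral>x. (H m x - G x) ^ 8 \<partial>PP)) / rate ^ m"
    using H_props(3) by simp
  also have "\<dots> \<le> 256 * (C1 * rate ^ m + C1 * rate ^ m) / rate ^ m"
  proof (intro divide_right_mono mult_left_mono add_mono H_props(4))
    have "0 \<le> C1 * rate ^ m" using H_props(4)[of m] by (rule order.trans[rotated]) simp
    then have "C1 * rate ^ Suc m \<le> C1 * rate ^ m" using rate mult_left_le[of rate "C1 * rate ^ m"] by (simp add: mult_ac)
    then show "(\<integral>x. (H (Suc m) x - G x) ^ 8 \<partial>PP) \<le> C1 * rate ^ m" using H_props(4)[of "Suc m"] by linarith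
  qed (use r in auto)
  also have "\<dots> = 512 * C1"
  proof -
    have "256 * (C1 * q + C1 * q) / q = 512 * C1" if "0 < q" for q :: real using that by (simp add: field_simps)
    from this[OF r] show ?thesis .
  qed
  finally show "(\<integral>x. incr m x ^ 8 \<partial>PP) \<le> 512 * C1" .
qed

lemma incr_sums: "AE x in PP. (\<lambda>i. decay ^ i * incr i x) sums G x"
  using H_tendsto
proof eventually_elim
  case (elim x)
  \<comment> \<open>At radius zero everything is resampled, so \<open>H 0\<close> is the mean of
    \<open>G\<close> and the telescoping sum starts from zero.\<close>
  have H0: "H 0 x = 0"
  proof -
    have "mix 0 x y = y" for y by (rule ext) (auto simp: mix_def max_norm_def max_def)
    then show ?thesis using G_mean by (simp add: H_def)
  qed
  have "(\<Sum>i<n. decay ^ i * incr i x) = H n x" for n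
  proof (induction n)
    case (Suc n)
    then show ?case using decay(1) by (simp add: incr_def)
  qed (simp add: H0)
  then show ?case using elim by (simp add: sums_def)
qed

text \<open>For lattice points a norm below \<open>m + 1\<close> is a norm of at most
  \<open>m\<close>, so even \<open>H (Suc m)\<close> looks no farther than radius
  \<open>m\<close>.\<close>

lemma incr_local:
  assumes "\<And>s. near (int m) s 0 \<Longrightarrow> x s = y s"
  shows "incr m x = incr m y"
proof -
  have near: "near (int m) s 0" if "max_norm (rvec s) < real (Suc m)" for s
  proof -
    have "\<bar>real_of_int (fst s)\<bar> < real (Suc m)" "\<bar>real_of_int (snd s)\<bar> < real (Suc m)"
      using that by (auto simp: max_norm_def rvec_def)
    then show ?thesis by (auto simp: near_def)
  qed
  have "mix k x z = mix k y z" if "k \<le> Suc m" for k z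
    using assms near that by (fastforce simp: mix_def)
  then have "H (Suc m) x = H (Suc m) y" "H m x = H m y" by (simp_all add: H_def)
  then show ?thesis by (simp add: incr_def)
qed

end

text \<open>The innovations seen from a site have the product law, and two copies on
  \<open>M \<Otimes>\<^sub>M M\<close> have the law of two independent sequences. Moments and
  contraction thus pass to the canonical space, and the expansion found there is pulled back along
  \<open>X t\<close>.\<close>

lemma gmc_field_block_expansion:
  assumes prob: "prob_space M" and V: "\<And>t. V t \<in> borel_measurable M" and gmc: "gmc_field M V \<mu>"
    and int16: "integrable M (\<lambda>\<omega>. \<bar>V 0 \<omega>\<bar> ^ 16)" and mean: "integrable M (V 0)" "(\<integral>\<omega>. V 0 \<omega> \<partial>M) = \<mu>"
  obtains e U c v q C0 where "block_expansion M e U c v q C0 (\<lambda>t \<omega>. V t \<omega> - \<mu>)"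
proof -
  interpret prob_space M by fact
  interpret MM: pair_prob_space M M ..
  note [measurable] = V
  from gmc obtain e G \<alpha> C \<rho> where G: "G \<in> borel_measurable (Pi\<^sub>M UNIV (\<lambda>_. borel))" and iid: "iid_field M e"
    and VG: "\<And>j. AE \<omega> in M. V j \<omega> - \<mu> = G (\<lambda>s. e (j - s) \<omega>)"
    and par: "0 < \<alpha>" "0 < C" "0 < \<rho>" "\<rho> < 1"
    and contr: "\<And>j. integrable (M \<Otimes>\<^sub>M M) (\<lambda>w. \<bar>V j (fst w) - (\<mu> + G (\<lambda>s. if max_norm (rvec s) < max_norm (rvec j) then e (j - s) (fst w) else e (j - s) (snd w)))\<bar> powr \<alpha>)"
      "\<And>j. (\<integral>w. \<bar>V j (fst w) - (\<mu> + G (\<lambda>s. if max_norm (rvec s) < max_norm (rvec j) then e (j - s) (fst w) else e (j - s) (snd w)))\<bar> powr \<alpha> \<partial>(M \<Otimes>\<^sub>M M)) \<le> C * \<rho> powr max_norm (rvec j)"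
    unfolding gmc_field_def Let_def split_beta by blast
  have ind: "indep_vars (\<lambda>_. borel) e UNIV" and same: "\<And>i. distr M borel (e i) = distr M borel (e 0)"
    using iid unfolding iid_field_def by blast+
  have [measurable]: "e s \<in> borel_measurable M" for s using ind unfolding indep_vars_def by blast
  define \<nu> where "\<nu> = distr M borel (e 0)"
  interpret ic: iid_coding \<nu> G
    proof (rule iid_coding.intro)
    show "prob_space \<nu>" unfolding \<nu>_def by (rule prob_space_distr) measurable
  qed (simp_all only: \<nu>_def G sets_distr)
  define X where "X t \<omega> = (\<lambda>s. e (t - s) \<omega>)" for t \<omega>
  have law: "distr M borel (e s) = \<nu>" for s unfolding \<nu>_def by (rule same)
  have X_law: "distr M ic.PP (X t) = ic.PP" for t
  proof -
    have "disjoint_family (\<lambda>s. {t - s})" by (auto simp: disjoint_family_on_def)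
    then have "indep_vars (\<lambda>_. borel) (\<lambda>s. e (t - s)) UNIV"
      by (intro depends_on_indep_vars[OF ind, where A = "\<lambda>s. {t - s}"] depends_on_self) auto
    then have "distr M (Pi\<^sub>M UNIV (\<lambda>_. borel)) (\<lambda>\<omega>. \<lambda>s\<in>UNIV. e (t - s) \<omega>) = Pi\<^sub>M UNIV (\<lambda>s. distr M borel (e (t - s)))"
      by (subst (asm) indep_vars_iff_distr_eq_PiM) auto
    then have "distr M (Pi\<^sub>M UNIV (\<lambda>_. borel)) (X t) = ic.PP"
      by (simp add: law X_def[abs_def] restrict_def)
    then show ?thesis using distr_cong[OF refl ic.sets_PP, of M "X t" "X t"] by simp
  qed
  have X_meas [measurable]: "X t \<in> measurable M ic.PP" for t
  proof -
    have "(\<lambda>\<omega> s. e (t - s) \<omega>) \<in> measurable M (Pi\<^sub>M UNIV (\<lambda>_. borel))"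
      by (rule measurable_PiM_single') auto
    then show ?thesis by (simp add: X_def[abs_def] measurable_cong_sets[OF refl ic.sets_PP])
  qed
  have EX: "(\<integral>\<omega>. f (X t \<omega>) \<partial>M) = (\<integral>x. f x \<partial>ic.PP)" "integrable M (\<lambda>\<omega>. f (X t \<omega>)) \<longleftrightarrow> integrable ic.PP f"
    if "f \<in> borel_measurable ic.PP" for f :: "(int \<times> int \<Rightarrow> real) \<Rightarrow> real" and t
    using integral_distr[OF X_meas that, of t] integrable_distr_eq[OF X_meas that, of t] by (simp_all add: X_law)
  have VX: "AE \<omega> in M. V j \<omega> - \<mu> = G (X j \<omega>)" for j using VG[of j] by (simp add: X_def)
  have G16: "integrable ic.PP (\<lambda>x. G x ^ 16)"
  proof -
    have "integrable M (\<lambda>\<omega>. (V 0 \<omega> - \<mu>) ^ 16)"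
    proof (rule Bochner_Integration.integrable_bound)
      show "integrable M (\<lambda>\<omega>. 2 ^ 16 * (\<bar>V 0 \<omega>\<bar> ^ 16 + \<bar>\<mu>\<bar> ^ 16))" using int16 by simp
      show "AE \<omega> in M. norm ((V 0 \<omega> - \<mu>) ^ 16) \<le> norm (2 ^ 16 * (\<bar>V 0 \<omega>\<bar> ^ 16 + \<bar>\<mu>\<bar> ^ 16))"
      proof (rule AE_I2)
        fix \<omega>
        have "norm ((V 0 \<omega> - \<mu>) ^ 16) = \<bar>V 0 \<omega> - \<mu>\<bar> ^ 16" by (simp add: power_even_abs)
        also have "\<dots> \<le> (\<bar>V 0 \<omega>\<bar> + \<bar>\<mu>\<bar>) ^ 16" by (intro power_mono abs_triangle_ineq4) simp
        also have "\<dots> \<le> 2 ^ 16 * (\<bar>V 0 \<omega>\<bar> ^ 16 + \<bar>\<mu>\<bar> ^ 16)" by (rule power_add_le) auto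
        also have "\<dots> \<le> norm (2 ^ 16 * (\<bar>V 0 \<omega>\<bar> ^ 16 + \<bar>\<mu>\<bar> ^ 16))" unfolding real_norm_def by (rule abs_ge_self)
        finally show "norm ((V 0 \<omega> - \<mu>) ^ 16) \<le> norm (2 ^ 16 * (\<bar>V 0 \<omega>\<bar> ^ 16 + \<bar>\<mu>\<bar> ^ 16))" .
      qed
    qed measurable
    also have "integrable M (\<lambda>\<omega>. (V 0 \<omega> - \<mu>) ^ 16) \<longleftrightarrow> integrable M (\<lambda>\<omega>. G (X 0 \<omega>) ^ 16)"
      by (rule integrable_cong_AE) (use VX[of 0] in \<open>auto elim: eventually_mono\<close>)
    finally show ?thesis using EX(2)[of "\<lambda>x. G x ^ 16" 0] by simp
  qed
  have G_mean: "(\<integral>x. G x \<partial>ic.PP) = 0"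
  proof -
    have "(\<integral>x. G x \<partial>ic.PP) = expectation (\<lambda>\<omega>. G (X 0 \<omega>))" using EX(1)[OF ic.G_meas] by simp
    also have "\<dots> = expectation (\<lambda>\<omega>. V 0 \<omega> - \<mu>)"
      by (rule integral_cong_AE) (use VX[of 0] in \<open>auto elim: eventually_mono\<close>)
    also have "\<dots> = 0" using mean by (simp add: prob_space)
    finally show ?thesis .
  qed
  have pair_law: "distr (M \<Otimes>\<^sub>M M) (ic.PP \<Otimes>\<^sub>M ic.PP) (\<lambda>w. (X t (fst w), X t (snd w))) = ic.PP \<Otimes>\<^sub>M ic.PP" for t
    using pair_measure_distr[OF X_meas X_meas, of t t] by (simp add: X_law ic.P.sigma_finite_measure_axioms case_prod_unfold)
  have ctr: "integrable (ic.PP \<Otimes>\<^sub>M ic.PP) (\<lambda>p. \<bar>G (fst p) - G (mix m (fst p) (snd p))\<bar> powr \<alpha>)"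
    "(\<integral>p. \<bar>G (fst p) - G (mix m (fst p) (snd p))\<bar> powr \<alpha> \<partial>(ic.PP \<Otimes>\<^sub>M ic.PP)) \<le> C * \<rho> ^ m" for m
  proof -
    \<comment> \<open>A site of max-norm \<open>m\<close>: contraction along one axis already
      supplies every radius.\<close>
    define j :: "int \<times> int" where "j = (int m, 0)"
    have jm: "max_norm (rvec j) = real m" by (simp add: j_def max_norm_def rvec_def)
    let ?f = "\<lambda>p. \<bar>G (fst p) - G (mix m (fst p) (snd p))\<bar> powr \<alpha>"
    let ?w = "\<lambda>w. (X j (fst w), X j (snd w))"
    let ?h = "\<lambda>w. \<bar>V j (fst w) - (\<mu> + G (mix m (X j (fst w)) (X j (snd w))))\<bar> powr \<alpha>"
    have h: "(\<lambda>s. if max_norm (rvec s) < max_norm (rvec j) then e (j - s) (fst w) else e (j - s) (snd w)) = mix m (X j (fst w)) (X j (snd w))" for w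
      by (simp add: fun_eq_iff mix_def X_def jm)
    have [measurable]: "?w \<in> measurable (M \<Otimes>\<^sub>M M) (ic.PP \<Otimes>\<^sub>M ic.PP)" by measurable
    have [measurable]: "(\<lambda>w. mix m (X j (fst w)) (X j (snd w))) \<in> measurable (M \<Otimes>\<^sub>M M) ic.PP"
      using measurable_compose[OF \<open>?w \<in> measurable (M \<Otimes>\<^sub>M M) (ic.PP \<Otimes>\<^sub>M ic.PP)\<close> ic.mix_meas[of m]] by simp
    have mf: "?f \<in> borel_measurable (ic.PP \<Otimes>\<^sub>M ic.PP)" by measurable
    have mfw: "(\<lambda>w. ?f (?w w)) \<in> borel_measurable (M \<Otimes>\<^sub>M M)"
      by (rule measurable_compose[OF \<open>?w \<in> measurable (M \<Otimes>\<^sub>M M) (ic.PP \<Otimes>\<^sub>M ic.PP)\<close> mf])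
    have "AE w in M \<Otimes>\<^sub>M M. V j (fst w) - \<mu> = G (X j (fst w))"
      by (rule AE_distrD[OF measurable_fst]) (unfold distr_pair_fst, rule VX)
    then have ae: "AE w in M \<Otimes>\<^sub>M M. ?h w = ?f (?w w)"
      by eventually_elim (simp add: algebra_simps)
    have c: "integrable (M \<Otimes>\<^sub>M M) ?h" "(\<integral>w. ?h w \<partial>(M \<Otimes>\<^sub>M M)) \<le> C * \<rho> ^ m"
      using contr[of j] par unfolding h unfolding jm by (simp_all add: powr_realpow)
    have "integrable (M \<Otimes>\<^sub>M M) (\<lambda>w. ?f (?w w))"
      by (rule integrable_cong_AE_imp[OF c(1) mfw ae])
    then show "integrable (ic.PP \<Otimes>\<^sub>M ic.PP) ?f"
      using integrable_distr_eq[OF \<open>?w \<in> measurable (M \<Otimes>\<^sub>M M) (ic.PP \<Otimes>\<^sub>M ic.PP)\<close> mf] by (simp add: pair_law)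
    have "(\<integral>p. ?f p \<partial>(ic.PP \<Otimes>\<^sub>M ic.PP)) = (\<integral>w. ?f (?w w) \<partial>(M \<Otimes>\<^sub>M M))"
      using integral_distr[OF \<open>?w \<in> measurable (M \<Otimes>\<^sub>M M) (ic.PP \<Otimes>\<^sub>M ic.PP)\<close> mf] by (simp add: pair_law)
    also have "\<dots> = (\<integral>w. ?h w \<partial>(M \<Otimes>\<^sub>M M))"
      by (rule integral_cong_AE[OF mfw borel_measurable_integrable[OF c(1)] AE_symmetric[OF ae]])
    finally show "(\<integral>p. ?f p \<partial>(ic.PP \<Otimes>\<^sub>M ic.PP)) \<le> C * \<rho> ^ m" using c(2) by simp
  qed
  interpret cc: contracting_coding \<nu> G \<alpha> C \<rho>
    by (unfold_locales) (rule par G16 G_mean ctr)+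
  have "block_expansion M e (\<lambda>i t \<omega>. cc.incr i (X t \<omega>)) (\<lambda>i. cc.decay ^ i) (\<lambda>_. 0) (\<lambda>i. i) (512 * cc.C1) (\<lambda>t \<omega>. V t \<omega> - \<mu>)"
  proof (unfold_locales)
    show "indep_vars (\<lambda>_. borel) e UNIV" by (rule ind)
    show "depends_on e (block 0 i t) (\<lambda>\<omega>. cc.incr i (X t \<omega>))" for i t
      unfolding depends_on_def
    proof (rule bexI)
      \<comment> \<open>\<open>X t\<close> reads the innovations reflected, at \<open>t - s\<close>.
        \<open>ext\<close> performs this reflection on the block and fills in zeros beyond radius
        \<open>i\<close>, where the increment does not look.\<close>
      define ext where "ext z s = (if near (int i) s 0 then z (t - s) else 0)" for z :: "int \<times> int \<Rightarrow> real" and s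
      have blk: "t - s \<in> block 0 i t" if "near (int i) s 0" for s
        using that unfolding block_def near_def by simp
      have "ext \<in> measurable (Pi\<^sub>M (block 0 i t) (\<lambda>_. borel)) (Pi\<^sub>M UNIV (\<lambda>_. borel))"
        unfolding ext_def[abs_def]
      proof (rule measurable_PiM_single')
        fix s :: "int \<times> int"
        show "(\<lambda>z. if near (int i) s 0 then z (t - s) else 0) \<in> borel_measurable (Pi\<^sub>M (block 0 i t) (\<lambda>_. borel))"
          using blk[of s] by (cases "near (int i) s 0") (simp_all add: measurable_component_singleton)
      qed (simp add: space_PiM)
      then have "ext \<in> measurable (Pi\<^sub>M (block 0 i t) (\<lambda>_. borel)) ic.PP"
        by (simp add: measurable_cong_sets[OF refl ic.sets_PP])
      then show "(\<lambda>z. cc.incr i (ext z)) \<in> borel_measurable (Pi\<^sub>M (block 0 i t) (\<lambda>_. borel))"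
        by (rule measurable_compose[OF _ cc.incr_meas])
      show "(\<lambda>\<omega>. cc.incr i (X t \<omega>)) = (\<lambda>\<omega>. cc.incr i (ext (restrict (\<lambda>s. e s \<omega>) (block 0 i t))))"
        by (rule HOL.ext, rule cc.incr_local) (simp add: ext_def X_def blk)
    qed
    show "expectation (\<lambda>\<omega>. cc.incr i (X t \<omega>)) = 0" for i t
      using EX(1)[OF cc.incr_meas] cc.incr_mean by simp
    show "integrable M (\<lambda>\<omega>. cc.incr i (X t \<omega>) ^ 8)" "expectation (\<lambda>\<omega>. cc.incr i (X t \<omega>) ^ 8) \<le> 512 * cc.C1" for i t
      using EX[of "\<lambda>x. cc.incr i x ^ 8" t] cc.incr_mom8[of i] by simp_all
    show "summable (\<lambda>i. \<bar>cc.decay ^ i\<bar> * (real i + 1)\<^sup>2)"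
      using poly_geometric_summable[OF cc.decay(1,2)] cc.decay(1) by simp
    show "(\<lambda>\<omega>. V t \<omega> - \<mu>) \<in> borel_measurable M" for t by measurable
    show "AE \<omega> in M. (\<lambda>i. cc.decay ^ i * cc.incr i (X t \<omega>)) sums (V t \<omega> - \<mu>)" for t
    proof -
      have "AE \<omega> in M. (\<lambda>i. cc.decay ^ i * cc.incr i (X t \<omega>)) sums G (X t \<omega>)"
        by (rule AE_distrD[OF X_meas[of t]]) (unfold X_law, rule cc.incr_sums)
      then show ?thesis using VX[of t] by eventually_elim simp
    qed
  qed
  then show ?thesis by (rule that)
qed

section \<open>Coefficients over the rectangle and the mean periodogram\<close>

lemma finite_half_set [simp]: "finite (half_set d)"
  by (simp add: half_set_def Let_def)

lemma half_set_subset: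
  assumes "0 < fst d" "0 < snd d"
  shows "half_set d \<subseteq> rect d"
proof -
  define a b where "a = int (fst d)" and "b = int (snd d)"
  have p: "0 < a" "0 < b" using assms by (simp_all add: a_def b_def)
  have sub: "{1..c div 2 - 1} \<subseteq> {1..c}" "{1..(c - 1) div 2} \<subseteq> {1..c}" "{c} \<subseteq> {1..c}"
    "even c \<Longrightarrow> {c div 2, c} \<subseteq> {1..c}" if c: "0 < c" for c :: int
  proof -
    show "{1..c div 2 - 1} \<subseteq> {1..c}" "{1..(c - 1) div 2} \<subseteq> {1..c}" "{c} \<subseteq> {1..c}" using c by auto
    assume "even c"
    then obtain b where "c = 2 * b" by (rule evenE)
    then show "{c div 2, c} \<subseteq> {1..c}" using c by auto
  qed
  have "half_set d \<subseteq> {1..a} \<times> {1..b}"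
    unfolding half_set_def Let_def a_def[symmetric] b_def[symmetric]
    by (cases "odd a"; cases "odd b"; simp only: if_True if_False simp_thms not_not not_True_eq_False not_False_eq_True;
        intro Un_least Sigma_mono sub p order_refl)
  then show ?thesis unfolding rect_def a_def b_def .
qed

text \<open>Side length 4 puts \<open>(1, 1)\<close> into the set for every parity; suprema over the
  set are meaningful only when it is nonempty.\<close>

lemma half_set_nonempty:
  assumes "4 \<le> fst d" "4 \<le> snd d"
  shows "half_set d \<noteq> {}"
proof -
  define a b where "a = int (fst d)" and "b = int (snd d)"
  have p: "4 \<le> a" "4 \<le> b" using assms by (simp_all add: a_def b_def)
  have "1 \<le> c div 2 - 1" "1 \<le> (c - 1) div 2" if "4 \<le> c" for c :: int
    using that by linarith+
  note q = this
  from q[OF p(1)] q[OF p(2)] have "(1, 1) \<in> half_set d"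
    using p unfolding half_set_def Let_def a_def[symmetric] b_def[symmetric] by auto
  then show ?thesis by blast
qed

lemma zero_freqs_diff: "j \<in> zero_freqs d \<Longrightarrow> k \<in> zero_freqs d \<Longrightarrow> j - k \<in> zero_freqs d"
proof -
  assume "j \<in> zero_freqs d" "k \<in> zero_freqs d"
  then obtain a b a' b' where "j = (a * int (fst d), b * int (snd d))" "k = (a' * int (fst d), b' * int (snd d))"
    unfolding zero_freqs_def by blast
  then have "j - k = ((a - a') * int (fst d), (b - b') * int (snd d))" by (simp add: algebra_simps)
  then show ?thesis unfolding zero_freqs_def by blast
qed

lemma zero_freqs_add_period: "k + period d c \<in> zero_freqs d \<longleftrightarrow> k \<in> zero_freqs d"
proof -
  have p: "period d c \<in> zero_freqs d" "0 - period d c \<in> zero_freqs d"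
    unfolding zero_freqs_def period_def by (blast, rule CollectI, rule exI[of _ "- fst c"], rule exI[of _ "- snd c"]) simp
  show ?thesis
  proof
    assume "k + period d c \<in> zero_freqs d"
    from zero_freqs_diff[OF this p(1)] show "k \<in> zero_freqs d" by simp
  next
    assume "k \<in> zero_freqs d"
    from zero_freqs_diff[OF this p(2)] show "k + period d c \<in> zero_freqs d" by simp
  qed
qed

lemma card_rect_zero_freqs: "card (rect d \<inter> zero_freqs d) \<le> 1"
proof -
  have "x = y" if "x \<in> rect d \<inter> zero_freqs d" "y \<in> rect d \<inter> zero_freqs d" for x y
    using that zero_freqs_diff[of x d y] diff_in_zero_freqs_iff[of x d y] by blast
  then show ?thesis by (metis One_nat_def card_le_Suc0_iff_eq finite_Int finite_rect)
qed

section \<open>Periodicity and measurability of the smoothed statistics\<close>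

lemma periodic_xcoef: "0 < fst d \<Longrightarrow> 0 < snd d \<Longrightarrow> periodic d (\<lambda>j. xcoef V d j \<omega>)"
  using periodic_dcos[of d "\<lambda>t. V t \<omega>"] unfolding periodic_def xcoef_eq_dcos by blast

lemma periodic_ycoef: "0 < fst d \<Longrightarrow> 0 < snd d \<Longrightarrow> periodic d (\<lambda>j. ycoef V d j \<omega>)"
  using periodic_dsin[of d "\<lambda>t. V t \<omega>"] unfolding periodic_def ycoef_eq_dsin by simp

lemma periodic_periodogram:
  assumes "0 < fst d" "0 < snd d"
  shows "periodic d (\<lambda>j. periodogram V d j \<omega>)"
  unfolding periodic_def periodogram_def zero_freqs_add_period
  by (intro allI) (simp only: periodicD[OF periodic_xcoef[OF assms]] periodicD[OF periodic_ycoef[OF assms]])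

text \<open>Measurability is demanded for every \<open>n\<close>, including early ones with an empty
  rectangle; there sums are empty and \<open>vol d\<close> is zero.\<close>

lemma coef_empty_rect:
  assumes "\<not> (0 < fst d \<and> 0 < snd d)"
  shows "xcoef V d j \<omega> = 0" "ycoef V d j \<omega> = 0" "periodogram V d j \<omega> = 0"
  using assms by (auto simp: xcoef_def ycoef_def periodogram_def vol_def)

lemma coef_measurable [measurable]:
  assumes [measurable]: "\<And>t. V t \<in> borel_measurable M"
  shows "xcoef V d j \<in> borel_measurable M" "ycoef V d j \<in> borel_measurable M" "periodogram V d j \<in> borel_measurable M"
proof -
  show [measurable]: "xcoef V d j \<in> borel_measurable M" "ycoef V d j \<in> borel_measurable M"
    unfolding xcoef_def[abs_def] ycoef_def[abs_def] by measurable
  show "periodogram V d j \<in> borel_measurable M"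
    unfolding periodogram_def[abs_def] by (cases "j \<in> zero_freqs d") simp_all
qed

text \<open>Folding turns the lattice sum into a finite sum. If the kernel values are not summable,
  the denominator takes the default value 0 and every weight is 0.\<close>

lemma smooth_measurable:
  assumes meas: "\<And>k. \<phi> k \<in> borel_measurable M"
    and per: "\<And>\<omega>. 0 < fst d \<Longrightarrow> 0 < snd d \<Longrightarrow> periodic d (\<lambda>k. \<phi> k \<omega>)"
    and empty: "\<And>k \<omega>. \<not> (0 < fst d \<and> 0 < snd d) \<Longrightarrow> \<phi> k \<omega> = 0"
  shows "(\<lambda>\<omega>. \<Sum>\<^sub>\<infinity>s. weight K d h s * \<phi> (j + s) \<omega>) \<in> borel_measurable M"
proof (cases "0 < fst d \<and> 0 < snd d")
  case d: True
  show ?thesis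
  proof (cases "(\<lambda>s. scaled_kernel K h (freq d s)) summable_on UNIV")
    case True
    have "(\<Sum>\<^sub>\<infinity>s. weight K d h s * \<phi> (j + s) \<omega>) = (\<Sum>k\<in>rect d. periodize d (weight K d h) (k - j) * \<phi> k \<omega>)" for \<omega>
      using d by (intro infsum_mult_periodic_shift per weight_summable True) auto
    then show ?thesis using meas by simp
  next
    case False
    then have "weight K d h s = 0" for s unfolding weight_def by (simp add: infsum_not_exists)
    then show ?thesis by simp
  qed
next
  case False
  then have "(\<Sum>\<^sub>\<infinity>s. weight K d h s * \<phi> (j + s) \<omega>) = 0" for \<omega> by (simp add: empty)
  then show ?thesis by simp
qed

lemma dcos_centred:
  assumes "0 < fst d" "0 < snd d"
  shows "dcos d (\<lambda>t. w t + a) j = dcos d w j + (if j \<in> zero_freqs d then a * sqrt (vol d) else 0)"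
    "dsin d (\<lambda>t. w t + a) j = dsin d w j"
  using assms by (simp_all add: dcos_add dsin_add dcos_const dsin_const)

lemma cos_diff_le: "\<bar>cos x - cos y\<bar> \<le> \<bar>x - y\<bar>" for x y :: real
proof -
  have "norm (cos x - cos y) \<le> 1 * norm (x - y)"
    by (rule field_differentiable_bound[of UNIV cos "\<lambda>x. - sin x"]) (auto intro!: derivative_eq_intros)
  then show ?thesis by simp
qed

section \<open>Spectral density and mean periodogram for absolutely summable covariances\<close>

locale summable_autocovariance =
  fixes \<gamma> :: "int \<times> int \<Rightarrow> real"
  assumes abs_summable: "(\<lambda>u. \<bar>\<gamma> u\<bar>) summable_on UNIV"
begin

definition total :: real where "total = (\<Sum>\<^sub>\<infinity>u. \<bar>\<gamma> u\<bar>)"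

text \<open>This is \<open>4 * pi\<^sup>2\<close> times the spectral density, written with real
  cosines.\<close>

definition spec :: "real \<times> real \<Rightarrow> real" where "spec l = (\<Sum>\<^sub>\<infinity>u. \<gamma> u * cos (l \<bullet> rvec u))"

lemma abs_summable_sub: "(\<lambda>u. \<bar>\<gamma> u\<bar>) summable_on A"
  by (rule summable_on_subset_banach[OF abs_summable]) simp

lemma total_nonneg: "0 \<le> total" unfolding total_def by (rule infsum_nonneg) simp

lemma dominated_summable: "(\<And>u. \<bar>b u\<bar> \<le> C * \<bar>\<gamma> u\<bar>) \<Longrightarrow> b summable_on A" for b :: "int \<times> int \<Rightarrow> real"
proof -
  assume b: "\<And>u. \<bar>b u\<bar> \<le> C * \<bar>\<gamma> u\<bar>"
  have "Infinite_Sum.abs_summable_on b A"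
    by (rule Infinite_Sum.abs_summable_on_comparison_test'[OF summable_on_cmult_right[OF abs_summable_sub[of A], of C]]) (simp add: b)
  then show ?thesis by (rule abs_summable_summable)
qed

lemma dominated_infsum_le:
  fixes b :: "int \<times> int \<Rightarrow> real"
  assumes "\<And>u. \<bar>b u\<bar> \<le> C * \<bar>\<gamma> u\<bar>"
  shows "\<bar>infsum b A\<bar> \<le> C * (\<Sum>\<^sub>\<infinity>u\<in>A. \<bar>\<gamma> u\<bar>)"
proof -
  have s: "b summable_on A" "(\<lambda>u. - b u) summable_on A" using assms by (auto intro!: dominated_summable)
  have c: "(\<Sum>\<^sub>\<infinity>u\<in>A. C * \<bar>\<gamma> u\<bar>) = C * (\<Sum>\<^sub>\<infinity>u\<in>A. \<bar>\<gamma> u\<bar>)" by (rule infsum_cmult_right) (rule abs_summable_sub)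
  have le: "b u \<le> C * \<bar>\<gamma> u\<bar>" "- b u \<le> C * \<bar>\<gamma> u\<bar>" for u using assms[of u] by linarith+
  have "infsum b A \<le> C * (\<Sum>\<^sub>\<infinity>u\<in>A. \<bar>\<gamma> u\<bar>)" "(\<Sum>\<^sub>\<infinity>u\<in>A. - b u) \<le> C * (\<Sum>\<^sub>\<infinity>u\<in>A. \<bar>\<gamma> u\<bar>)"
    unfolding c[symmetric] by (intro infsum_mono s summable_on_cmult_right abs_summable_sub le)+
  then show ?thesis by (simp add: infsum_uminus)
qed

lemma infsum_abs_le_total: "(\<Sum>\<^sub>\<infinity>u\<in>A. \<bar>\<gamma> u\<bar>) \<le> total"
  unfolding total_def by (rule infsum_mono2) (auto intro: abs_summable_sub)

lemma spec_summand_le: "\<bar>\<gamma> u * cos x\<bar> \<le> 1 * \<bar>\<gamma> u\<bar>"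
  using abs_cos_le_one[of x] mult_left_le[of "\<bar>cos x\<bar>" "\<bar>\<gamma> u\<bar>"] by (simp add: abs_mult mult.commute)

lemma abs_spec_le: "\<bar>spec l\<bar> \<le> total"
  using dominated_infsum_le[OF spec_summand_le, where A = UNIV] unfolding spec_def total_def by simp

lemma finite_tail:
  assumes "0 < \<epsilon>"
  obtains R :: nat where "(\<Sum>\<^sub>\<infinity>u\<in>- {u. near (int R) u 0}. \<bar>\<gamma> u\<bar>) < \<epsilon>"
proof -
  have "((\<lambda>u. \<bar>\<gamma> u\<bar>) has_sum total) UNIV" unfolding total_def by (rule has_sum_infsum[OF abs_summable])
  then obtain F where F: "finite F" "dist (\<Sum>u\<in>F. \<bar>\<gamma> u\<bar>) total \<le> \<epsilon> / 2"
    using has_sum_finite_approximation[where \<epsilon> = "\<epsilon> / 2"] assms half_gt_zero by blast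
  define R where "R = nat (\<Sum>u\<in>F. \<bar>fst u\<bar> + \<bar>snd u\<bar>)"
  have "near (int R) u 0" if "u \<in> F" for u
  proof -
    have "\<bar>fst u\<bar> + \<bar>snd u\<bar> \<le> (\<Sum>u\<in>F. \<bar>fst u\<bar> + \<bar>snd u\<bar>)" using F(1) by (intro member_le_sum that) simp_all
    then have "\<bar>fst u\<bar> \<le> (\<Sum>u\<in>F. \<bar>fst u\<bar> + \<bar>snd u\<bar>)" "\<bar>snd u\<bar> \<le> (\<Sum>u\<in>F. \<bar>fst u\<bar> + \<bar>snd u\<bar>)"
      by linarith+
    moreover from this have "int R = (\<Sum>u\<in>F. \<bar>fst u\<bar> + \<bar>snd u\<bar>)" unfolding R_def by (intro nat_0_le) linarith
    ultimately show ?thesis unfolding near_def by simp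
  qed
  then have sub: "- {u. near (int R) u 0} \<subseteq> UNIV - F" by blast
  have "(\<Sum>\<^sub>\<infinity>u\<in>- {u. near (int R) u 0}. \<bar>\<gamma> u\<bar>) \<le> (\<Sum>\<^sub>\<infinity>u\<in>UNIV - F. \<bar>\<gamma> u\<bar>)"
    using sub by (intro infsum_mono2 abs_summable_sub) auto
  also have "\<dots> = total - (\<Sum>u\<in>F. \<bar>\<gamma> u\<bar>)"
    unfolding total_def using F by (subst infsum_Diff[OF abs_summable abs_summable_sub]) auto
  also have "\<dots> < \<epsilon>" using F(2) assms unfolding dist_real_def by linarith
  finally show ?thesis by (rule that)
qed

text \<open>Finitely many lags carry almost all of the series, and on these the cosines are
  uniformly Lipschitz in the frequency.\<close>

lemma spec_uniformly_continuous:
  assumes "0 < \<epsilon>"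
  obtains \<delta> where "0 < \<delta>"
    "\<And>l l'. \<bar>fst l - fst l'\<bar> \<le> \<delta> \<Longrightarrow> \<bar>snd l - snd l'\<bar> \<le> \<delta> \<Longrightarrow> \<bar>spec l - spec l'\<bar> \<le> \<epsilon>"
proof -
  obtain R :: nat where R: "(\<Sum>\<^sub>\<infinity>u\<in>- {u. near (int R) u 0}. \<bar>\<gamma> u\<bar>) < \<epsilon> / 4"
    using finite_tail[of "\<epsilon> / 4"] assms by auto
  define N where "N = {u. near (int R) u 0}"
  \<comment> \<open>The near lags then contribute at most \<open>\<epsilon> / 2\<close>, and the far
    ones at most twice \<open>\<epsilon> / 4\<close>; the added 1 avoids division by a vanishing
    \<open>total\<close>.\<close>
  define \<delta> where "\<delta> = \<epsilon> / (4 * (real R + 1) * (total + 1))"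
  have \<delta>: "0 < \<delta>" unfolding \<delta>_def using assms total_nonneg by simp
  have "\<bar>spec l - spec l'\<bar> \<le> \<epsilon>" if l: "\<bar>fst l - fst l'\<bar> \<le> \<delta>" "\<bar>snd l - snd l'\<bar> \<le> \<delta>" for l l'
  proof -
    let ?b = "\<lambda>u. \<gamma> u * cos (l \<bullet> rvec u) - \<gamma> u * cos (l' \<bullet> rvec u)"
    define b1 where "b1 u = (if u \<in> N then ?b u else 0)" for u
    define b2 where "b2 u = (if u \<in> N then 0 else ?b u)" for u
    have two: "\<bar>?b u\<bar> \<le> 2 * \<bar>\<gamma> u\<bar>" for u
      using spec_summand_le[of u "l \<bullet> rvec u"] spec_summand_le[of u "l' \<bullet> rvec u"] by linarith
    have le2: "\<bar>b2 u\<bar> \<le> 2 * \<bar>\<gamma> u\<bar>" for u using two[of u] by (simp add: b2_def)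
    have le1: "\<bar>b1 u\<bar> \<le> (2 * (real R + 1) * \<delta>) * \<bar>\<gamma> u\<bar>" for u
    proof (cases "u \<in> N")
      case True
      then have u: "\<bar>real_of_int (fst u)\<bar> \<le> real R + 1" "\<bar>real_of_int (snd u)\<bar> \<le> real R + 1"
        using of_int_le_iff[of "\<bar>fst u\<bar>" "int R", where 'a = real] of_int_le_iff[of "\<bar>snd u\<bar>" "int R", where 'a = real]
        by (auto simp: N_def near_def simp del: of_int_le_iff)
      have "l \<bullet> rvec u - l' \<bullet> rvec u = (fst l - fst l') * real_of_int (fst u) + (snd l - snd l') * real_of_int (snd u)"
        by (simp add: rvec_def inner_prod_def algebra_simps)
      also have "\<bar>\<dots>\<bar> \<le> \<bar>fst l - fst l'\<bar> * \<bar>real_of_int (fst u)\<bar> + \<bar>snd l - snd l'\<bar> * \<bar>real_of_int (snd u)\<bar>"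
        unfolding abs_mult[symmetric] by (rule abs_triangle_ineq)
      also have "\<dots> \<le> \<delta> * (real R + 1) + \<delta> * (real R + 1)" using l u \<delta> by (intro add_mono mult_mono) auto
      finally have "\<bar>cos (l \<bullet> rvec u) - cos (l' \<bullet> rvec u)\<bar> \<le> 2 * (real R + 1) * \<delta>"
        using cos_diff_le[of "l \<bullet> rvec u" "l' \<bullet> rvec u"] by (simp add: algebra_simps)
      then have "\<bar>\<gamma> u\<bar> * \<bar>cos (l \<bullet> rvec u) - cos (l' \<bullet> rvec u)\<bar> \<le> \<bar>\<gamma> u\<bar> * (2 * (real R + 1) * \<delta>)"
        by (rule mult_left_mono) simp
      moreover have "b1 u = \<gamma> u * (cos (l \<bullet> rvec u) - cos (l' \<bullet> rvec u))" using True by (simp add: b1_def right_diff_distrib)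
      ultimately show ?thesis by (simp add: abs_mult mult.commute)
    next
      case False
      then show ?thesis using \<delta> by (simp add: b1_def)
    qed
    have "spec l - spec l' = infsum ?b UNIV"
    proof -
      have "spec l = (\<Sum>\<^sub>\<infinity>u. \<gamma> u * cos (l' \<bullet> rvec u) + ?b u)" by (simp add: spec_def)
      also have "\<dots> = spec l' + infsum ?b UNIV"
        unfolding spec_def by (rule infsum_add[OF dominated_summable[OF spec_summand_le] dominated_summable[OF two]])
      finally show ?thesis by simp
    qed
    also have "\<dots> = infsum (\<lambda>u. b1 u + b2 u) UNIV" by (rule infsum_cong) (simp add: b1_def b2_def)
    also have "\<dots> = infsum b1 UNIV + infsum b2 UNIV"
      by (rule infsum_add[OF dominated_summable[OF le1] dominated_summable[OF le2]])
    also have "infsum b2 UNIV = infsum b2 (- N)" by (rule infsum_cong_neutral) (auto simp: b2_def)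
    finally have "\<bar>spec l - spec l'\<bar> \<le> \<bar>infsum b1 UNIV\<bar> + \<bar>infsum b2 (- N)\<bar>" by simp
    also have "\<dots> \<le> 2 * (real R + 1) * \<delta> * total + 2 * (\<epsilon> / 4)"
      using dominated_infsum_le[OF le1, of UNIV] dominated_infsum_le[OF le2, of "- N"] R
      unfolding total_def N_def by linarith
    also have "2 * (real R + 1) * \<delta> * total = \<epsilon> / 2 * (total / (total + 1))"
      unfolding \<delta>_def using total_nonneg by (simp add: divide_simps) (simp add: algebra_simps)
    also have "\<dots> \<le> \<epsilon> / 2" using assms total_nonneg by (intro mult_left_le) auto
    finally show ?thesis by simp
  qed
  with \<delta> show ?thesis by (rule that)
qed

lemma row_sum_le: "finite A \<Longrightarrow> (\<Sum>t\<in>A. \<bar>\<gamma> (t - s)\<bar>) \<le> total" "finite A \<Longrightarrow> (\<Sum>t\<in>A. \<bar>\<gamma> (s - t)\<bar>) \<le> total"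
proof -
  assume A: "finite A"
  have "(\<Sum>t\<in>A. \<bar>\<gamma> (t - s)\<bar>) = (\<Sum>u\<in>(\<lambda>t. t - s) ` A. \<bar>\<gamma> u\<bar>)"
    by (subst sum.reindex) (auto simp: inj_on_def)
  also have "\<dots> \<le> total" unfolding total_def using A by (intro finite_sum_le_infsum abs_summable) auto
  finally show "(\<Sum>t\<in>A. \<bar>\<gamma> (t - s)\<bar>) \<le> total" .
  have "(\<Sum>t\<in>A. \<bar>\<gamma> (s - t)\<bar>) = (\<Sum>u\<in>(\<lambda>t. s - t) ` A. \<bar>\<gamma> u\<bar>)"
    by (subst sum.reindex) (auto simp: inj_on_def)
  also have "\<dots> \<le> total" unfolding total_def using A by (intro finite_sum_le_infsum abs_summable) auto
  finally show "(\<Sum>t\<in>A. \<bar>\<gamma> (s - t)\<bar>) \<le> total" .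
qed

text \<open>Schur's test: every row and every column of the Toeplitz matrix has absolute sum at most
  \<open>total\<close>.\<close>

lemma toeplitz_form_le:
  assumes A: "finite A"
  shows "(\<Sum>s\<in>A. \<Sum>t\<in>A. a s * a t * \<gamma> (t - s)) \<le> total * (\<Sum>s\<in>A. (a s)\<^sup>2)"
proof -
  have "(\<Sum>s\<in>A. \<Sum>t\<in>A. a s * a t * \<gamma> (t - s)) \<le> (\<Sum>s\<in>A. \<Sum>t\<in>A. ((a s)\<^sup>2 / 2 * \<bar>\<gamma> (t - s)\<bar> + (a t)\<^sup>2 / 2 * \<bar>\<gamma> (t - s)\<bar>))"
  proof (intro sum_mono)
    fix s t
    have "a s * a t * \<gamma> (t - s) \<le> \<bar>a s * a t\<bar> * \<bar>\<gamma> (t - s)\<bar>" by (metis abs_ge_self abs_mult)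
    also have "\<dots> \<le> ((a s)\<^sup>2 / 2 + (a t)\<^sup>2 / 2) * \<bar>\<gamma> (t - s)\<bar>"
    proof (rule mult_right_mono)
      have "0 \<le> (\<bar>a s\<bar> - \<bar>a t\<bar>)\<^sup>2" by simp
      then show "\<bar>a s * a t\<bar> \<le> (a s)\<^sup>2 / 2 + (a t)\<^sup>2 / 2" by (simp add: power2_diff abs_mult)
    qed simp
    finally show "a s * a t * \<gamma> (t - s) \<le> (a s)\<^sup>2 / 2 * \<bar>\<gamma> (t - s)\<bar> + (a t)\<^sup>2 / 2 * \<bar>\<gamma> (t - s)\<bar>"
      by (simp add: distrib_right)
  qed
  also have "\<dots> = (\<Sum>s\<in>A. (a s)\<^sup>2 / 2 * (\<Sum>t\<in>A. \<bar>\<gamma> (t - s)\<bar>)) + (\<Sum>t\<in>A. (a t)\<^sup>2 / 2 * (\<Sum>s\<in>A. \<bar>\<gamma> (t - s)\<bar>))"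
    unfolding sum.distrib sum_distrib_left by (rule arg_cong2[where f = "(+)"], rule refl, rule sum.swap)
  also have "\<dots> \<le> (\<Sum>s\<in>A. (a s)\<^sup>2 / 2 * total) + (\<Sum>t\<in>A. (a t)\<^sup>2 / 2 * total)"
    using row_sum_le[OF A] by (intro add_mono sum_mono mult_left_mono) auto
  also have "\<dots> = total * (\<Sum>s\<in>A. (a s)\<^sup>2)" unfolding sum_distrib_left sum.distrib[symmetric] by (rule sum.cong) auto
  finally show ?thesis .
qed

text \<open>The expected power spectrum of the centred field, written through the covariances alone
  so that its limit is a deterministic statement.\<close>

definition mean_spectrum :: "nat \<times> nat \<Rightarrow> int \<times> int \<Rightarrow> real" where
  "mean_spectrum d k = (\<Sum>s\<in>rect d. \<Sum>t\<in>rect d. \<gamma> (t - s) * cos (freq d k \<bullet> rvec (s - t))) / vol d"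

lemma abs_mean_spectrum_le: "\<bar>mean_spectrum d k\<bar> \<le> total"
proof (cases "vol d = 0")
  case False
  then have v: "0 < vol d" using vol_nonneg[of d] by linarith
  have "\<bar>\<Sum>s\<in>rect d. \<Sum>t\<in>rect d. \<gamma> (t - s) * cos (freq d k \<bullet> rvec (s - t))\<bar> \<le> (\<Sum>s\<in>rect d. \<Sum>t\<in>rect d. \<bar>\<gamma> (t - s)\<bar>)"
    using spec_summand_le by (intro order_trans[OF sum_abs] sum_mono) auto
  also have "\<dots> \<le> (\<Sum>s\<in>rect d. total)" by (intro sum_mono row_sum_le) simp
  also have "\<dots> = vol d * total" by (simp add: card_rect)
  finally show ?thesis using v by (simp add: mean_spectrum_def pos_divide_le_eq mult.commute)
qed (simp add: mean_spectrum_def total_nonneg)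

lemma mean_spectrum_row:
  "\<bar>(\<Sum>t\<in>rect d. \<gamma> (t - s) * cos (freq d k \<bullet> rvec (s - t))) - spec (freq d k)\<bar>
    \<le> (\<Sum>\<^sub>\<infinity>u\<in>- ((\<lambda>t. t - s) ` rect d). \<bar>\<gamma> u\<bar>)"
proof -
  let ?B = "(\<lambda>t. t - s) ` rect d"
  let ?b = "\<lambda>u. \<gamma> u * cos (freq d k \<bullet> rvec u)"
  have "cos (freq d k \<bullet> rvec (s - t)) = cos (freq d k \<bullet> rvec (t - s))" for t
    by (metis cos_minus inner_minus_right minus_diff_eq rvec_diff)
  then have "(\<Sum>t\<in>rect d. \<gamma> (t - s) * cos (freq d k \<bullet> rvec (s - t))) = (\<Sum>u\<in>?B. ?b u)"
    by (subst sum.reindex) (auto simp: inj_on_def)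
  moreover have "spec (freq d k) = (\<Sum>u\<in>?B. ?b u) + infsum ?b (- ?B)"
  proof -
    have "infsum ?b (?B \<union> - ?B) = infsum ?b ?B + infsum ?b (- ?B)"
      by (rule infsum_Un_disjoint) (auto intro: dominated_summable[OF spec_summand_le])
    then show ?thesis by (simp add: spec_def)
  qed
  ultimately show ?thesis using dominated_infsum_le[OF spec_summand_le, where A = "- ?B"] by simp
qed

text \<open>A site at least \<open>R\<close> away from the boundary sees every lag up to
  \<open>R\<close>, so its row is close to the full series. The remaining sites are a fraction of at
  most \<open>2 * R\<close> over each side length, and there the crude bound \<open>total\<close>
  suffices. No estimate involves the frequency, hence the uniformity in \<open>k\<close>.\<close>

lemma mean_spectrum_tendsto:
  assumes sides: "filterlim (\<lambda>n. fst (d n)) at_top sequentially" "filterlim (\<lambda>n. snd (d n)) at_top sequentially"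
    and \<epsilon>: "0 < \<epsilon>"
  shows "\<forall>\<^sub>F n in sequentially. \<forall>k. \<bar>mean_spectrum (d n) k - spec (freq (d n) k)\<bar> \<le> \<epsilon>"
proof -
  obtain R :: nat where R: "(\<Sum>\<^sub>\<infinity>u\<in>- {u. near (int R) u 0}. \<bar>\<gamma> u\<bar>) < \<epsilon> / 2"
    using finite_tail[of "\<epsilon> / 2"] \<epsilon> by auto
  define B where "B n = total * (2 * real R / real (fst (d n)) + 2 * real R / real (snd (d n)))" for n
  have inv: "filterlim (\<lambda>n. real (fst (d n))) at_top sequentially" "filterlim (\<lambda>n. real (snd (d n))) at_top sequentially"
    using sides by (auto intro: filterlim_compose[OF filterlim_real_sequentially])
  have "(\<lambda>n. 2 * real R / real (fst (d n))) \<longlonglongrightarrow> 0" "(\<lambda>n. 2 * real R / real (snd (d n))) \<longlonglongrightarrow> 0"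
    using inv by (auto intro!: real_tendsto_divide_at_top[OF tendsto_const])
  then have "B \<longlonglongrightarrow> total * (0 + 0)" unfolding B_def[abs_def] by (intro tendsto_intros)
  then have "B \<longlonglongrightarrow> 0" by simp
  then have e1: "\<forall>\<^sub>F n in sequentially. B n < \<epsilon> / 2" by (rule order_tendstoD) (use \<epsilon> in simp)
  have e2: "\<forall>\<^sub>F n in sequentially. 2 * R < fst (d n)" "\<forall>\<^sub>F n in sequentially. 2 * R < snd (d n)"
    using sides[unfolded filterlim_at_top, rule_format, of "2 * R + 1"] by (auto elim: eventually_mono)
  show ?thesis using e1 e2
  proof eventually_elim
    case (elim n)
    then have pos: "0 < fst (d n)" "0 < snd (d n)" by auto
    note v = vol_pos[OF pos]
    define C where "C = {int R + 1..int (fst (d n)) - int R} \<times> {int R + 1..int (snd (d n)) - int R}"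
    have C: "C \<subseteq> rect (d n)" unfolding C_def rect_def by auto
    have card: "real (card (rect (d n) - C)) \<le> 2 * real R * real (snd (d n)) + 2 * real R * real (fst (d n))"
    proof -
      have "real (card C) = (real (fst (d n)) - 2 * real R) * (real (snd (d n)) - 2 * real R)"
        unfolding C_def using elim by (simp add: card_cartesian_product of_nat_diff)
      then have "real (card (rect (d n) - C)) = vol (d n) - (real (fst (d n)) - 2 * real R) * (real (snd (d n)) - 2 * real R)"
        using C card_mono[OF finite_rect C] by (simp add: card_Diff_subset finite_subset[OF C] of_nat_diff card_rect)
      also have "\<dots> \<le> 2 * real R * real (snd (d n)) + 2 * real R * real (fst (d n))" by (simp add: vol_def algebra_simps)
      finally show ?thesis .
    qed
    show ?case
    proof
      fix k
      let ?r = "\<lambda>s. (\<Sum>t\<in>rect (d n). \<gamma> (t - s) * cos (freq (d n) k \<bullet> rvec (s - t)))"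
      have row: "\<bar>?r s - spec (freq (d n) k)\<bar> \<le> \<epsilon> / 2 + total * of_bool (s \<notin> C)" for s
      proof (cases "s \<in> C")
        case True
        have "- ((\<lambda>t. t - s) ` rect (d n)) \<subseteq> - {u. near (int R) u 0}"
        proof (rule Compl_anti_mono, rule subsetI)
          fix u assume u: "u \<in> {u. near (int R) u 0}"
          have "s + u \<in> rect (d n)"
            using True u unfolding C_def near_def rect_def by (cases s; cases u) auto
          then show "u \<in> (\<lambda>t. t - s) ` rect (d n)" by (rule rev_image_eqI) simp
        qed
        then have "(\<Sum>\<^sub>\<infinity>u\<in>- ((\<lambda>t. t - s) ` rect (d n)). \<bar>\<gamma> u\<bar>) \<le> (\<Sum>\<^sub>\<infinity>u\<in>- {u. near (int R) u 0}. \<bar>\<gamma> u\<bar>)"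
          by (intro infsum_mono2 abs_summable_sub) auto
        then show ?thesis using mean_spectrum_row[where d = "d n" and s = s and k = k] R True by simp
      next
        case False
        have "\<bar>?r s - spec (freq (d n) k)\<bar> \<le> total"
          by (rule order_trans[OF mean_spectrum_row infsum_abs_le_total])
        then show ?thesis using False \<epsilon> by simp
      qed
      have "mean_spectrum (d n) k - spec (freq (d n) k) = (\<Sum>s\<in>rect (d n). ?r s - spec (freq (d n) k)) / vol (d n)"
        using v by (simp add: mean_spectrum_def sum_subtractf card_rect diff_divide_distrib)
      also have "\<bar>\<dots>\<bar> \<le> (\<Sum>s\<in>rect (d n). \<epsilon> / 2 + total * of_bool (s \<notin> C)) / vol (d n)"
        using v row by (simp add: divide_right_mono order_trans[OF sum_abs sum_mono])
      also have "(\<Sum>s\<in>rect (d n). \<epsilon> / 2 + total * of_bool (s \<notin> C)) = vol (d n) * (\<epsilon> / 2) + total * real (card (rect (d n) - C))"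
      proof -
        have "rect (d n) - C = {s \<in> rect (d n). s \<notin> C}" by blast
        then show ?thesis by (simp add: sum.distrib card_rect sum_distrib_left[symmetric] sum_of_bool_eq Int_def)
      qed
      also have "(vol (d n) * (\<epsilon> / 2) + total * real (card (rect (d n) - C))) / vol (d n)
          \<le> (vol (d n) * (\<epsilon> / 2) + total * (2 * real R * real (snd (d n)) + 2 * real R * real (fst (d n)))) / vol (d n)"
        using v card total_nonneg by (intro divide_right_mono add_left_mono mult_left_mono) auto
      also have "\<dots> = \<epsilon> / 2 + B n"
        unfolding B_def vol_def using pos by (simp add: field_simps)
      also have "\<dots> \<le> \<epsilon>" using elim by simp
      finally show "\<bar>mean_spectrum (d n) k - spec (freq (d n) k)\<bar> \<le> \<epsilon>" .
    qed
  qed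
qed

end

lemma spectral_density_eq:
  assumes "(\<lambda>j. \<bar>autocov M V j\<bar>) summable_on UNIV"
  shows "4 * pi\<^sup>2 * spectral_density M V l = (\<Sum>\<^sub>\<infinity>u. autocov M V u * cos (l \<bullet> rvec u))"
proof -
  let ?z = "\<lambda>j. exp (- \<i> * complex_of_real (l \<bullet> rvec j)) * complex_of_real (autocov M V j)"
  have s: "?z summable_on UNIV"
    by (rule abs_summable_summable) (use assms in \<open>simp add: norm_mult\<close>)
  have "spectral_density M V l = 1 / (4 * pi\<^sup>2) * Re (infsum ?z UNIV)"
  proof -
    have "1 / (4 * complex_of_real pi ^ 2) = complex_of_real (1 / (4 * pi\<^sup>2))" by simp
    then show ?thesis unfolding spectral_density_def by (simp only: times_complex.sel Re_complex_of_real Im_complex_of_real mult_zero_left diff_zero)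
  qed
  also have "Re (infsum ?z UNIV) = (\<Sum>\<^sub>\<infinity>j. Re (?z j))" by (rule infsum_Re[OF s, symmetric])
  also have "\<dots> = (\<Sum>\<^sub>\<infinity>u. autocov M V u * cos (l \<bullet> rvec u))"
    by (rule infsum_cong) (simp add: Re_exp mult.commute)
  finally show ?thesis by simp
qed

section \<open>Smoothed spectra\<close>

locale smoothed_spectrum = block_expansion M e U c v r C0 W + summable_autocovariance \<gamma>
  for M :: "'a measure" and e U c v r C0 W \<gamma> +
  fixes V :: "int \<times> int \<Rightarrow> 'a \<Rightarrow> real" and \<mu> :: real and d :: "nat \<Rightarrow> nat \<times> nat" and h :: "nat \<Rightarrow> real \<times> real"
    and K :: "real \<times> real \<Rightarrow> real" and L :: real
  assumes V_def: "V = (\<lambda>t \<omega>. W t \<omega> + \<mu>)"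
    and W_int: "integrable M (W t)"
    and W_cov: "expectation (\<lambda>\<omega>. W s \<omega> * W t \<omega>) = \<gamma> (t - s)"
    and sides: "filterlim (\<lambda>n. fst (d n)) at_top sequentially" "filterlim (\<lambda>n. snd (d n)) at_top sequentially"
    and h0: "(\<lambda>n. fst (h n)) \<longlonglongrightarrow> 0" "(\<lambda>n. snd (h n)) \<longlonglongrightarrow> 0"
    and hd: "filterlim (\<lambda>n. fst (h n) * real (fst (d n))) at_top sequentially"
            "filterlim (\<lambda>n. snd (h n) * real (snd (d n))) at_top sequentially"
    and rate: "(\<lambda>n. 1 / (abs_prod (h n) ^ 4 * vol (d n))) \<longlonglongrightarrow> 0"
    and K0: "\<And>x. 0 \<le> K x" and K_int: "has_plane_integral K 1"
    and riem: "(\<lambda>n. 4 * pi\<^sup>2 / (abs_prod (h n) * vol (d n)) *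
                  (\<Sum>\<^sub>\<infinity>j. scaled_kernel K (h n) (freq (d n) j))) \<longlonglongrightarrow> 1"
    and L: "0 < L"
    and lip: "\<forall>\<^sub>F n in sequentially. \<forall>s t. abs_prod (h n) powr (3/2) *
                 \<bar>periodized_kernel K (h n) (freq (d n) s) - periodized_kernel K (h n) (freq (d n) t)\<bar>
               \<le> L * max_norm (freq (d n) s - freq (d n) t)"
begin

definition P :: "nat \<Rightarrow> int \<times> int \<Rightarrow> real" where "P n = periodize (d n) (weight K (d n) (h n))"

definition Cp :: real where "Cp = 8 + 32 * pi\<^sup>2 * (8 * pi\<^sup>2 * L)\<^sup>2"

text \<open>The deterministic conditions valid for all large \<open>n\<close>, bundled so that
  estimates can be stated for a single index.\<close>

definition good :: "nat \<Rightarrow> bool" where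
  "good n \<longleftrightarrow> 0 < fst (d n) \<and> 0 < snd (d n) \<and> 0 < fst (h n) \<and> 0 < snd (h n) \<and> abs_prod (h n) \<le> 1 \<and>
    1 / 2 < 4 * pi\<^sup>2 / (abs_prod (h n) * vol (d n)) * (\<Sum>\<^sub>\<infinity>j. scaled_kernel K (h n) (freq (d n) j)) \<and>
    (\<forall>s t. abs_prod (h n) powr (3/2) *
       \<bar>periodized_kernel K (h n) (freq (d n) s) - periodized_kernel K (h n) (freq (d n) t)\<bar>
       \<le> L * max_norm (freq (d n) s - freq (d n) t))"

section \<open>Eventual conditions and estimates for the folded weights\<close>

lemma Cp_pos: "0 < Cp"
proof -
  have "0 \<le> 32 * pi\<^sup>2 * (8 * pi\<^sup>2 * L)\<^sup>2" by simp
  then show ?thesis unfolding Cp_def by linarith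
qed

lemma sides_ge: "\<forall>\<^sub>F n in sequentially. m \<le> fst (d n)" "\<forall>\<^sub>F n in sequentially. m \<le> snd (d n)"
  using sides unfolding filterlim_at_top by blast+

lemma eventually_good: "\<forall>\<^sub>F n in sequentially. good n"
proof -
  have e: "\<forall>\<^sub>F n in sequentially. 1 \<le> fst (h n) * real (fst (d n))" "\<forall>\<^sub>F n in sequentially. 1 \<le> snd (h n) * real (snd (d n))"
    using hd unfolding filterlim_at_top by blast+
  have f: "\<forall>\<^sub>F n in sequentially. fst (h n) < 1" "\<forall>\<^sub>F n in sequentially. snd (h n) < 1"
    using h0 by (auto intro: order_tendstoD)
  have g: "\<forall>\<^sub>F n in sequentially. 1 / 2 < 4 * pi\<^sup>2 / (abs_prod (h n) * vol (d n)) * (\<Sum>\<^sub>\<infinity>j. scaled_kernel K (h n) (freq (d n) j))"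
    by (rule order_tendstoD(1)[OF riem]) simp
  show ?thesis using sides_ge[of 1] e f g lip
  proof eventually_elim
    case (elim n)
    \<comment> \<open>The bandwidth is a real vector; its components are eventually positive because
      their products with the side lengths are.\<close>
    have p: "0 < fst (h n)" "0 < snd (h n)"
      using elim(1-4) by (auto intro: zero_less_mult_pos2[of _ "real (fst (d n))"] zero_less_mult_pos2[of _ "real (snd (d n))"])
    have "abs_prod (h n) \<le> 1 * 1" unfolding abs_prod_def using p elim(5,6) by (intro mult_mono) auto
    then have "abs_prod (h n) \<le> 1" by simp
    moreover have "0 < fst (d n)" "0 < snd (d n)" using elim(1,2) by linarith+
    ultimately show ?case unfolding good_def using p elim(7,8) by (intro conjI) assumption+
  qed
qed

lemma goodD:
  assumes "good n"
  shows "0 < fst (d n)" "0 < snd (d n)" "0 < fst (h n)" "0 < snd (h n)" "abs_prod (h n) \<le> 1"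
    "0 < abs_prod (h n)" "0 < vol (d n)"
  using assms abs_prod_pos vol_pos unfolding good_def by blast+

lemma P_facts:
  assumes g: "good n"
  shows "weight K (d n) (h n) summable_on UNIV" "infsum (weight K (d n) (h n)) UNIV = 1"
    "0 \<le> P n u" "(\<Sum>k\<in>rect (d n). P n (k - j)) = 1"
    "\<bar>P n u - P n w\<bar> \<le> 8 * pi\<^sup>2 * L * abs_prod (h n) powr (- 3/2) / vol (d n) * max_norm (freq (d n) u - freq (d n) w)"
    "P n u \<le> Cp / (abs_prod (h n) * vol (d n))"
proof -
  have S: "1 / 2 < 4 * pi\<^sup>2 / (abs_prod (h n) * vol (d n)) * (\<Sum>\<^sub>\<infinity>j. scaled_kernel K (h n) (freq (d n) j))"
    and l: "\<And>s t. abs_prod (h n) powr (3/2) *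
       \<bar>periodized_kernel K (h n) (freq (d n) s) - periodized_kernel K (h n) (freq (d n) t)\<bar>
       \<le> L * max_norm (freq (d n) s - freq (d n) t)"
    using g unfolding good_def by blast+
  note b = periodized_weight_bounds[OF goodD(1-5)[OF g] K0 L S l]
  show "weight K (d n) (h n) summable_on UNIV" "infsum (weight K (d n) (h n)) UNIV = 1"
    "0 \<le> P n u" "(\<Sum>k\<in>rect (d n). P n (k - j)) = 1"
    "\<bar>P n u - P n w\<bar> \<le> 8 * pi\<^sup>2 * L * abs_prod (h n) powr (- 3/2) / vol (d n) * max_norm (freq (d n) u - freq (d n) w)"
    "P n u \<le> Cp / (abs_prod (h n) * vol (d n))"
    unfolding P_def Cp_def by (rule b)+
qed

lemma smooth_eq:
  assumes "good n" "periodic (d n) \<phi>"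
  shows "(\<Sum>\<^sub>\<infinity>s. weight K (d n) (h n) s * \<phi> (j + s)) = (\<Sum>k\<in>rect (d n). P n (k - j) * \<phi> k)"
  unfolding P_def by (rule infsum_mult_periodic_shift[OF goodD(1,2)[OF assms(1)] assms(2) P_facts(1)[OF assms(1)]])

lemma sum_P_sq_le:
  assumes g: "good n"
  shows "(\<Sum>k\<in>rect (d n). (P n (k - j))\<^sup>2) \<le> Cp / (abs_prod (h n) * vol (d n))"
proof -
  have "(\<Sum>k\<in>rect (d n). (P n (k - j))\<^sup>2) \<le> (\<Sum>k\<in>rect (d n). P n (k - j) * (Cp / (abs_prod (h n) * vol (d n))))"
    unfolding power2_eq_square by (intro sum_mono mult_left_mono P_facts(3,6)[OF g])
  also have "\<dots> = Cp / (abs_prod (h n) * vol (d n))" unfolding sum_distrib_right[symmetric] P_facts(4)[OF g] by simp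
  finally show ?thesis .
qed

text \<open>One period contains at most one frequency of \<open>zero_freqs\<close>, so the whole
  contribution is a single maximal weight times \<open>B\<close>.\<close>

lemma sum_P_zero_freqs_le:
  assumes g: "good n" and b: "\<And>k. \<bar>b k\<bar> \<le> B"
  shows "\<bar>\<Sum>k\<in>rect (d n). P n (k - j) * (if k \<in> zero_freqs (d n) then b k else 0)\<bar> \<le> Cp / (abs_prod (h n) * vol (d n)) * B"
proof -
  let ?C = "Cp / (abs_prod (h n) * vol (d n))"
  have B: "0 \<le> B" using b[of 0] by linarith
  have C: "0 \<le> ?C" using P_facts(3,6)[OF g, of 0] by linarith
  have "(\<Sum>k\<in>rect (d n). P n (k - j) * (if k \<in> zero_freqs (d n) then b k else 0)) = (\<Sum>k\<in>rect (d n) \<inter> zero_freqs (d n). P n (k - j) * b k)"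
    by (subst sum.inter_restrict) (auto intro!: sum.cong)
  also have "\<bar>\<dots>\<bar> \<le> (\<Sum>k\<in>rect (d n) \<inter> zero_freqs (d n). ?C * B)"
  proof (intro order_trans[OF sum_abs] sum_mono)
    fix k show "\<bar>P n (k - j) * b k\<bar> \<le> ?C * B"
      unfolding abs_mult abs_of_nonneg[OF P_facts(3)[OF g]] by (intro mult_mono P_facts[OF g] b C) simp
  qed
  also have "\<dots> = real (card (rect (d n) \<inter> zero_freqs (d n))) * (?C * B)" by simp
  also have "\<dots> \<le> 1 * (?C * B)" using card_rect_zero_freqs[of "d n"] by (intro mult_right_mono mult_nonneg_nonneg[OF C B]) simp
  finally show ?thesis by simp
qed

text \<open>The second limit is for the mean of the field, which puts
  \<open>\<mu> * sqrt (vol d)\<close> into the zero-frequency coefficient. With H \<le> 1 the factor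
  1/(H sqrt vol) is at most 1/(H^2 sqrt vol), the square root of the quantity in
  \<open>rate\<close>.\<close>

lemma max_weight_tendsto: "(\<lambda>n. Cp / (abs_prod (h n) * vol (d n)) * B) \<longlonglongrightarrow> 0"
  "(\<lambda>n. Cp / (abs_prod (h n) * vol (d n)) * (B * sqrt (vol (d n)))) \<longlonglongrightarrow> 0"
proof -
  have "(\<lambda>n. sqrt (1 / (abs_prod (h n) ^ 4 * vol (d n)))) \<longlonglongrightarrow> sqrt 0" by (intro tendsto_real_sqrt rate)
  then have lim: "(\<lambda>n. Cp * \<bar>B\<bar> * sqrt (1 / (abs_prod (h n) ^ 4 * vol (d n)))) \<longlonglongrightarrow> 0"
    by (auto intro: tendsto_mult_right_zero)
  have key: "\<forall>\<^sub>F n in sequentially. norm (Cp / (abs_prod (h n) * vol (d n)) * (B * sqrt (vol (d n)))) \<le> Cp * \<bar>B\<bar> * sqrt (1 / (abs_prod (h n) ^ 4 * vol (d n)))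
     \<and> norm (Cp / (abs_prod (h n) * vol (d n)) * B) \<le> norm (Cp / (abs_prod (h n) * vol (d n)) * (B * sqrt (vol (d n))))"
    using eventually_good
  proof eventually_elim
    case (elim n)
    note g = goodD[OF elim]
    define H w where "H = abs_prod (h n)" and "w = sqrt (vol (d n))"
    have H: "0 < H" "H \<le> 1" and v: "vol (d n) = w * w" and w: "0 < w" using g by (auto simp: H_def w_def)
    have "1 \<le> vol (d n)" unfolding vol_def using g(1,2) by (intro mult_ge1_I) auto
    then have w1: "1 \<le> w" by (simp add: w_def)
    have "sqrt (1 / (H ^ 4 * vol (d n))) = 1 / (H\<^sup>2 * w)"
    proof (rule real_sqrt_unique)
      show "(1 / (H\<^sup>2 * w))\<^sup>2 = 1 / (H ^ 4 * vol (d n))" by (simp add: v power2_eq_square power4_eq_xxxx mult_ac)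
    qed (use w in simp)
    moreover have "1 / (H * w) \<le> 1 / (H\<^sup>2 * w)"
    proof (rule divide_left_mono)
      show "H\<^sup>2 * w \<le> H * w" using H w by (intro mult_right_mono) (auto simp: power2_eq_square mult_left_le)
    qed (use H w in auto)
    ultimately have "1 / (H * w) \<le> sqrt (1 / (H ^ 4 * vol (d n)))" by simp
    then have 1: "Cp * \<bar>B\<bar> * (1 / (H * w)) \<le> Cp * \<bar>B\<bar> * sqrt (1 / (H ^ 4 * vol (d n)))"
      using Cp_pos by (intro mult_left_mono) auto
    have 2: "norm (Cp / (H * vol (d n)) * (B * w)) = Cp * \<bar>B\<bar> * (1 / (H * w))"
      using H w Cp_pos by (simp add: v abs_mult)
    have 3: "norm (Cp / (H * vol (d n)) * B) \<le> norm (Cp / (H * vol (d n)) * B) * w"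
      using mult_left_mono[OF w1 norm_ge_zero[of "Cp / (H * vol (d n)) * B"]] by (simp only: mult_1_right)
    have 4: "norm (Cp / (H * vol (d n)) * (B * w)) = norm (Cp / (H * vol (d n)) * B) * w"
      unfolding mult.assoc[symmetric] norm_mult using w by simp
    show ?case
      unfolding H_def[symmetric] w_def[symmetric] using 1 2 3 4 by (intro conjI) linarith+
  qed
  show a: "(\<lambda>n. Cp / (abs_prod (h n) * vol (d n)) * (B * sqrt (vol (d n)))) \<longlonglongrightarrow> 0"
    by (rule Lim_null_comparison[OF _ lim]) (use key in \<open>auto elim: eventually_mono\<close>)
  show "(\<lambda>n. Cp / (abs_prod (h n) * vol (d n)) * B) \<longlonglongrightarrow> 0"
    by (rule Lim_null_comparison[OF _ tendsto_norm_zero[OF a]]) (use key in \<open>auto elim: eventually_mono\<close>)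
qed

section \<open>From exceedance probabilities to stochastic orders\<close>

lemma exceeds_sets:
  fixes F :: "int \<times> int \<Rightarrow> 'a \<Rightarrow> real"
  assumes "\<And>j. F j \<in> borel_measurable M"
  shows "{\<omega> \<in> space M. \<exists>j\<in>rect D. s < F j \<omega>} \<in> sets M"
proof -
  note [measurable] = assms
  have "{\<omega> \<in> space M. \<exists>j\<in>rect D. s < F j \<omega>} = (\<Union>j\<in>rect D. {\<omega> \<in> space M. s < F j \<omega>})" by blast
  also have "\<dots> \<in> sets M" by (rule sets.finite_UN[OF finite_rect]) measurable
  finally show ?thesis .
qed

lemma prob_tendsto_mono:
  assumes "\<forall>\<^sub>F n in sequentially. A n \<subseteq> B n" "\<And>n. B n \<in> sets M" "(\<lambda>n. prob (B n)) \<longlonglongrightarrow> 0"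
  shows "(\<lambda>n. prob (A n)) \<longlonglongrightarrow> 0"
proof (rule tendsto_sandwich[OF _ _ tendsto_const assms(3)])
  show "\<forall>\<^sub>F n in sequentially. prob (A n) \<le> prob (B n)"
    using assms(1) by eventually_elim (intro finite_measure_mono assms(2))
qed simp

lemma exceeds_mono:
  fixes F F' :: "nat \<Rightarrow> int \<times> int \<Rightarrow> 'a \<Rightarrow> real"
  assumes "\<And>n j. F' n j \<in> borel_measurable M"
    and "\<forall>\<^sub>F n in sequentially. \<forall>j \<omega>. s < F n j \<omega> \<longrightarrow> s' < F' n j \<omega>"
    and "(\<lambda>n. prob {\<omega> \<in> space M. \<exists>j\<in>rect (d n). s' < F' n j \<omega>}) \<longlonglongrightarrow> 0"
  shows "(\<lambda>n. prob {\<omega> \<in> space M. \<exists>j\<in>rect (d n). s < F n j \<omega>}) \<longlonglongrightarrow> 0"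
proof (rule prob_tendsto_mono[OF _ exceeds_sets[OF assms(1)] assms(3)])
  show "\<forall>\<^sub>F n in sequentially. {\<omega> \<in> space M. \<exists>j\<in>rect (d n). s < F n j \<omega>} \<subseteq> {\<omega> \<in> space M. \<exists>j\<in>rect (d n). s' < F' n j \<omega>}"
    using assms(2) by eventually_elim blast
qed

lemma SUP_measurable:
  fixes F :: "int \<times> int \<Rightarrow> 'a \<Rightarrow> real"
  assumes "\<And>j. F j \<in> borel_measurable M"
  shows "(\<lambda>\<omega>. SUP j\<in>half_set D. F j \<omega>) \<in> borel_measurable M"
  by (rule borel_measurable_cSUP) (auto intro: countable_finite assms)

lemma eventually_half_set: "\<forall>\<^sub>F n in sequentially. half_set (d n) \<noteq> {} \<and> half_set (d n) \<subseteq> rect (d n)"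
  using sides_ge[of 4]
proof eventually_elim
  case (elim n)
  then have "0 < fst (d n)" "0 < snd (d n)" by linarith+
  then show ?case using half_set_nonempty[OF elim] half_set_subset by blast
qed

text \<open>The remainder is the positive part of the excess over \<open>s\<close>. Once
  \<open>half_set\<close> is nonempty and contained in the rectangle, it is nonzero only on the
  exceedance event in \<open>lim\<close>.\<close>

lemma le_plus_op1I:
  fixes F :: "nat \<Rightarrow> int \<times> int \<Rightarrow> 'a \<Rightarrow> real"
  assumes F: "\<And>n j. F n j \<in> borel_measurable M"
    and lim: "(\<lambda>n. prob {\<omega> \<in> space M. \<exists>j\<in>rect (d n). s < F n j \<omega>}) \<longlonglongrightarrow> 0"
  shows "le_plus_op1 M (\<lambda>n \<omega>. SUP j\<in>half_set (d n). F n j \<omega>) s"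
  unfolding le_plus_op1_def
proof (intro exI conjI allI ballI)
  let ?S = "\<lambda>n \<omega>. SUP j\<in>half_set (d n). F n j \<omega>"
  show "is_op1 M (\<lambda>n \<omega>. max 0 (?S n \<omega> - s))" unfolding is_op1_def
  proof (intro conjI allI impI)
    note [measurable] = SUP_measurable[OF F]
    show "(\<lambda>\<omega>. max 0 (?S n \<omega> - s)) \<in> borel_measurable M" for n by measurable
    fix \<epsilon> :: real assume \<epsilon>: "0 < \<epsilon>"
    show "(\<lambda>n. prob {\<omega> \<in> space M. \<bar>max 0 (?S n \<omega> - s)\<bar> > \<epsilon>}) \<longlonglongrightarrow> 0"
    proof (rule prob_tendsto_mono[OF _ exceeds_sets[OF F] lim])
      show "\<forall>\<^sub>F n in sequentially. {\<omega> \<in> space M. \<bar>max 0 (?S n \<omega> - s)\<bar> > \<epsilon>} \<subseteq> {\<omega> \<in> space M. \<exists>j\<in>rect (d n). s < F n j \<omega>}"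
        using eventually_half_set
      proof eventually_elim
        case (elim n)
        show ?case
        proof
          fix \<omega> assume "\<omega> \<in> {\<omega> \<in> space M. \<bar>max 0 (?S n \<omega> - s)\<bar> > \<epsilon>}"
          then have w: "\<omega> \<in> space M" "s < ?S n \<omega>" using \<epsilon> by (auto simp: max_def split: if_splits)
          then obtain j where "j \<in> half_set (d n)" "s < F n j \<omega>"
            using less_cSUP_iff[of "half_set (d n)" "\<lambda>j. F n j \<omega>" s] elim by auto
          then show "\<omega> \<in> {\<omega> \<in> space M. \<exists>j\<in>rect (d n). s < F n j \<omega>}" using w elim by blast
        qed
      qed
    qed
  qed
  show "?S n \<omega> \<le> s + max 0 (?S n \<omega> - s)" for n \<omega> by simp
qed

lemma is_op1I:
  fixes F :: "nat \<Rightarrow> int \<times> int \<Rightarrow> 'a \<Rightarrow> real"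
  assumes F: "\<And>n j. F n j \<in> borel_measurable M" and nonneg: "\<And>n j \<omega>. 0 \<le> F n j \<omega>"
    and lim: "\<And>\<eta>. 0 < \<eta> \<Longrightarrow> (\<lambda>n. prob {\<omega> \<in> space M. \<exists>j\<in>rect (d n). \<eta> < F n j \<omega>}) \<longlonglongrightarrow> 0"
  shows "is_op1 M (\<lambda>n \<omega>. SUP j\<in>half_set (d n). F n j \<omega>)"
  unfolding is_op1_def
proof (intro conjI allI impI)
  let ?S = "\<lambda>n \<omega>. SUP j\<in>half_set (d n). F n j \<omega>"
  show "?S n \<in> borel_measurable M" for n by (rule SUP_measurable[OF F])
  fix \<epsilon> :: real assume \<epsilon>: "0 < \<epsilon>"
  show "(\<lambda>n. prob {\<omega> \<in> space M. \<bar>?S n \<omega>\<bar> > \<epsilon>}) \<longlonglongrightarrow> 0"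
  proof (rule prob_tendsto_mono[OF _ exceeds_sets[OF F] lim[OF \<epsilon>]])
    show "\<forall>\<^sub>F n in sequentially. {\<omega> \<in> space M. \<bar>?S n \<omega>\<bar> > \<epsilon>} \<subseteq> {\<omega> \<in> space M. \<exists>j\<in>rect (d n). \<epsilon> < F n j \<omega>}"
      using eventually_half_set
    proof eventually_elim
      case (elim n)
      show ?case
      proof
        fix \<omega> assume w: "\<omega> \<in> {\<omega> \<in> space M. \<bar>?S n \<omega>\<bar> > \<epsilon>}"
        obtain i where "i \<in> half_set (d n)" using elim by blast
        then have "F n i \<omega> \<le> ?S n \<omega>" by (intro cSUP_upper bdd_above_finite) auto
        then have "\<epsilon> < ?S n \<omega>" using w nonneg[of n i \<omega>] by auto
        then obtain j where "j \<in> half_set (d n)" "\<epsilon> < F n j \<omega>"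
          using less_cSUP_iff[of "half_set (d n)" "\<lambda>j. F n j \<omega>" \<epsilon>] elim by auto
        then show "\<omega> \<in> {\<omega> \<in> space M. \<exists>j\<in>rect (d n). \<epsilon> < F n j \<omega>}" using w elim by blast
      qed
    qed
  qed
qed

section \<open>Second-order structure of the centred field\<close>

lemma WW_int [simp]: "integrable M (\<lambda>\<omega>. W s \<omega> * W t \<omega>)"
  using quadratic_form_variance(1)[of "{(s, t)}" "\<lambda>_. 1"] by simp

lemma pspec_integrable_expectation:
  shows pspec_integrable: "integrable M (\<lambda>\<omega>. pspec D (\<lambda>t. W t \<omega>) k)"
    and pspec_expectation: "expectation (\<lambda>\<omega>. pspec D (\<lambda>t. W t \<omega>) k) = mean_spectrum D k"
  unfolding pspec_def power_spectrum_eq mean_spectrum_def by (simp_all add: W_cov)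

lemma mean_spectrum_nonneg: "0 \<le> mean_spectrum D k"
  unfolding pspec_expectation[symmetric] by (rule integral_nonneg_AE) simp

lemma sum_mean_spectrum:
  assumes D: "0 < fst D" "0 < snd D"
  shows "(\<Sum>k\<in>rect D. mean_spectrum D k) = vol D * \<gamma> 0"
proof -
  have "(\<Sum>k\<in>rect D. mean_spectrum D k) = expectation (\<lambda>\<omega>. \<Sum>k\<in>rect D. pspec D (\<lambda>t. W t \<omega>) k)"
    by (simp add: pspec_integrable pspec_expectation)
  also have "\<dots> = expectation (\<lambda>\<omega>. \<Sum>t\<in>rect D. W t \<omega> * W t \<omega>)"
    unfolding pspec_def parseval[OF D] by (simp add: power2_eq_square)
  also have "\<dots> = (\<Sum>t\<in>rect D. \<gamma> 0)" by (simp add: W_cov)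
  finally show ?thesis by (simp add: card_rect)
qed

lemma linear_form_variance:
  assumes A: "finite A"
  shows "integrable M (\<lambda>\<omega>. (\<Sum>t\<in>A. a t * W t \<omega>)\<^sup>2)"
    "expectation (\<lambda>\<omega>. (\<Sum>t\<in>A. a t * W t \<omega>)\<^sup>2) \<le> total * (\<Sum>t\<in>A. (a t)\<^sup>2)"
proof -
  have eq: "(\<Sum>t\<in>A. a t * W t \<omega>)\<^sup>2 = (\<Sum>s\<in>A. \<Sum>t\<in>A. a s * a t * (W s \<omega> * W t \<omega>))" for \<omega>
    unfolding power2_eq_square sum_product by (intro sum.cong refl) (simp add: mult_ac)
  show "integrable M (\<lambda>\<omega>. (\<Sum>t\<in>A. a t * W t \<omega>)\<^sup>2)" unfolding eq by simp
  show "expectation (\<lambda>\<omega>. (\<Sum>t\<in>A. a t * W t \<omega>)\<^sup>2) \<le> total * (\<Sum>t\<in>A. (a t)\<^sup>2)"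
    unfolding eq using toeplitz_form_le[OF A, of a] by (simp add: W_cov)
qed

lemma smoothed_tendsto:
  fixes G :: "nat \<Rightarrow> int \<times> int \<Rightarrow> 'a \<Rightarrow> real"
  assumes int: "\<And>n k. good n \<Longrightarrow> integrable M (G n k)"
    and mm1: "\<And>n. good n \<Longrightarrow> (\<Sum>k\<in>rect (d n). expectation (\<lambda>\<omega>. \<bar>G n k \<omega>\<bar>)) \<le> mm * vol (d n)"
    and mm2: "\<And>n j. good n \<Longrightarrow> integrable M (\<lambda>\<omega>. (\<Sum>k\<in>rect (d n). P n (k - j) * G n k \<omega>)\<^sup>2)"
      "\<And>n j. good n \<Longrightarrow> expectation (\<lambda>\<omega>. (\<Sum>k\<in>rect (d n). P n (k - j) * G n k \<omega>)\<^sup>2) \<le> cc / (abs_prod (h n) * vol (d n))"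
    and cc0: "0 \<le> cc" and \<eta>: "0 < \<eta>"
  shows "(\<lambda>n. prob {\<omega> \<in> space M. \<exists>j\<in>rect (d n). \<eta> < \<bar>\<Sum>k\<in>rect (d n). P n (k - j) * G n k \<omega>\<bar>}) \<longlonglongrightarrow> 0"
\<comment> \<open>Chaining uses one constant for the Lipschitz bound and for the variance; the sum
  of the two serves both.\<close>
proof (rule uniform_chaining[where c = "8 * pi\<^sup>2 * L + cc" and H = "\<lambda>n. abs_prod (h n)"])
  show "0 < 8 * pi\<^sup>2 * L + cc" using L cc0 by (intro add_pos_nonneg) auto
  show "\<forall>\<^sub>F n in sequentially. 0 < fst (d n) \<and> 0 < snd (d n) \<and> 0 < abs_prod (h n) \<and> abs_prod (h n) \<le> 1 \<and>
      (\<forall>u v. \<bar>P n u - P n v\<bar> \<le> (8 * pi\<^sup>2 * L + cc) * abs_prod (h n) powr (- 3/2) / vol (d n) * max_norm (freq (d n) u - freq (d n) v)) \<and>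
      (\<forall>k\<in>rect (d n). integrable M (G n k)) \<and>
      (\<Sum>k\<in>rect (d n). expectation (\<lambda>\<omega>. \<bar>G n k \<omega>\<bar>)) \<le> mm * vol (d n) \<and>
      (\<forall>j\<in>rect (d n). integrable M (\<lambda>\<omega>. (\<Sum>k\<in>rect (d n). P n (k - j) * G n k \<omega>)\<^sup>2) \<and>
         expectation (\<lambda>\<omega>. (\<Sum>k\<in>rect (d n). P n (k - j) * G n k \<omega>)\<^sup>2) \<le> (8 * pi\<^sup>2 * L + cc) / (abs_prod (h n) * vol (d n)))"
    using eventually_good
  proof eventually_elim
    case g: (elim n)
    have 1: "\<bar>P n u - P n v\<bar> \<le> (8 * pi\<^sup>2 * L + cc) * abs_prod (h n) powr (- 3/2) / vol (d n) * max_norm (freq (d n) u - freq (d n) v)" for u v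
      by (rule order_trans[OF P_facts(5)[OF g]], intro mult_right_mono divide_right_mono)
         (use cc0 goodD[OF g] in \<open>auto simp: max_norm_def\<close>)
    have 2: "cc / (abs_prod (h n) * vol (d n)) \<le> (8 * pi\<^sup>2 * L + cc) / (abs_prod (h n) * vol (d n))"
      using L goodD[OF g] by (intro divide_right_mono) auto
    show ?case
      by (intro conjI allI ballI goodD[OF g] 1 int[OF g] mm1[OF g] mm2(1)[OF g] order_trans[OF mm2(2)[OF g] 2])
  qed
qed (fact rate \<eta>)+

section \<open>The smoothed statistics\<close>

lemma V_meas: "V t \<in> borel_measurable M"
  unfolding V_def by measurable

lemma dcos_integrable [simp]: "integrable M (\<lambda>\<omega>. dcos D (\<lambda>t. W t \<omega>) k)" "integrable M (\<lambda>\<omega>. dsin D (\<lambda>t. W t \<omega>) k)"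
  unfolding dcos_def dsin_def by (simp_all add: W_int)

text \<open>By duality the smoothed coefficient is a linear form in the field whose coefficients are
  transforms of the folded weights. Parseval and the Toeplitz bound give its variance the order
  1/(|h||T|). The mean of the field enters through the single zero frequency and is
  negligible.\<close>

lemma smoothed_coefficients:
  "is_op1 M (\<lambda>n \<omega>. SUP j\<in>half_set (d n).
     \<bar>\<Sum>\<^sub>\<infinity>s. weight K (d n) (h n) s * (xcoef V (d n) (j + s) \<omega> + ycoef V (d n) (j + s) \<omega>)\<bar>)"
proof (rule is_op1I)
  note [measurable] = V_meas
  show "(\<lambda>\<omega>. \<bar>\<Sum>\<^sub>\<infinity>s. weight K (d n) (h n) s * (xcoef V (d n) (j + s) \<omega> + ycoef V (d n) (j + s) \<omega>)\<bar>) \<in> borel_measurable M" for n j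
  proof (intro borel_measurable_abs smooth_measurable)
    show "(\<lambda>\<omega>. xcoef V (d n) k \<omega> + ycoef V (d n) k \<omega>) \<in> borel_measurable M" for k by measurable
    show "periodic (d n) (\<lambda>k. xcoef V (d n) k \<omega> + ycoef V (d n) k \<omega>)" if "0 < fst (d n)" "0 < snd (d n)" for \<omega>
      unfolding periodic_def by (intro allI) (simp only: periodicD[OF periodic_xcoef[OF that]] periodicD[OF periodic_ycoef[OF that]])
  qed (simp add: coef_empty_rect)
  fix \<eta> :: real assume \<eta>: "0 < \<eta>"
  define G where "G n k \<omega> = dcos (d n) (\<lambda>t. W t \<omega>) k - dsin (d n) (\<lambda>t. W t \<omega>) k" for n k \<omega>
  define a where "a n j t = dcos (d n) (\<lambda>k. P n (k - j)) t - dsin (d n) (\<lambda>k. P n (k - j)) t" for n j t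
  have G_int: "integrable M (G n k)" for n k unfolding G_def by simp
  have form: "(\<Sum>k\<in>rect (d n). P n (k - j) * G n k \<omega>) = (\<Sum>t\<in>rect (d n). a n j t * W t \<omega>)" for n j \<omega>
    unfolding G_def a_def right_diff_distrib left_diff_distrib sum_subtractf
    by (subst sum_mult_dcos[where c = "\<lambda>k. P n (k - j)"], subst sum_mult_dsin[where c = "\<lambda>k. P n (k - j)"]) (simp add: mult.commute)
  have a_sq: "(\<Sum>t\<in>rect (d n). (a n j t)\<^sup>2) \<le> 2 * (Cp / (abs_prod (h n) * vol (d n)))" if g: "good n" for n j
  proof -
    let ?p = "\<lambda>k. P n (k - j)"
    have "(\<Sum>t\<in>rect (d n). (a n j t)\<^sup>2) \<le> 2 * ((\<Sum>t\<in>rect (d n). (dcos (d n) ?p t)\<^sup>2) + (\<Sum>t\<in>rect (d n). (dsin (d n) ?p t)\<^sup>2))"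
      using sum_add_sq_le[of "dcos (d n) ?p" "\<lambda>t. - dsin (d n) ?p t" "rect (d n)"] by (simp add: a_def)
    also have "\<dots> = 2 * (\<Sum>k\<in>rect (d n). (?p k)\<^sup>2)"
      unfolding sum.distrib[symmetric] parseval[OF goodD(1,2)[OF g]] ..
    also have "\<dots> \<le> 2 * (Cp / (abs_prod (h n) * vol (d n)))" using sum_P_sq_le[OF g, of j] by simp
    finally show ?thesis .
  qed
  have lim: "(\<lambda>n. prob {\<omega> \<in> space M. \<exists>j\<in>rect (d n). \<eta> / 2 < \<bar>\<Sum>k\<in>rect (d n). P n (k - j) * G n k \<omega>\<bar>}) \<longlonglongrightarrow> 0"
  proof (rule smoothed_tendsto[where cc = "total * (2 * Cp)" and mm = "1 + \<gamma> 0"])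
    fix n assume g: "good n"
    have "expectation (\<lambda>\<omega>. \<bar>G n k \<omega>\<bar>) \<le> 1 + mean_spectrum (d n) k" for k
    proof -
      have "expectation (\<lambda>\<omega>. \<bar>G n k \<omega>\<bar>) \<le> expectation (\<lambda>\<omega>. 1 + pspec (d n) (\<lambda>t. W t \<omega>) k)"
      proof (rule integral_mono)
        fix \<omega>
        have "\<bar>x - y\<bar> \<le> 1 + (x\<^sup>2 + y\<^sup>2)" for x y :: real
        proof -
          have "0 \<le> (\<bar>x\<bar> - 1)\<^sup>2" "0 \<le> (\<bar>y\<bar> - 1)\<^sup>2" "0 \<le> x\<^sup>2" "0 \<le> y\<^sup>2" by simp_all
          then have "2 * \<bar>x\<bar> \<le> 1 + x\<^sup>2" "2 * \<bar>y\<bar> \<le> 1 + y\<^sup>2" "0 \<le> x\<^sup>2" "0 \<le> y\<^sup>2" by (simp_all add: power2_diff)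
          then show ?thesis by linarith
        qed
        then show "\<bar>G n k \<omega>\<bar> \<le> 1 + pspec (d n) (\<lambda>t. W t \<omega>) k" unfolding G_def pspec_def .
      qed (simp_all add: G_int pspec_integrable)
      then show ?thesis by (simp add: pspec_integrable pspec_expectation prob_space)
    qed
    then have "(\<Sum>k\<in>rect (d n). expectation (\<lambda>\<omega>. \<bar>G n k \<omega>\<bar>)) \<le> (\<Sum>k\<in>rect (d n). 1 + mean_spectrum (d n) k)"
      by (rule sum_mono)
    also have "\<dots> = (1 + \<gamma> 0) * vol (d n)"
      unfolding sum.distrib sum_mean_spectrum[OF goodD(1,2)[OF g]] by (simp add: card_rect distrib_right)
    finally show "(\<Sum>k\<in>rect (d n). expectation (\<lambda>\<omega>. \<bar>G n k \<omega>\<bar>)) \<le> (1 + \<gamma> 0) * vol (d n)" .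
    show "integrable M (\<lambda>\<omega>. (\<Sum>k\<in>rect (d n). P n (k - j) * G n k \<omega>)\<^sup>2)" for j
      unfolding form by (rule linear_form_variance) simp
    show "expectation (\<lambda>\<omega>. (\<Sum>k\<in>rect (d n). P n (k - j) * G n k \<omega>)\<^sup>2) \<le> total * (2 * Cp) / (abs_prod (h n) * vol (d n))" for j
      unfolding form using order_trans[OF linear_form_variance(2)[OF finite_rect] mult_left_mono[OF a_sq[OF g] total_nonneg]] by simp
  qed (use G_int total_nonneg Cp_pos \<eta> in auto)
  have small: "\<forall>\<^sub>F n in sequentially. Cp / (abs_prod (h n) * vol (d n)) * (\<bar>\<mu>\<bar> * sqrt (vol (d n))) < \<eta> / 2"
    by (rule order_tendstoD(2)[OF max_weight_tendsto(2)]) (use \<eta> in simp)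
  show "(\<lambda>n. prob {\<omega> \<in> space M. \<exists>j\<in>rect (d n). \<eta> < \<bar>\<Sum>\<^sub>\<infinity>s. weight K (d n) (h n) s * (xcoef V (d n) (j + s) \<omega> + ycoef V (d n) (j + s) \<omega>)\<bar>}) \<longlonglongrightarrow> 0"
  proof (rule exceeds_mono[OF _ _ lim])
    show "(\<lambda>\<omega>. \<bar>\<Sum>k\<in>rect (d n). P n (k - j) * G n k \<omega>\<bar>) \<in> borel_measurable M" for n j
      using borel_measurable_integrable[OF G_int] by measurable
    show "\<forall>\<^sub>F n in sequentially. \<forall>j \<omega>. \<eta> < \<bar>\<Sum>\<^sub>\<infinity>s. weight K (d n) (h n) s * (xcoef V (d n) (j + s) \<omega> + ycoef V (d n) (j + s) \<omega>)\<bar>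
        \<longrightarrow> \<eta> / 2 < \<bar>\<Sum>k\<in>rect (d n). P n (k - j) * G n k \<omega>\<bar>"
      using eventually_good small
    proof eventually_elim
      case (elim n)
      note g = elim(1) and p = goodD(1,2)[OF elim(1)]
      show ?case
      proof (intro allI impI)
        fix j \<omega>
        let ?\<phi> = "\<lambda>k. xcoef V (d n) k \<omega> + ycoef V (d n) k \<omega>"
        let ?b = "\<lambda>k. if k \<in> zero_freqs (d n) then \<mu> * sqrt (vol (d n)) else 0"
        assume big: "\<eta> < \<bar>\<Sum>\<^sub>\<infinity>s. weight K (d n) (h n) s * ?\<phi> (j + s)\<bar>"
        have "periodic (d n) ?\<phi>"
          unfolding periodic_def by (intro allI) (simp only: periodicD[OF periodic_xcoef[OF p]] periodicD[OF periodic_ycoef[OF p]])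
        note smooth_eq[OF g this, of j]
        also have "(\<Sum>k\<in>rect (d n). P n (k - j) * ?\<phi> k) = (\<Sum>k\<in>rect (d n). P n (k - j) * (G n k \<omega> + ?b k))"
          by (intro sum.cong refl arg_cong2[where f = "(*)"])
             (simp add: G_def xcoef_eq_dcos ycoef_eq_dsin V_def dcos_centred[OF p])
        also have "\<dots> = (\<Sum>k\<in>rect (d n). P n (k - j) * G n k \<omega>) + (\<Sum>k\<in>rect (d n). P n (k - j) * ?b k)"
          by (simp only: distrib_left sum.distrib)
        finally have "\<bar>\<Sum>\<^sub>\<infinity>s. weight K (d n) (h n) s * ?\<phi> (j + s)\<bar> \<le> \<bar>\<Sum>k\<in>rect (d n). P n (k - j) * G n k \<omega>\<bar> + \<bar>\<Sum>k\<in>rect (d n). P n (k - j) * ?b k\<bar>"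
          by linarith
        moreover have "\<bar>\<Sum>k\<in>rect (d n). P n (k - j) * ?b k\<bar> \<le> Cp / (abs_prod (h n) * vol (d n)) * (\<bar>\<mu>\<bar> * sqrt (vol (d n)))"
          by (rule sum_P_zero_freqs_le[OF g]) (simp add: abs_mult)
        ultimately show "\<eta> / 2 < \<bar>\<Sum>k\<in>rect (d n). P n (k - j) * G n k \<omega>\<bar>" using big elim(2) by linarith
      qed
    qed
  qed
qed simp

lemma periodogram_eq:
  assumes "0 < fst D" "0 < snd D"
  shows "periodogram V D k \<omega> = (if k \<in> zero_freqs D then 0 else pspec D (\<lambda>t. W t \<omega>) k)"
  by (simp add: periodogram_def pspec_def xcoef_eq_dcos ycoef_eq_dsin V_def dcos_centred[OF assms])

lemma periodic_spec:
  assumes "0 < fst D" "0 < snd D"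
  shows "periodic D (\<lambda>k. spec (freq D k))"
  unfolding periodic_def
proof (intro allI)
  fix k m
  have "cos ((freq D k + (2 * pi) *\<^sub>R rvec m) \<bullet> rvec u) = cos (freq D k \<bullet> rvec u)" for u
  proof -
    define i where "i = fst m * fst u + snd m * snd u"
    have "(freq D k + (2 * pi) *\<^sub>R rvec m) \<bullet> rvec u = freq D k \<bullet> rvec u + 2 * pi * real_of_int i"
      by (simp add: inner_add_left rvec_def inner_prod_def i_def algebra_simps)
    then show ?thesis by (simp add: cos_add)
  qed
  then show "spec (freq D (k + period D m)) = spec (freq D k)"
    unfolding spec_def freq_period[OF assms] by simp
qed

text \<open>Inside the box of \<open>box_mass_ge\<close> the frequencies move by at most
  \<open>R\<close> times the bandwidth, which is eventually below the modulus of continuity; outside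
  it the weights have mass at most \<open>\<epsilon>1\<close>.\<close>

lemma smoothing_bias:
  assumes \<epsilon>: "0 < \<epsilon>"
  shows "\<forall>\<^sub>F n in sequentially. \<forall>j. \<bar>(\<Sum>k\<in>rect (d n). P n (k - j) * spec (freq (d n) k)) - spec (freq (d n) j)\<bar> \<le> \<epsilon>"
proof -
  \<comment> \<open>Outside the box two values of the spectrum differ by at most
    \<open>2 * total\<close>, so this mass contributes at most
    \<open>\<epsilon> / 2\<close>.\<close>
  define \<epsilon>1 where "\<epsilon>1 = \<epsilon> / (4 * (total + 1))"
  have \<epsilon>1: "0 < \<epsilon>1" "2 * total * \<epsilon>1 \<le> \<epsilon> / 2" unfolding \<epsilon>1_def using \<epsilon> total_nonneg by (auto simp: field_simps)
  obtain \<delta> where \<delta>: "0 < \<delta>"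
    "\<And>l l'. \<bar>fst l - fst l'\<bar> \<le> \<delta> \<Longrightarrow> \<bar>snd l - snd l'\<bar> \<le> \<delta> \<Longrightarrow> \<bar>spec l - spec l'\<bar> \<le> \<epsilon> / 2"
    using spec_uniformly_continuous[of "\<epsilon> / 2"] \<epsilon> by auto
  have mesh: "(\<lambda>n. 2 * pi / (fst (h n) * real (fst (d n)))) \<longlonglongrightarrow> 0" "(\<lambda>n. 2 * pi / (snd (h n) * real (snd (d n)))) \<longlonglongrightarrow> 0"
    by (rule real_tendsto_divide_at_top[OF tendsto_const hd(1)], rule real_tendsto_divide_at_top[OF tendsto_const hd(2)])
  have pos: "\<forall>\<^sub>F n in sequentially. 0 < fst (h n) \<and> 0 < snd (h n) \<and> 0 < fst (d n) \<and> 0 < snd (d n)"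
    using eventually_good by eventually_elim (auto dest: goodD)
  obtain R where R: "0 < R" "\<forall>\<^sub>F n in sequentially. \<exists>B. finite B \<and> 1 - \<epsilon>1 \<le> (\<Sum>s\<in>B. weight K (d n) (h n) s) \<and>
     (\<forall>s\<in>B. \<bar>fst (freq (d n) s)\<bar> \<le> R * fst (h n) \<and> \<bar>snd (freq (d n) s)\<bar> \<le> R * snd (h n))"
    using box_mass_ge[OF K0 K_int riem pos mesh \<epsilon>1(1)] by blast
  have "(\<lambda>n. R * fst (h n)) \<longlonglongrightarrow> R * 0" "(\<lambda>n. R * snd (h n)) \<longlonglongrightarrow> R * 0" by (intro tendsto_mult_left h0)+
  then have small: "\<forall>\<^sub>F n in sequentially. R * fst (h n) < \<delta>" "\<forall>\<^sub>F n in sequentially. R * snd (h n) < \<delta>"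
    using \<delta>(1) by (auto intro: order_tendstoD)
  show ?thesis using eventually_good R(2) small
  proof eventually_elim
    case (elim n)
    note g = elim(1) and p = goodD(1,2)[OF elim(1)]
    let ?w = "weight K (d n) (h n)"
    obtain B where B: "finite B" "1 - \<epsilon>1 \<le> (\<Sum>s\<in>B. ?w s)"
      and Bs: "\<And>s. s \<in> B \<Longrightarrow> \<bar>fst (freq (d n) s)\<bar> \<le> R * fst (h n)" "\<And>s. s \<in> B \<Longrightarrow> \<bar>snd (freq (d n) s)\<bar> \<le> R * snd (h n)"
      using elim(2) by blast
    have w0: "0 \<le> ?w s" for s by (rule weight_nonneg[OF K0])
    have w1: "(?w has_sum 1) UNIV" using P_facts(1,2)[OF g] has_sum_infsum by metis
    show ?case
    proof
      fix j
      let ?f = "\<lambda>k. spec (freq (d n) k)"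
      have "(\<lambda>s. ?w s * ?f (j + s)) summable_on UNIV"
        by (rule periodic_mult_summable[OF p _ P_facts(1)[OF g]])
           (use periodic_spec[OF p] in \<open>simp only: periodic_def add.assoc[symmetric] simp_thms\<close>)
      then have a: "((\<lambda>s. ?w s * ?f (j + s)) has_sum (\<Sum>k\<in>rect (d n). P n (k - j) * ?f k)) UNIV"
        unfolding smooth_eq[OF g periodic_spec[OF p], symmetric] by (rule has_sum_infsum)
      have b: "((\<lambda>s. ?w s * ?f j) has_sum (1 * ?f j)) UNIV" by (rule has_sum_cmult_left[OF w1])
      have D: "((\<lambda>s. ?w s * ?f (j + s) + - (?w s * ?f j)) has_sum ((\<Sum>k\<in>rect (d n). P n (k - j) * ?f k) + - (1 * ?f j))) UNIV"
        by (intro has_sum_add a) (use b in \<open>simp only: has_sum_uminus minus_minus\<close>)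
      then have D': "((\<lambda>s. - (?w s * ?f (j + s) + - (?w s * ?f j))) has_sum - ((\<Sum>k\<in>rect (d n). P n (k - j) * ?f k) + - (1 * ?f j))) UNIV"
        by (simp only: has_sum_uminus minus_minus)
      have "(?w has_sum (1 - (\<Sum>s\<in>B. ?w s))) (UNIV - B)"
        by (rule has_sum_Diff[OF w1 has_sum_finite[OF B(1)]]) simp
      then have "((\<lambda>s. ?w s * of_bool (s \<notin> B)) has_sum (1 - (\<Sum>s\<in>B. ?w s))) UNIV"
        by (rule has_sum_cong_neutral[THEN iffD1, rotated -1]) auto
      then have "((\<lambda>s. ?w s * (\<epsilon> / 2) + ?w s * of_bool (s \<notin> B) * (2 * total)) has_sum (1 * (\<epsilon> / 2) + (1 - (\<Sum>s\<in>B. ?w s)) * (2 * total))) UNIV"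
        by (intro has_sum_add has_sum_cmult_left w1)
      note U = this
      have le: "\<bar>?w s * ?f (j + s) + - (?w s * ?f j)\<bar> \<le> ?w s * (\<epsilon> / 2) + ?w s * of_bool (s \<notin> B) * (2 * total)" for s
      proof -
        have "\<bar>?f (j + s) - ?f j\<bar> \<le> \<epsilon> / 2 + of_bool (s \<notin> B) * (2 * total)"
        proof (cases "s \<in> B")
          case True
          have "\<bar>?f (j + s) - ?f j\<bar> \<le> \<epsilon> / 2"
            by (rule \<delta>(2)) (use Bs[OF True] elim(3,4) in \<open>simp_all add: freq_add\<close>)
          then show ?thesis using True by simp
        next
          case False
          then show ?thesis using abs_spec_le[of "freq (d n) (j + s)"] abs_spec_le[of "freq (d n) j"] \<epsilon>
            by (simp; linarith)
        qed
        note m = mult_left_mono[OF this w0[of s]]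
        have "?w s * ?f (j + s) + - (?w s * ?f j) = ?w s * (?f (j + s) - ?f j)" by (simp add: right_diff_distrib)
        then have "\<bar>?w s * ?f (j + s) + - (?w s * ?f j)\<bar> = ?w s * \<bar>?f (j + s) - ?f j\<bar>"
          using w0[of s] by (simp add: abs_mult)
        with m show ?thesis by (simp only: distrib_left mult.assoc)
      qed
      have "(\<Sum>k\<in>rect (d n). P n (k - j) * ?f k) + - (1 * ?f j) \<le> 1 * (\<epsilon> / 2) + (1 - (\<Sum>s\<in>B. ?w s)) * (2 * total)"
        by (rule has_sum_mono[OF D U]) (rule abs_le_D1[OF le])
      moreover have "- ((\<Sum>k\<in>rect (d n). P n (k - j) * ?f k) + - (1 * ?f j)) \<le> 1 * (\<epsilon> / 2) + (1 - (\<Sum>s\<in>B. ?w s)) * (2 * total)"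
        by (rule has_sum_mono[OF D' U]) (rule abs_le_D2[OF le])
      moreover have "(1 - (\<Sum>s\<in>B. ?w s)) * (2 * total) \<le> \<epsilon>1 * (2 * total)"
        using B(2) total_nonneg by (intro mult_right_mono) auto
      ultimately show "\<bar>(\<Sum>k\<in>rect (d n). P n (k - j) * ?f k) - ?f j\<bar> \<le> \<epsilon>"
        using \<epsilon>1(2) by (simp only: mult_1_left mult.commute[of \<epsilon>1 "2 * total"] abs_le_iff; linarith)
    qed
  qed
qed

text \<open>The error splits into the random fluctuation \<open>G\<close>, the bias of the mean
  periodogram, the loss at the zero frequency and the smoothing bias. The last three are
  deterministic and receive \<open>\<eta> / 6\<close> each, which leaves \<open>\<eta> / 2\<close>
  for the fluctuation.\<close>

lemma smoothed_periodogram: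
  "is_op1 M (\<lambda>n \<omega>. SUP j\<in>half_set (d n).
     \<bar>(\<Sum>\<^sub>\<infinity>s. weight K (d n) (h n) s * periodogram V (d n) (j + s) \<omega>) - spec (freq (d n) j)\<bar>)"
proof (rule is_op1I)
  show "(\<lambda>\<omega>. \<bar>(\<Sum>\<^sub>\<infinity>s. weight K (d n) (h n) s * periodogram V (d n) (j + s) \<omega>) - spec (freq (d n) j)\<bar>) \<in> borel_measurable M" for n j
    by (intro borel_measurable_abs borel_measurable_diff borel_measurable_const smooth_measurable
        coef_measurable V_meas periodic_periodogram coef_empty_rect)
  fix \<eta> :: real assume \<eta>: "0 < \<eta>"
  define G where "G n k \<omega> = (if k \<in> zero_freqs (d n) then 0 else pspec (d n) (\<lambda>t. W t \<omega>) k - mean_spectrum (d n) k)" for n k \<omega>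
  have G_int: "integrable M (G n k)" for n k unfolding G_def by (cases "k \<in> zero_freqs (d n)") (simp_all add: pspec_integrable)
  have lim: "(\<lambda>n. prob {\<omega> \<in> space M. \<exists>j\<in>rect (d n). \<eta> / 2 < \<bar>\<Sum>k\<in>rect (d n). P n (k - j) * G n k \<omega>\<bar>}) \<longlonglongrightarrow> 0"
  proof (rule smoothed_tendsto[where cc = "quad_const * (2 * Cp)" and mm = "2 * \<gamma> 0"])
    fix n assume g: "good n"
    have "expectation (\<lambda>\<omega>. \<bar>G n k \<omega>\<bar>) \<le> 2 * mean_spectrum (d n) k" for k
    proof -
      have "expectation (\<lambda>\<omega>. \<bar>G n k \<omega>\<bar>) \<le> expectation (\<lambda>\<omega>. pspec (d n) (\<lambda>t. W t \<omega>) k + mean_spectrum (d n) k)"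
      proof (rule integral_mono)
        show "\<bar>G n k \<omega>\<bar> \<le> pspec (d n) (\<lambda>t. W t \<omega>) k + mean_spectrum (d n) k" for \<omega>
          using mean_spectrum_nonneg[of "d n" k] pspec_nonneg[of "d n" "\<lambda>t. W t \<omega>" k] unfolding G_def by (auto simp: abs_le_iff)
      qed (simp_all add: G_int pspec_integrable)
      then show ?thesis by (simp add: pspec_integrable pspec_expectation prob_space)
    qed
    then have "(\<Sum>k\<in>rect (d n). expectation (\<lambda>\<omega>. \<bar>G n k \<omega>\<bar>)) \<le> (\<Sum>k\<in>rect (d n). 2 * mean_spectrum (d n) k)"
      by (rule sum_mono)
    also have "\<dots> = 2 * \<gamma> 0 * vol (d n)"
      unfolding sum_distrib_left[symmetric] sum_mean_spectrum[OF goodD(1,2)[OF g]] by simp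
    finally show "(\<Sum>k\<in>rect (d n). expectation (\<lambda>\<omega>. \<bar>G n k \<omega>\<bar>)) \<le> 2 * \<gamma> 0 * vol (d n)" .
    fix j
    \<comment> \<open>Setting the weight to zero at the zero frequencies makes the sum a centred
      quadratic form of the field and can only lower the sum of squares.\<close>
    define q where "q k = (if k \<in> zero_freqs (d n) then 0 else P n (k - j))" for k
    define Q where "Q z = (\<Sum>k\<in>rect (d n). q k * cos (freq (d n) k \<bullet> rvec (fst z - snd z))) / vol (d n)" for z
    define X where "X \<omega> = (\<Sum>z\<in>rect (d n) \<times> rect (d n). Q z * (W (fst z) \<omega> * W (snd z) \<omega>))" for \<omega>
    note var = quadratic_form_variance[where A = "rect (d n) \<times> rect (d n)" and Q = Q, folded X_def, simplified]
    have X: "X \<omega> = (\<Sum>k\<in>rect (d n). q k * pspec (d n) (\<lambda>t. W t \<omega>) k)" for \<omega>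
      unfolding X_def pspec_def sum_power_spectrum_eq Q_def by (simp add: sum.cartesian_product split_beta)
    have EX: "expectation X = (\<Sum>k\<in>rect (d n). q k * mean_spectrum (d n) k)"
      unfolding X[abs_def] by (simp add: pspec_integrable pspec_expectation)
    have form: "(\<Sum>k\<in>rect (d n). P n (k - j) * G n k \<omega>) = X \<omega> - expectation X" for \<omega>
      unfolding EX unfolding X sum_subtractf[symmetric] by (intro sum.cong refl) (simp add: q_def G_def right_diff_distrib)
    have "(X \<omega> - a)\<^sup>2 = (X \<omega>)\<^sup>2 - 2 * a * X \<omega> + a\<^sup>2" for \<omega> a by (simp add: power2_diff)
    then show "integrable M (\<lambda>\<omega>. (\<Sum>k\<in>rect (d n). P n (k - j) * G n k \<omega>)\<^sup>2)"
      unfolding form using var(1,2) by simp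
    have "(\<Sum>z\<in>rect (d n) \<times> rect (d n). (Q z)\<^sup>2) = (\<Sum>s\<in>rect (d n). \<Sum>t\<in>rect (d n). ((\<Sum>k\<in>rect (d n). q k * cos (freq (d n) k \<bullet> rvec (s - t))) / vol (d n))\<^sup>2)"
      unfolding Q_def by (simp add: sum.cartesian_product split_beta)
    also have "\<dots> \<le> 2 * (\<Sum>k\<in>rect (d n). (q k)\<^sup>2)" by (rule sum_spectral_kernel_sq_le[OF goodD(1,2)[OF g]])
    also have "\<dots> \<le> 2 * (\<Sum>k\<in>rect (d n). (P n (k - j))\<^sup>2)" by (intro mult_left_mono sum_mono) (auto simp: q_def)
    also have "\<dots> \<le> 2 * (Cp / (abs_prod (h n) * vol (d n)))" using sum_P_sq_le[OF g, of j] by simp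
    finally have "quad_const * (\<Sum>z\<in>rect (d n) \<times> rect (d n). (Q z)\<^sup>2) \<le> quad_const * (2 * (Cp / (abs_prod (h n) * vol (d n))))"
      by (rule mult_left_mono[OF _ quad_const_nonneg])
    then show "expectation (\<lambda>\<omega>. (\<Sum>k\<in>rect (d n). P n (k - j) * G n k \<omega>)\<^sup>2) \<le> quad_const * (2 * Cp) / (abs_prod (h n) * vol (d n))"
      unfolding form using var(3) by simp
  qed (use G_int quad_const_nonneg Cp_pos \<eta> in auto)
  have small: "\<forall>\<^sub>F n in sequentially. Cp / (abs_prod (h n) * vol (d n)) * total < \<eta> / 6"
    by (rule order_tendstoD(2)[OF max_weight_tendsto(1)]) (use \<eta> in simp)
  have e6: "0 < \<eta> / 6" using \<eta> by simp
  show "(\<lambda>n. prob {\<omega> \<in> space M. \<exists>j\<in>rect (d n). \<eta> < \<bar>(\<Sum>\<^sub>\<infinity>s. weight K (d n) (h n) s * periodogram V (d n) (j + s) \<omega>) - spec (freq (d n) j)\<bar>}) \<longlonglongrightarrow> 0"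
  proof (rule exceeds_mono[OF _ _ lim])
    show "(\<lambda>\<omega>. \<bar>\<Sum>k\<in>rect (d n). P n (k - j) * G n k \<omega>\<bar>) \<in> borel_measurable M" for n j
      using borel_measurable_integrable[OF G_int] by measurable
    show "\<forall>\<^sub>F n in sequentially. \<forall>j \<omega>. \<eta> < \<bar>(\<Sum>\<^sub>\<infinity>s. weight K (d n) (h n) s * periodogram V (d n) (j + s) \<omega>) - spec (freq (d n) j)\<bar>
        \<longrightarrow> \<eta> / 2 < \<bar>\<Sum>k\<in>rect (d n). P n (k - j) * G n k \<omega>\<bar>"
      using eventually_good small smoothing_bias[OF e6] mean_spectrum_tendsto[OF sides e6]
    proof eventually_elim
      case (elim n)
      note g = elim(1) and p = goodD(1,2)[OF elim(1)]
      show ?case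
      proof (intro allI impI)
        fix j \<omega>
        let ?m = "mean_spectrum (d n)" and ?f = "\<lambda>k. spec (freq (d n) k)"
        let ?b = "\<lambda>k. if k \<in> zero_freqs (d n) then ?m k else 0"
        assume big: "\<eta> < \<bar>(\<Sum>\<^sub>\<infinity>s. weight K (d n) (h n) s * periodogram V (d n) (j + s) \<omega>) - ?f j\<bar>"
        have "(\<Sum>\<^sub>\<infinity>s. weight K (d n) (h n) s * periodogram V (d n) (j + s) \<omega>) = (\<Sum>k\<in>rect (d n). P n (k - j) * periodogram V (d n) k \<omega>)"
          by (rule smooth_eq[OF g periodic_periodogram[OF p]])
        also have "\<dots> = (\<Sum>k\<in>rect (d n). P n (k - j) * (G n k \<omega> + (?m k - ?f k) - ?b k + ?f k))"
          by (intro sum.cong refl arg_cong2[where f = "(*)"]) (simp add: G_def periodogram_eq[OF p])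
        also have "\<dots> = (\<Sum>k\<in>rect (d n). P n (k - j) * G n k \<omega>) + (\<Sum>k\<in>rect (d n). P n (k - j) * (?m k - ?f k))
            - (\<Sum>k\<in>rect (d n). P n (k - j) * ?b k) + (\<Sum>k\<in>rect (d n). P n (k - j) * ?f k)"
          by (simp only: distrib_left right_diff_distrib sum.distrib sum_subtractf)
        finally have eq: "(\<Sum>\<^sub>\<infinity>s. weight K (d n) (h n) s * periodogram V (d n) (j + s) \<omega>) - ?f j = \<dots> - ?f j" by simp
        have 1: "\<bar>\<Sum>k\<in>rect (d n). P n (k - j) * ?b k\<bar> \<le> Cp / (abs_prod (h n) * vol (d n)) * total"
          by (rule sum_P_zero_freqs_le[OF g]) (rule abs_mean_spectrum_le)
        have "\<bar>\<Sum>k\<in>rect (d n). P n (k - j) * (?m k - ?f k)\<bar> \<le> (\<Sum>k\<in>rect (d n). P n (k - j) * (\<eta> / 6))"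
          unfolding abs_mult[symmetric]
        proof (intro order_trans[OF sum_abs] sum_mono)
          fix k
          show "\<bar>P n (k - j) * (?m k - ?f k)\<bar> \<le> P n (k - j) * (\<eta> / 6)"
            unfolding abs_mult abs_of_nonneg[OF P_facts(3)[OF g]] using elim(4) by (intro mult_left_mono P_facts(3)[OF g]) blast
        qed
        then have 2: "\<bar>\<Sum>k\<in>rect (d n). P n (k - j) * (?m k - ?f k)\<bar> \<le> \<eta> / 6"
          unfolding sum_distrib_right[symmetric] P_facts(4)[OF g] by simp
        have 3: "\<bar>(\<Sum>k\<in>rect (d n). P n (k - j) * ?f k) - ?f j\<bar> \<le> \<eta> / 6" using elim(3) by blast
        show "\<eta> / 2 < \<bar>\<Sum>k\<in>rect (d n). P n (k - j) * G n k \<omega>\<bar>"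
          using big 1 2 3 elim(2) unfolding eq by linarith
      qed
    qed
  qed
qed simp

text \<open>The folded weights have total mass 1, so the majorant \<open>1 + x ^ 5\<close> turns the
  bound for the fifth power into one for \<open>f\<close> with the constant raised by 1.
  \<open>f 0 = 0\<close> keeps the statistic zero on an empty rectangle.\<close>

lemma smoothed_powers:
  assumes f [measurable]: "f \<in> borel_measurable borel" and f0: "f 0 = 0" and f_le: "\<And>x. 0 \<le> x \<Longrightarrow> f x \<le> 1 + x ^ 5"
  obtains C where "le_plus_op1 M (\<lambda>n \<omega>. SUP j\<in>half_set (d n). \<Sum>\<^sub>\<infinity>s. weight K (d n) (h n) s * f (periodogram V (d n) (j + s) \<omega>)) C"
proof -
  note [measurable] = V_meas
  have vol_lim: "filterlim (\<lambda>n. vol (d n)) at_top sequentially"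
    unfolding vol_def using sides by (intro filterlim_at_top_mult_at_top filterlim_compose[OF filterlim_real_sequentially])
  have "\<forall>\<^sub>F n in sequentially. 0 < fst (d n) \<and> 0 < snd (d n) \<and> 0 < abs_prod (h n) \<and>
      (\<forall>u. 0 \<le> P n u \<and> P n u \<le> Cp / (abs_prod (h n) * vol (d n))) \<and> (\<forall>j. (\<Sum>k\<in>rect (d n). P n (k - j)) = 1)"
    using eventually_good by eventually_elim (intro conjI allI goodD P_facts)
  from power_mean_bounded[OF this rate vol_lim Cp_pos]
  obtain s where s: "(\<lambda>n. prob {\<omega>\<in>space M. \<exists>j\<in>rect (d n). s < (\<Sum>k\<in>rect (d n). P n (k - j) * pspec (d n) (\<lambda>t. W t \<omega>) k ^ 5)}) \<longlonglongrightarrow> 0"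
    by blast
  have "le_plus_op1 M (\<lambda>n \<omega>. SUP j\<in>half_set (d n). \<Sum>\<^sub>\<infinity>s. weight K (d n) (h n) s * f (periodogram V (d n) (j + s) \<omega>)) (1 + s)"
  proof (rule le_plus_op1I)
    show "(\<lambda>\<omega>. \<Sum>\<^sub>\<infinity>s. weight K (d n) (h n) s * f (periodogram V (d n) (j + s) \<omega>)) \<in> borel_measurable M" for n j
    proof (rule smooth_measurable)
      show "(\<lambda>\<omega>. f (periodogram V (d n) k \<omega>)) \<in> borel_measurable M" for k by measurable
      show "periodic (d n) (\<lambda>k. f (periodogram V (d n) k \<omega>))" if "0 < fst (d n)" "0 < snd (d n)" for \<omega>
        unfolding periodic_def by (intro allI) (simp only: periodicD[OF periodic_periodogram[OF that]])
    qed (simp add: coef_empty_rect f0)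
    show "(\<lambda>n. prob {\<omega> \<in> space M. \<exists>j\<in>rect (d n). 1 + s < (\<Sum>\<^sub>\<infinity>s. weight K (d n) (h n) s * f (periodogram V (d n) (j + s) \<omega>))}) \<longlonglongrightarrow> 0"
    proof (rule exceeds_mono[OF _ _ s])
      show "(\<lambda>\<omega>. \<Sum>k\<in>rect (d n). P n (k - j) * pspec (d n) (\<lambda>t. W t \<omega>) k ^ 5) \<in> borel_measurable M" for n j
        using borel_measurable_integrable[OF pspec_integrable] by measurable
      show "\<forall>\<^sub>F n in sequentially. \<forall>j \<omega>. 1 + s < (\<Sum>\<^sub>\<infinity>s. weight K (d n) (h n) s * f (periodogram V (d n) (j + s) \<omega>))
          \<longrightarrow> s < (\<Sum>k\<in>rect (d n). P n (k - j) * pspec (d n) (\<lambda>t. W t \<omega>) k ^ 5)"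
        using eventually_good
      proof eventually_elim
        case g: (elim n)
        note p = goodD(1,2)[OF g]
        have "(\<Sum>\<^sub>\<infinity>s. weight K (d n) (h n) s * f (periodogram V (d n) (j + s) \<omega>)) \<le> 1 + (\<Sum>k\<in>rect (d n). P n (k - j) * pspec (d n) (\<lambda>t. W t \<omega>) k ^ 5)" for j \<omega>
        proof -
          have per: "periodic (d n) (\<lambda>k. f (periodogram V (d n) k \<omega>))"
            unfolding periodic_def by (intro allI) (simp only: periodicD[OF periodic_periodogram[OF p]])
          have "f (periodogram V (d n) k \<omega>) \<le> 1 + pspec (d n) (\<lambda>t. W t \<omega>) k ^ 5" for k
            using f_le[OF pspec_nonneg, of "d n" "\<lambda>t. W t \<omega>" k] zero_le_power[OF pspec_nonneg, of "d n" "\<lambda>t. W t \<omega>" k 5]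
            unfolding periodogram_eq[OF p] by (simp add: f0)
          then have "(\<Sum>k\<in>rect (d n). P n (k - j) * f (periodogram V (d n) k \<omega>)) \<le> (\<Sum>k\<in>rect (d n). P n (k - j) * (1 + pspec (d n) (\<lambda>t. W t \<omega>) k ^ 5))"
            by (intro sum_mono mult_left_mono P_facts(3)[OF g])
          also have "\<dots> = 1 + (\<Sum>k\<in>rect (d n). P n (k - j) * pspec (d n) (\<lambda>t. W t \<omega>) k ^ 5)"
            unfolding distrib_left sum.distrib mult_1_right P_facts(4)[OF g] ..
          finally show ?thesis unfolding smooth_eq[OF g per] .
        qed
        then show ?case by (meson add_less_cancel_left less_le_trans)
      qed
    qed
  qed
  then show ?thesis by (rule that)
qed

end

section \<open>Moments of a stationary field and the conclusion\<close>

lemma stationary_field_law: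
  fixes f :: "(int \<times> int \<Rightarrow> real) \<Rightarrow> real"
  assumes "stationary_field M V" and f: "f \<in> borel_measurable (Pi\<^sub>M UNIV (\<lambda>_. borel))"
  shows "integrable M (\<lambda>\<omega>. f (\<lambda>t. V (t + u) \<omega>)) \<longleftrightarrow> integrable M (\<lambda>\<omega>. f (\<lambda>t. V t \<omega>))"
    "(\<integral>\<omega>. f (\<lambda>t. V (t + u) \<omega>) \<partial>M) = (\<integral>\<omega>. f (\<lambda>t. V t \<omega>) \<partial>M)"
proof -
  have V: "\<And>t. V t \<in> borel_measurable M"
    and law: "distr M (Pi\<^sub>M UNIV (\<lambda>_. borel)) (\<lambda>\<omega> t. V (t + u) \<omega>) = distr M (Pi\<^sub>M UNIV (\<lambda>_. borel)) (\<lambda>\<omega> t. V t \<omega>)"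
    using assms(1) unfolding stationary_field_def by blast+
  have m: "(\<lambda>\<omega> t. V (t + w) \<omega>) \<in> measurable M (Pi\<^sub>M UNIV (\<lambda>_. borel))" for w
    by (rule measurable_PiM_single') (use V in auto)
  have m0: "(\<lambda>\<omega> t. V t \<omega>) \<in> measurable M (Pi\<^sub>M UNIV (\<lambda>_. borel))" using m[of 0] by simp
  show "integrable M (\<lambda>\<omega>. f (\<lambda>t. V (t + u) \<omega>)) \<longleftrightarrow> integrable M (\<lambda>\<omega>. f (\<lambda>t. V t \<omega>))"
    using integrable_distr_eq[OF m[of u] f] integrable_distr_eq[OF m0 f] unfolding law by blast
  show "(\<integral>\<omega>. f (\<lambda>t. V (t + u) \<omega>) \<partial>M) = (\<integral>\<omega>. f (\<lambda>t. V t \<omega>) \<partial>M)"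
    using integral_distr[OF m[of u] f] integral_distr[OF m0 f] unfolding law by simp
qed

lemma stationary_field_moments:
  assumes "prob_space M" "stationary_field M V" "integrable M (V 0)" "(\<integral>\<omega>. V 0 \<omega> \<partial>M) = \<mu>"
  shows "integrable M (V t)" "(\<integral>\<omega>. (V s \<omega> - \<mu>) * (V t \<omega> - \<mu>) \<partial>M) = autocov M V (t - s)"
proof -
  have c: "(\<lambda>x. x t) \<in> borel_measurable (Pi\<^sub>M UNIV (\<lambda>_. borel))" for t :: "int \<times> int"
    by (rule measurable_component_singleton) simp
  have int: "integrable M (V t)" and mean: "(\<integral>\<omega>. V t \<omega> \<partial>M) = \<mu>" for t
    using stationary_field_law[OF assms(2) c[of 0], of t] assms(3,4) by simp_all
  show "integrable M (V t)" by (rule int)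
  note [measurable] = c
  have "(\<lambda>x. (x 0 - \<mu>) * (x (t - s) - \<mu>)) \<in> borel_measurable (Pi\<^sub>M UNIV (\<lambda>_ :: int \<times> int. borel))" by measurable
  from stationary_field_law(2)[OF assms(2) this, of s]
  show "(\<integral>\<omega>. (V s \<omega> - \<mu>) * (V t \<omega> - \<mu>) \<partial>M) = autocov M V (t - s)"
    by (simp add: autocov_def cov_def mean)
qed

theorem theorem4p4:
  fixes M :: "'a measure"
    and V :: "int \<times> int \<Rightarrow> 'a \<Rightarrow> real"
    and \<mu> :: real
    and d :: "nat \<Rightarrow> nat \<times> nat"
    and h :: "nat \<Rightarrow> real \<times> real"
    and K :: "real \<times> real \<Rightarrow> real"
  assumes prob: "prob_space M"
    and stat: "stationary_field M V"
    and mean: "integrable M (V 0)" "(\<integral>\<omega>. V 0 \<omega> \<partial>M) = \<mu>"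
    and sides: "filterlim (\<lambda>n. fst (d n)) at_top sequentially"
               "filterlim (\<lambda>n. snd (d n)) at_top sequentially"
    and band: "(\<lambda>n. fst (h n)) \<longlonglongrightarrow> 0" "(\<lambda>n. snd (h n)) \<longlonglongrightarrow> 0"
              "(\<lambda>n. fst (h n)) \<in> \<Theta>(\<lambda>n. snd (h n))"
              "filterlim (\<lambda>n. fst (h n) * real (fst (d n))) at_top sequentially"
              "filterlim (\<lambda>n. snd (h n) * real (snd (d n))) at_top sequentially"
    and a1: "\<exists>\<xi> c1 c2. 0 < \<xi> \<and> \<xi> \<le> 1/2 \<and> c1 > 0 \<and> c2 > 0 \<and>
               (\<forall>\<^sub>F n in sequentially. real (fst (d n)) > c1 * vol (d n) powr \<xi> \<and>
                                     real (snd (d n)) > c2 * vol (d n) powr \<xi>)"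
    and a2: "integrable M (\<lambda>\<omega>. (V 0 \<omega>)\<^sup>2)" "(\<lambda>j. \<bar>autocov M V j\<bar>) summable_on UNIV"
    and a3: "\<exists>c>0. \<forall>lam \<in> {0..2*pi} \<times> {0..2*pi}. spectral_density M V lam \<ge> c"
    and a4: "(\<exists>r>1/2. linear_field M V \<mu> r) \<or>
             (gmc_field M V \<mu> \<and> integrable M (\<lambda>\<omega>. \<bar>V 0 \<omega>\<bar> ^ 16))"
    and a5: "(\<lambda>n. 1 / (abs_prod (h n) ^ 4 * vol (d n))) \<in> o(\<lambda>_. 1)"
    and a6: "\<forall>lam. K lam \<ge> 0" "\<forall>lam. K (- lam) = K lam" "has_plane_integral K 1"
            "(\<lambda>n. 4 * pi\<^sup>2 / (abs_prod (h n) * vol (d n)) *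
                  (\<Sum>\<^sub>\<infinity>j. scaled_kernel K (h n) (freq (d n) j))) \<longlonglongrightarrow> 1"
    and a7: "\<exists>L>0. \<forall>\<^sub>F n in sequentially. \<forall>s t.
               abs_prod (h n) powr (3/2) *
                 \<bar>periodized_kernel K (h n) (freq (d n) s) -
                  periodized_kernel K (h n) (freq (d n) t)\<bar>
               \<le> L * max_norm (freq (d n) s - freq (d n) t)"
    and a8: "(\<lambda>n. 1 / (vol (d n) * abs_prod (h n)) *
                  (\<Sum>\<^sub>\<infinity>j. (scaled_kernel K (h n) (freq (d n) j))\<^sup>2)) \<in> O(\<lambda>_. 1)"
  shows
    "((\<lambda>n. SUP (l, k)\<in>half_set (d n) \<times> half_set (d n).
         \<bar>cov M (xcoef V (d n) l) (xcoef V (d n) k)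
            - 2 * pi\<^sup>2 * spectral_density M V (freq (d n) k) * of_bool (l = k)\<bar>)
        \<in> O(\<lambda>n. 1 / (abs_prod (h n) * vol (d n))) \<and>
      (\<lambda>n. SUP (l, k)\<in>half_set (d n) \<times> half_set (d n).
         \<bar>cov M (ycoef V (d n) l) (ycoef V (d n) k)
            - 2 * pi\<^sup>2 * spectral_density M V (freq (d n) k) * of_bool (l = k)\<bar>)
        \<in> O(\<lambda>n. 1 / (abs_prod (h n) * vol (d n)))
      \<longrightarrow> is_op1 M (\<lambda>n \<omega>. SUP j\<in>half_set (d n).
            \<bar>\<Sum>\<^sub>\<infinity>s. weight K (d n) (h n) s * (xcoef V (d n) (j + s) \<omega> + ycoef V (d n) (j + s) \<omega>)\<bar>))
     \<and> is_op1 M (\<lambda>n \<omega>. SUP j\<in>half_set (d n).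
            \<bar>(\<Sum>\<^sub>\<infinity>s. weight K (d n) (h n) s * periodogram V (d n) (j + s) \<omega>)
              - 4 * pi\<^sup>2 * spectral_density M V (freq (d n) j)\<bar>)
     \<and> (\<exists>C1. le_plus_op1 M (\<lambda>n \<omega>. SUP j\<in>half_set (d n).
            \<Sum>\<^sub>\<infinity>s. weight K (d n) (h n) s * (periodogram V (d n) (j + s) \<omega>)\<^sup>2) C1)
     \<and> (\<exists>\<epsilon>\<in>{0<..<1}. \<exists>C2. le_plus_op1 M (\<lambda>n \<omega>. SUP j\<in>half_set (d n).
            \<Sum>\<^sub>\<infinity>s. weight K (d n) (h n) s * periodogram V (d n) (j + s) \<omega> powr (4 + \<epsilon>)) C2)"
proof -
  have V: "\<And>t. V t \<in> borel_measurable M" using stat unfolding stationary_field_def by blast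
  \<comment> \<open>Both alternatives are reduced to the same kind of expansion; from here on they
    are not distinguished.\<close>
  obtain e U c v q C0 where blk: "block_expansion M e U c v q C0 (\<lambda>t \<omega>. V t \<omega> - \<mu>)"
  proof (cases "gmc_field M V \<mu> \<and> integrable M (\<lambda>\<omega>. \<bar>V 0 \<omega>\<bar> ^ 16)")
    case True
    then have g: "gmc_field M V \<mu>" and i: "integrable M (\<lambda>\<omega>. \<bar>V 0 \<omega>\<bar> ^ 16)" by blast+
    show ?thesis
      by (rule gmc_field_block_expansion[where M = M and V = V and \<mu> = \<mu>]) (fact prob V g i mean that)+
  next
    case False
    then obtain r where r: "linear_field M V \<mu> r" using a4 by blast
    show ?thesis
      by (rule linear_field_block_expansion[where M = M and V = V and \<mu> = \<mu> and r = r]) (fact prob V r that)+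
  qed
  obtain L where L: "0 < L" and lip: "\<forall>\<^sub>F n in sequentially. \<forall>s t.
               abs_prod (h n) powr (3/2) *
                 \<bar>periodized_kernel K (h n) (freq (d n) s) -
                  periodized_kernel K (h n) (freq (d n) t)\<bar>
               \<le> L * max_norm (freq (d n) s - freq (d n) t)"
    using a7 by blast
  have rate: "(\<lambda>n. 1 / (abs_prod (h n) ^ 4 * vol (d n))) \<longlonglongrightarrow> 0"
    using smalloD_tendsto[OF a5] by simp
  interpret prob_space M by fact
  note mom = stationary_field_moments[OF prob stat mean]
  interpret smoothed_spectrum M e U c v q C0 "\<lambda>t \<omega>. V t \<omega> - \<mu>" "autocov M V" V \<mu> d h K L
  proof (intro smoothed_spectrum.intro smoothed_spectrum_axioms.intro blk)
    show "summable_autocovariance (autocov M V)" by (rule summable_autocovariance.intro[OF a2(2)])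
    show "V = (\<lambda>t \<omega>. V t \<omega> - \<mu> + \<mu>)" by simp
    show "integrable M (\<lambda>\<omega>. V t \<omega> - \<mu>)" for t using mom(1) by simp
    show "expectation (\<lambda>\<omega>. (V s \<omega> - \<mu>) * (V t \<omega> - \<mu>)) = autocov M V (t - s)" for s t by (rule mom(2))
    show "0 \<le> K x" for x using a6(1) by blast
  qed (fact sides band a6 L lip rate)+
  obtain C1 where C1: "le_plus_op1 M (\<lambda>n \<omega>. SUP j\<in>half_set (d n).
      \<Sum>\<^sub>\<infinity>s. weight K (d n) (h n) s * (periodogram V (d n) (j + s) \<omega>)\<^sup>2) C1"
  proof (rule smoothed_powers[of "\<lambda>x. x\<^sup>2"])
    show "x\<^sup>2 \<le> 1 + x ^ 5" if "0 \<le> x" for x :: real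
    proof (cases "x \<le> 1")
      case True
      then show ?thesis using that power_le_one[of x 2] zero_le_power[OF that, of 5] by linarith
    next
      case False
      then have "x\<^sup>2 \<le> x ^ 5" by (intro power_increasing) auto
      then show ?thesis by linarith
    qed
  qed auto
  \<comment> \<open>The choice is \<epsilon> = 1/2: the exponent 4 + 1/2 stays below 5, so the fifth
    power dominates it up to the constant 1.\<close>
  obtain C2 where C2: "le_plus_op1 M (\<lambda>n \<omega>. SUP j\<in>half_set (d n).
      \<Sum>\<^sub>\<infinity>s. weight K (d n) (h n) s * periodogram V (d n) (j + s) \<omega> powr (4 + 1 / 2)) C2"
  proof (rule smoothed_powers[of "\<lambda>x. x powr (4 + 1 / 2)"])
    show "x powr (4 + 1 / 2) \<le> 1 + x ^ 5" if x: "0 \<le> x" for x :: real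
    proof (cases "x \<le> 1")
      case True
      then show ?thesis using x powr_le1[of "4 + 1 / 2" x] zero_le_power[OF x, of 5] by linarith
    next
      case False
      then have "x powr (4 + 1 / 2) \<le> x powr real 5" by (intro powr_mono) auto
      also have "\<dots> = x ^ 5" using False by (intro powr_realpow) simp
      finally show ?thesis by simp
    qed
  qed auto
  have b: "is_op1 M (\<lambda>n \<omega>. SUP j\<in>half_set (d n).
            \<bar>(\<Sum>\<^sub>\<infinity>s. weight K (d n) (h n) s * periodogram V (d n) (j + s) \<omega>)
              - 4 * pi\<^sup>2 * spectral_density M V (freq (d n) j)\<bar>)"
    using smoothed_periodogram unfolding spec_def spectral_density_eq[OF a2(2)] .
  have half: "(1 / 2 :: real) \<in> {0<..<1}" by simp
  show ?thesis
    by (intro conjI impI smoothed_coefficients b exI[of _ C1] C1 bexI[OF _ half] exI[of _ C2] C2)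
qed

end
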